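(* Suppose that $a(n)/n\to0$ as $n\to\infty$ and $\gamma_*>L^{-1}$. Let $\sigma_n=\sqrt{a(n)/\gamma_n}$. Then, as $n\to\infty$, $$\sigma_n(\theta^n_n-\theta_* )\ \text{converges in distribution to}\ \mathcal N(0,V),$$ where $V$ is the solution of the Lyapunov equation $$U_*+\nabla h(\theta_* )V+V\nabla h(\theta_* )^T+\gamma_*^{-1}V=0 .$$
   Context: Setting. $\Delta=\Delta^o\cup\{0\}$ is a finite set, $\Delta^o=\{1,\dots,d\}$ nonempty, $0\notin\Delta^o$. $P=(P_{x,y})_{x,y\in\Delta}$ is the transition matrix of a Markov chain $\{Y_n\}$ on $\Delta$ with $0$ absorbing ($P_{0,0}=1$); $\Delta^o$ is an irreducible class of the chain and $P_{x,0}>0$ for some $x\in\Delta^o$. $\mathcal{P}(\Delta^o)$ is identified with the simplex $\mathcal S=\{x\in\mathbb{R}_+^d:\sum_i x_i=1\}$. $\theta_*$ is the unique quasi-stationary distribution: the unique $\mu\in\mathcal{P}(\Delta^o)$ with $\mathbf{P}_\mu(Y_n=x\mid Y_n\in\Delta^o)=\mu(x)$ for all $x\in\Delta^o$, $n\in\mathbb{N}$. For $\nu\in\mathcal{P}(\Delta^o)$, $K[\nu]_{x,y}=P_{x,y}+P_{x,0}\,\nu(y)$, $x,y\in\Delta^o$, an irreducible transition matrix with unique invariant distribution $\pi(\nu)$; $h(\nu)=\pi(\nu)-\nu$. Jacobian. $h:\mathcal S\to T\mathcal S=\{x\in\mathbb R^d:\sum_ix_i=0\}$ is smooth; $\nabla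 h(\theta_* )$ is its derivative at $\theta_*$, viewed as a linear map $T\mathcal S\to T\mathcal S$. It is known to be Hurwitz; $L>0$ is a fixed constant such that all its eigenvalues have real part $\le -L$. In the Lyapunov equation $V$ is a symmetric $d\times d$ matrix whose columns lie in $T\mathcal S$, $\nabla h(\theta_* )V$ is computed columnwise, and $V\nabla h(\theta_* )^T=(\nabla h(\theta_* )V)^T$. Poisson solution and $U_*$. $\Pi(\nu)_{x,y}=\pi(\nu)_y$; $Q[\nu]=\int_0^\infty[\exp(t(K[\nu]-I))-\Pi(\nu)]\,dt$, so that $(I-K[\nu])Q[\nu]=Q[\nu](I-K[\nu])=I-\Pi(\nu)$. For $z\in\Delta^o$, $F_\theta(z)$ is the $d\times d$ matrix $$F_\theta(z)_{x,y}=\sum_{u\in\Delta^o}K[\theta]_{z,u}Q[\theta]_{u,x}Q[\theta]_{u,y}-(K[\theta]Q[\theta])_{z,x}(K[\theta]Q[\theta])_{z,y},$$ and $U_*=\sum_{w\in\Delta^o}F_{\theta_*}(w)\,(\theta_* )_w$ (nonnegative definite). Step sizes: $\gamma_*>0$, $N_*=\lfloor\gamma_*\rfloor+1$, $\gamma_{k+1}=\gamma_*/(k+N_* )$ for $k\in\mathbb{N}_0$. Algorithm I. $\{a(n)\}_{n\in\mathbb N}$ is a sequence of positive integers increasing to $\infty$; $x_0\in\Delta^o$ is fixed. On a probability space $(\Omega,\mathcal F,\mathbf P)$, for every $n\in\mathbb N$ there are $\Delta^o$-valued random variables $X^{i,n}_k$ ($1\le i\le a(n)$, $k\in\mathbb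 N_0$), random probability measures $\theta^n_k$ and $\sigma$-fields $\mathcal F^n_k$ such that: $X^{i,n}_0=x_0$, $\theta^n_0=\delta_{x_0}$, $\mathcal F^n_0=\{\emptyset,\Omega\}$; on $\{X^{1,n}_k=x_1,\dots,X^{a(n),n}_k=x_{a(n)}\}$, $$\mathbf P(X^{1,n}_{k+1}=y_1,\dots,X^{a(n),n}_{k+1}=y_{a(n)}\mid\mathcal F^n_k)=\prod_{i=1}^{a(n)}K[\theta^n_k]_{x_i,y_i};$$ $\mathcal F^n_{k+1}=\mathcal F^n_k\vee\sigma(X^{1,n}_{k+1},\dots,X^{a(n),n}_{k+1})$; and $\theta^n_{k+1}=(1-\gamma_{k+1})\theta^n_k+\gamma_{k+1}\frac1{a(n)}\sum_{i=1}^{a(n)}\delta_{X^{i,n}_{k+1}}$. *)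

theory Defs
  imports "HOL-Probability.Probability"
begin

section \<open>Conventions\<close>

text \<open>
  The non-absorbing states form an arbitrary finite type \<open>'s\<close> (of class \<open>finite\<close>, hence nonempty),
  and the full state space is \<open>'s option\<close>, where \<open>None\<close> is the absorbing state \<open>0\<close> and
  \<open>Some x\<close> is the state \<open>x\<close>. Measures on \<open>'s\<close> are vectors in \<open>real ^ 's\<close>, and for a matrix \<open>A\<close>
  the entry in row \<open>x\<close> and column \<open>y\<close> is \<open>A $ x $ y\<close>. On the type of square matrices the library's
  \<open>*\<close> is the componentwise product, so powers and exponentials of matrices are defined here
  from the matrix product \<open>**\<close>.
\<close>

primrec mat_pow :: "real ^ 'n ^ 'n \<Rightarrow> nat \<Rightarrow> real ^ 'n ^ 'n" where
  "mat_pow A 0 = mat 1"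
| "mat_pow A (Suc k) = A ** mat_pow A k"

definition mat_exp :: "real ^ 'n ^ 'n \<Rightarrow> real ^ 'n ^ 'n" where
  "mat_exp A = (\<Sum>k. mat_pow A k /\<^sub>R fact k)"

definition prob_simplex :: "(real ^ 's) set" where
  "prob_simplex = {x. (\<forall>i. 0 \<le> x $ i) \<and> (\<Sum>i\<in>UNIV. x $ i) = 1}"

definition tangent_space :: "(real ^ 's) set" where
  "tangent_space = {x. (\<Sum>i\<in>UNIV. x $ i) = 0}"

section \<open>The absorbed chain and its quasi-stationary distribution\<close>

definition transition_matrix :: "real ^ 'n ^ 'n \<Rightarrow> bool" where
  "transition_matrix A \<longleftrightarrow> (\<forall>x y. 0 \<le> A $ x $ y) \<and> (\<forall>x. (\<Sum>y\<in>UNIV. A $ x $ y) = 1)"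

definition absorbed_chain :: "real ^ ('s::finite) option ^ 's option \<Rightarrow> bool" where
  "absorbed_chain P \<longleftrightarrow>
     transition_matrix P \<and>
     P $ None $ None = 1 \<and>
     (\<forall>x y. \<exists>n\<ge>1. mat_pow P n $ Some x $ Some y > 0) \<and>
     (\<exists>x. P $ Some x $ None > 0)"

text \<open>The probability that \<open>Y\<^sub>n = y\<close> for the chain started from the law \<open>\<mu>\<close> on the
  non-absorbing states.\<close>

definition chain_prob :: "real ^ ('s::finite) option ^ 's option \<Rightarrow> real ^ 's \<Rightarrow> nat \<Rightarrow> 's option \<Rightarrow> real" where
  "chain_prob P \<mu> n y = (\<Sum>x\<in>UNIV. \<mu> $ x * mat_pow P n $ Some x $ y)"

text \<open>If the denominator vanishes, the quotient is \<open>0\<close> in HOL for every \<open>x\<close>,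
  which contradicts that \<open>\<mu>\<close> has total mass \<open>1\<close>; hence survival has positive probability.\<close>

definition quasi_stationary :: "real ^ ('s::finite) option ^ 's option \<Rightarrow> real ^ 's \<Rightarrow> bool" where
  "quasi_stationary P \<mu> \<longleftrightarrow>
     \<mu> \<in> prob_simplex \<and>
     (\<forall>n x. chain_prob P \<mu> n (Some x) / (\<Sum>z\<in>UNIV. chain_prob P \<mu> n (Some z)) = \<mu> $ x)"

section \<open>The kernels, the vector field and its derivative\<close>

definition K :: "real ^ ('s::finite) option ^ 's option \<Rightarrow> real ^ 's \<Rightarrow> real ^ 's ^ 's" where
  "K P \<nu> = (\<chi> x y. P $ Some x $ Some y + P $ Some x $ None * \<nu> $ y)"

definition invariant_dist :: "real ^ ('s::finite) option ^ 's option \<Rightarrow> real ^ 's \<Rightarrow> real ^ 's" where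
  "invariant_dist P \<nu> = (THE p. p \<in> prob_simplex \<and> p v* K P \<nu> = p)"

definition h :: "real ^ ('s::finite) option ^ 's option \<Rightarrow> real ^ 's \<Rightarrow> real ^ 's" where
  "h P \<nu> = invariant_dist P \<nu> - \<nu>"

text \<open>The derivative is taken within the simplex, so only its restriction to the tangent space
  is determined; only that restriction is used below.\<close>

definition grad_h :: "real ^ ('s::finite) option ^ 's option \<Rightarrow> real ^ 's \<Rightarrow> real ^ 's \<Rightarrow> real ^ 's" where
  "grad_h P \<theta> = frechet_derivative (h P) (at \<theta> within prob_simplex)"

text \<open>\<open>z\<close> is an eigenvalue of the complexification of \<open>T\<close> acting on the complexified
  tangent space.\<close>

definition tangent_eigenvalue :: "(real ^ 's \<Rightarrow> real ^ 's) \<Rightarrow> complex \<Rightarrow> bool" where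
  "tangent_eigenvalue T z \<longleftrightarrow>
     (\<exists>v :: complex ^ 's. v \<noteq> 0 \<and> (\<Sum>i\<in>UNIV. v $ i) = 0 \<and>
        (\<forall>i. Complex (T (\<chi> j. Re (v $ j)) $ i) (T (\<chi> j. Im (v $ j)) $ i) = z * v $ i))"

section \<open>Poisson solution, limiting covariance and Lyapunov equation\<close>

definition Q :: "real ^ ('s::finite) option ^ 's option \<Rightarrow> real ^ 's \<Rightarrow> real ^ 's ^ 's" where
  "Q P \<nu> = integral {0..}
     (\<lambda>t::real. mat_exp (t *\<^sub>R (K P \<nu> - mat 1)) - (\<chi> x y. invariant_dist P \<nu> $ y))"

definition F_mat :: "real ^ ('s::finite) option ^ 's option \<Rightarrow> real ^ 's \<Rightarrow> 's \<Rightarrow> real ^ 's ^ 's" where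
  "F_mat P \<theta> z = (\<chi> x y.
     (\<Sum>u\<in>UNIV. K P \<theta> $ z $ u * Q P \<theta> $ u $ x * Q P \<theta> $ u $ y)
     - (K P \<theta> ** Q P \<theta>) $ z $ x * (K P \<theta> ** Q P \<theta>) $ z $ y)"

definition U_star :: "real ^ ('s::finite) option ^ 's option \<Rightarrow> real ^ 's \<Rightarrow> real ^ 's ^ 's" where
  "U_star P \<theta> = (\<Sum>w\<in>UNIV. \<theta> $ w *\<^sub>R F_mat P \<theta> w)"

definition columnwise :: "(real ^ 's \<Rightarrow> real ^ 's) \<Rightarrow> real ^ 's ^ 's \<Rightarrow> real ^ 's ^ 's" where
  "columnwise T V = (\<chi> i j. T (column j V) $ i)"

definition lyapunov_solution ::
    "real ^ ('s::finite) option ^ 's option \<Rightarrow> real ^ 's \<Rightarrow> real \<Rightarrow> real ^ 's ^ 's \<Rightarrow> bool" where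
  "lyapunov_solution P \<theta> g V \<longleftrightarrow>
     transpose V = V \<and>
     (\<forall>j. column j V \<in> tangent_space) \<and>
     U_star P \<theta> + columnwise (grad_h P \<theta>) V + transpose (columnwise (grad_h P \<theta>) V)
       + (1 / g) *\<^sub>R V = 0"

section \<open>The particle algorithm\<close>

text \<open>\<open>step_size g k\<close> is \<open>\<gamma>\<^sub>k\<close> for \<open>k \<ge> 1\<close>; the value at \<open>0\<close> is a dummy.\<close>

primrec step_size :: "real \<Rightarrow> nat \<Rightarrow> real" where
  "step_size g 0 = 0"
| "step_size g (Suc k) = g / (real k + real_of_int (\<lfloor>g\<rfloor> + 1))"

text \<open>In the following, \<open>N\<close> is the number of particles and \<open>X i k\<close> the position of particle
  \<open>i \<in> {1..N}\<close> at time \<open>k\<close>; \<open>axis x 1\<close> is the point mass at \<open>x\<close>.\<close>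

primrec weighted_occupation ::
    "real \<Rightarrow> nat \<Rightarrow> 's \<Rightarrow> (nat \<Rightarrow> nat \<Rightarrow> 'w \<Rightarrow> 's) \<Rightarrow> nat \<Rightarrow> 'w \<Rightarrow> real ^ 's" where
  "weighted_occupation g N x0 X 0 = (\<lambda>\<omega>. axis x0 1)"
| "weighted_occupation g N x0 X (Suc k) = (\<lambda>\<omega>.
     (1 - step_size g (Suc k)) *\<^sub>R weighted_occupation g N x0 X k \<omega>
     + step_size g (Suc k) *\<^sub>R ((1 / real N) *\<^sub>R (\<Sum>i=1..N. axis (X i (Suc k) \<omega>) 1)))"

primrec particle_filtration ::
    "'w measure \<Rightarrow> nat \<Rightarrow> (nat \<Rightarrow> nat \<Rightarrow> 'w \<Rightarrow> 's) \<Rightarrow> nat \<Rightarrow> 'w measure" where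
  "particle_filtration M N X 0 = sigma (space M) {}"
| "particle_filtration M N X (Suc k) = sigma (space M)
     (sets (particle_filtration M N X k)
      \<union> {X i (Suc k) -` A \<inter> space M | i A. i \<in> {1..N}})"

definition algorithm_I ::
    "'w measure \<Rightarrow> real ^ ('s::finite) option ^ 's option \<Rightarrow> real \<Rightarrow> nat \<Rightarrow> 's
      \<Rightarrow> (nat \<Rightarrow> nat \<Rightarrow> 'w \<Rightarrow> 's) \<Rightarrow> bool" where
  "algorithm_I M P g N x0 X \<longleftrightarrow>
     (\<forall>i\<in>{1..N}. \<forall>k. X i k \<in> measurable M (count_space UNIV)) \<and>
     (\<forall>i\<in>{1..N}. \<forall>\<omega>\<in>space M. X i 0 \<omega> = x0) \<and>
     (\<forall>k y. AE \<omega> in M.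
        real_cond_exp M (particle_filtration M N X k)
          (indicator {\<omega> \<in> space M. \<forall>i\<in>{1..N}. X i (Suc k) \<omega> = y i}) \<omega>
        = (\<Prod>i=1..N. K P (weighted_occupation g N x0 X k \<omega>) $ X i k \<omega> $ y i))"

section \<open>Weak convergence and normal laws in Euclidean space\<close>

definition converges_in_distribution ::
    "'w measure \<Rightarrow> (nat \<Rightarrow> 'w \<Rightarrow> 'b::euclidean_space) \<Rightarrow> 'b measure \<Rightarrow> bool" where
  "converges_in_distribution M Z \<mu> \<longleftrightarrow>
     (\<forall>f :: 'b \<Rightarrow> real. continuous_on UNIV f \<and> bounded (range f) \<longrightarrow>
        (\<lambda>n. \<integral>x. f x \<partial>distr M borel (Z n)) \<longlonglongrightarrow> (\<integral>x. f x \<partial>\<mu>))"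

text \<open>The covariance matrix may be singular, so there need not be a density and the normal
  law is specified by its characteristic function.\<close>

definition normal_law :: "(real ^ 's) measure \<Rightarrow> real ^ 's \<Rightarrow> real ^ 's ^ 's \<Rightarrow> bool" where
  "normal_law \<mu> m V \<longleftrightarrow>
     prob_space \<mu> \<and> sets \<mu> = sets borel \<and>
     (\<forall>u. (CLINT x|\<mu>. iexp (u \<bullet> x))
        = exp (\<i> * complex_of_real (u \<bullet> m) - complex_of_real (u \<bullet> (V *v u)) / 2))"

end

theory Submission
  imports Defs "HOL-Computational_Algebra.Fundamental_Theorem_Algebra" "HOL-Library.Discrete_Functions"
begin

text \<open>
  Let \<open>A\<close> be the restriction of \<open>P\<close> to the non-absorbing states, \<open>G\<close> the inverse of \<open>I - A\<close> and \<open>g1 = G 1\<close>. Then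
  \<open>\<pi>(\<nu>) = \<nu> G / (\<nu> g1)\<close>, and \<open>\<theta>\<close> is the left Perron eigenvector of \<open>G\<close>. A Poisson-equation corrector turns
  \<open>\<theta>\<^sub>k\<close> into a path whose increments are \<open>\<gamma>\<^sub>k\<^sub>+\<^sub>1 (h(\<theta>\<^sub>k) + \<xi>\<^sub>k)\<close> with martingale differences \<open>\<xi>\<close>. Let \<open>X\<close> solve
  the linear recursion with drift \<open>\<nabla>h(\<theta>)\<close> and noise \<open>\<xi>\<close>. The normalized map \<open>\<nu> \<mapsto> \<nu> G\<close> is a
  contraction of the whole simplex, so smallness of \<open>X\<close> forces convergence of \<open>\<theta>\<^sub>k\<close> to \<open>\<theta>\<close>; once the path is
  close to \<open>\<theta>\<close>, the remainder \<open>\<theta>\<^sub>n - \<theta> - X\<^sub>n\<close> is of order \<open>1/n\<close> plus the accumulated squares of \<open>X\<close>, which is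
  \<open>o(1/\<sigma>\<^sub>n)\<close> because \<open>a(n)/n \<longrightarrow> 0\<close> and \<open>\<gamma> L > 1\<close>.

  For the linear part, \<open>u\<close> is transported backwards by the adjoint recursion to \<open>u\<^sub>k\<close>, so that \<open>u\<^sub>k \<bullet> X\<^sub>k\<close>
  changes by martingale increments only. The Lyapunov equation says that the increments of
  \<open>q\<^sub>k = (\<gamma>\<^sub>k / \<gamma>\<^sub>n) u\<^sub>k \<bullet> V u\<^sub>k\<close> cancel the conditional variances on average, hence the expectation of
  \<open>exp (i \<sigma>\<^sub>n u\<^sub>k \<bullet> X\<^sub>k + q\<^sub>k / 2)\<close> is asymptotically constant in \<open>k\<close>, which yields the Gaussian characteristic
  function; the same telescoping of \<open>q\<close> gives uniqueness and nonnegativity of \<open>V\<close>. The fluctuation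
  of the empirical measure in the conditional variance is removed by a second Poisson corrector.
\<close>

section \<open>Quadratic forms of Hurwitz matrices\<close>

text \<open>Scaling: \<open>sn n\<close> is of order sqrt (a(n) n) and the remainder has mean
  O(1/n), so their product is of order sqrt (a(n)/n). The bound O(1/n) comes from a scalar recursion
  whose rate must exceed 1, and this rate is \<gamma> times a number below L. Part of L is given
  away twice: once because the derivative need not be a normal matrix and contracts only in an
  adapted inner product (\<open>Lq\<close>), once for the quadratic error of the drift
  (\<open>Lr\<close>). Both stay above 1/\<gamma>. The systems for different n are not coupled, so
  almost sure convergence along n is out of reach. Instead all trajectory estimates concern
  arbitrary deterministic sequences, with constants independent of n and of the path, and
  probability enters through the event that \<open>Xn\<close> leaves a small ball after a fixed
  time. It has probability O(1/a(n)): noise at a fixed time is averaged over a(n) particles, later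
  noise is damped by the step sizes. The derivative is determined on the tangent space only; it is
  extended to a Hurwitz matrix \<open>J\<close> on the whole space, so that tangency need not be
  tracked. The formulas through G are explicit for all \<nu>, and are compared with the integral Q
  at \<theta>.\<close>

definition poly_op :: "(complex^'n \<Rightarrow> complex^'n) \<Rightarrow> complex poly \<Rightarrow> complex^'n \<Rightarrow> complex^'n" where
  "poly_op T p v = (\<Sum>i\<le>degree p. coeff p i *s (T ^^ i) v)"

lemma poly_op_0 [simp]: "poly_op T 0 v = 0"
  by (simp add: poly_op_def)

context
  fixes T :: "complex^'n \<Rightarrow> complex^'n"
  assumes T: "Vector_Spaces.linear (*s) (*s) T"
begin

interpretation T: Vector_Spaces.linear "(*s)" "(*s)" T by (rule T)

lemma poly_op_pCons: "poly_op T (pCons a p) v = a *s v + T (poly_op T p v)"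
proof (cases "p = 0")
  case True
  then show ?thesis by (simp add: poly_op_def T.zero)
next
  case False
  then have "poly_op T (pCons a p) v = (\<Sum>i\<le>Suc (degree p). coeff (pCons a p) i *s (T ^^ i) v)"
    by (simp add: poly_op_def)
  also have "\<dots> = a *s v + (\<Sum>i\<le>degree p. coeff p i *s (T ^^ Suc i) v)"
    by (subst sum.atMost_Suc_shift) simp
  also have "\<dots> = a *s v + T (poly_op T p v)"
    by (simp add: poly_op_def T.sum T.scale)
  finally show ?thesis .
qed

lemma poly_op_add: "poly_op T (p + q) v = poly_op T p v + poly_op T q v"
  by (induction p q rule: poly_induct2) (simp_all add: poly_op_pCons T.add vec.scale_left_distrib)

lemma poly_op_smult: "poly_op T (smult c p) v = c *s poly_op T p v"
  by (induction p) (simp_all add: poly_op_pCons T.scale vec.scale_right_distrib)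

lemma poly_op_mult: "poly_op T (p * q) v = poly_op T p (poly_op T q v)"
  by (induction p) (simp_all add: poly_op_pCons poly_op_add poly_op_smult)

lemma poly_op_monom: "poly_op T (monom c i) v = c *s (T ^^ i) v"
  by (induction i) (simp_all add: monom_0 monom_Suc poly_op_pCons T.zero T.scale)

lemma poly_op_sum: "poly_op T (\<Sum>i\<in>I. f i) v = (\<Sum>i\<in>I. poly_op T (f i) v)"
  by (induction I rule: infinite_finite_induct) (simp_all add: poly_op_add)

lemma poly_op_linear_factor: "poly_op T [:- a, 1:] v = T v - a *s v"
  by (simp add: poly_op_pCons T.zero)

text \<open>An annihilating polynomial of least degree has only eigenvalues as roots.\<close>
lemma split_annihilator:
  assumes ex: "\<exists>p. p \<noteq> 0 \<and> (\<forall>v. poly_op T p v = 0)"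
  obtains as where "\<forall>v. poly_op T (\<Prod>a\<leftarrow>as. [:- a, 1:]) v = 0"
    "\<forall>a\<in>set as. \<exists>w. w \<noteq> 0 \<and> T w = a *s w"
proof -
  obtain p where p: "p \<noteq> 0" "\<forall>v. poly_op T p v = 0"
    and least: "\<And>q. q \<noteq> 0 \<and> (\<forall>v. poly_op T q v = 0) \<Longrightarrow> degree p \<le> degree q"
    using ex_has_least_nat[of "\<lambda>p. p \<noteq> 0 \<and> (\<forall>v. poly_op T p v = 0)" _ degree] ex by metis
  obtain as where mas: "mset as = proots p" using ex_mset by blast
  have "(\<Prod>a\<leftarrow>as. [:- a, 1:]) = (\<Prod>a\<in>#proots p. [:- a, 1:])"
    unfolding mas[symmetric] by (metis mset_map prod_mset_prod_list)
  then have as: "smult (coeff p (degree p)) (\<Prod>a\<leftarrow>as. [:- a, 1:]) = p"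
    using complex_poly_decompose_multiset[of p] by simp
  have c0: "coeff p (degree p) \<noteq> 0" using p(1) by simp
  have ann: "\<forall>v. poly_op T (\<Prod>a\<leftarrow>as. [:- a, 1:]) v = 0"
  proof
    fix v
    have "coeff p (degree p) *s poly_op T (\<Prod>a\<leftarrow>as. [:- a, 1:]) v = 0"
      using p(2) as poly_op_smult by metis
    then show "poly_op T (\<Prod>a\<leftarrow>as. [:- a, 1:]) v = 0" using c0 by (simp add: vec.scale_eq_0_iff)
  qed
  have "\<exists>w. w \<noteq> 0 \<and> T w = a *s w" if "a \<in> set as" for a
  proof -
    have "poly (\<Prod>a\<leftarrow>as. [:- a, 1:]) a = 0" using that by (induction as) auto
    then have "poly p a = 0" by (metis as poly_smult mult_zero_right)
    then have "[:- a, 1:] dvd p" by (simp only: poly_eq_0_iff_dvd)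
    then obtain q where q: "p = [:- a, 1:] * q" by (rule dvdE)
    have q0: "q \<noteq> 0" using q p(1) by auto
    have "degree p = Suc (degree q)" using q0 unfolding q by (subst degree_mult_eq) auto
    \<comment> \<open>The cofactor has smaller degree, so it does not annihilate; a nonzero value of
      \<open>q(T)\<close> is killed by \<open>T - a\<close>.\<close>
    then have "\<exists>v. poly_op T q v \<noteq> 0" using least[of q] q0 by force
    then obtain v where v: "poly_op T q v \<noteq> 0" by blast
    have "T (poly_op T q v) - a *s poly_op T q v = 0"
      using p(2) poly_op_mult[of "[:- a, 1:]" q v] unfolding q[symmetric]
      by (simp add: poly_op_linear_factor)
    with v show ?thesis by (intro exI[of _ "poly_op T q v"]) auto
  qed
  with ann that show ?thesis by blast
qed

lemma linear_T: "linear T"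
proof
  show "T (x + y) = T x + T y" for x y by (rule T.add)
  have *: "r *\<^sub>R x = complex_of_real r *s x" for r and x :: "complex^'n"
    by (simp add: vec_eq_iff complex_eq_iff)
  show "T (r *\<^sub>R x) = r *\<^sub>R T x" for r x unfolding * by (rule T.scale)
qed

text \<open>Along the chain \<open>v, (T - a) v, \<dots>\<close> the operator is triangular; weighting the later
  vectors heavily makes the off-diagonal part negligible.\<close>
lemma lyapunov_form_of_annihilator:
  fixes L :: real
  assumes "\<forall>a\<in>set as. Re a \<le> - L" and "e > 0"
  shows "\<exists>B :: complex^'n \<Rightarrow> complex^'n \<Rightarrow> real. bilinear B \<and> (\<forall>v w. B v w = B w v) \<and>
     (\<forall>v. v \<bullet> v \<le> B v v) \<and>
     (\<forall>v. poly_op T (\<Prod>a\<leftarrow>as. [:- a, 1:]) v = 0 \<longrightarrow> B v (T v) \<le> - (L - e) * B v v)"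
  using assms
proof (induction as arbitrary: e)
  case Nil
  then show ?case
    by (intro exI[of _ "(\<bullet>)"])
      (auto simp: bilinear_conv_bounded_bilinear bounded_bilinear_inner inner_commute
        poly_op_pCons one_pCons T.zero)
next
  case (Cons a as)
  have e2: "e / 2 > 0" using Cons.prems by simp
  obtain B where B: "bilinear B" "\<forall>v w. B v w = B w v" "\<forall>v. v \<bullet> v \<le> B v v"
    "\<forall>v. poly_op T (\<Prod>a\<leftarrow>as. [:- a, 1:]) v = 0 \<longrightarrow> B v (T v) \<le> - (L - e/2) * B v v"
    using Cons.IH[OF _ e2] Cons.prems by auto
  define w where "w v = T v - a *s v" for v
  have linw: "linear w" unfolding w_def
  proof (rule linear_compose_sub[OF linear_T])
    show "linear (\<lambda>v. a *s v)"
      by (rule linearI) (simp_all add: vec_eq_iff algebra_simps scaleR_conv_of_real)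
  qed
  \<comment> \<open>Weight for which the slack \<open>e / 2\<close> left by the induction
    hypothesis, times \<open>c\<close>, equals the coefficient \<open>1 / (4 * e)\<close> with which
    Young's inequality charges the coupling term \<open>v \<bullet> w v\<close>.\<close>
  define c where "c = 1 / (2 * e^2)"
  have c: "c > 0" using Cons.prems by (simp add: c_def)
  define B' where "B' v v' = v \<bullet> v' + c * B (w v) (w v')" for v v'
  have l1: "linear (\<lambda>x. B (w y) (w x))" for y
    using linear_compose[OF linw, of "B (w y)"] B(1) unfolding bilinear_def o_def by blast
  have l2: "linear (\<lambda>x. B (w x) (w y))" for y
    using linear_compose[OF linw, of "\<lambda>x. B x (w y)"] B(1) unfolding bilinear_def o_def by blast
  have l3: "linear (\<lambda>x. c * B (w y) (w x))" "linear (\<lambda>x. c * B (w x) (w y))" for y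
    using linear_compose_scale_right[OF l1, of c] linear_compose_scale_right[OF l2, of c] by simp_all
  have bil: "bilinear B'"
    unfolding bilinear_def B'_def
    by (intro conjI allI linear_compose_add l3
          bounded_linear.linear[OF bounded_linear_inner_right] bounded_linear.linear[OF bounded_linear_inner_left])
  have pos: "0 \<le> B v v" for v using B(3) inner_ge_zero order_trans by blast
  have "B' v (T v) \<le> - (L - e) * B' v v"
    if v: "poly_op T (\<Prod>a\<leftarrow>a # as. [:- a, 1:]) v = 0" for v
  proof -
    have "poly_op T ((\<Prod>a\<leftarrow>as. [:- a, 1:]) * [:- a, 1:]) v = 0" using v by (simp add: mult.commute)
    then have "poly_op T (\<Prod>a\<leftarrow>as. [:- a, 1:]) (w v) = 0"
      unfolding poly_op_mult poly_op_linear_factor w_def .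
    then have 1: "B (w v) (T (w v)) \<le> - (L - e/2) * B (w v) (w v)" using B(4) by blast
    have 2: "w (T v) = T (w v)" by (simp add: w_def T.diff T.scale)
    have "v \<bullet> (a *s v) = Re a * (v \<bullet> v)"
      unfolding inner_vec_def sum_distrib_left
      by (intro sum.cong refl) (simp add: inner_complex_def algebra_simps)
    also have "\<dots> \<le> - L * (v \<bullet> v)" using Cons.prems by (intro mult_right_mono) auto
    finally have 3: "v \<bullet> (a *s v) \<le> - L * (v \<bullet> v)" .
    have 4: "v \<bullet> (T v) = v \<bullet> (a *s v) + v \<bullet> w v" by (simp add: w_def inner_diff_right)
    have "v \<bullet> w v \<le> norm v * norm (w v)" by (rule norm_cauchy_schwarz)
    also have "\<dots> \<le> e * (norm v)^2 + (norm (w v))^2 / (4 * e)"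
    proof -
      have "0 \<le> (2 * e * norm v - norm (w v))^2 / (4 * e)" using Cons.prems by simp
      also have "\<dots> = e * (norm v)^2 + (norm (w v))^2 / (4 * e) - norm v * norm (w v)"
        using Cons.prems by (simp add: power2_eq_square field_simps)
      finally show ?thesis by simp
    qed
    also have "\<dots> \<le> e * (v \<bullet> v) + B (w v) (w v) / (4 * e)"
      using Cons.prems B(3) by (simp add: power2_norm_eq_inner divide_right_mono)
    finally have 5: "v \<bullet> w v \<le> e * (v \<bullet> v) + B (w v) (w v) / (4 * e)" .
    have "c * B (w v) (T (w v)) \<le> c * (- (L - e/2) * B (w v) (w v))"
      using 1 c by simp
    then have 6: "c * B (w v) (T (w v)) \<le> - (L - e) * (c * B (w v) (w v)) - (c * e / 2) * B (w v) (w v)"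
      by (simp add: algebra_simps)
    have 7: "c * e / 2 = 1 / (4 * e)" using Cons.prems by (simp add: c_def power2_eq_square)
    have "B' v (T v) = v \<bullet> (a *s v) + v \<bullet> w v + c * B (w v) (T (w v))"
      by (simp add: B'_def 2 4)
    also have "\<dots> \<le> - L * (v \<bullet> v) + (e * (v \<bullet> v) + B (w v) (w v) / (4 * e)) +
       (- (L - e) * (c * B (w v) (w v)) - (c * e / 2) * B (w v) (w v))"
      by (intro add_mono 3 5 6)
    also have "\<dots> = - (L - e) * B' v v" unfolding 7 B'_def by (simp add: algebra_simps)
    finally show ?thesis .
  qed
  moreover have "v \<bullet> v \<le> B' v v" for v using c pos by (simp add: B'_def)
  moreover have "B' v v' = B' v' v" for v v' using B(2) by (simp add: B'_def inner_commute)
  ultimately show ?case using bil by blast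
qed

end

definition cmat :: "real^'n^'m \<Rightarrow> complex^'n^'m" where
  "cmat A = (\<chi> i j. complex_of_real (A $ i $ j))"

text \<open>The powers of \<open>J\<close> up to the dimension of the matrix space are one too many
  to be linearly independent; a relation among them is an annihilating polynomial.\<close>

lemma real_matrix_annihilator:
  fixes J :: "real^'n^'n"
  shows "\<exists>p. p \<noteq> 0 \<and> (\<forall>v. poly_op ((*v) (cmat J)) p v = 0)"
proof -
  let ?T = "(*v) (cmat J)"
  have lin: "Vector_Spaces.linear (*s) (*s) ?T" by (rule matrix_vector_mul_linear_gen)
  have pw: "(?T ^^ i) v = cmat (mat_pow J i) *v v" for i v
  proof (induction i)
    case 0
    then show ?case by (simp add: cmat_def vec_eq_iff matrix_vector_mult_def mat_def if_distrib if_distribR sum.If_cases cong: if_cong)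
  next
    case (Suc i)
    have "cmat J ** cmat (mat_pow J i) = cmat (mat_pow J (Suc i))"
      by (simp add: cmat_def vec_eq_iff matrix_matrix_mult_def)
    then show ?case using Suc by (simp add: matrix_vector_mul_assoc)
  qed
  let ?m = "DIM(real^'n^'n)"
  have "\<exists>c::nat\<Rightarrow>real. (\<exists>i\<le>?m. c i \<noteq> 0) \<and> (\<Sum>i\<le>?m. c i *\<^sub>R mat_pow J i) = 0"
  proof (cases "inj_on (mat_pow J) {..?m}")
    case True
    have "dependent (mat_pow J ` {..?m})"
      using True by (intro dependent_biggerset) (auto simp: card_image)
    then obtain u where u: "\<exists>v\<in>mat_pow J ` {..?m}. u v \<noteq> 0" "(\<Sum>v\<in>mat_pow J ` {..?m}. u v *\<^sub>R v) = 0"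
      by (subst (asm) dependent_finite) auto
    from u(2) have "(\<Sum>i\<le>?m. u (mat_pow J i) *\<^sub>R mat_pow J i) = 0"
      using True by (simp add: sum.reindex)
    then show ?thesis using u(1) by (intro exI[of _ "\<lambda>i. u (mat_pow J i)"]) auto
  next
    \<comment> \<open>Equal powers shrink the set, so counting dimensions says nothing; but then
      their difference is already a relation.\<close>
    case False
    then obtain i j where ij: "i \<le> ?m" "j \<le> ?m" "i \<noteq> j" "mat_pow J i = mat_pow J j"
      unfolding inj_on_def by auto
    let ?c = "\<lambda>k. (if k = i then 1 else 0) - (if k = j then 1 else 0) :: real"
    have "(\<Sum>k\<le>?m. ?c k *\<^sub>R mat_pow J k) = 0"
      using ij by (simp add: scaleR_left_diff_distrib sum_subtractf if_distrib[of "\<lambda>c. c *\<^sub>R _"] cong: if_cong)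
    then show ?thesis using ij by (intro exI[of _ ?c]) auto
  qed
  then obtain c :: "nat \<Rightarrow> real" and i0 where c: "i0 \<le> ?m" "c i0 \<noteq> 0" "(\<Sum>i\<le>?m. c i *\<^sub>R mat_pow J i) = 0" by blast
  define p where "p = (\<Sum>i\<le>?m. monom (complex_of_real (c i)) i)"
  have "coeff p i0 = complex_of_real (c i0)" using c(1) by (simp add: p_def coeff_sum)
  then have "p \<noteq> 0" using c(2) by auto
  moreover have "poly_op ?T p v = 0" for v
  proof -
    have "poly_op ?T p v = (\<Sum>i\<le>?m. complex_of_real (c i) *s (cmat (mat_pow J i) *v v))"
      unfolding p_def poly_op_sum[OF lin] poly_op_monom[OF lin] pw ..
    also have "\<dots> = cmat (\<Sum>i\<le>?m. c i *\<^sub>R mat_pow J i) *v v"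
      unfolding vec_eq_iff cmat_def matrix_vector_mult_def
      by (auto simp: sum_distrib_left sum_distrib_right mult.assoc intro: sum.swap)
    also have "\<dots> = 0" unfolding c(3) by (simp add: cmat_def vec_eq_iff matrix_vector_mult_def)
    finally show ?thesis .
  qed
  ultimately show ?thesis by blast
qed

text \<open>Lyapunov's stability theorem with a rate. Arbitrarily little of \<open>L\<close> is
  lost, and in general something must be lost because of Jordan blocks. The form is built on complex
  vectors, where the annihilator splits, and restricted to real ones.\<close>

lemma hurwitz_form:
  fixes J :: "real^'n^'n"
  assumes ev: "\<And>z v. v \<noteq> 0 \<Longrightarrow> cmat J *v v = z *s v \<Longrightarrow> Re z \<le> - L" and "L' < L"
  obtains S :: "real^'n^'n" where "transpose S = S" "\<And>x. x \<bullet> x \<le> x \<bullet> (S *v x)"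
    "\<And>x. x \<bullet> (S *v (J *v x)) \<le> - L' * (x \<bullet> (S *v x))"
proof -
  let ?T = "(*v) (cmat J)"
  have lin: "Vector_Spaces.linear (*s) (*s) ?T" by (rule matrix_vector_mul_linear_gen)
  obtain as where as: "\<forall>v. poly_op ?T (\<Prod>a\<leftarrow>as. [:- a, 1:]) v = 0"
    "\<forall>a\<in>set as. \<exists>w. w \<noteq> 0 \<and> ?T w = a *s w"
    using split_annihilator[OF lin real_matrix_annihilator] by blast
  then have "\<forall>a\<in>set as. Re a \<le> - L" using ev by blast
  from lyapunov_form_of_annihilator[OF lin this, of "L - L'"] assms(2) as(1)
  obtain B :: "complex^'n \<Rightarrow> complex^'n \<Rightarrow> real" where B: "bilinear B" "\<forall>v w. B v w = B w v"
    "\<forall>v. v \<bullet> v \<le> B v v" "\<forall>v. B v (?T v) \<le> - L' * B v v"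
    by auto
  define c :: "real^'n \<Rightarrow> complex^'n" where "c x = (\<chi> i. of_real (x $ i))" for x
  have linc: "linear c"
    by (rule linearI) (simp_all add: c_def vec_eq_iff complex_eq_iff)
  define S :: "real^'n^'n" where "S = (\<chi> i j. B (c (axis i 1)) (c (axis j 1)))"
  have bil: "bilinear (\<lambda>x y. B (c x) (c y))"
    using B(1) linear_compose[OF linc] unfolding bilinear_def o_def by blast
  have S: "x \<bullet> (S *v y) = B (c x) (c y)" for x y
  proof -
    have "B (c x) (c y) = B (c (\<Sum>i\<in>UNIV. x $ i *\<^sub>R axis i 1)) (c (\<Sum>j\<in>UNIV. y $ j *\<^sub>R axis j 1))"
      by (simp add: basis_expansion scalar_mult_eq_scaleR[symmetric])
    also have "\<dots> = (\<Sum>i\<in>UNIV. \<Sum>j\<in>UNIV. x $ i * y $ j * B (c (axis i 1)) (c (axis j 1)))"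
      by (simp add: bilinear_sum[OF bil] sum.cartesian_product bilinear_lmul[OF bil] bilinear_rmul[OF bil] split_def mult_ac)
    finally show ?thesis
      by (simp add: inner_vec_def matrix_vector_mult_def S_def sum_distrib_left mult_ac)
  qed
  have cJ: "c (J *v x) = cmat J *v c x" for x
    by (simp add: c_def cmat_def vec_eq_iff matrix_vector_mult_def)
  have cc: "c x \<bullet> c x = x \<bullet> x" for x
    by (simp add: c_def inner_vec_def inner_complex_def)
  show ?thesis
  proof (rule that[of S])
    show "transpose S = S" using B(2) by (simp add: S_def transpose_def vec_eq_iff)
    show "x \<bullet> x \<le> x \<bullet> (S *v x)" for x using B(3) cc by (metis S)
    show "x \<bullet> (S *v (J *v x)) \<le> - L' * (x \<bullet> (S *v x))" for x using B(4) unfolding S cJ by blast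
  qed
qed

section \<open>Normal laws and characteristic functions\<close>

lemma symmetric_matrix_swap:
  fixes V :: "real^'n^'n"
  assumes "transpose V = V"
  shows "x \<bullet> (V *v y) = y \<bullet> (V *v x)"
proof -
  have "x v* V = V *v x" using transpose_matrix_vector[of V x] assms by simp
  then show ?thesis using dot_lmul_matrix[of x V y] by (simp add: inner_commute)
qed

lemma psd_cauchy_schwarz:
  fixes V :: "real^'n^'n"
  assumes sym: "transpose V = V" and psd: "\<And>u. 0 \<le> u \<bullet> (V *v u)"
  shows "(u \<bullet> (V *v w))^2 \<le> (u \<bullet> (V *v u)) * (w \<bullet> (V *v w))"
proof -
  have swap: "x \<bullet> (V *v y) = y \<bullet> (V *v x)" for x y
    by (rule symmetric_matrix_swap[OF sym])
  define a where "a = u \<bullet> (V *v u)"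
  define b where "b = u \<bullet> (V *v w)"
  define c where "c = w \<bullet> (V *v w)"
  have q: "0 \<le> c + 2 * s * b + s^2 * a" for s
  proof -
    have "0 \<le> (w + s *\<^sub>R u) \<bullet> (V *v (w + s *\<^sub>R u))" by (rule psd)
    also have "\<dots> = c + 2 * s * b + s^2 * a"
      unfolding a_def b_def c_def
      by (simp add: matrix_vector_right_distrib matrix_vector_mult_scaleR inner_add_left inner_add_right
          swap[of w u] algebra_simps power2_eq_square)
    finally show ?thesis .
  qed
  have a0: "0 \<le> a" using psd by (simp add: a_def)
  show ?thesis
  proof (cases "a = 0")
    case True
    have "b = 0"
    proof (rule ccontr)
      assume "b \<noteq> 0"
      \<comment> \<open>With a = 0 the form is affine in s, and this s makes it equal to -1.\<close>
      with q[of "- (c + 1) / (2 * b)"] True show False by (simp add: field_simps)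
    qed
    then show ?thesis using True psd[of w] by (simp add: a_def b_def)
  next
    case False
    then have "a > 0" using a0 by simp
    have "0 \<le> c + 2 * (- b / a) * b + (- b / a)^2 * a" by (rule q)
    also have "\<dots> = c - b^2 / a" using False by (simp add: field_simps power2_eq_square)
    finally have "b^2 / a \<le> c" by simp
    then show ?thesis using \<open>a > 0\<close> by (simp add: a_def b_def c_def field_simps)
  qed
qed

text \<open>Adds to a \<open>\<mu>\<close>-distributed vector an independent standard normal
  multiple of \<open>l\<close>: on the product space the characteristic function factorizes and the
  exponents add up.\<close>

lemma normal_law_add_rank_one:
  fixes l :: "real^'n"
  assumes "normal_law \<mu> 0 V"
  shows "\<exists>\<mu>'. normal_law \<mu>' 0 (V + (\<chi> i j. l $ i * l $ j))"
proof -
  have ps: "prob_space \<mu>" and sets: "sets \<mu> = sets borel"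
    and cf: "\<And>u. (CLINT x|\<mu>. iexp (u \<bullet> x)) = exp (- complex_of_real (u \<bullet> (V *v u)) / 2)"
    using assms by (auto simp: normal_law_def)
  interpret \<mu>: prob_space \<mu> by (rule ps)
  interpret S: prob_space std_normal_distribution
    using real_dist_normal_dist by (simp add: real_distribution_def)
  interpret pair_prob_space \<mu> std_normal_distribution ..
  let ?f = "\<lambda>(x, t). x + t *\<^sub>R l"
  have [measurable]: "fst \<in> borel_measurable (\<mu> \<Otimes>\<^sub>M std_normal_distribution)"
    "snd \<in> borel_measurable (\<mu> \<Otimes>\<^sub>M std_normal_distribution)"
    using measurable_compose[OF measurable_fst measurable_ident_sets[OF sets]]
      measurable_compose[OF measurable_snd measurable_ident_sets[of std_normal_distribution borel]] by simp_all
  have meas: "?f \<in> measurable (\<mu> \<Otimes>\<^sub>M std_normal_distribution) borel"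
    unfolding split_beta' by measurable
  define \<mu>' where "\<mu>' = distr (\<mu> \<Otimes>\<^sub>M std_normal_distribution) borel ?f"
  have "prob_space \<mu>'" unfolding \<mu>'_def by (rule prob_space_distr[OF meas])
  moreover have "sets \<mu>' = sets borel" by (simp add: \<mu>'_def)
  moreover have "(CLINT x|\<mu>'. iexp (u \<bullet> x)) =
     exp (- complex_of_real (u \<bullet> ((V + (\<chi> i j. l $ i * l $ j)) *v u)) / 2)" for u
  proof -
    have m1: "(\<lambda>x. iexp (u \<bullet> x)) \<in> borel_measurable borel" by measurable
    have "(CLINT x|\<mu>'. iexp (u \<bullet> x)) =
      (CLINT z|(\<mu> \<Otimes>\<^sub>M std_normal_distribution). iexp (u \<bullet> ?f z))"
      unfolding \<mu>'_def by (rule integral_distr[OF meas m1])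
    also have "\<dots> = (CLINT x|\<mu>. CLINT t|std_normal_distribution. iexp (u \<bullet> ?f (x, t)))"
    proof (rule integral_fst'[symmetric])
      show "integrable (\<mu> \<Otimes>\<^sub>M std_normal_distribution) (\<lambda>z. iexp (u \<bullet> ?f z))"
        by (rule P.integrable_const_bound[of _ 1])
          (use measurable_compose[OF meas m1] in \<open>auto simp: norm_exp_i_times\<close>)
    qed
    also have "\<dots> = (CLINT x|\<mu>. iexp (u \<bullet> x) * char std_normal_distribution (u \<bullet> l))"
    proof (rule Bochner_Integration.integral_cong[OF refl])
      fix x
      have "(CLINT t|std_normal_distribution. iexp (u \<bullet> ?f (x, t))) =
        (CLINT t|std_normal_distribution. iexp (u \<bullet> x) * iexp ((u \<bullet> l) * t))"
        by (intro Bochner_Integration.integral_cong refl)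
          (simp add: inner_add_right exp_add ring_distribs mult.commute)
      then show "(CLINT t|std_normal_distribution. iexp (u \<bullet> ?f (x, t))) =
        iexp (u \<bullet> x) * char std_normal_distribution (u \<bullet> l)"
        by (simp add: char_def)
    qed
    also have "\<dots> = exp (- complex_of_real (u \<bullet> (V *v u)) / 2) * exp (- complex_of_real ((u \<bullet> l)^2) / 2)"
      by (simp add: cf char_std_normal_distribution exp_of_real[symmetric])
    also have "\<dots> = exp (- complex_of_real (u \<bullet> (V *v u) + (u \<bullet> l)^2) / 2)"
      by (simp add: exp_add[symmetric] field_simps)
    also have "u \<bullet> (V *v u) + (u \<bullet> l)^2 = u \<bullet> ((V + (\<chi> i j. l $ i * l $ j)) *v u)"
      by (simp add: matrix_vector_mult_add_rdistrib inner_add_right power2_eq_square)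
        (simp add: inner_vec_def matrix_vector_mult_def sum_distrib_left sum_distrib_right mult_ac)
    finally show ?thesis .
  qed
  ultimately show ?thesis unfolding normal_law_def by (intro exI[of _ \<mu>']) simp
qed

text \<open>Induction on the rank of \<open>V\<close>. One step of a Cholesky decomposition removes
  the rank-one part along \<open>V *v u0\<close>; Cauchy-Schwarz keeps the rest nonnegative, and its
  kernel has gained \<open>u0\<close>. Rank zero is the point mass at the origin.\<close>

lemma normal_law_exists:
  fixes V :: "real^'n^'n"
  assumes "transpose V = V" "\<And>u. 0 \<le> u \<bullet> (V *v u)"
  shows "\<exists>\<mu>. normal_law \<mu> 0 V"
  using assms
proof (induction "DIM(real^'n) - dim {u. V *v u = 0}" arbitrary: V rule: less_induct)
  case less
  note sym = less.prems(1) and psd = less.prems(2)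
  have swap: "x \<bullet> (V *v y) = y \<bullet> (V *v x)" for x y
    by (rule symmetric_matrix_swap[OF sym])
  show ?case
  proof (cases "\<exists>u. u \<bullet> (V *v u) \<noteq> 0")
    case False
    then have z: "u \<bullet> (V *v u) = 0" for u by blast
    interpret prob_space "return borel (0::real^'n)" by (rule prob_space_return) simp
    have "normal_law (return borel 0) 0 V"
      unfolding normal_law_def by (auto simp: z integral_return prob_space_axioms)
    then show ?thesis by blast
  next
    case True
    then obtain u0 where u0: "u0 \<bullet> (V *v u0) \<noteq> 0" by blast
    define c where "c = u0 \<bullet> (V *v u0)"
    have c: "c > 0" using u0 psd[of u0] by (simp add: c_def)
    define l where "l = (1 / sqrt c) *\<^sub>R (V *v u0)"
    define V' where "V' = V - (\<chi> i j. l $ i * l $ j)"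
    have Vu: "V' *v u = V *v u - (l \<bullet> u) *\<^sub>R l" for u
      by (simp add: V'_def matrix_vector_mult_diff_rdistrib)
        (simp add: vec_eq_iff inner_vec_def matrix_vector_mult_def sum_distrib_left sum_distrib_right mult_ac)
    have lu: "l \<bullet> u = (u \<bullet> (V *v u0)) / sqrt c" for u by (simp add: l_def inner_commute)
    have sym': "transpose V' = V'"
      using sym by (simp add: V'_def transpose_def vec_eq_iff mult.commute)
    have psd': "0 \<le> u \<bullet> (V' *v u)" for u
    proof -
      have "u \<bullet> (V' *v u) = u \<bullet> (V *v u) - (u \<bullet> (V *v u0))^2 / c"
        using c by (simp add: Vu inner_diff_right lu inner_commute[of u l] power2_eq_square)
      also have "\<dots> \<ge> 0" using psd_cauchy_schwarz[OF sym psd, of u u0] c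
        by (simp add: c_def[symmetric] field_simps)
      finally show ?thesis .
    qed
    have sub: "subspace {u. V *v u = 0}" "subspace {u. V' *v u = 0}"
      by (auto simp: subspace_def matrix_vector_right_distrib matrix_vector_mult_scaleR)
    have "{u. V *v u = 0} \<subseteq> {u. V' *v u = 0}"
      by (auto simp: Vu lu swap[of _ u0])
    moreover have "V' *v u0 = 0"
      using c unfolding Vu lu c_def[symmetric] by (simp add: l_def real_div_sqrt)
    moreover have "V *v u0 \<noteq> 0" using u0 by auto
    ultimately have "{u. V *v u = 0} \<subset> {u. V' *v u = 0}" by blast
    then have "dim {u. V *v u = 0} < dim {u. V' *v u = 0}"
      by (intro dim_psubset) (simp only: sub[THEN span_eq_iff[THEN iffD2]])
    moreover have "dim {u. V' *v u = 0} \<le> DIM(real^'n)" by (rule dim_subset_UNIV)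
    ultimately obtain \<mu> where "normal_law \<mu> 0 V'" using less.hyps[OF _ sym' psd'] by force
    from normal_law_add_rank_one[OF this, of l] show ?thesis by (simp add: V'_def)
  qed
qed

section \<open>Trigonometric polynomials and Levy's continuity theorem\<close>

inductive trig_poly :: "(real^'n \<Rightarrow> complex) \<Rightarrow> bool" where
  monomial: "trig_poly (\<lambda>x. c * iexp (u \<bullet> x))"
| sum: "trig_poly f \<Longrightarrow> trig_poly g \<Longrightarrow> trig_poly (\<lambda>x. f x + g x)"

lemma trig_poly_const: "trig_poly (\<lambda>x. c)"
  using trig_poly.monomial[of c 0] by simp

lemma trig_poly_mult:
  assumes "trig_poly f" "trig_poly g" shows "trig_poly (\<lambda>x. f x * g x)"
  using assms
proof (induction f)
  case (monomial c u)
  then show ?case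
  proof (induction g)
    case (monomial c' u')
    then show ?case using trig_poly.monomial[of "c * c'" "u + u'"]
      by (simp add: inner_add_left exp_add ring_distribs mult_ac)
  next
    case (sum f g)
    then show ?case using trig_poly.sum by (simp add: ring_distribs)
  qed
next
  case (sum f g)
  then show ?case using trig_poly.sum by (simp add: ring_distribs)
qed

lemma trig_poly_sum: "(\<And>i. i \<in> I \<Longrightarrow> trig_poly (f i)) \<Longrightarrow> trig_poly (\<lambda>x. \<Sum>i\<in>I. f i x)"
  by (induction I rule: infinite_finite_induct) (auto intro: trig_poly_const trig_poly.sum)

lemma trig_poly_sin: "trig_poly (\<lambda>x::real^'n. complex_of_real (sin (s * x $ i)))"
proof -
  have "complex_of_real (sin y) = (1 / (2 * \<i>)) * iexp y + (- 1 / (2 * \<i>)) * iexp (- y)" for y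
    unfolding sin_of_real[symmetric] sin_exp_eq by (simp add: field_simps)
  then have "(\<lambda>x::real^'n. complex_of_real (sin (s * x $ i))) =
    (\<lambda>x. (1 / (2 * \<i>)) * iexp ((s *\<^sub>R axis i 1) \<bullet> x) + (- 1 / (2 * \<i>)) * iexp ((- s *\<^sub>R axis i 1) \<bullet> x))"
    by (simp add: inner_axis')
  then show ?thesis by (simp only:) (intro trig_poly.intros)
qed

text \<open>A sine is a combination of two characters and characters multiply to characters, so
  polynomials in scaled sines stay in the class whose integrals are read off from characteristic
  functions.\<close>

lemma trig_poly_of_polynomial:
  fixes p :: "real^'n \<Rightarrow> real"
  assumes "real_polynomial_function p"
  shows "trig_poly (\<lambda>x. complex_of_real (p (\<chi> i. sin (s * x $ i))))"
  using assms
proof (induction p)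
  case (linear f)
  interpret f: bounded_linear f by (rule linear)
  have "f y = (\<Sum>i\<in>UNIV. y $ i * f (axis i 1))" for y
  proof -
    have "f y = f (\<Sum>i\<in>UNIV. y $ i *\<^sub>R axis i 1)"
      by (simp add: basis_expansion scalar_mult_eq_scaleR[symmetric])
    also have "\<dots> = (\<Sum>i\<in>UNIV. y $ i * f (axis i 1))" by (simp only: f.sum f.scaleR real_scaleR_def)
    finally show ?thesis .
  qed
  from this[of "\<chi> i. sin (s * _ $ i)"]
  have eq: "complex_of_real (f (\<chi> i. sin (s * x $ i))) =
     (\<Sum>i\<in>UNIV. complex_of_real (sin (s * x $ i)) * complex_of_real (f (axis i 1)))" for x :: "real^'n"
    by (simp only: of_real_sum of_real_mult vec_lambda_beta)
  show ?case
    unfolding eq by (rule trig_poly_sum) (rule trig_poly_mult[OF trig_poly_sin trig_poly_const])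
qed (simp_all add: trig_poly_const trig_poly.sum trig_poly_mult)

lemma trig_poly_continuous: "trig_poly f \<Longrightarrow> continuous_on UNIV f"
  by (induction rule: trig_poly.induct) (auto intro!: continuous_intros)

lemma trig_poly_bounded: "trig_poly f \<Longrightarrow> \<exists>B. \<forall>x. norm (f x) \<le> B"
proof (induction rule: trig_poly.induct)
  case (monomial c u)
  then show ?case by (intro exI[of _ "norm c"]) (simp add: norm_mult norm_exp_i_times)
next
  case (sum f g)
  then obtain A B where "\<forall>x. norm (f x) \<le> A" "\<forall>x. norm (g x) \<le> B" by blast
  then have "\<forall>x. norm (f x + g x) \<le> A + B" by (simp add: norm_triangle_mono)
  then show ?case by blast
qed

lemma trig_poly_integrable:
  assumes "trig_poly f" "finite_measure N" "sets N = sets borel"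
  shows "integrable N f"
proof -
  obtain B where "\<forall>x. norm (f x) \<le> B" using trig_poly_bounded[OF assms(1)] by blast
  moreover have "f \<in> borel_measurable N"
    using trig_poly_continuous[OF assms(1)] assms(3)
    by (simp add: borel_measurable_continuous_onI cong: measurable_cong_sets)
  ultimately show ?thesis by (intro finite_measure.integrable_const_bound[OF assms(2), of f B]) auto
qed

lemma trig_poly_integral_tendsto:
  fixes N :: "nat \<Rightarrow> (real^'n) measure"
  assumes "trig_poly f"
    and N: "\<And>n. finite_measure (N n)" "\<And>n. sets (N n) = sets borel"
    and \<mu>: "finite_measure \<mu>" "sets \<mu> = sets borel"
    and lim: "\<And>u. (\<lambda>n. CLINT x|N n. iexp (u \<bullet> x)) \<longlonglongrightarrow> (CLINT x|\<mu>. iexp (u \<bullet> x))"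
  shows "(\<lambda>n. integral\<^sup>L (N n) f) \<longlonglongrightarrow> integral\<^sup>L \<mu> f"
  using assms(1)
proof induction
  case (monomial c u)
  show ?case unfolding integral_mult_right_zero by (rule tendsto_mult_left[OF lim])
next
  case (sum f g)
  have "integral\<^sup>L \<nu> (\<lambda>x. f x + g x) = integral\<^sup>L \<nu> f + integral\<^sup>L \<nu> g"
    if "finite_measure \<nu>" "sets \<nu> = sets borel" for \<nu>
    using trig_poly_integrable[OF sum.hyps(1) that] trig_poly_integrable[OF sum.hyps(2) that]
    by (rule Bochner_Integration.integral_add)
  then show ?case using tendsto_add[OF sum.IH] N \<mu> by presburger
qed

text \<open>On the cube of half-width \<open>T\<close> a continuous \<open>f\<close> agrees with a periodic function
  \<open>g (sin (s x\<^sub>1), \<dots>, sin (s x\<^sub>d))\<close>, \<open>s = \<pi> / (2 T)\<close>, and \<open>g\<close> is uniformly close to a polynomial.\<close>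
lemma trig_poly_approximation:
  fixes f :: "real^'n \<Rightarrow> real"
  assumes cont: "continuous_on UNIV f" and B: "\<And>x. \<bar>f x\<bar> \<le> B" and "T > 0" "e > 0"
  obtains q :: "real^'n \<Rightarrow> real" where "trig_poly (\<lambda>x. complex_of_real (q x))"
    "\<And>x. norm x \<le> T \<Longrightarrow> \<bar>f x - q x\<bar> \<le> e" "\<And>x. \<bar>q x\<bar> \<le> B + e"
proof -
  define s where "s = pi / (2 * T)"
  have s: "s > 0" using assms by (simp add: s_def)
  define g where "g y = f (\<chi> i. arcsin (y $ i) / s)" for y :: "real^'n"
  let ?C = "{y::real^'n. \<forall>i. y $ i \<in> {-1..1}}"
  have C: "?C = cbox (\<chi> i. -1) (\<chi> i. 1)" by (auto simp: mem_box_cart)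
  have "continuous_on ?C g"
    unfolding g_def
    by (rule continuous_on_compose2[OF cont])
      (use s in \<open>auto intro!: continuous_intros continuous_on_arcsin simp: continuous_on_vec_lambda\<close>)
  then obtain p where p: "real_polynomial_function p" "\<And>y. y \<in> ?C \<Longrightarrow> \<bar>g y - p y\<bar> < e"
    using Stone_Weierstrass_real_polynomial_function[of ?C g e] assms(4) compact_cbox
    unfolding C by blast
  define S :: "real^'n \<Rightarrow> real^'n" where "S x = (\<chi> i. sin (s * x $ i))" for x
  have S: "S x \<in> ?C" for x by (simp add: S_def)
  show ?thesis
  proof (rule that[of "\<lambda>x. p (S x)"])
    show "trig_poly (\<lambda>x. complex_of_real (p (S x)))"
      unfolding S_def by (rule trig_poly_of_polynomial[OF p(1)])
    show "\<bar>f x - p (S x)\<bar> \<le> e" if "norm x \<le> T" for x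
    proof -
      have "arcsin (sin (s * x $ i)) = s * x $ i" for i
      proof (rule arcsin_sin)
        have "\<bar>x $ i\<bar> \<le> T" using that component_le_norm_cart order_trans by blast
        then have "\<bar>s * x $ i\<bar> \<le> s * T" using s by (simp add: abs_mult)
        also have "s * T = pi / 2" using assms by (simp add: s_def)
        finally show "- (pi / 2) \<le> s * x $ i" "s * x $ i \<le> pi / 2" by auto
      qed
      then have "g (S x) = f x" using s by (simp add: g_def S_def)
      then show ?thesis using p(2)[OF S, of x] by simp
    qed
    show "\<bar>p (S x)\<bar> \<le> B + e" for x
      using p(2)[OF S, of x] B[of "\<chi> i. arcsin (S x $ i) / s"] by (simp add: g_def)
  qed
qed

text \<open>Levy's continuity theorem with tightness supplied as a hypothesis. Convergence is known
  for trigonometric polynomials; tightness confines the error of replacing \<open>f\<close> by such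
  a \<open>q\<close> to the small mass outside a ball, where both are bounded.\<close>

lemma converges_in_distribution_of_char:
  fixes Z :: "nat \<Rightarrow> 'w \<Rightarrow> real^'n"
  assumes M: "prob_space M" and Z: "\<And>n. Z n \<in> borel_measurable M"
    and \<mu>: "prob_space \<mu>" "sets \<mu> = sets borel"
    and lim: "\<And>u. (\<lambda>n. CLINT \<omega>|M. iexp (u \<bullet> Z n \<omega>)) \<longlonglongrightarrow> (CLINT x|\<mu>. iexp (u \<bullet> x))"
    and tight: "\<And>e. e > 0 \<Longrightarrow> \<exists>T. \<forall>\<^sub>F n in sequentially. measure M {\<omega>\<in>space M. norm (Z n \<omega>) > T} \<le> e"
  shows "converges_in_distribution M Z \<mu>"
  unfolding converges_in_distribution_def
proof (intro allI impI)
  fix f :: "real^'n \<Rightarrow> real"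
  assume f: "continuous_on UNIV f \<and> bounded (range f)"
  then obtain B where B: "\<And>x. \<bar>f x\<bar> \<le> B" by (auto simp: bounded_iff)
  have B0: "0 \<le> B" using B[of 0] by simp
  interpret M: prob_space M by (rule M)
  interpret \<mu>: prob_space \<mu> by (rule \<mu>)
  define N where "N n = distr M borel (Z n)" for n
  have psN: "prob_space (N n)" for n unfolding N_def by (rule M.prob_space_distr[OF Z])
  have setsN: "sets (N n) = sets borel" for n by (simp add: N_def)
  have limN: "(\<lambda>n. CLINT x|N n. iexp (u \<bullet> x)) \<longlonglongrightarrow> (CLINT x|\<mu>. iexp (u \<bullet> x))" for u
    unfolding N_def using lim[of u] by (subst integral_distr[OF Z]) measurable
  have close: "\<bar>integral\<^sup>L \<nu> f - integral\<^sup>L \<nu> q\<bar> \<le> e + (2 * B + e) * measure \<nu> {x\<in>space \<nu>. norm x > T}"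
    if \<nu>: "prob_space \<nu>" "sets \<nu> = sets borel" and q: "trig_poly (\<lambda>x. complex_of_real (q x))"
      and qf: "\<And>x. norm x \<le> T \<Longrightarrow> \<bar>f x - q x\<bar> \<le> e" "\<And>x. \<bar>q x\<bar> \<le> B + e" and e: "e > 0"
    for \<nu> and q :: "real^'n \<Rightarrow> real" and e T
  proof -
    interpret \<nu>: prob_space \<nu> by (rule \<nu>)
    have qm: "q \<in> borel_measurable \<nu>"
    proof -
      have "continuous_on UNIV (\<lambda>x. Re (complex_of_real (q x)))"
        by (intro continuous_intros trig_poly_continuous[OF q])
      then have "continuous_on UNIV q" by simp
      then show ?thesis using \<nu>(2) by (simp add: borel_measurable_continuous_onI cong: measurable_cong_sets)
    qed
    have fm: "f \<in> borel_measurable \<nu>"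
      using f \<nu>(2) by (simp add: borel_measurable_continuous_onI cong: measurable_cong_sets)
    have sp: "space \<nu> = UNIV" using sets_eq_imp_space_eq[OF \<nu>(2)] by simp
    have i1: "integrable \<nu> f" by (rule \<nu>.integrable_const_bound[of _ B]) (use B fm in auto)
    have i2: "integrable \<nu> q" by (rule \<nu>.integrable_const_bound[of _ "B + e"]) (use qf(2) qm in auto)
    have A: "{x. norm x > T} \<in> sets \<nu>" unfolding \<nu>(2) by measurable
    have "\<bar>integral\<^sup>L \<nu> f - integral\<^sup>L \<nu> q\<bar> = \<bar>\<integral>x. f x - q x \<partial>\<nu>\<bar>" using i1 i2 by simp
    also have "\<dots> \<le> (\<integral>x. \<bar>f x - q x\<bar> \<partial>\<nu>)" by (rule integral_abs_bound)
    also have "\<dots> \<le> (\<integral>x. e + (2 * B + e) * indicator {x. norm x > T} x \<partial>\<nu>)"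
    proof (rule integral_mono)
      show "integrable \<nu> (\<lambda>x. \<bar>f x - q x\<bar>)" using i1 i2 by auto
      show "integrable \<nu> (\<lambda>x. e + (2 * B + e) * indicator {x. norm x > T} x)"
        using A by (intro Bochner_Integration.integrable_add integrable_mult_right integrable_real_indicator)
          (auto simp: \<nu>.emeasure_eq_measure)
      show "\<bar>f x - q x\<bar> \<le> e + (2 * B + e) * indicator {x. norm x > T} x" for x
        using qf(1)[of x] qf(2)[of x] B[of x] e by (cases "norm x \<le> T") (auto simp: indicator_def)
    qed
    also have "\<dots> = e + (2 * B + e) * measure \<nu> {x. norm x > T}"
      using A by (subst Bochner_Integration.integral_add) (auto simp: \<nu>.emeasure_eq_measure \<nu>.prob_space)
    finally show ?thesis by (simp add: sp)
  qed
  have "(\<lambda>n. integral\<^sup>L (N n) f) \<longlonglongrightarrow> integral\<^sup>L \<mu> f"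
  proof (rule LIMSEQ_I)
    fix r :: real assume r: "0 < r"
    \<comment> \<open>Passing from \<open>f\<close> to \<open>q\<close> costs
      \<open>e + (2 * B + e) * e\<close> for \<open>N n\<close> and once more for
      \<open>\<mu>\<close>; this \<open>e\<close> keeps the total below \<open>r\<close>.\<close>
    define e where "e = min 1 (r / (2 * (2 * (2 * B + 2)) + 1))"
    have e: "e > 0" "e \<le> 1" using r B0 by (auto simp: e_def)
    have er: "2 * (e + (2 * B + e) * e) < r"
    proof -
      have "2 * (e + (2 * B + e) * e) \<le> 2 * (e + (2 * B + 1) * e)"
        using e B0 by (intro mult_left_mono add_mono mult_right_mono) auto
      also have "\<dots> = (2 * (2 * B + 2)) * e" by (simp add: algebra_simps)
      also have "\<dots> < (2 * (2 * (2 * B + 2)) + 1) * e" using e B0 by (intro mult_strict_right_mono) auto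
      also have "\<dots> \<le> r"
      proof -
        have "e \<le> r / (2 * (2 * (2 * B + 2)) + 1)" unfolding e_def by (rule min.cobounded2)
        then show ?thesis using B0 by (simp add: pos_le_divide_eq mult.commute)
      qed
      finally show ?thesis .
    qed
    obtain T1 where T1: "\<forall>\<^sub>F n in sequentially. measure M {\<omega>\<in>space M. norm (Z n \<omega>) > T1} \<le> e"
      using tight[OF e(1)] by blast
    have "(\<lambda>k. measure \<mu> {x\<in>space \<mu>. norm x > real k}) \<longlonglongrightarrow> 0"
    proof -
      have m: "{x\<in>space \<mu>. norm x > c} \<in> sets \<mu>" for c
        using measurable_ident_sets[OF \<mu>(2)] by measurable
      have "(\<lambda>k. measure \<mu> ((\<lambda>k. {x\<in>space \<mu>. norm x > real k}) k)) \<longlonglongrightarrow> measure \<mu> (\<Inter>k. {x\<in>space \<mu>. norm x > real k})"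
      proof (rule \<mu>.finite_Lim_measure_decseq)
        show "range (\<lambda>k. {x\<in>space \<mu>. norm x > real k}) \<subseteq> sets \<mu>" using m by blast
        show "decseq (\<lambda>k. {x\<in>space \<mu>. norm x > real k})"
          unfolding decseq_def by (auto intro: le_less_trans[of "real _" "real _"])
      qed
      moreover have "(\<Inter>k. {x\<in>space \<mu>. norm x > real k}) = {}"
      proof -
        have "\<exists>k. \<not> norm x > real k" for x :: "real^'n" using real_arch_simple[of "norm x"] by (auto simp: not_less)
        then show ?thesis by blast
      qed
      ultimately show ?thesis by simp
    qed
    from LIMSEQ_D[OF this e(1)]
    obtain k where "norm (measure \<mu> {x\<in>space \<mu>. norm x > real k} - 0) < e" by blast
    then have k: "measure \<mu> {x\<in>space \<mu>. norm x > real k} < e" by simp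
    \<comment> \<open>One radius for all laws: \<open>T1\<close> for the sequence, \<open>k\<close>
      for the limit, and 1 to have a cube of positive width.\<close>
    define T where "T = max (max T1 (real k)) 1"
    have T0: "T > 0" by (simp add: T_def)
    have mono: "measure \<nu> {x\<in>space \<nu>. g x > T} \<le> measure \<nu> {x\<in>space \<nu>. g x > T'}"
      if "prob_space \<nu>" "g \<in> borel_measurable \<nu>" "T' \<le> T" for \<nu> :: "'b measure" and g :: "'b \<Rightarrow> real" and T'
    proof -
      interpret \<nu>: prob_space \<nu> by (rule that)
      show ?thesis using that by (intro \<nu>.finite_measure_mono) auto
    qed
    obtain q where q: "trig_poly (\<lambda>x. complex_of_real (q x))"
      "\<And>x. norm x \<le> T \<Longrightarrow> \<bar>f x - q x\<bar> \<le> e" "\<And>x. \<bar>q x\<bar> \<le> B + e"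
      using trig_poly_approximation[OF conjunct1[OF f] B T0 e(1)] by blast
    have c\<mu>: "\<bar>integral\<^sup>L \<mu> f - integral\<^sup>L \<mu> q\<bar> \<le> e + (2 * B + e) * e"
    proof -
      have "(\<lambda>x. norm x) \<in> borel_measurable \<mu>"
        by (rule measurable_compose[OF measurable_ident_sets[OF \<mu>(2)] borel_measurable_norm])
      moreover have "real k \<le> T" by (simp add: T_def)
      ultimately have "measure \<mu> {x\<in>space \<mu>. norm x > T} \<le> e" using mono[OF \<mu>(1), of norm "real k"] k by linarith
      then have "e + (2 * B + e) * measure \<mu> {x\<in>space \<mu>. norm x > T} \<le> e + (2 * B + e) * e"
        using B0 e by (intro add_left_mono mult_left_mono) auto
      moreover have "\<bar>integral\<^sup>L \<mu> f - integral\<^sup>L \<mu> q\<bar> \<le> e + (2 * B + e) * measure \<mu> {x\<in>space \<mu>. norm x > T}"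
        by (rule close[OF \<mu> q e(1)])
      ultimately show ?thesis by linarith
    qed
    have cN: "\<forall>\<^sub>F n in sequentially. \<bar>integral\<^sup>L (N n) f - integral\<^sup>L (N n) q\<bar> \<le> e + (2 * B + e) * e"
      using T1
    proof eventually_elim
      case (elim n)
      have "measure (N n) {x\<in>space (N n). norm x > T} = measure M {\<omega>\<in>space M. norm (Z n \<omega>) > T}"
        unfolding N_def using Z[of n] by (subst measure_distr) (auto intro!: arg_cong[of _ _ "measure M"])
      also have "\<dots> \<le> measure M {\<omega>\<in>space M. norm (Z n \<omega>) > T1}"
        by (rule mono[OF M measurable_compose[OF Z borel_measurable_norm]]) (simp add: T_def)
      also note elim
      finally have "e + (2 * B + e) * measure (N n) {x\<in>space (N n). norm x > T} \<le> e + (2 * B + e) * e"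
        using B0 e by (intro add_left_mono mult_left_mono) auto
      moreover have "\<bar>integral\<^sup>L (N n) f - integral\<^sup>L (N n) q\<bar> \<le> e + (2 * B + e) * measure (N n) {x\<in>space (N n). norm x > T}"
        by (rule close[OF psN setsN q e(1)])
      ultimately show ?case by linarith
    qed
    have "(\<lambda>n. integral\<^sup>L (N n) (\<lambda>x. complex_of_real (q x))) \<longlonglongrightarrow> integral\<^sup>L \<mu> (\<lambda>x. complex_of_real (q x))"
      by (rule trig_poly_integral_tendsto[OF q(1) _ setsN _ \<mu>(2) limN])
        (use psN \<mu>(1) in \<open>auto simp: prob_space_def\<close>)
    then have "(\<lambda>n. integral\<^sup>L (N n) q) \<longlonglongrightarrow> integral\<^sup>L \<mu> q" by (simp add: tendsto_of_real_iff)
    moreover have "0 < r - 2 * (e + (2 * B + e) * e)" using er by simp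
    ultimately have "\<forall>\<^sub>F n in sequentially. \<bar>integral\<^sup>L (N n) q - integral\<^sup>L \<mu> q\<bar> < r - 2 * (e + (2 * B + e) * e)"
      by (simp add: tendsto_iff dist_real_def)
    with cN have "\<forall>\<^sub>F n in sequentially. \<bar>integral\<^sup>L (N n) f - integral\<^sup>L \<mu> f\<bar> < r"
    proof eventually_elim
      case (elim n)
      have "\<bar>x - y\<bar> < r" if "\<bar>x - x'\<bar> \<le> b" "\<bar>x' - y'\<bar> < r - 2 * b" "\<bar>y - y'\<bar> \<le> b" for x y x' y' b :: real
        using that by linarith
      from this[OF elim c\<mu>] show ?case .
    qed
    then show "\<exists>no. \<forall>n\<ge>no. norm (integral\<^sup>L (N n) f - integral\<^sup>L \<mu> f) < r"
      by (simp add: eventually_sequentially)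
  qed
  then show "(\<lambda>n. \<integral>x. f x \<partial>distr M borel (Z n)) \<longlonglongrightarrow> (\<integral>x. f x \<partial>\<mu>)" by (simp add: N_def)
qed

section \<open>The Green kernel and the invariant distributions\<close>

lemma sum_UNIV_option: "(\<Sum>y\<in>UNIV. f y) = f None + (\<Sum>x\<in>UNIV. f (Some (x::'a::finite)))"
  by (simp add: UNIV_option_conv sum.reindex)

lemma inner_one: "x \<bullet> (1::real^'n) = (\<Sum>i\<in>UNIV. x $ i)"
  by (simp add: inner_vec_def)

lemma vmult_eq_sum: "(x v* M) $ j = (\<Sum>i\<in>UNIV. x $ i * M $ i $ j)"
  for x :: "real^'n" and M :: "real^'m^'n"
  by (simp add: vector_matrix_mult_def mult.commute)

lemma mat_pow_commute: "mat_pow M n ** M = M ** mat_pow M n"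
  by (induction n) (simp_all add: matrix_mul_assoc[symmetric])

lemma vmult_assoc: "(x v* M) v* N = x v* (M ** N)"
  for x :: "real^'n" and M :: "real^'m^'n" and N :: "real^'k^'m"
proof -
  have "((x v* M) v* N) \<bullet> y = (x v* (M ** N)) \<bullet> y" for y
    by (simp add: dot_lmul_matrix matrix_vector_mul_assoc)
  then show ?thesis by (metis vector_eq_rdot)
qed

lemma vmult_diff_right: "x v* (M - N) = x v* M - x v* N" for x :: "real^'n" and M N :: "real^'m^'n"
  by (simp add: vec_eq_iff vmult_eq_sum algebra_simps sum_subtractf)

lemma vmult_add_left: "(x + y) v* M = x v* M + y v* M" for x :: "real^'n" and M :: "real^'m^'n"
  by (simp add: vec_eq_iff vmult_eq_sum algebra_simps sum.distrib)

lemma vmult_scaleR_left: "(c *\<^sub>R x) v* M = c *\<^sub>R (x v* M)" for x :: "real^'n" and M :: "real^'m^'n"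
  by (simp add: vec_eq_iff vmult_eq_sum sum_distrib_left mult_ac)

lemma mmult_diff_left: "(M - N) ** X = M ** X - N ** X" for M N :: "real^'n^'m" and X :: "real^'k^'n"
  by (simp add: vec_eq_iff matrix_matrix_mult_def algebra_simps sum_subtractf)

lemma mmult_diff_right: "X ** (M - N) = X ** M - X ** N" for M N :: "real^'k^'n" and X :: "real^'n^'m"
  by (simp add: vec_eq_iff matrix_matrix_mult_def algebra_simps sum_subtractf)

lemma bounded_linear_vmult: "bounded_linear (\<lambda>x. x v* M)" for M :: "real^'m^'n"
  by (intro linear_conv_bounded_linear[THEN iffD1] linearI) (simp_all add: vmult_add_left vmult_scaleR_left)

lemmas vmult_diff_left = linear_diff[OF bounded_linear.linear[OF bounded_linear_vmult]]
lemmas vmult_sum_left = linear_sum[OF bounded_linear.linear[OF bounded_linear_vmult]]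

lemma inner_mono_nonneg:
  fixes x y z :: "real^'n"
  assumes "\<And>i. 0 \<le> x $ i" "\<And>i. y $ i \<le> z $ i"
  shows "x \<bullet> y \<le> x \<bullet> z"
  by (simp add: inner_vec_def assms mult_left_mono sum_mono)

lemma simplex_norm_le_1: assumes "x \<in> prob_simplex" shows "norm x \<le> 1"
  using norm_le_l1_cart[of x] assms by (simp add: prob_simplex_def)

lemma simplex_inner_one: "x \<in> prob_simplex \<Longrightarrow> x \<bullet> 1 = 1"
  by (simp add: prob_simplex_def inner_one)

lemma simplex_nonneg: "x \<in> prob_simplex \<Longrightarrow> 0 \<le> x $ i"
  by (simp add: prob_simplex_def)

lemma convex_prob_simplex: "convex (prob_simplex :: (real^'n) set)"
  by (auto simp: convex_def prob_simplex_def sum.distrib simp flip: sum_distrib_left)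

locale qsd_chain =
  fixes P :: "real ^ ('s::finite) option ^ 's option" and \<theta> :: "real^'s"
  assumes chain: "absorbed_chain P" and qsd: "quasi_stationary P \<theta>"
begin

definition A :: "real^'s^'s" where "A = (\<chi> x y. P $ Some x $ Some y)"
definition b :: "real^'s" where "b = (\<chi> x. P $ Some x $ None)"
text \<open>One-step survival probability from \<open>\<theta>\<close>; it turns out to be the
  Perron eigenvalue of \<open>A\<close>.\<close>

definition lam :: real where "lam = (\<theta> v* A) \<bullet> 1"
text \<open>Green kernel: the mean number of visits before absorption. \<open>g1\<close> is then the
  mean absorption time, and \<open>\<rho>\<close> its value under \<open>\<theta>\<close>.\<close>

definition G :: "real^'s^'s" where "G = matrix_inv (mat 1 - A)"
definition g1 :: "real^'s" where "g1 = G *v 1"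
definition \<rho> :: real where "\<rho> = 1 / (1 - lam)"
text \<open>Regeneration formula: under \<open>K P \<nu>\<close> the chain restarts from
  \<open>\<nu>\<close> at each absorption, so its invariant law is the mean occupation of a cycle
  over the mean cycle length. The dependence on \<open>\<nu>\<close> becomes rational and
  explicit.\<close>

definition pi :: "real^'s \<Rightarrow> real^'s" where "pi \<nu> = (1 / (\<nu> \<bullet> g1)) *\<^sub>R (\<nu> v* G)"

lemma P_nonneg: "0 \<le> P $ x $ y" and P_row: "(\<Sum>y\<in>UNIV. P $ x $ y) = 1"
  using chain by (auto simp: absorbed_chain_def transition_matrix_def)

lemma A_nonneg: "0 \<le> A $ x $ y" and b_nonneg: "0 \<le> b $ x"
  by (simp_all add: A_def b_def P_nonneg)

lemma A_one: "A *v 1 = 1 - b"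
proof -
  have "b $ x + (\<Sum>y\<in>UNIV. A $ x $ y) = 1" for x
    using P_row[of "Some x"] unfolding sum_UNIV_option by (simp add: A_def b_def)
  then show ?thesis by (simp add: vec_eq_iff matrix_vector_mult_def) (metis add_diff_cancel_left')
qed

lemma \<theta>_simplex: "\<theta> \<in> prob_simplex" using qsd by (simp add: quasi_stationary_def)
lemma \<theta>_nonneg: "0 \<le> \<theta> $ x" using \<theta>_simplex by (simp add: prob_simplex_def)
lemma \<theta>_one: "\<theta> \<bullet> 1 = 1" using simplex_inner_one[OF \<theta>_simplex] .

lemma mat_pow_P: "mat_pow P n $ None $ Some y = 0"
  "mat_pow P n $ Some x $ Some y = mat_pow A n $ x $ y"
proof -
  have PN: "P $ None $ Some y = 0" for y
  proof -
    have "(\<Sum>x\<in>UNIV. P $ None $ Some x) = 0"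
      using P_row[of None] chain unfolding sum_UNIV_option by (simp add: absorbed_chain_def)
    then show ?thesis using P_nonneg by (subst (asm) sum_nonneg_eq_0_iff) auto
  qed
  have 1: "mat_pow P n $ None $ Some y = 0" for n y
    by (induction n) (simp_all add: mat_def matrix_matrix_mult_def sum_UNIV_option PN)
  then show "mat_pow P n $ None $ Some y = 0" .
  show "mat_pow P n $ Some x $ Some y = mat_pow A n $ x $ y"
    by (induction n arbitrary: x) (simp_all add: mat_def matrix_matrix_mult_def sum_UNIV_option 1 A_def)
qed

lemma irreducible: obtains n where "n \<ge> 1" "mat_pow A n $ x $ y > 0"
  using chain unfolding absorbed_chain_def mat_pow_P by blast

lemma mat_pow_A_nonneg: "0 \<le> mat_pow A n $ x $ y"
  by (induction n arbitrary: x) (auto simp: mat_def matrix_matrix_mult_def A_nonneg intro!: sum_nonneg)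

lemma \<theta>_A: "\<theta> v* A = lam *\<^sub>R \<theta>" and lam_nz: "lam \<noteq> 0"
proof -
  have cp: "chain_prob P \<theta> 1 (Some x) = (\<theta> v* A) $ x" for x
    by (simp add: chain_prob_def vmult_eq_sum mat_pow_P A_def)
  have "(\<theta> v* A) $ x / lam = \<theta> $ x" for x
  proof -
    have "chain_prob P \<theta> 1 (Some x) / (\<Sum>z\<in>UNIV. chain_prob P \<theta> 1 (Some z)) = \<theta> $ x"
      using qsd unfolding quasi_stationary_def by blast
    then show ?thesis by (simp only: cp lam_def inner_one)
  qed
  then have *: "(1 / lam) *\<^sub>R (\<theta> v* A) = \<theta>" by (simp add: vec_eq_iff)
  \<comment> \<open>\<open>lam = 0\<close> would make the left-hand side zero by the convention for
    division, while \<open>\<theta>\<close> has mass one.\<close>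
  then show nz: "lam \<noteq> 0" using \<theta>_one by auto
  have "lam *\<^sub>R ((1 / lam) *\<^sub>R (\<theta> v* A)) = lam *\<^sub>R \<theta>" unfolding * ..
  then show "\<theta> v* A = lam *\<^sub>R \<theta>" using nz by simp
qed

lemma lam_pos: "0 < lam"
proof -
  have "0 \<le> lam" unfolding lam_def inner_one vmult_eq_sum
    by (intro sum_nonneg mult_nonneg_nonneg \<theta>_nonneg A_nonneg)
  then show ?thesis using lam_nz by simp
qed

text \<open>\<open>\<theta>\<close> is a left eigenvector of every power of \<open>A\<close>, and
  irreducibility transports the mass of some charged state to \<open>x\<close>.\<close>

lemma \<theta>_pos: "0 < \<theta> $ x"
proof -
  have pow: "\<theta> v* mat_pow A n = lam ^ n *\<^sub>R \<theta>" for n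
    by (induction n) (simp_all add: vmult_assoc[symmetric] \<theta>_A vmult_scaleR_left)
  have "\<exists>y. \<theta> $ y > 0"
    using \<theta>_one \<theta>_nonneg unfolding inner_one by (metis less_numeral_extra(1) not_less order.antisym sum_nonpos zero_neq_one)
  then obtain y where y: "\<theta> $ y > 0" by blast
  obtain n where n: "mat_pow A n $ y $ x > 0" using irreducible by blast
  have "0 < \<theta> $ y * mat_pow A n $ y $ x" using y n by simp
  also have "\<dots> \<le> (\<Sum>z\<in>UNIV. \<theta> $ z * mat_pow A n $ z $ x)"
    by (intro member_le_sum) (auto intro: mult_nonneg_nonneg \<theta>_nonneg mat_pow_A_nonneg)
  also have "\<dots> = lam ^ n * \<theta> $ x" unfolding vmult_eq_sum[symmetric] pow by simp
  finally show ?thesis using lam_pos by (simp add: zero_less_mult_iff)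
qed

lemma lam_less_1: "lam < 1"
proof -
  obtain x where x: "0 < b $ x" using chain by (auto simp: absorbed_chain_def b_def)
  have "lam = \<theta> \<bullet> (A *v 1)" by (simp add: lam_def dot_lmul_matrix)
  also have "\<dots> = 1 - \<theta> \<bullet> b" by (simp add: A_one inner_diff_right \<theta>_one)
  finally have "lam = 1 - \<theta> \<bullet> b" .
  moreover have "0 < \<theta> \<bullet> b" unfolding inner_vec_def
    using x \<theta>_pos by (intro sum_pos2[of _ x]) (auto intro: mult_nonneg_nonneg \<theta>_nonneg b_nonneg)
  ultimately show ?thesis by simp
qed

lemma \<rho>_ge_1: "1 \<le> \<rho>" using lam_pos lam_less_1 by (simp add: \<rho>_def)
lemma \<rho>_pos: "0 < \<rho>" using \<rho>_ge_1 by simp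

text \<open>Pairing with \<open>\<theta>\<close> shrinks the right-hand side by
  \<open>lam < 1\<close>, and \<open>\<theta>\<close> charges every state. This maximum principle
  yields both the invertibility of I - A and the positivity of its inverse.\<close>

lemma subharmonic_zero:
  fixes v :: "real^'s"
  assumes "\<And>x. 0 \<le> v $ x" "\<And>x. v $ x \<le> (A *v v) $ x"
  shows "v = 0"
proof -
  have "\<theta> \<bullet> v \<le> \<theta> \<bullet> (A *v v)" using assms \<theta>_nonneg by (intro inner_mono_nonneg)
  also have "\<dots> = lam * (\<theta> \<bullet> v)" by (simp add: dot_lmul_matrix[symmetric] \<theta>_A)
  finally have "(1 - lam) * (\<theta> \<bullet> v) \<le> 0" by (simp add: algebra_simps)
  then have "\<theta> \<bullet> v \<le> 0" using lam_less_1 by (simp add: mult_le_0_iff)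
  moreover have n: "0 \<le> \<theta> $ x * v $ x" for x using assms \<theta>_nonneg by simp
  ultimately have "(\<Sum>x\<in>UNIV. \<theta> $ x * v $ x) = 0"
    using sum_nonneg[of UNIV "\<lambda>x. \<theta> $ x * v $ x"] by (simp add: inner_vec_def)
  then have "\<forall>x. \<theta> $ x * v $ x = 0" using n by (subst (asm) sum_nonneg_eq_0_iff) auto
  then show ?thesis using \<theta>_pos by (simp add: vec_eq_iff) (metis less_irrefl)
qed

lemma abs_mult_vec_le: "\<bar>(A *v v) $ x\<bar> \<le> (A *v (\<chi> y. \<bar>v $ y\<bar>)) $ x"
  unfolding matrix_vector_mult_def using A_nonneg
  by (auto intro!: order_trans[OF sum_abs] sum_mono simp: abs_mult)

lemma invertible_I_A: "invertible (mat 1 - A)"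
  unfolding invertible_left_inverse matrix_left_invertible_ker
proof (intro allI impI)
  fix v assume "(mat 1 - A) *v v = 0"
  then have v: "A *v v = v" by (simp add: matrix_vector_mult_diff_rdistrib)
  have "(\<chi> y. \<bar>v $ y\<bar>) = (0::real^'s)"
    using abs_mult_vec_le[of v] unfolding v by (intro subharmonic_zero) auto
  then show "v = 0" by (simp add: vec_eq_iff)
qed

lemma AG: "A ** G = G - mat 1" and GA: "G ** A = G - mat 1"
proof -
  have "(mat 1 - A) ** G = mat 1" "G ** (mat 1 - A) = mat 1"
    using someI_ex[OF invertible_I_A[unfolded invertible_def]] by (simp_all add: G_def matrix_inv_def)
  then show "A ** G = G - mat 1" "G ** A = G - mat 1"
    by (auto simp: mmult_diff_left mmult_diff_right algebra_simps)
qed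

text \<open>A column \<open>w\<close> of \<open>G\<close> satisfies
  \<open>A *v w = w - axis y 1\<close>, so its negative part is subharmonic and vanishes.\<close>

lemma G_nonneg: "0 \<le> G $ x $ y"
proof -
  define w where "w = G *v axis y 1"
  have Aw: "A *v w = w - axis y 1"
    by (simp add: w_def matrix_vector_mul_assoc AG matrix_vector_mult_diff_rdistrib)
  define m where "m = (\<chi> z. max 0 (- w $ z))"
  have "m = 0"
  proof (rule subharmonic_zero)
    show "0 \<le> m $ z" for z by (simp add: m_def)
    have nn: "0 \<le> (A *v m) $ z" for z
      unfolding matrix_vector_mult_def by (auto simp: m_def A_nonneg intro!: sum_nonneg)
    have "- w $ z \<le> (A *v m) $ z" for z
    proof -
      have "- (A *v w) $ z \<le> (A *v m) $ z"
      proof -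
        have "- (A *v w) $ z = (\<Sum>j\<in>UNIV. A $ z $ j * (- w $ j))"
          by (simp add: matrix_vector_mult_def sum_negf)
        also have "\<dots> \<le> (\<Sum>j\<in>UNIV. A $ z $ j * m $ j)"
          by (intro sum_mono mult_left_mono A_nonneg) (simp add: m_def)
        finally show ?thesis by (simp add: matrix_vector_mult_def)
      qed
      moreover have "0 \<le> (axis y 1 :: real^'s) $ z" by (simp add: axis_def)
      ultimately show ?thesis unfolding Aw by simp
    qed
    then show "m $ z \<le> (A *v m) $ z" for z using nn by (simp add: m_def)
  qed
  then have "0 \<le> w $ x" by (simp add: m_def vec_eq_iff) (metis max.cobounded2 neg_le_0_iff_le max_def)
  then show ?thesis by (simp add: w_def matrix_vector_mult_basis column_def)
qed

lemma G_ge_mat1: "(mat 1 :: real^'s^'s) $ x $ y \<le> G $ x $ y"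
proof -
  have "0 \<le> (A ** G) $ x $ y" by (simp add: matrix_matrix_mult_def sum_nonneg A_nonneg G_nonneg)
  then show ?thesis by (simp add: AG)
qed

text \<open>Iterating \<open>A ** G = G - mat 1\<close> bounds \<open>mat_pow A n ** G\<close> by
  \<open>G\<close> entrywise; a path of positive probability from \<open>x\<close> to
  \<open>y\<close> does the rest.\<close>

lemma G_pos: "0 < G $ x $ y"
proof -
  have ge: "(mat_pow A n ** G) $ x $ y \<le> G $ x $ y" for n x
  proof (induction n arbitrary: x)
    case 0
    then show ?case by simp
  next
    case (Suc n)
    have "(mat_pow A (Suc n) ** G) $ x $ y = (\<Sum>z\<in>UNIV. A $ x $ z * (mat_pow A n ** G) $ z $ y)"
      by (simp add: matrix_mul_assoc[symmetric]) (simp add: matrix_matrix_mult_def)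
    also have "\<dots> \<le> (\<Sum>z\<in>UNIV. A $ x $ z * G $ z $ y)"
      by (intro sum_mono mult_left_mono Suc A_nonneg)
    also have "\<dots> = G $ x $ y - (mat 1 :: real^'s^'s) $ x $ y"
      using arg_cong[OF AG, of "\<lambda>M. M $ x $ y"] by (simp add: matrix_matrix_mult_def)
    also have "\<dots> \<le> G $ x $ y" by (simp add: mat_def)
    finally show ?case .
  qed
  obtain n where n: "mat_pow A n $ x $ y > 0" using irreducible by blast
  have "1 \<le> G $ y $ y" using G_ge_mat1[of y y] by (simp add: mat_def)
  then have "0 < mat_pow A n $ x $ y * G $ y $ y" using n by simp
  also have "\<dots> \<le> (\<Sum>z\<in>UNIV. mat_pow A n $ x $ z * G $ z $ y)"
    by (intro member_le_sum) (auto intro: mult_nonneg_nonneg G_nonneg mat_pow_A_nonneg)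
  also have "\<dots> \<le> G $ x $ y" using ge[of n x] by (simp add: matrix_matrix_mult_def)
  finally show ?thesis .
qed

lemma \<theta>_G: "\<theta> v* G = \<rho> *\<^sub>R \<theta>"
proof -
  have "\<theta> v* (A ** G) = lam *\<^sub>R (\<theta> v* G)" by (simp add: vmult_assoc[symmetric] \<theta>_A vmult_scaleR_left)
  then have "(1 - lam) *\<^sub>R (\<theta> v* G) = \<theta>"
    unfolding AG vmult_diff_right by (simp add: algebra_simps)
  then have "(1 / (1 - lam)) *\<^sub>R ((1 - lam) *\<^sub>R (\<theta> v* G)) = \<rho> *\<^sub>R \<theta>" by (simp only: \<rho>_def)
  then show ?thesis using lam_less_1 by simp
qed

lemma g1_ge_1: "1 \<le> g1 $ x"
proof -
  have "1 = (\<Sum>y\<in>UNIV. (mat 1 :: real^'s^'s) $ x $ y)" by (simp add: mat_def)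
  also have "\<dots> \<le> (\<Sum>y\<in>UNIV. G $ x $ y)" by (intro sum_mono G_ge_mat1)
  finally show ?thesis by (simp add: g1_def matrix_vector_mult_def)
qed

lemma vG_one: "(x v* G) \<bullet> 1 = x \<bullet> g1" by (simp add: g1_def dot_lmul_matrix)

lemma simplex_g1: "\<nu> \<in> prob_simplex \<Longrightarrow> 1 \<le> \<nu> \<bullet> g1"
  using inner_mono_nonneg[of \<nu> 1 g1] g1_ge_1 by (simp add: simplex_nonneg simplex_inner_one)

lemma \<theta>_g1: "\<theta> \<bullet> g1 = \<rho>" by (simp add: vG_one[symmetric] \<theta>_G \<theta>_one)

lemma pi_\<theta>: "pi \<theta> = \<theta>" using \<rho>_pos by (simp add: pi_def \<theta>_g1 \<theta>_G)

lemma vmult_K: "p v* K P \<nu> = p v* A + (p \<bullet> b) *\<^sub>R \<nu>"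
  by (simp add: vec_eq_iff vmult_eq_sum K_def A_def b_def inner_vec_def ring_distribs sum.distrib sum_distrib_left mult_ac)

lemma K_mult_vec: "K P \<nu> *v v = A *v v + (\<nu> \<bullet> v) *\<^sub>R b"
  by (simp add: vec_eq_iff matrix_vector_mult_def K_def A_def b_def inner_vec_def ring_distribs sum.distrib sum_distrib_left mult_ac)

lemma pi_simplex: assumes "\<nu> \<in> prob_simplex" shows "pi \<nu> \<in> prob_simplex"
proof -
  have "1 \<le> \<nu> \<bullet> g1" using simplex_g1[OF assms] .
  moreover have "0 \<le> (\<nu> v* G) $ x" for x
    unfolding vmult_eq_sum by (intro sum_nonneg mult_nonneg_nonneg simplex_nonneg[OF assms] G_nonneg)
  moreover have "pi \<nu> \<bullet> 1 = 1" using calculation by (simp add: pi_def vG_one)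
  ultimately show ?thesis unfolding prob_simplex_def inner_one[symmetric] by (simp add: pi_def)
qed

text \<open>For uniqueness: invariance of \<open>p\<close> reads p (I - A) = (p . b) \<nu>.
  Multiplying by \<open>G\<close> determines \<open>p\<close> up to the scalar
  \<open>p \<bullet> b\<close>, which the total mass fixes.\<close>

lemma invariant_dist_eq: assumes \<nu>: "\<nu> \<in> prob_simplex" shows "invariant_dist P \<nu> = pi \<nu>"
  unfolding invariant_dist_def
proof (rule the_equality)
  have g: "\<nu> \<bullet> g1 \<noteq> 0" using simplex_g1[OF \<nu>] by simp
  have \<nu>GA: "\<nu> v* G v* A = \<nu> v* G - \<nu>" by (simp add: vmult_assoc GA vmult_diff_right)
  have "(\<nu> v* G) \<bullet> b = (\<nu> v* G) \<bullet> 1 - (\<nu> v* G v* A) \<bullet> 1"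
    by (simp add: dot_lmul_matrix[of "\<nu> v* G"] A_one inner_diff_right)
  then have "(\<nu> v* G) \<bullet> b = 1" unfolding \<nu>GA by (simp add: inner_diff_left simplex_inner_one[OF \<nu>])
  then have "pi \<nu> v* K P \<nu> = pi \<nu>"
    unfolding vmult_K by (simp add: pi_def vmult_scaleR_left \<nu>GA scaleR_diff_right)
  then show "pi \<nu> \<in> prob_simplex \<and> pi \<nu> v* K P \<nu> = pi \<nu>" using pi_simplex[OF \<nu>] by simp
  fix p :: "real^'s" assume p: "p \<in> prob_simplex \<and> p v* K P \<nu> = p"
  then have "p v* (mat 1 - A) = (p \<bullet> b) *\<^sub>R \<nu>"
    by (simp add: vmult_K vmult_diff_right) (simp add: algebra_simps)
  then have "p v* (mat 1 - A) v* G = (p \<bullet> b) *\<^sub>R (\<nu> v* G)" by (simp add: vmult_scaleR_left)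
  moreover have "p v* (mat 1 - A) v* G = p"
    unfolding vmult_assoc by (simp add: mmult_diff_left AG)
  ultimately have pp: "p = (p \<bullet> b) *\<^sub>R (\<nu> v* G)" by simp
  then have "p \<bullet> 1 = (p \<bullet> b) * ((\<nu> v* G) \<bullet> 1)" by (metis inner_scaleR_left)
  then have "1 = (p \<bullet> b) * (\<nu> \<bullet> g1)" using p by (simp only: vG_one simplex_inner_one)
  then have "p \<bullet> b = 1 / (\<nu> \<bullet> g1)" using g by (simp add: field_simps)
  then show "p = pi \<nu>" using pp by (simp add: pi_def)
qed

lemma h_eq: "\<nu> \<in> prob_simplex \<Longrightarrow> h P \<nu> = pi \<nu> - \<nu>"
  by (simp add: h_def invariant_dist_eq)

section \<open>Perron theory of \<open>G\<close>, the Poisson equation and the derivative at the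
  fixed point\<close>

text \<open>The left eigenvector makes G - \<rho> singular, so some right eigenvector exists. Its
  absolute values \<open>s\<close> satisfy \<open>\<rho> * s \<le> G *v s\<close> entrywise, and
  pairing with the strictly positive \<open>\<theta>\<close> turns this into equality.\<close>

lemma right_eigenvector: "\<exists>r. (\<forall>x. 0 < r $ x) \<and> G *v r = \<rho> *\<^sub>R r \<and> \<theta> \<bullet> r = 1"
proof -
  define B where "B = G - \<rho> *\<^sub>R mat 1"
  have Bv: "B *v v = G *v v - \<rho> *\<^sub>R v" for v
    by (simp add: B_def matrix_vector_mult_diff_rdistrib scaleR_matrix_vector_assoc[symmetric])
  have \<theta>B: "\<theta> v* B = 0"
  proof -
    have "(\<theta> v* B) \<bullet> v = 0 \<bullet> v" for v
      unfolding dot_lmul_matrix Bv by (simp add: inner_diff_right dot_lmul_matrix[symmetric] \<theta>_G)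
    then show ?thesis by (metis vector_eq_rdot)
  qed
  have "\<exists>r. B *v r = 0 \<and> r \<noteq> 0"
  proof (rule ccontr)
    assume "\<not> ?thesis"
    then have "invertible B" unfolding invertible_left_inverse matrix_left_invertible_ker by blast
    then obtain B' where "B ** B' = mat 1" by (auto simp: invertible_def)
    then have "\<theta> = \<theta> v* B v* B'" by (simp add: vmult_assoc)
    then show False using \<theta>B \<theta>_one by simp
  qed
  then obtain r0 where r0: "G *v r0 = \<rho> *\<^sub>R r0" "r0 \<noteq> 0" by (auto simp: Bv)
  define s where "s = (\<chi> x. \<bar>r0 $ x\<bar>)"
  have le: "\<rho> * s $ x \<le> (G *v s) $ x" for x
  proof -
    have "\<rho> * s $ x = \<bar>(G *v r0) $ x\<bar>" using \<rho>_pos by (simp add: r0 s_def abs_mult)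
    also have "\<dots> \<le> (G *v s) $ x"
      unfolding matrix_vector_mult_def s_def using G_nonneg
      by (auto intro!: order_trans[OF sum_abs] sum_mono simp: abs_mult)
    finally show ?thesis .
  qed
  have "\<theta> \<bullet> (G *v s - \<rho> *\<^sub>R s) = 0"
    by (simp add: inner_diff_right dot_lmul_matrix[symmetric] \<theta>_G)
  then have "(\<Sum>x\<in>UNIV. \<theta> $ x * ((G *v s) $ x - \<rho> * s $ x)) = 0" by (simp add: inner_vec_def)
  then have "\<forall>x. \<theta> $ x * ((G *v s) $ x - \<rho> * s $ x) = 0"
    using le \<theta>_nonneg by (subst (asm) sum_nonneg_eq_0_iff) auto
  then have "(G *v s) $ x = \<rho> * s $ x" for x using \<theta>_pos[of x] by (auto dest: spec[of _ x])
  then have Gs: "G *v s = \<rho> *\<^sub>R s" by (simp add: vec_eq_iff)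
  obtain x0 where x0: "r0 $ x0 \<noteq> 0" using r0(2) by (auto simp: vec_eq_iff)
  have spos: "0 < s $ x" for x
  proof -
    have "0 < G $ x $ x0 * s $ x0" using x0 G_pos by (simp add: s_def)
    also have "\<dots> \<le> (\<Sum>y\<in>UNIV. G $ x $ y * s $ y)"
      by (intro member_le_sum) (auto simp: s_def G_nonneg)
    also have "\<dots> = \<rho> * s $ x" using arg_cong[OF Gs, of "\<lambda>v. v $ x"] by (simp add: matrix_vector_mult_def)
    finally show ?thesis using \<rho>_pos by (simp add: zero_less_mult_iff)
  qed
  have "0 < \<theta> \<bullet> s" unfolding inner_vec_def using spos \<theta>_pos by (intro sum_pos) auto
  then show ?thesis using spos Gs
    by (intro exI[of _ "(1 / (\<theta> \<bullet> s)) *\<^sub>R s"]) (simp add: matrix_vector_mult_scaleR)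
qed

definition r :: "real^'s" where "r = (SOME r. (\<forall>x. 0 < r $ x) \<and> G *v r = \<rho> *\<^sub>R r \<and> \<theta> \<bullet> r = 1)"

lemma r_pos: "0 < r $ x" and G_r: "G *v r = \<rho> *\<^sub>R r" and \<theta>_r: "\<theta> \<bullet> r = 1"
  using someI_ex[OF right_eigenvector] unfolding r_def by auto

text \<open>Doeblin condition relative to the rank-one Perron projection: finitely many strictly
  positive entries have a positive least ratio.\<close>

lemma minorization: "\<exists>\<kappa>>0. \<forall>x y. \<kappa> * (r $ x * \<theta> $ y) \<le> G $ x $ y"
proof -
  define \<kappa> where "\<kappa> = Min (range (\<lambda>(x, y). G $ x $ y / (r $ x * \<theta> $ y)))"
  have "0 < \<kappa>" unfolding \<kappa>_def by (subst Min_gr_iff) (auto simp: G_pos r_pos \<theta>_pos)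
  moreover have "\<kappa> * (r $ x * \<theta> $ y) \<le> G $ x $ y" for x y
  proof -
    have "\<kappa> \<le> (case (x, y) of (x, y) \<Rightarrow> G $ x $ y / (r $ x * \<theta> $ y))"
      unfolding \<kappa>_def by (rule Min_le) (auto intro: rangeI)
    then show ?thesis using r_pos[of x] \<theta>_pos[of y] by (simp add: field_simps)
  qed
  ultimately show ?thesis by blast
qed

text \<open>The weights \<open>r\<close> are adapted to \<open>G\<close>: acting on row vectors,
  \<open>G\<close> has norm at most \<open>\<rho>\<close> in this weighted l1 norm.\<close>

definition rnorm :: "real^'s \<Rightarrow> real" where "rnorm v = (\<Sum>x\<in>UNIV. \<bar>v $ x\<bar> * r $ x)"

lemma rnorm_triangle: "rnorm (u + v) \<le> rnorm u + rnorm v"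
  unfolding rnorm_def sum.distrib[symmetric] ring_distribs(2)[symmetric]
  using r_pos by (intro sum_mono mult_right_mono) (auto intro: less_imp_le)

lemma rnorm_scale: "rnorm (c *\<^sub>R v) = \<bar>c\<bar> * rnorm v"
  by (simp add: rnorm_def abs_mult sum_distrib_left mult_ac)

lemma rnorm_nonneg: "0 \<le> rnorm v"
  unfolding rnorm_def using r_pos by (intro sum_nonneg mult_nonneg_nonneg) (auto intro: less_imp_le)

text \<open>Subtracting the rank-one minorant \<open>\<kappa> r \<otimes> \<theta>\<close> does not change the action of \<open>G\<close> on \<open>r\<close>-orthogonal
  row vectors but shrinks the row sums of the nonnegative matrix.\<close>
lemma contraction:
  assumes \<kappa>: "\<And>x y. \<kappa> * (r $ x * \<theta> $ y) \<le> G $ x $ y" and v: "v \<bullet> r = 0"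
  shows "rnorm (v v* G) \<le> (\<rho> - \<kappa>) * rnorm v"
proof -
  have "\<bar>(v v* G) $ y\<bar> \<le> (\<Sum>x\<in>UNIV. \<bar>v $ x\<bar> * (G $ x $ y - \<kappa> * (r $ x * \<theta> $ y)))" for y
  proof -
    have "(\<Sum>x\<in>UNIV. v $ x * (\<kappa> * (r $ x * \<theta> $ y))) = \<kappa> * \<theta> $ y * (v \<bullet> r)"
      by (simp add: inner_vec_def sum_distrib_left mult_ac)
    then have "(v v* G) $ y = (\<Sum>x\<in>UNIV. v $ x * (G $ x $ y - \<kappa> * (r $ x * \<theta> $ y)))"
      using v by (simp add: vmult_eq_sum right_diff_distrib sum_subtractf)
    then show ?thesis using \<kappa> by (auto intro!: order_trans[OF sum_abs] sum_mono simp: abs_mult)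
  qed
  then have "rnorm (v v* G) \<le> (\<Sum>y\<in>UNIV. (\<Sum>x\<in>UNIV. \<bar>v $ x\<bar> * (G $ x $ y - \<kappa> * (r $ x * \<theta> $ y))) * r $ y)"
    unfolding rnorm_def using r_pos by (intro sum_mono mult_right_mono) (auto intro: less_imp_le)
  also have "\<dots> = (\<Sum>x\<in>UNIV. \<bar>v $ x\<bar> * ((\<Sum>y\<in>UNIV. G $ x $ y * r $ y) - \<kappa> * r $ x * (\<Sum>y\<in>UNIV. \<theta> $ y * r $ y)))"
    by (subst sum_distrib_right, subst sum.swap)
      (simp add: right_diff_distrib sum_subtractf sum_distrib_left left_diff_distrib mult_ac)
  also have "(\<lambda>x. \<Sum>y\<in>UNIV. G $ x $ y * r $ y) = (\<lambda>x. \<rho> * r $ x)"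
    using G_r by (auto simp: vec_eq_iff matrix_vector_mult_def)
  also have "(\<Sum>y\<in>UNIV. \<theta> $ y * r $ y) = 1" using \<theta>_r by (simp add: inner_vec_def)
  finally show ?thesis by (simp add: rnorm_def sum_distrib_left algebra_simps)
qed

text \<open>\<open>rop \<nu> x\<close> is the row vector \<open>x R(\<nu>)\<close> with \<open>R(\<nu>) = G - G1 \<otimes> \<pi>(\<nu>)\<close>, a solution of the
  Poisson equation \<open>(I - K[\<nu>]) R = I - 1 \<otimes> \<pi>(\<nu>)\<close>.\<close>
definition rop :: "real^'s \<Rightarrow> real^'s \<Rightarrow> real^'s" where "rop \<nu> x = x v* G - (x \<bullet> g1) *\<^sub>R pi \<nu>"

text \<open>Splits a deviation from the invariant law into an increment of conditional mean zero and
  the difference of one function at two consecutive empirical measures. The subtraction of the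
  argument in that function stems from AG = G - I.\<close>

lemma poisson:
  assumes \<nu>: "\<nu> \<in> prob_simplex" and \<eta>: "\<eta> \<bullet> 1 = 1"
  shows "rop \<nu> (\<eta>' - \<eta> v* K P \<nu>) = (\<eta>' - pi \<nu>) + (rop \<nu> \<eta>' - \<eta>') - (rop \<nu> \<eta> - \<eta>)"
proof -
  have g: "\<nu> \<bullet> g1 \<noteq> 0" using simplex_g1[OF \<nu>] by simp
  have KG: "(\<eta> v* K P \<nu>) v* G = \<eta> v* G - \<eta> + (\<eta> \<bullet> b) *\<^sub>R (\<nu> v* G)"
    by (simp add: vmult_K vmult_add_left vmult_scaleR_left vmult_assoc AG vmult_diff_right)
  have Kg: "(\<eta> v* K P \<nu>) \<bullet> g1 = \<eta> \<bullet> g1 - 1 + (\<eta> \<bullet> b) * (\<nu> \<bullet> g1)"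
    unfolding vG_one[symmetric] KG by (simp add: inner_add_left inner_diff_left \<eta>)
  have "(\<nu> \<bullet> g1) *\<^sub>R pi \<nu> = \<nu> v* G" using g by (simp add: pi_def)
  then have "rop \<nu> (\<eta>' - \<eta> v* K P \<nu>) = \<eta>' v* G - (\<eta> v* G - \<eta>) - (\<eta>' \<bullet> g1 - \<eta> \<bullet> g1 + 1) *\<^sub>R pi \<nu>"
    unfolding rop_def vmult_diff_left inner_diff_left KG Kg
    by (simp add: algebra_simps scaleR_scaleR[symmetric] del: scaleR_scaleR)
  then show ?thesis unfolding rop_def by (simp add: algebra_simps)
qed

text \<open>On the tangent space this is \<open>\<nabla>h(\<theta>)\<close>; the last term gives the transversal direction \<open>\<theta>\<close> the
  eigenvalue \<open>-(1 + \<kappa>)\<close>, so that the whole matrix is Hurwitz when \<open>\<nabla>h(\<theta>)\<close> is.\<close>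
definition Jop :: "real \<Rightarrow> real^'s \<Rightarrow> real^'s" where
  "Jop \<kappa> y = (1/\<rho>) *\<^sub>R (y v* G - (y \<bullet> g1) *\<^sub>R \<theta>) - y - (\<kappa> * (y \<bullet> 1)) *\<^sub>R \<theta>"

lemma linear_Jop: "linear (Jop \<kappa>)"
  by (rule linearI) (simp_all add: Jop_def vmult_add_left vmult_scaleR_left inner_add_left algebra_simps)

lemma Jop_one: "Jop \<kappa> y \<bullet> 1 = - (1 + \<kappa>) * (y \<bullet> 1)"
  by (simp add: Jop_def inner_diff_left vG_one \<theta>_one algebra_simps)

lemma pi_minus_\<theta>: assumes "\<nu> \<in> prob_simplex"
  shows "pi \<nu> - \<theta> = (1 / (\<nu> \<bullet> g1)) *\<^sub>R ((\<nu> - \<theta>) v* G - ((\<nu> - \<theta>) \<bullet> g1) *\<^sub>R \<theta>)"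
proof -
  have g: "\<nu> \<bullet> g1 \<noteq> 0" using simplex_g1[OF assms] by simp
  show ?thesis
    unfolding vmult_diff_left inner_diff_left \<theta>_G \<theta>_g1 pi_def
    using g by (simp add: algebra_simps)
qed

text \<open>\<open>pi \<nu> - \<theta>\<close> is linear in \<open>\<nu> - \<theta>\<close> up to
  the scalar \<open>1 / (\<nu> \<bullet> g1)\<close>, which differs from \<open>1 / \<rho>\<close>
  by a multiple of \<open>(\<nu> - \<theta>) \<bullet> g1\<close>; hence the error is quadratic on
  the whole simplex. The \<open>\<kappa>\<close> term vanishes on differences of probability
  vectors.\<close>

lemma h_quadratic: "\<exists>C\<ge>0. \<forall>\<nu>\<in>prob_simplex. norm (pi \<nu> - \<nu> - Jop \<kappa> (\<nu> - \<theta>)) \<le> C * (norm (\<nu> - \<theta>))^2"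
proof -
  obtain c where c: "c > 0" "\<And>x. norm (x v* G) \<le> norm x * c"
    using bounded_linear.pos_bounded[OF bounded_linear_vmult[of G]] by auto
  define C where "C = (c + norm g1 * norm \<theta>) * norm g1"
  have "norm (pi \<nu> - \<nu> - Jop \<kappa> (\<nu> - \<theta>)) \<le> C * (norm (\<nu> - \<theta>))^2" if \<nu>: "\<nu> \<in> prob_simplex" for \<nu>
  proof -
    define y where "y = \<nu> - \<theta>"
    define w where "w = y v* G - (y \<bullet> g1) *\<^sub>R \<theta>"
    have g: "1 \<le> \<nu> \<bullet> g1" using simplex_g1[OF \<nu>] .
    have y1: "y \<bullet> 1 = 0" by (simp add: y_def inner_diff_left \<theta>_one simplex_inner_one[OF \<nu>])
    have "pi \<nu> - \<nu> = (pi \<nu> - \<theta>) - y" by (simp add: y_def)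
    also have "pi \<nu> - \<theta> = (1 / (\<nu> \<bullet> g1)) *\<^sub>R w" using pi_minus_\<theta>[OF \<nu>] by (simp add: w_def y_def)
    finally have "pi \<nu> - \<nu> - Jop \<kappa> y = (1 / (\<nu> \<bullet> g1) - 1 / \<rho>) *\<^sub>R w"
      by (simp add: Jop_def y1 w_def[symmetric] algebra_simps)
    also have "1 / (\<nu> \<bullet> g1) - 1 / \<rho> = - (y \<bullet> g1) / ((\<nu> \<bullet> g1) * \<rho>)"
      using g \<rho>_pos by (simp add: y_def inner_diff_left \<theta>_g1 field_simps)
    finally have "norm (pi \<nu> - \<nu> - Jop \<kappa> y) = \<bar>y \<bullet> g1\<bar> / ((\<nu> \<bullet> g1) * \<rho>) * norm w"
      using g \<rho>_pos by (simp add: abs_mult)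
    also have "\<dots> \<le> \<bar>y \<bullet> g1\<bar> * norm w"
    proof (rule mult_right_mono)
      have "1 \<le> (\<nu> \<bullet> g1) * \<rho>" using mult_mono[OF g \<rho>_ge_1] g by simp
      then show "\<bar>y \<bullet> g1\<bar> / ((\<nu> \<bullet> g1) * \<rho>) \<le> \<bar>y \<bullet> g1\<bar>" by (simp add: divide_le_eq mult_le_cancel_left1)
    qed simp
    also have "\<dots> \<le> (norm y * norm g1) * (norm y * c + norm y * norm g1 * norm \<theta>)"
    proof (rule mult_mono)
      show "\<bar>y \<bullet> g1\<bar> \<le> norm y * norm g1" by (rule Cauchy_Schwarz_ineq2)
      have "norm w \<le> norm (y v* G) + \<bar>y \<bullet> g1\<bar> * norm \<theta>"
        unfolding w_def using norm_triangle_ineq4[of "y v* G" "(y \<bullet> g1) *\<^sub>R \<theta>"] by simp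
      also have "\<dots> \<le> norm y * c + norm y * norm g1 * norm \<theta>"
        by (intro add_mono c mult_right_mono Cauchy_Schwarz_ineq2) simp
      finally show "norm w \<le> norm y * c + norm y * norm g1 * norm \<theta>" .
    qed auto
    also have "\<dots> = C * (norm y)^2" by (simp add: C_def power2_eq_square algebra_simps)
    finally show ?thesis by (simp add: y_def)
  qed
  moreover have "0 \<le> C" using c by (simp add: C_def)
  ultimately show ?thesis by blast
qed

lemma pi_lipschitz: "\<exists>C\<ge>0. \<forall>\<nu>\<in>prob_simplex. \<forall>\<nu>'\<in>prob_simplex. norm (pi \<nu> - pi \<nu>') \<le> C * norm (\<nu> - \<nu>')"
proof -
  obtain c where c: "c > 0" "\<And>x. norm (x v* G) \<le> norm x * c"
    using bounded_linear.pos_bounded[OF bounded_linear_vmult[of G]] by auto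
  have "norm (pi \<nu> - pi \<nu>') \<le> (c + norm g1) * norm (\<nu> - \<nu>')"
    if \<nu>: "\<nu> \<in> prob_simplex" and \<nu>': "\<nu>' \<in> prob_simplex" for \<nu> \<nu>'
  proof -
    have g: "1 \<le> \<nu> \<bullet> g1" "1 \<le> \<nu>' \<bullet> g1" using simplex_g1 \<nu> \<nu>' by auto
    have "pi \<nu> - pi \<nu>' = (1 / (\<nu> \<bullet> g1)) *\<^sub>R ((\<nu> - \<nu>') v* G - ((\<nu> - \<nu>') \<bullet> g1) *\<^sub>R pi \<nu>')"
      unfolding pi_def vmult_diff_left inner_diff_left using g by (simp add: algebra_simps)
    then have "norm (pi \<nu> - pi \<nu>') = norm ((\<nu> - \<nu>') v* G - ((\<nu> - \<nu>') \<bullet> g1) *\<^sub>R pi \<nu>') / (\<nu> \<bullet> g1)"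
      using g by simp
    also have "\<dots> \<le> norm ((\<nu> - \<nu>') v* G - ((\<nu> - \<nu>') \<bullet> g1) *\<^sub>R pi \<nu>')"
      using g by (simp add: divide_le_eq mult_le_cancel_left1)
    also have "\<dots> \<le> norm ((\<nu> - \<nu>') v* G) + \<bar>(\<nu> - \<nu>') \<bullet> g1\<bar> * norm (pi \<nu>')"
      using norm_triangle_ineq4[of "(\<nu> - \<nu>') v* G" "((\<nu> - \<nu>') \<bullet> g1) *\<^sub>R pi \<nu>'"] by simp
    also have "\<dots> \<le> norm (\<nu> - \<nu>') * c + (norm (\<nu> - \<nu>') * norm g1) * 1"
      by (intro add_mono c mult_mono Cauchy_Schwarz_ineq2 simplex_norm_le_1 pi_simplex \<nu>') auto
    finally show ?thesis by (simp add: algebra_simps)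
  qed
  then show ?thesis using c by (intro exI[of _ "c + norm g1"]) auto
qed

lemma h_derivative: "(h P has_derivative Jop \<kappa>) (at \<theta> within prob_simplex)"
proof -
  obtain C where C: "C \<ge> 0" "\<And>\<nu>. \<nu> \<in> prob_simplex \<Longrightarrow> norm (pi \<nu> - \<nu> - Jop \<kappa> (\<nu> - \<theta>)) \<le> C * (norm (\<nu> - \<theta>))^2"
    using h_quadratic by blast
  have h\<theta>: "h P \<theta> = 0" by (simp add: h_eq \<theta>_simplex pi_\<theta>)
  show ?thesis
    unfolding has_derivative_within_alt
  proof (intro conjI allI impI)
    show "bounded_linear (Jop \<kappa>)" using linear_Jop linear_conv_bounded_linear by blast
    fix e :: real assume e: "0 < e"
    show "\<exists>d>0. \<forall>y\<in>prob_simplex. norm (y - \<theta>) < d \<longrightarrow> norm (h P y - h P \<theta> - Jop \<kappa> (y - \<theta>)) \<le> e * norm (y - \<theta>)"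
    proof (intro exI[of _ "e / (C + 1)"] conjI ballI impI)
      show "0 < e / (C + 1)" using e C by simp
      fix y :: "real^'s" assume y: "y \<in> prob_simplex" "norm (y - \<theta>) < e / (C + 1)"
      have "norm (h P y - h P \<theta> - Jop \<kappa> (y - \<theta>)) \<le> C * norm (y - \<theta>) * norm (y - \<theta>)"
        using C(2)[OF y(1)] y(1) by (simp add: h\<theta> h_eq power2_eq_square)
      also have "\<dots> \<le> e * norm (y - \<theta>)"
      proof (rule mult_right_mono)
        have "C * norm (y - \<theta>) \<le> (C + 1) * norm (y - \<theta>)" by (simp add: mult_right_mono)
        also have "\<dots> \<le> e" using y(2) C by (simp add: field_simps)
        finally show "C * norm (y - \<theta>) \<le> e" .
      qed simp
      finally show "norm (h P y - h P \<theta> - Jop \<kappa> (y - \<theta>)) \<le> e * norm (y - \<theta>)" .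
    qed
  qed
qed

text \<open>A derivative within the simplex is not unique on the whole space. As
  \<open>\<theta>\<close> has positive entries, a tangent direction gives a segment in the simplex
  with \<open>\<theta>\<close> in its interior, and there the one-dimensional derivative
  decides.\<close>

lemma grad_h_eq: assumes y: "y \<bullet> 1 = 0" shows "grad_h P \<theta> y = Jop \<kappa> y"
proof -
  have d1: "(h P has_derivative grad_h P \<theta>) (at \<theta> within prob_simplex)"
    unfolding grad_h_def frechet_derivative_works[symmetric] using h_derivative differentiableI by blast
  have "\<exists>e>0. \<forall>x. e * \<bar>y $ x\<bar> < \<theta> $ x"
  proof -
    define e where "e = Min (range (\<lambda>x. \<theta> $ x)) / (norm y + 1)"
    have m0: "0 < Min (range (\<lambda>x. \<theta> $ x))" by (subst Min_gr_iff) (auto simp: \<theta>_pos)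
    have ny: "0 < norm y + 1" by (simp add: add_nonneg_pos)
    have e0: "0 < e" unfolding e_def by (rule divide_pos_pos[OF m0 ny])
    have "e * \<bar>y $ x\<bar> < \<theta> $ x" for x
    proof -
      have "e * \<bar>y $ x\<bar> < e * (norm y + 1)"
        using e0 component_le_norm_cart[of y x] by (intro mult_strict_left_mono) auto
      also have "\<dots> = Min (range (\<lambda>x. \<theta> $ x))" using ny unfolding e_def by simp
      also have "\<dots> \<le> \<theta> $ x" by (rule Min_le) auto
      finally show ?thesis .
    qed
    then show ?thesis using e0 by blast
  qed
  then obtain e where e: "e > 0" "\<And>x. e * \<bar>y $ x\<bar> < \<theta> $ x" by blast
  define c where "c t = \<theta> + t *\<^sub>R y" for t :: real
  have c: "c ` {-e<..<e} \<subseteq> prob_simplex"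
  proof
    fix z assume "z \<in> c ` {-e<..<e}"
    then obtain t where "t \<in> {-e<..<e}" and z: "z = c t" by blast
    then have t: "\<bar>t\<bar> < e" "z = c t" by auto
    have "0 \<le> z $ x" for x
    proof -
      have "\<bar>t * y $ x\<bar> \<le> e * \<bar>y $ x\<bar>" using t by (simp add: abs_mult mult_right_mono)
      then show ?thesis using e(2)[of x] t by (simp add: c_def)
    qed
    moreover have "z \<bullet> 1 = 1" by (simp add: t c_def inner_add_left \<theta>_one y)
    ultimately show "z \<in> prob_simplex" by (simp add: prob_simplex_def inner_one)
  qed
  have "(h P \<circ> c has_vector_derivative D y) (at 0)"
    if D: "(h P has_derivative D) (at \<theta> within prob_simplex)" for D
  proof -
    have 1: "(c has_derivative (\<lambda>t. t *\<^sub>R y)) (at 0 within {-e<..<e})"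
      unfolding c_def by (auto intro!: derivative_eq_intros)
    have "(h P has_derivative D) (at (c 0) within c ` {-e<..<e})"
      using has_derivative_subset[OF D c] by (simp add: c_def)
    from diff_chain_within[OF 1 this]
    have "(h P \<circ> c has_derivative D \<circ> (\<lambda>t. t *\<^sub>R y)) (at 0)"
      using e at_within_open[of "0::real" "{-e<..<e}"] by simp
    moreover have "D (t *\<^sub>R y) = t *\<^sub>R D y" for t
      using has_derivative_linear[OF D] by (simp add: linear_cmul)
    ultimately show ?thesis by (simp add: has_vector_derivative_def o_def)
  qed
  from vector_derivative_unique_at[OF this[OF d1] this[OF h_derivative]] show ?thesis .
qed

end

section \<open>The Poisson solution as a time integral\<close>

lemma mat_pow_scaleR: "mat_pow (t *\<^sub>R B) k = t ^ k *\<^sub>R mat_pow B k"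
  by (induction k) (simp_all add: matrix_scalar_ac scalar_matrix_assoc[symmetric])

lemma mat_pow_bound: "\<exists>\<beta>. \<forall>k i j. \<bar>mat_pow (B :: real^'n^'n) k $ i $ j\<bar> \<le> \<beta> ^ k"
proof -
  define \<beta> where "\<beta> = (\<Sum>i\<in>UNIV. \<Sum>l\<in>UNIV. \<bar>B $ i $ l\<bar>)"
  have row: "(\<Sum>l\<in>UNIV. \<bar>B $ i $ l\<bar>) \<le> \<beta>" for i
    unfolding \<beta>_def by (rule member_le_sum) (auto intro: sum_nonneg)
  have "\<bar>mat_pow B k $ i $ j\<bar> \<le> \<beta> ^ k" for k i j
  proof (induction k arbitrary: i)
    case 0
    then show ?case by (simp add: mat_def)
  next
    case (Suc k)
    have "0 \<le> \<beta> ^ k" using order_trans[OF abs_ge_zero Suc] .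
    have "\<bar>mat_pow B (Suc k) $ i $ j\<bar> \<le> (\<Sum>l\<in>UNIV. \<bar>B $ i $ l\<bar> * \<beta> ^ k)"
      using Suc by (auto simp: matrix_matrix_mult_def abs_mult intro!: order_trans[OF sum_abs] sum_mono mult_left_mono)
    also have "\<dots> \<le> \<beta> * \<beta> ^ k"
      unfolding sum_distrib_right[symmetric] by (rule mult_right_mono[OF row \<open>0 \<le> \<beta> ^ k\<close>])
    finally show ?case by simp
  qed
  then show ?thesis by blast
qed

lemma mat_exp_entry_summable: "summable (\<lambda>k. mat_pow (B :: real^'n^'n) k $ i $ j / fact k * t ^ k)"
proof -
  obtain \<beta> where \<beta>: "\<And>k i j. \<bar>mat_pow B k $ i $ j\<bar> \<le> \<beta> ^ k" using mat_pow_bound[of B] by blast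
  show ?thesis
  proof (rule summable_comparison_test')
    show "summable (\<lambda>k. inverse (fact k) * (\<beta> * \<bar>t\<bar>) ^ k)" by (rule summable_exp)
    show "norm (mat_pow B k $ i $ j / fact k * t ^ k) \<le> inverse (fact k) * (\<beta> * \<bar>t\<bar>) ^ k" for k
    proof -
      have "norm (mat_pow B k $ i $ j / fact k * t ^ k) = inverse (fact k) * (\<bar>mat_pow B k $ i $ j\<bar> * \<bar>t\<bar> ^ k)"
        by (simp add: abs_mult power_abs field_simps)
      also have "\<dots> \<le> inverse (fact k) * (\<beta> ^ k * \<bar>t\<bar> ^ k)"
        by (intro mult_left_mono mult_right_mono \<beta>) auto
      finally show ?thesis by (simp add: power_mult_distrib)
    qed
  qed
qed

lemma mat_exp_entry: "mat_exp (t *\<^sub>R B) $ i $ j = (\<Sum>k. mat_pow (B :: real^'n^'n) k $ i $ j / fact k * t ^ k)"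
proof -
  have "(\<lambda>k. mat_pow (t *\<^sub>R B) k /\<^sub>R fact k) sums (\<chi> i j. \<Sum>k. mat_pow B k $ i $ j / fact k * t ^ k)"
    unfolding sums_def
  proof (intro vec_tendstoI)
    fix i j
    have "(\<lambda>n. \<Sum>k<n. mat_pow B k $ i $ j / fact k * t ^ k) \<longlonglongrightarrow> (\<Sum>k. mat_pow B k $ i $ j / fact k * t ^ k)"
      by (rule summable_LIMSEQ[OF mat_exp_entry_summable])
    then show "(\<lambda>n. (\<Sum>k<n. mat_pow (t *\<^sub>R B) k /\<^sub>R fact k) $ i $ j) \<longlonglongrightarrow>
        (\<chi> i j. \<Sum>k. mat_pow B k $ i $ j / fact k * t ^ k) $ i $ j"
      by (simp add: mat_pow_scaleR divide_inverse mult_ac)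
  qed
  then show ?thesis unfolding mat_exp_def by (simp add: sums_unique[symmetric])
qed

text \<open>Both orders of the product are used: the left one is the flow y' = By of the decay
  estimate, the right one differentiates the exponential applied to a fixed vector \<open>v\<close>
  in terms of \<open>B *v v\<close>.\<close>

lemma mat_exp_derivative:
  fixes B :: "real^'n^'n"
  shows "((\<lambda>t. mat_exp (t *\<^sub>R B) $ i $ j) has_real_derivative (B ** mat_exp (t *\<^sub>R B)) $ i $ j) (at t)" (is ?l)
    and "((\<lambda>t. mat_exp (t *\<^sub>R B) $ i $ j) has_real_derivative (mat_exp (t *\<^sub>R B) ** B) $ i $ j) (at t)" (is ?r)
proof -
  define c where "c k = mat_pow B k $ i $ j / fact k" for k
  have "((\<lambda>t. \<Sum>k. c k * t ^ k) has_real_derivative (\<Sum>k. diffs c k * t ^ k)) (at t)"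
    by (rule termdiffs_strong_converges_everywhere) (unfold c_def, rule mat_exp_entry_summable)
  then have d: "((\<lambda>t. mat_exp (t *\<^sub>R B) $ i $ j) has_real_derivative (\<Sum>k. diffs c k * t ^ k)) (at t)"
    by (simp only: mat_exp_entry c_def)
  have dc: "diffs c k = mat_pow B (Suc k) $ i $ j / fact k" for k
    by (simp add: diffs_def c_def del: mat_pow.simps of_nat_Suc)
  have "(\<Sum>k. diffs c k * t ^ k) = (\<Sum>k. \<Sum>l\<in>UNIV. B $ i $ l * (mat_pow B k $ l $ j / fact k * t ^ k))"
    unfolding dc by (simp add: matrix_matrix_mult_def sum_divide_distrib sum_distrib_right mult.assoc)
  also have "\<dots> = (\<Sum>l\<in>UNIV. \<Sum>k. B $ i $ l * (mat_pow B k $ l $ j / fact k * t ^ k))"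
    by (rule suminf_sum) (intro summable_mult mat_exp_entry_summable)
  also have "\<dots> = (\<Sum>l\<in>UNIV. B $ i $ l * mat_exp (t *\<^sub>R B) $ l $ j)"
    by (simp only: mat_exp_entry suminf_mult[OF mat_exp_entry_summable])
  also have "\<dots> = (B ** mat_exp (t *\<^sub>R B)) $ i $ j" by (simp add: matrix_matrix_mult_def)
  finally show ?l using d by simp
  have "(\<Sum>k. diffs c k * t ^ k) = (\<Sum>k. \<Sum>l\<in>UNIV. B $ l $ j * (mat_pow B k $ i $ l / fact k * t ^ k))"
  proof -
    have "diffs c k * t ^ k = (\<Sum>l\<in>UNIV. B $ l $ j * (mat_pow B k $ i $ l / fact k * t ^ k))" for k
      unfolding dc mat_pow.simps mat_pow_commute[symmetric]
      unfolding matrix_matrix_mult_def vec_lambda_beta sum_divide_distrib sum_distrib_right by (intro sum.cong refl) simp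
    then show ?thesis by (simp only:)
  qed
  also have "\<dots> = (\<Sum>l\<in>UNIV. \<Sum>k. B $ l $ j * (mat_pow B k $ i $ l / fact k * t ^ k))"
    by (rule suminf_sum) (intro summable_mult mat_exp_entry_summable)
  also have "\<dots> = (\<Sum>l\<in>UNIV. B $ l $ j * mat_exp (t *\<^sub>R B) $ i $ l)"
    by (simp only: mat_exp_entry suminf_mult[OF mat_exp_entry_summable])
  also have "\<dots> = (mat_exp (t *\<^sub>R B) ** B) $ i $ j" by (simp add: matrix_matrix_mult_def mult.commute)
  finally show ?r using d by simp
qed

lemma mat_exp_zero: "mat_exp (0 :: real^'n^'n) = mat 1"
proof -
  have "mat_exp (0 *\<^sub>R (0 :: real^'n^'n)) $ i $ j = (mat 1 :: real^'n^'n) $ i $ j" for i j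
    unfolding mat_exp_entry by (subst powser_zero[of "\<lambda>k. mat_pow 0 k $ i $ j / fact k"]) simp
  then show ?thesis by (simp add: vec_eq_iff)
qed

context qsd_chain
begin

abbreviation "Kt \<equiv> K P \<theta>"
abbreviation "Bt \<equiv> Kt - mat 1"
text \<open>R(\<nu>) and Q(\<nu>) solve the same Poisson equation, so they differ by a matrix with
  equal rows. At \<open>\<theta>\<close>, an eigenvector of \<open>G\<close>, both annihilate
  \<open>\<theta>\<close> from the left and therefore coincide.\<close>

definition "Rt = G - (\<chi> x y. g1 $ x * \<theta> $ y)"

lemma Rt_mult: "Rt *v v = G *v v - (\<theta> \<bullet> v) *\<^sub>R g1"
  by (simp add: Rt_def matrix_vector_mult_diff_rdistrib)
    (simp add: vec_eq_iff matrix_vector_mult_def inner_vec_def sum_distrib_left mult_ac)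

lemma vmult_Rt: "x v* Rt = rop \<theta> x"
  by (simp add: Rt_def vmult_diff_right rop_def pi_\<theta>)
    (simp add: vec_eq_iff vmult_eq_sum inner_vec_def sum_distrib_right sum_distrib_left mult_ac)

lemma Kt_one: "Kt *v 1 = 1" by (simp add: K_mult_vec A_one \<theta>_one)

lemma \<theta>_b: "\<theta> \<bullet> b = 1 - lam"
proof -
  have "\<theta> \<bullet> (A *v 1) = lam" by (simp add: lam_def dot_lmul_matrix)
  then show ?thesis by (simp add: A_one inner_diff_right \<theta>_one)
qed

lemma \<theta>_Kt: "\<theta> v* Kt = \<theta>"
  by (simp add: vmult_K \<theta>_A \<theta>_b) (simp add: algebra_simps)

lemma \<theta>_Rt: "\<theta> v* Rt = 0" by (simp add: vmult_Rt rop_def \<theta>_G \<theta>_g1 pi_\<theta>)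

lemma Kt_nonneg: "0 \<le> Kt $ x $ y"
  by (simp add: K_def P_nonneg \<theta>_nonneg)

lemma Kt_ge_A: "A $ x $ y \<le> Kt $ x $ y"
  by (simp add: K_def A_def P_nonneg \<theta>_nonneg)

section \<open>Dirichlet form, Poincare inequality and exponential decay\<close>

text \<open>Twice the Dirichlet form of \<open>Kt\<close> in L2(\<theta>); it is minus the
  derivative of the weighted square norm along the flow of \<open>Bt\<close>.\<close>

definition dirichlet :: "real^'s \<Rightarrow> real" where
  "dirichlet v = (\<Sum>i\<in>UNIV. \<Sum>j\<in>UNIV. \<theta> $ i * Kt $ i $ j * (v $ i - v $ j)^2)"

lemma dirichlet_eq: "2 * (\<Sum>i\<in>UNIV. \<theta> $ i * (v $ i * (Bt *v v) $ i)) = - dirichlet v"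
proof -
  have r: "(\<Sum>j\<in>UNIV. Kt $ i $ j) = 1" for i
    using arg_cong[OF Kt_one, of "\<lambda>v. v $ i"] by (simp add: matrix_vector_mult_def)
  have c: "(\<Sum>i\<in>UNIV. \<theta> $ i * Kt $ i $ j) = \<theta> $ j" for j
    using arg_cong[OF \<theta>_Kt, of "\<lambda>v. v $ j"] by (simp add: vmult_eq_sum)
  have 1: "(\<Sum>i\<in>UNIV. \<Sum>j\<in>UNIV. \<theta> $ i * Kt $ i $ j * (v $ i)^2) = (\<Sum>i\<in>UNIV. \<theta> $ i * (v $ i)^2)"
  proof (intro sum.cong refl)
    fix i
    have "(\<Sum>j\<in>UNIV. \<theta> $ i * Kt $ i $ j * (v $ i)^2) = (\<Sum>j\<in>UNIV. Kt $ i $ j) * (\<theta> $ i * (v $ i)^2)"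
      unfolding sum_distrib_right by (intro sum.cong) auto
    then show "(\<Sum>j\<in>UNIV. \<theta> $ i * Kt $ i $ j * (v $ i)^2) = \<theta> $ i * (v $ i)^2" by (simp add: r)
  qed
  have 2: "(\<Sum>i\<in>UNIV. \<Sum>j\<in>UNIV. \<theta> $ i * Kt $ i $ j * (v $ j)^2) = (\<Sum>i\<in>UNIV. \<theta> $ i * (v $ i)^2)"
    by (subst sum.swap) (simp only: sum_distrib_right[symmetric] c)
  have 3: "(\<Sum>i\<in>UNIV. \<Sum>j\<in>UNIV. \<theta> $ i * Kt $ i $ j * (v $ i * v $ j)) = (\<Sum>i\<in>UNIV. \<theta> $ i * (v $ i * (Kt *v v) $ i))"
    by (simp add: matrix_vector_mult_def sum_distrib_left mult_ac)
  have "dirichlet v = (\<Sum>i\<in>UNIV. \<Sum>j\<in>UNIV. \<theta> $ i * Kt $ i $ j * (v $ i)^2 + \<theta> $ i * Kt $ i $ j * (v $ j)^2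
     - 2 * (\<theta> $ i * Kt $ i $ j * (v $ i * v $ j)))"
    unfolding dirichlet_def by (intro sum.cong refl) (simp add: power2_eq_square algebra_simps)
  also have "\<dots> = 2 * (\<Sum>i\<in>UNIV. \<theta> $ i * (v $ i)^2) - 2 * (\<Sum>i\<in>UNIV. \<theta> $ i * (v $ i * (Kt *v v) $ i))"
    by (simp only: sum.distrib sum_subtractf sum_distrib_left[symmetric] 1 2 3)
  also have "\<dots> = - 2 * (\<Sum>i\<in>UNIV. \<theta> $ i * (v $ i * (Bt *v v) $ i))"
    by (simp add: matrix_vector_mult_diff_rdistrib power2_eq_square right_diff_distrib sum_subtractf)
  finally show ?thesis by simp
qed

lemma dirichlet_nonneg: "0 \<le> dirichlet v"
  unfolding dirichlet_def by (intro sum_nonneg mult_nonneg_nonneg \<theta>_nonneg Kt_nonneg) simp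

text \<open>Zero energy makes \<open>v\<close> constant along the edges of \<open>A\<close>, which
  \<open>Kt\<close> dominates, and irreducibility connects all states by such edges.\<close>

lemma dirichlet_zero:
  assumes z: "dirichlet v = 0" shows "v $ x = v $ y"
proof -
  have nn: "0 \<le> \<theta> $ i * Kt $ i $ j * (v $ i - v $ j)^2" for i j
    by (intro mult_nonneg_nonneg \<theta>_nonneg Kt_nonneg) simp
  have "\<theta> $ i * Kt $ i $ j * (v $ i - v $ j)^2 = 0" for i j
  proof -
    have "(\<Sum>j\<in>UNIV. \<theta> $ i * Kt $ i $ j * (v $ i - v $ j)^2) = 0"
      using z nn unfolding dirichlet_def by (subst (asm) sum_nonneg_eq_0_iff) (auto intro!: sum_nonneg)
    then show ?thesis using nn by (subst (asm) sum_nonneg_eq_0_iff) auto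
  qed
  then have eq: "v $ i = v $ j" if "A $ i $ j > 0" for i j
  proof -
    have "\<theta> $ i \<noteq> 0" "Kt $ i $ j \<noteq> 0" using that Kt_ge_A[of i j] \<theta>_pos[of i] by auto
    then show ?thesis using \<open>\<And>i j. \<theta> $ i * Kt $ i $ j * (v $ i - v $ j)^2 = 0\<close>[of i j] by simp
  qed
  have path: "v $ i = v $ j" if "mat_pow A n $ i $ j > 0" for n i j
    using that
  proof (induction n arbitrary: i)
    case 0
    then show ?case by (simp add: mat_def split: if_splits)
  next
    case (Suc n)
    then have "0 < (\<Sum>l\<in>UNIV. A $ i $ l * mat_pow A n $ l $ j)" by (simp add: matrix_matrix_mult_def)
    then have "\<exists>l. 0 < A $ i $ l * mat_pow A n $ l $ j"
      using sum_nonpos[of UNIV "\<lambda>l. A $ i $ l * mat_pow A n $ l $ j"] by (auto simp: not_less[symmetric])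
    then obtain l where l: "0 < A $ i $ l * mat_pow A n $ l $ j" by blast
    then have "0 < A $ i $ l" "0 < mat_pow A n $ l $ j"
      using A_nonneg[of i l] mat_pow_A_nonneg[of n l j] by (auto simp: zero_less_mult_iff)
    then show ?case using eq[of i l] Suc.IH[of l] by simp
  qed
  obtain n where "mat_pow A n $ x $ y > 0" using irreducible by blast
  then show ?thesis by (rule path)
qed

text \<open>A spectral gap by compactness: the form attains its minimum on the unit sphere of the
  hyperplane, and a zero minimum would be attained at a constant vector of
  \<open>\<theta>\<close>-mean zero.\<close>

lemma poincare: "\<exists>m>0. \<forall>v. \<theta> \<bullet> v = 0 \<longrightarrow> m * (\<Sum>i\<in>UNIV. \<theta> $ i * (v $ i)^2) \<le> dirichlet v"
proof -
  let ?S = "{v::real^'s. \<theta> \<bullet> v = 0 \<and> norm v = 1}"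
  have S: "compact ?S"
  proof -
    have "?S = {v. \<theta> \<bullet> v = 0} \<inter> sphere 0 1" by auto
    then show ?thesis by (simp add: closed_Int_compact closed_hyperplane)
  qed
  have cont: "continuous_on ?S dirichlet"
    unfolding dirichlet_def by (intro continuous_intros)
  have "\<exists>m>0. \<forall>v\<in>?S. m \<le> dirichlet v"
  proof (cases "?S = {}")
    case True
    then show ?thesis by (intro exI[of _ 1]) auto
  next
    case False
    then obtain v0 where v0: "v0 \<in> ?S" "\<forall>v\<in>?S. dirichlet v0 \<le> dirichlet v"
      using continuous_attains_inf[OF S False cont] by blast
    have "dirichlet v0 \<noteq> 0"
    proof
      assume "dirichlet v0 = 0"
      \<comment> \<open>\<open>undefined\<close> is merely some state at which to read off the
        constant.\<close>
      then have "v0 = (v0 $ undefined) *\<^sub>R 1" using dirichlet_zero by (simp add: vec_eq_iff)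
      then have "\<theta> \<bullet> v0 = v0 $ undefined" by (metis \<theta>_one inner_scaleR_right mult.right_neutral)
      then have "v0 = 0" using \<open>v0 = (v0 $ undefined) *\<^sub>R 1\<close> v0(1) by auto
      then show False using v0(1) by simp
    qed
    then have "0 < dirichlet v0" using dirichlet_nonneg[of v0] by simp
    then show ?thesis using v0(2) by blast
  qed
  then obtain m where m: "m > 0" "\<And>v. v \<in> ?S \<Longrightarrow> m \<le> dirichlet v" by blast
  have "m * (\<Sum>i\<in>UNIV. \<theta> $ i * (v $ i)^2) \<le> dirichlet v" if v: "\<theta> \<bullet> v = 0" for v
  proof (cases "v = 0")
    case True
    then show ?thesis by (simp add: dirichlet_nonneg)
  next
    case False
    define u where "u = (1 / norm v) *\<^sub>R v"
    have "m \<le> dirichlet u" using m(2)[of u] v False by (simp add: u_def)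
    also have "dirichlet u = dirichlet v / (norm v)^2"
    proof -
      have "(u $ i - u $ j)^2 = (v $ i - v $ j)^2 / (norm v)^2" for i j
        by (simp add: u_def diff_divide_distrib[symmetric] power_divide)
      then show ?thesis unfolding dirichlet_def by (simp add: sum_divide_distrib)
    qed
    finally have 1: "m * (norm v)^2 \<le> dirichlet v" using False by (simp add: field_simps)
    have t1: "\<theta> $ i \<le> 1" for i
      using simplex_norm_le_1[OF \<theta>_simplex] component_le_norm_cart[of \<theta> i] by linarith
    have "(\<Sum>i\<in>UNIV. \<theta> $ i * (v $ i)^2) \<le> (\<Sum>i\<in>UNIV. 1 * (v $ i)^2)"
      by (intro sum_mono mult_right_mono t1) simp
    also have "\<dots> = (norm v)^2" by (simp add: norm_vec_def L2_set_def sum_nonneg)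
    finally show ?thesis using 1 m(1) by (meson mult_left_mono less_imp_le order_trans)
  qed
  then show ?thesis using m(1) by blast
qed

text \<open>The flow stays in the hyperplane because \<open>\<theta>\<close> is invariant, and there
  Gronwall applies to the weighted square norm: its derivative is \<open>- dirichlet\<close>, at
  most -m times itself.\<close>

lemma semigroup_decay:
  assumes v0: "\<theta> \<bullet> v0 = 0"
  shows "\<exists>m>0. \<exists>C. \<forall>t\<ge>0. \<forall>i. \<bar>(mat_exp (t *\<^sub>R Bt) *v v0) $ i\<bar> \<le> C * exp (- m * t)"
proof -
  obtain m where m: "m > 0" "\<And>v. \<theta> \<bullet> v = 0 \<Longrightarrow> m * (\<Sum>i\<in>UNIV. \<theta> $ i * (v $ i)^2) \<le> dirichlet v"
    using poincare by blast
  define y where "y t = mat_exp (t *\<^sub>R Bt) *v v0" for t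
  have dy: "((\<lambda>t. y t $ i) has_real_derivative (Bt *v y t) $ i) (at t)" for i t
  proof -
    have "((\<lambda>t. \<Sum>j\<in>UNIV. mat_exp (t *\<^sub>R Bt) $ i $ j * v0 $ j) has_real_derivative
      (\<Sum>j\<in>UNIV. (Bt ** mat_exp (t *\<^sub>R Bt)) $ i $ j * v0 $ j)) (at t)"
      by (intro DERIV_sum DERIV_cmult_right mat_exp_derivative(1))
    moreover have "(\<Sum>j\<in>UNIV. (Bt ** mat_exp (t *\<^sub>R Bt)) $ i $ j * v0 $ j) = (Bt *v y t) $ i"
      unfolding y_def matrix_vector_mul_assoc by (simp add: matrix_vector_mult_def)
    ultimately show ?thesis by (simp add: y_def matrix_vector_mult_def)
  qed
  have \<theta>y: "\<theta> \<bullet> y t = 0" for t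
  proof -
    have "((\<lambda>t. \<theta> \<bullet> y t) has_real_derivative 0) (at t)" for t
    proof -
      have "((\<lambda>t. \<Sum>i\<in>UNIV. \<theta> $ i * y t $ i) has_real_derivative (\<Sum>i\<in>UNIV. \<theta> $ i * (Bt *v y t) $ i)) (at t)"
        by (intro DERIV_sum DERIV_cmult dy)
      moreover have "(\<Sum>i\<in>UNIV. \<theta> $ i * (Bt *v y t) $ i) = 0"
      proof -
        have "(\<theta> v* Bt) \<bullet> y t = 0" by (simp add: vmult_diff_right \<theta>_Kt)
        then show ?thesis unfolding dot_lmul_matrix by (simp add: inner_vec_def)
      qed
      ultimately show ?thesis by (simp add: inner_vec_def)
    qed
    from DERIV_isconst_all[OF allI[OF this]] have "\<theta> \<bullet> y t = \<theta> \<bullet> y 0" .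
    then show ?thesis using v0 by (simp add: y_def mat_exp_zero)
  qed
  define f where "f t = (\<Sum>i\<in>UNIV. \<theta> $ i * (y t $ i)^2)" for t
  have df: "(f has_real_derivative - dirichlet (y t)) (at t)" for t
  proof -
    have "(f has_real_derivative (\<Sum>i\<in>UNIV. \<theta> $ i * (2 * (y t $ i * (Bt *v y t) $ i)))) (at t)"
      unfolding f_def
      by (intro DERIV_sum DERIV_cmult) (rule DERIV_cong[OF DERIV_power[OF dy]], simp)
    also have "(\<Sum>i\<in>UNIV. \<theta> $ i * (2 * (y t $ i * (Bt *v y t) $ i))) = - dirichlet (y t)"
      unfolding dirichlet_eq[symmetric] by (simp add: sum_distrib_left mult_ac)
    finally show ?thesis .
  qed
  have dec: "exp (m * t) * f t \<le> f 0" if t: "0 \<le> t" for t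
  proof -
    have "exp (m * t) * f t \<le> exp (m * 0) * f 0"
    proof (rule DERIV_nonpos_imp_nonincreasing[OF t])
      fix s :: real
      have "((\<lambda>t. exp (m * t) * f t) has_real_derivative (exp (m * s) * m * f s + - dirichlet (y s) * exp (m * s))) (at s)"
        by (rule DERIV_mult'[THEN DERIV_cong, OF _ df]) (auto intro!: derivative_eq_intros)
      moreover have "exp (m * s) * m * f s + - dirichlet (y s) * exp (m * s) \<le> 0"
        using m(2)[OF \<theta>y, of s] by (simp add: f_def algebra_simps mult_left_mono flip: mult.assoc)
      ultimately show "\<exists>y. ((\<lambda>t. exp (m * t) * f t) has_real_derivative y) (at s) \<and> y \<le> 0" by blast
    qed
    then show ?thesis by simp
  qed
  define q where "q = Min (range (\<lambda>i. \<theta> $ i))"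
  have q: "0 < q" unfolding q_def by (subst Min_gr_iff) (auto simp: \<theta>_pos)
  have qi: "q \<le> \<theta> $ i" for i unfolding q_def by (rule Min_le) auto
  have "\<bar>y t $ i\<bar> \<le> sqrt (f 0 / q) * exp (- (m / 2) * t)" if t: "0 \<le> t" for t i
  proof -
    have "q * (y t $ i)^2 \<le> \<theta> $ i * (y t $ i)^2" by (intro mult_right_mono qi) simp
    also have "\<dots> \<le> f t" unfolding f_def
      by (rule member_le_sum) (auto intro: mult_nonneg_nonneg \<theta>_nonneg)
    also have "\<dots> \<le> f 0 * exp (- m * t)" using dec[OF t] by (simp add: exp_minus field_simps)
    finally have "(y t $ i)^2 \<le> f 0 / q * exp (- m * t)" using q by (simp add: field_simps)
    then have "sqrt ((y t $ i)^2) \<le> sqrt (f 0 / q * exp (- m * t))" by (rule real_sqrt_le_mono)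
    also have "exp (- m * t) = (exp (- (m / 2) * t))^2"
      by (simp add: power2_eq_square flip: exp_add)
    finally show ?thesis by (simp only: real_sqrt_mult real_sqrt_abs abs_exp_cancel)
  qed
  then show ?thesis using m(1) unfolding y_def by (intro exI[of _ "m / 2"]) auto
qed

text \<open>By the Poisson equation the integrand is the derivative of \<open>- E t ** Rt\<close>.
  Decay removes the value at infinity, and the value at 0 leaves \<open>Rt\<close>.\<close>

lemma Q_eq: "Q P \<theta> = Rt"
proof -
  define E where "E t = mat_exp (t *\<^sub>R Bt)" for t
  define F where "F t = E t - (\<chi> x y. invariant_dist P \<theta> $ y)" for t
  have inv: "invariant_dist P \<theta> = \<theta>" by (simp add: invariant_dist_eq \<theta>_simplex pi_\<theta>)
  have BR: "Bt ** Rt = (\<chi> x y. \<theta> $ y) - mat 1"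
  proof -
    have "(Bt ** Rt) *v v = ((\<chi> x y. \<theta> $ y) - mat 1) *v v" for v
    proof -
      have a1: "A *v (G *v v) = G *v v - v" by (simp add: matrix_vector_mul_assoc AG matrix_vector_mult_diff_rdistrib)
      have a2: "A *v g1 = g1 - 1"
        by (simp add: g1_def matrix_vector_mul_assoc AG matrix_vector_mult_diff_rdistrib)
      have a3: "\<theta> \<bullet> (G *v v) = \<rho> * (\<theta> \<bullet> v)" by (simp add: dot_lmul_matrix[symmetric] \<theta>_G)
      have a4: "(\<chi> x y. \<theta> $ y) *v v = (\<theta> \<bullet> v) *\<^sub>R (1::real^'s)"
        by (simp add: vec_eq_iff matrix_vector_mult_def inner_vec_def)
      show ?thesis
        unfolding matrix_vector_mul_assoc[symmetric] Rt_mult matrix_vector_mult_diff_rdistrib K_mult_vec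
          matrix_vector_mult_diff_distrib matrix_vector_mult_scaleR inner_diff_right inner_scaleR_right
          matrix_vector_mul_lid \<theta>_g1 a1 a2 a3 a4
        by (simp add: algebra_simps)
    qed
    then show ?thesis using matrix_eq by blast
  qed
  have E1: "E t *v 1 = 1" for t
  proof -
    have "(E t *v 1) $ i = 1" for i
    proof -
      have d: "((\<lambda>t. (E t *v 1) $ i) has_real_derivative 0) (at t)" for t
      proof -
        have "((\<lambda>t. \<Sum>j\<in>UNIV. E t $ i $ j) has_real_derivative (\<Sum>j\<in>UNIV. (E t ** Bt) $ i $ j)) (at t)"
          unfolding E_def by (intro DERIV_sum mat_exp_derivative(2))
        moreover have "(\<Sum>j\<in>UNIV. (E t ** Bt) $ i $ j) = ((E t ** Bt) *v 1) $ i"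
          by (simp add: matrix_vector_mult_def)
        moreover have "(E t ** Bt) *v 1 = E t *v (Bt *v 1)" by (simp only: matrix_vector_mul_assoc)
        moreover have "Bt *v 1 = 0" by (simp add: matrix_vector_mult_diff_rdistrib Kt_one)
        moreover have "(\<lambda>t. (E t *v 1) $ i) = (\<lambda>t. \<Sum>j\<in>UNIV. E t $ i $ j)"
          by (simp add: matrix_vector_mult_def)
        ultimately show ?thesis by simp
      qed
      have "(E t *v 1) $ i = (E 0 *v 1) $ i" by (rule DERIV_isconst_all[OF allI[OF d]])
      then show ?thesis by (simp add: E_def mat_exp_zero)
    qed
    then show ?thesis by (simp add: vec_eq_iff)
  qed
  have hi: "((\<lambda>t. F t $ i $ j) has_integral Rt $ i $ j) {0..}" for i j
  proof -
    define \<psi> where "\<psi> t = - (E t *v column j Rt) $ i" for t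
    have "\<theta> \<bullet> column j Rt = 0"
      using arg_cong[OF \<theta>_Rt, of "\<lambda>v. v $ j"] by (simp add: vmult_eq_sum inner_vec_def column_def)
    from semigroup_decay[OF this] obtain m C where mC: "m > 0" "\<And>t i. t \<ge> 0 \<Longrightarrow> \<bar>(E t *v column j Rt) $ i\<bar> \<le> C * exp (- m * t)"
      unfolding E_def by blast
    \<comment> \<open>Column \<open>j\<close> of the integrand is the flow started in the centred
      unit vector; its decay provides the integrable majorant.\<close>
    define u where "u = axis j 1 - (\<theta> $ j) *\<^sub>R (1::real^'s)"
    have "\<theta> \<bullet> u = 0" by (simp add: u_def inner_diff_right \<theta>_one inner_axis)
    from semigroup_decay[OF this] obtain m' C' where mC': "m' > 0" "\<And>t i. t \<ge> 0 \<Longrightarrow> \<bar>(E t *v u) $ i\<bar> \<le> C' * exp (- m' * t)"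
      unfolding E_def by blast
    have Fu: "F t $ i $ j = (E t *v u) $ i" for t
      by (simp add: u_def matrix_vector_mult_diff_distrib matrix_vector_mult_scaleR E1 F_def inv
          matrix_vector_mult_basis column_def)
    have d\<psi>: "(\<psi> has_real_derivative F t $ i $ j) (at t)" for t
    proof -
      have "(\<psi> has_real_derivative - (\<Sum>l\<in>UNIV. (E t ** Bt) $ i $ l * column j Rt $ l)) (at t)"
        unfolding \<psi>_def E_def matrix_vector_mult_def vec_lambda_beta
        by (intro DERIV_minus DERIV_sum DERIV_cmult_right mat_exp_derivative(2))
      also have "(\<Sum>l\<in>UNIV. (E t ** Bt) $ i $ l * column j Rt $ l) = (E t ** (Bt ** Rt)) $ i $ j"
        unfolding matrix_mul_assoc by (simp add: matrix_matrix_mult_def column_def)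
      also have "\<dots> = \<theta> $ j * (E t *v 1) $ i - E t $ i $ j"
        unfolding BR mmult_diff_right matrix_mul_rid
        by (simp add: matrix_matrix_mult_def matrix_vector_mult_def sum_distrib_left mult.commute)
      finally show ?thesis by (simp add: E1 F_def inv)
    qed
    have int: "((\<lambda>t. F t $ i $ j) has_integral (\<psi> (real k) - \<psi> 0)) {0..real k}" for k
      by (rule fundamental_theorem_of_calculus)
        (auto simp: has_real_derivative_iff_has_vector_derivative[symmetric] intro: has_field_derivative_at_within[OF d\<psi>])
    \<comment> \<open>The integral over the half-line is the limit of the integrals of truncations,
      by dominated convergence.\<close>
    define Fr where "Fr k t = (if t \<in> {0..real k} then F t $ i $ j else 0)" for k t
    have Fr: "(Fr k has_integral (\<psi> (real k) - \<psi> 0)) {0..}" for k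
    proof -
      have "{0..real k} \<subseteq> {0..}" by auto
      then show ?thesis
        unfolding Fr_def by (rule has_integral_restrict[THEN iffD2]) (rule int)
    qed
    have h: "(\<lambda>t. C' * exp (- m' * t)) integrable_on {0..}"
      by (rule has_integral_integrable[OF has_integral_mult_right[OF has_integral_exp_minus_to_infinity[OF mC'(1)]]])
    have le: "norm (Fr k t) \<le> C' * exp (- m' * t)" if "t \<in> {0..}" for k t
      using mC'(2)[of t i] that order_trans[OF abs_ge_zero mC'(2)[of t i]] by (simp add: Fr_def Fu)
    have conv: "(\<lambda>k. Fr k t) \<longlonglongrightarrow> F t $ i $ j" if "t \<in> {0..}" for t
    proof (rule tendsto_eventually)
      obtain n where "t \<le> real n" using real_arch_simple by blast
      then show "\<forall>\<^sub>F k in sequentially. Fr k t = F t $ i $ j"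
        unfolding eventually_sequentially using that by (intro exI[of _ n]) (auto simp: Fr_def)
    qed
    note dc = dominated_convergence[of Fr "{0..}" "\<lambda>t. C' * exp (- m' * t)" "\<lambda>t. F t $ i $ j", OF _ h le conv]
    have Fri: "Fr k integrable_on {0..}" for k by (rule has_integral_integrable[OF Fr])
    have int_F: "(\<lambda>t. F t $ i $ j) integrable_on {0..}" by (rule dc(1)[OF Fri])
    have "(\<lambda>k. integral {0..} (Fr k)) \<longlonglongrightarrow> integral {0..} (\<lambda>t. F t $ i $ j)" by (rule dc(2)[OF Fri])
    moreover have "integral {0..} (Fr k) = \<psi> (real k) - \<psi> 0" for k using Fr by (rule integral_unique)
    ultimately have 1: "(\<lambda>k. \<psi> (real k) - \<psi> 0) \<longlonglongrightarrow> integral {0..} (\<lambda>t. F t $ i $ j)" by simp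
    have "(\<lambda>k. \<psi> (real k)) \<longlonglongrightarrow> 0"
    proof (rule Lim_null_comparison)
      show "\<forall>\<^sub>F k in sequentially. norm (\<psi> (real k)) \<le> C * exp (- m * real k)"
        using mC(2) by (simp add: \<psi>_def)
      have "filterlim (\<lambda>k. m * real k) at_top sequentially"
        by (rule filterlim_tendsto_pos_mult_at_top[OF tendsto_const mC(1) filterlim_real_sequentially])
      then have "(\<lambda>k. exp (- (m * real k))) \<longlonglongrightarrow> 0"
        by (intro filterlim_compose[OF exp_at_bot] filterlim_compose[OF filterlim_uminus_at_bot_at_top])
      from tendsto_mult_right_zero[OF this, of C] show "(\<lambda>k. C * exp (- m * real k)) \<longlonglongrightarrow> 0" by simp
    qed
    then have "(\<lambda>k. \<psi> (real k) - \<psi> 0) \<longlonglongrightarrow> 0 - \<psi> 0" by (intro tendsto_diff tendsto_const)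
    from LIMSEQ_unique[OF 1 this] have "integral {0..} (\<lambda>t. F t $ i $ j) = - \<psi> 0" by simp
    also have "- \<psi> 0 = Rt $ i $ j" by (simp add: \<psi>_def E_def mat_exp_zero column_def)
    finally show ?thesis using integrable_integral[OF int_F] by simp
  qed
  have "(F has_integral Rt) {0..}"
    unfolding has_integral_componentwise_iff[of F]
  proof
    fix e :: "real^'s^'s" assume "e \<in> Basis"
    then obtain i j where e: "e = axis i (axis j 1)" by (auto simp: Basis_vec_def)
    show "((\<lambda>t. F t \<bullet> e) has_integral Rt \<bullet> e) {0..}"
      unfolding e inner_axis by (simp add: hi)
  qed
  then show ?thesis unfolding Q_def F_def E_def by (rule integral_unique)
qed

end

section \<open>One-step moments of the particle system\<close>

text \<open>Marginal of a product law: the factors of the other coordinates sum to one.\<close>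

lemma sum_PiE_prod_one:
  fixes k :: "nat \<Rightarrow> 's::finite \<Rightarrow> real"
  assumes I: "finite I" "i \<in> I" and k: "\<And>j. j \<in> I \<Longrightarrow> (\<Sum>z\<in>UNIV. k j z) = 1"
  shows "(\<Sum>y\<in>PiE I (\<lambda>_. UNIV). (\<Prod>j\<in>I. k j (y j)) * g (y i)) = (\<Sum>z\<in>UNIV. k i z * g z)"
proof -
  have "(\<Sum>y\<in>PiE I (\<lambda>_. UNIV). (\<Prod>j\<in>I. k j (y j)) * g (y i)) =
    (\<Sum>y\<in>PiE I (\<lambda>_. UNIV). \<Prod>j\<in>I. k j (y j) * (if j = i then g (y j) else 1))"
    using I by (intro sum.cong refl) (simp add: prod.distrib)
  also have "\<dots> = (\<Prod>j\<in>I. \<Sum>z\<in>UNIV. k j z * (if j = i then g z else 1))"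
    using I by (subst prod_sum_PiE) auto
  also have "\<dots> = (\<Prod>j\<in>I. if j = i then (\<Sum>z\<in>UNIV. k i z * g z) else 1)"
    using k by (intro prod.cong refl) auto
  finally show ?thesis using I by simp
qed

lemma sum_PiE_prod_two:
  fixes k :: "nat \<Rightarrow> 's::finite \<Rightarrow> real"
  assumes I: "finite I" "i \<in> I" "i' \<in> I" "i \<noteq> i'" and k: "\<And>j. j \<in> I \<Longrightarrow> (\<Sum>z\<in>UNIV. k j z) = 1"
  shows "(\<Sum>y\<in>PiE I (\<lambda>_. UNIV). (\<Prod>j\<in>I. k j (y j)) * (g (y i) * g' (y i'))) =
    (\<Sum>z\<in>UNIV. k i z * g z) * (\<Sum>z\<in>UNIV. k i' z * g' z)"
proof -
  have "(\<Sum>y\<in>PiE I (\<lambda>_. UNIV). (\<Prod>j\<in>I. k j (y j)) * (g (y i) * g' (y i'))) =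
    (\<Sum>y\<in>PiE I (\<lambda>_. UNIV). \<Prod>j\<in>I. k j (y j) * ((if j = i then g (y j) else 1) * (if j = i' then g' (y j) else 1)))"
    using I by (intro sum.cong refl) (simp add: prod.distrib)
  also have "\<dots> = (\<Prod>j\<in>I. \<Sum>z\<in>UNIV. k j z * ((if j = i then g z else 1) * (if j = i' then g' z else 1)))"
    using I by (subst prod_sum_PiE) auto
  also have "\<dots> = (\<Prod>j\<in>I. (if j = i then (\<Sum>z\<in>UNIV. k i z * g z) else 1) * (if j = i' then (\<Sum>z\<in>UNIV. k i' z * g' z) else 1))"
    using k I by (intro prod.cong refl) auto
  finally show ?thesis using I by (simp add: prod.distrib)
qed

text \<open>Independent centred summands: mixed products integrate to zero, so variances
  add.\<close>

lemma sum_PiE_centered: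
  fixes k g :: "nat \<Rightarrow> 's::finite \<Rightarrow> real"
  assumes I: "finite I" and k: "\<And>j. j \<in> I \<Longrightarrow> (\<Sum>z\<in>UNIV. k j z) = 1"
    and g: "\<And>j. j \<in> I \<Longrightarrow> (\<Sum>z\<in>UNIV. k j z * g j z) = 0"
  shows "(\<Sum>y\<in>PiE I (\<lambda>_. UNIV). (\<Prod>j\<in>I. k j (y j)) * (\<Sum>i\<in>I. g i (y i))) = 0"
    and "(\<Sum>y\<in>PiE I (\<lambda>_. UNIV). (\<Prod>j\<in>I. k j (y j)) * (\<Sum>i\<in>I. g i (y i))^2) =
      (\<Sum>i\<in>I. \<Sum>z\<in>UNIV. k i z * (g i z)^2)"
proof -
  let ?Y = "PiE I (\<lambda>_. UNIV :: 's set)"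
  let ?w = "\<lambda>y. \<Prod>j\<in>I. k j (y j)"
  have one: "(\<Sum>y\<in>?Y. ?w y * f (y i)) = (\<Sum>z\<in>UNIV. k i z * f z)" if "i \<in> I" for i f
    by (rule sum_PiE_prod_one[OF I that]) (rule k)
  show "(\<Sum>y\<in>?Y. ?w y * (\<Sum>i\<in>I. g i (y i))) = 0"
    unfolding sum_distrib_left by (subst sum.swap) (simp add: one g)
  have "(\<Sum>y\<in>?Y. ?w y * (\<Sum>i\<in>I. g i (y i))^2) = (\<Sum>i\<in>I. \<Sum>i'\<in>I. \<Sum>y\<in>?Y. ?w y * (g i (y i) * g i' (y i')))"
  proof -
    have "?w y * (\<Sum>i\<in>I. g i (y i))^2 = (\<Sum>i\<in>I. \<Sum>i'\<in>I. ?w y * (g i (y i) * g i' (y i')))" for y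
      unfolding power2_eq_square sum_product by (simp only: sum_distrib_left)
    then have "(\<Sum>y\<in>?Y. ?w y * (\<Sum>i\<in>I. g i (y i))^2) = (\<Sum>y\<in>?Y. \<Sum>i\<in>I. \<Sum>i'\<in>I. ?w y * (g i (y i) * g i' (y i')))"
      by (simp only:)
    also have "\<dots> = (\<Sum>i\<in>I. \<Sum>y\<in>?Y. \<Sum>i'\<in>I. ?w y * (g i (y i) * g i' (y i')))" by (rule sum.swap)
    also have "\<dots> = (\<Sum>i\<in>I. \<Sum>i'\<in>I. \<Sum>y\<in>?Y. ?w y * (g i (y i) * g i' (y i')))"
      by (intro sum.cong refl sum.swap)
    finally show ?thesis .
  qed
  also have "\<dots> = (\<Sum>i\<in>I. \<Sum>i'\<in>I. if i' = i then (\<Sum>z\<in>UNIV. k i z * (g i z)^2) else 0)"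
  proof (intro sum.cong refl)
    fix i i' assume i: "i \<in> I" "i' \<in> I"
    show "(\<Sum>y\<in>?Y. ?w y * (g i (y i) * g i' (y i'))) = (if i' = i then (\<Sum>z\<in>UNIV. k i z * (g i z)^2) else 0)"
    proof (cases "i' = i")
      case True
      then show ?thesis using one[OF i(1), of "\<lambda>z. (g i z)^2"] by (simp add: power2_eq_square)
    next
      case False
      have "(\<Sum>y\<in>?Y. ?w y * (g i (y i) * g i' (y i'))) = (\<Sum>z\<in>UNIV. k i z * g i z) * (\<Sum>z\<in>UNIV. k i' z * g i' z)"
        by (rule sum_PiE_prod_two[OF I i]) (use False k in auto)
      then show ?thesis using False g[OF i(1)] by simp
    qed
  qed
  also have "\<dots> = (\<Sum>i\<in>I. \<Sum>z\<in>UNIV. k i z * (g i z)^2)" using I by simp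
  finally show "(\<Sum>y\<in>?Y. ?w y * (\<Sum>i\<in>I. g i (y i))^2) = (\<Sum>i\<in>I. \<Sum>z\<in>UNIV. k i z * (g i z)^2)" .
qed

lemma vec_nth_measurable:
  fixes f :: "'a \<Rightarrow> real^'n"
  assumes "f \<in> borel_measurable L" shows "(\<lambda>\<omega>. f \<omega> $ i) \<in> borel_measurable L"
  by (rule measurable_compose[OF assms])
    (intro borel_measurable_continuous_onI continuous_intros)

lemma step_size_bounds:
  assumes "g > 0" shows "0 \<le> step_size g k" "step_size g k \<le> 1"
proof -
  have 1: "g < of_int (\<lfloor>g\<rfloor> + 1)" by linarith
  then have 2: "0 < real_of_int (\<lfloor>g\<rfloor> + 1)" using assms by linarith
  show "0 \<le> step_size g k" using assms 2 by (cases k) (auto simp del: of_int_add)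
  show "step_size g k \<le> 1"
    using assms 1 2 by (cases k) (auto simp: divide_le_eq simp del: of_int_add)
qed

text \<open>Entry \<open>w\<close> is the variance of \<open>c\<close> at the next state when
  \<open>Km\<close> starts from \<open>w\<close>.\<close>

definition kvar :: "real^'s^'s \<Rightarrow> real^'s \<Rightarrow> real^'s" where
  "kvar Km c = (\<chi> w. (\<Sum>u\<in>UNIV. Km $ w $ u * (c $ u)^2) - ((Km *v c) $ w)^2)"

lemma kvar_centered:
  assumes "(\<Sum>u\<in>UNIV. Km $ w $ u) = 1"
  shows "kvar Km c $ w = (\<Sum>u\<in>UNIV. Km $ w $ u * (c $ u - (Km *v c) $ w)^2)"
proof -
  define m where "m = (Km *v c) $ w"
  have "(\<Sum>u\<in>UNIV. Km $ w $ u * (c $ u - m)^2) =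
    (\<Sum>u\<in>UNIV. Km $ w $ u * (c $ u)^2) - 2 * m * (\<Sum>u\<in>UNIV. Km $ w $ u * c $ u) + m^2 * (\<Sum>u\<in>UNIV. Km $ w $ u)"
    by (simp add: power2_eq_square algebra_simps sum.distrib sum_subtractf sum_distrib_left)
  also have "(\<Sum>u\<in>UNIV. Km $ w $ u * c $ u) = m" by (simp add: m_def matrix_vector_mult_def)
  finally show ?thesis using assms by (simp add: kvar_def m_def[symmetric] power2_eq_square)
qed

lemma K_nonneg:
  assumes "absorbed_chain P" "\<nu> \<in> prob_simplex" shows "0 \<le> K P \<nu> $ x $ y"
  using assms by (simp add: K_def absorbed_chain_def transition_matrix_def prob_simplex_def)

lemma K_row:
  assumes "absorbed_chain P" "\<nu> \<in> prob_simplex" shows "(\<Sum>y\<in>UNIV. K P \<nu> $ x $ y) = 1"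
proof -
  have "(\<Sum>y\<in>UNIV. P $ Some x $ y) = 1" using assms by (simp add: absorbed_chain_def transition_matrix_def)
  moreover have "(\<Sum>y\<in>UNIV. P $ Some x $ None * \<nu> $ y) = P $ Some x $ None"
    unfolding sum_distrib_left[symmetric] using assms(2) by (simp add: prob_simplex_def)
  ultimately show ?thesis unfolding sum_UNIV_option by (simp add: K_def sum.distrib)
qed

lemma axis_simplex: "axis x 1 \<in> prob_simplex"
  by (simp add: prob_simplex_def axis_def)

section \<open>The particle system, its filtration and its one-step conditional moments\<close>

locale particles = prob_space M
  for M :: "'w measure" and P :: "real ^ ('s::finite) option ^ 's option" and g :: real
    and N :: nat and x0 :: 's and X :: "nat \<Rightarrow> nat \<Rightarrow> 'w \<Rightarrow> 's" +
  assumes alg: "algorithm_I M P g N x0 X" and N: "0 < N" and g: "0 < g" and chain: "absorbed_chain P"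
begin

abbreviation "Fk \<equiv> particle_filtration M N X"
abbreviation "\<theta>k \<equiv> weighted_occupation g N x0 X"
definition "\<eta>k k \<omega> = (1 / real N) *\<^sub>R (\<Sum>i=1..N. axis (X i k \<omega>) (1::real))"

lemma X_measurable: "i \<in> {1..N} \<Longrightarrow> X i k \<in> measurable M (count_space UNIV)"
  using alg by (simp add: algorithm_I_def)

lemma sets_Fk_Suc: "sets (Fk (Suc k)) = sigma_sets (space M)
     (sets (Fk k) \<union> {X i (Suc k) -` A \<inter> space M | i A. i \<in> {1..N}})"
  and space_Fk: "space (Fk k) = space M"
proof -
  have 1: "space (Fk k) = space M" for k by (cases k) (simp_all add: space_measure_of_conv)
  then show "space (Fk k) = space M" .
  have "sets (Fk k) \<subseteq> Pow (space M)" using sets.space_closed[of "Fk k"] by (simp add: 1)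
  then show "sets (Fk (Suc k)) = sigma_sets (space M)
     (sets (Fk k) \<union> {X i (Suc k) -` A \<inter> space M | i A. i \<in> {1..N}})"
    by (simp add: sets_measure_of_conv) blast
qed

lemma subalgebra_Fk: "subalgebra M (Fk k)"
proof -
  have "sets (Fk k) \<subseteq> sets M"
  proof (induction k)
    case 0
    then show ?case by (simp add: sigma_sets_empty_eq)
  next
    case (Suc k)
    have "{X i (Suc k) -` A \<inter> space M | i A. i \<in> {1..N}} \<subseteq> sets M"
      using X_measurable by (auto intro: measurable_sets)
    then show ?case unfolding sets_Fk_Suc using Suc by (intro sets.sigma_sets_subset) auto
  qed
  then show ?thesis by (simp add: subalgebra_def space_Fk)
qed

lemma sets_Fk_mono: "sets (Fk k) \<subseteq> sets (Fk (Suc k))"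
  unfolding sets_Fk_Suc by (intro subsetI sigma_sets.Basic UnI1)

lemma measurable_Fk_Suc:
  assumes f: "f \<in> measurable (Fk k) L" shows "f \<in> measurable (Fk (Suc k)) L"
proof (rule measurableI)
  show "f x \<in> space L" if "x \<in> space (Fk (Suc k))" for x
    using measurable_space[OF f, of x] that unfolding space_Fk .
  show "f -` A \<inter> space (Fk (Suc k)) \<in> sets (Fk (Suc k))" if "A \<in> sets L" for A
    using measurable_sets[OF f that] sets_Fk_mono unfolding space_Fk by (rule subsetD[rotated])
qed

lemma measurable_Fk_M: "f \<in> measurable (Fk k) L \<Longrightarrow> f \<in> measurable M L"
  using measurable_from_subalg[OF subalgebra_Fk] by blast

lemma X_measurable_Fk: assumes i: "i \<in> {1..N}" shows "X i k \<in> measurable (Fk k) (count_space UNIV)"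
proof (cases k)
  case 0
  have "X i 0 \<omega> = x0" if "\<omega> \<in> space (Fk 0)" for \<omega>
    using alg i that space_Fk[of 0] by (simp add: algorithm_I_def)
  then show ?thesis unfolding 0 by (subst measurable_cong[where g = "\<lambda>_. x0"]) simp_all
next
  case (Suc j)
  show ?thesis unfolding Suc
  proof (rule measurableI)
    fix A :: "'s set"
    show "X i (Suc j) -` A \<inter> space (Fk (Suc j)) \<in> sets (Fk (Suc j))"
      unfolding space_Fk sets_Fk_Suc
      by (rule sigma_sets.Basic, rule UnI2, rule CollectI, rule exI[of _ i], rule exI[of _ A]) (use i in simp)
  qed simp
qed

lemma \<eta>k_measurable: "\<eta>k k \<in> borel_measurable (Fk k)"
proof -
  have "(\<lambda>\<omega>. axis (X i k \<omega>) (1::real)) \<in> borel_measurable (Fk k)" if "i \<in> {1..N}" for i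
    by (rule measurable_compose[OF X_measurable_Fk[OF that]]) simp
  then show ?thesis
    unfolding \<eta>k_def by (intro borel_measurable_scaleR borel_measurable_sum borel_measurable_const)
qed

lemma \<theta>k_Suc: "\<theta>k (Suc k) \<omega> = (1 - step_size g (Suc k)) *\<^sub>R \<theta>k k \<omega> + step_size g (Suc k) *\<^sub>R \<eta>k (Suc k) \<omega>"
  by (simp add: \<eta>k_def)

lemma \<theta>k_measurable: "\<theta>k k \<in> borel_measurable (Fk k)"
proof (induction k)
  case 0
  then show ?case by simp
next
  case (Suc k)
  show ?case unfolding \<theta>k_Suc
    by (intro borel_measurable_add borel_measurable_scaleR borel_measurable_const
        measurable_Fk_Suc[OF Suc] \<eta>k_measurable)
qed

lemma \<eta>k_simplex: "\<eta>k k \<omega> \<in> prob_simplex"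
proof -
  have "0 \<le> (\<Sum>i=1..N. axis (X i k \<omega>) (1::real)) $ x" for x
    unfolding sum_component by (intro sum_nonneg) (simp add: axis_def)
  moreover have "(\<Sum>i=1..N. axis (X i k \<omega>) (1::real)) \<bullet> 1 = real N"
    by (simp add: inner_sum_left simplex_inner_one[OF axis_simplex])
  then have "\<eta>k k \<omega> \<bullet> 1 = 1" using N by (simp add: \<eta>k_def)
  ultimately show ?thesis by (simp add: \<eta>k_def prob_simplex_def inner_one)
qed

lemma \<theta>k_simplex: "\<theta>k k \<omega> \<in> prob_simplex"
proof (induction k)
  case 0
  then show ?case by (simp add: axis_simplex)
next
  case (Suc k)
  show ?case unfolding \<theta>k_Suc
    by (rule convexD[OF convex_prob_simplex Suc \<eta>k_simplex]) (use step_size_bounds[OF g, of "Suc k"] in \<open>simp_all del: step_size.simps\<close>)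
qed

text \<open>Bridge from the almost sure specification of conditional probabilities to plain
  expectations: split over the finitely many configurations; for each of them the integrand is
  \<open>Fk k\<close>-measurable and moves out of the conditional expectation.\<close>

lemma one_step_expectation:
  assumes f: "\<And>y. f y \<in> borel_measurable (Fk k)" and B: "\<And>y \<omega>. \<bar>f y \<omega>\<bar> \<le> B"
  shows "expectation (\<lambda>\<omega>. f (\<lambda>i\<in>{1..N}. X i (Suc k) \<omega>) \<omega>) =
    expectation (\<lambda>\<omega>. \<Sum>y\<in>PiE {1..N} (\<lambda>_. UNIV). (\<Prod>i=1..N. K P (\<theta>k k \<omega>) $ X i k \<omega> $ y i) * f y \<omega>)"
proof -
  let ?Y = "PiE {1..N} (\<lambda>_. UNIV :: 's set)"
  define E where "E y = {\<omega> \<in> space M. \<forall>i\<in>{1..N}. X i (Suc k) \<omega> = y i}" for y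
  have E: "E y \<in> sets M" for y
  proof -
    have "E y = space M \<inter> (\<Inter>i\<in>{1..N}. X i (Suc k) -` {y i} \<inter> space M)"
      by (auto simp: E_def)
    also have "\<dots> \<in> sets M"
      by (intro sets.Int[OF sets.top] sets.finite_INT measurable_sets[OF X_measurable]) (use N in auto)
    finally show ?thesis .
  qed
  interpret F: finite_measure_subalgebra M "Fk k"
    by unfold_locales (rule subalgebra_Fk)
  have fM: "f y \<in> borel_measurable M" for y by (rule measurable_Fk_M[OF f])
  have int: "integrable M (\<lambda>\<omega>. f y \<omega> * indicator (E y) \<omega>)" for y
  proof (rule integrable_const_bound[of _ B])
    show "AE \<omega> in M. norm (f y \<omega> * indicator (E y) \<omega>) \<le> B"
      using B order_trans[OF abs_ge_zero B] by (auto simp: indicator_def)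
    show "(\<lambda>\<omega>. f y \<omega> * indicator (E y) \<omega>) \<in> borel_measurable M" using fM E by measurable
  qed
  have ind: "indicator (E y) \<in> borel_measurable M" for y using E by simp
  have "expectation (\<lambda>\<omega>. f (\<lambda>i\<in>{1..N}. X i (Suc k) \<omega>) \<omega>) =
     expectation (\<lambda>\<omega>. \<Sum>y\<in>?Y. f y \<omega> * indicator (E y) \<omega>)"
  proof (rule Bochner_Integration.integral_cong[OF refl])
    fix \<omega> assume w: "\<omega> \<in> space M"
    \<comment> \<open>Restriction to \<open>{1..N}\<close> selects one extensional function per
      outcome, so exactly one summand survives.\<close>
    have "indicator (E y) \<omega> = (if y = (\<lambda>i\<in>{1..N}. X i (Suc k) \<omega>) then 1 else 0 :: real)" if "y \<in> ?Y" for y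
    proof -
      have "\<omega> \<in> E y \<longleftrightarrow> y = (\<lambda>i\<in>{1..N}. X i (Suc k) \<omega>)"
        using w that by (auto simp: E_def fun_eq_iff PiE_def extensional_def)
      then show ?thesis by (simp add: indicator_def)
    qed
    then have "(\<Sum>y\<in>?Y. f y \<omega> * indicator (E y) \<omega>) =
      (\<Sum>y\<in>?Y. if y = (\<lambda>i\<in>{1..N}. X i (Suc k) \<omega>) then f y \<omega> else 0)"
      by (intro sum.cong) auto
    also have "\<dots> = f (\<lambda>i\<in>{1..N}. X i (Suc k) \<omega>) \<omega>"
      by (subst sum.delta) (auto intro: finite_PiE)
    finally show "f (\<lambda>i\<in>{1..N}. X i (Suc k) \<omega>) \<omega> = (\<Sum>y\<in>?Y. f y \<omega> * indicator (E y) \<omega>)" by simp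
  qed
  also have "\<dots> = (\<Sum>y\<in>?Y. expectation (\<lambda>\<omega>. f y \<omega> * indicator (E y) \<omega>))"
    using int by (rule Bochner_Integration.integral_sum)
  also have "\<dots> = (\<Sum>y\<in>?Y. expectation (\<lambda>\<omega>. f y \<omega> * real_cond_exp M (Fk k) (indicator (E y)) \<omega>))"
    by (intro sum.cong refl F.real_cond_exp_intg(2)[symmetric] int f ind)
  also have "\<dots> = expectation (\<lambda>\<omega>. \<Sum>y\<in>?Y. f y \<omega> * real_cond_exp M (Fk k) (indicator (E y)) \<omega>)"
    by (rule Bochner_Integration.integral_sum[symmetric]) (intro F.real_cond_exp_intg(1) int f ind)
  also have "\<dots> = expectation (\<lambda>\<omega>. \<Sum>y\<in>?Y. (\<Prod>i=1..N. K P (\<theta>k k \<omega>) $ X i k \<omega> $ y i) * f y \<omega>)"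
  proof (rule integral_cong_AE)
    have ae: "AE \<omega> in M. \<forall>y\<in>?Y. real_cond_exp M (Fk k) (indicator (E y)) \<omega>
        = (\<Prod>i=1..N. K P (\<theta>k k \<omega>) $ X i k \<omega> $ y i)"
    proof (subst AE_finite_all)
      show "finite ?Y" by (intro finite_PiE) auto
      show "\<forall>y\<in>?Y. AE \<omega> in M. real_cond_exp M (Fk k) (indicator (E y)) \<omega>
        = (\<Prod>i=1..N. K P (\<theta>k k \<omega>) $ X i k \<omega> $ y i)"
        using alg unfolding algorithm_I_def E_def by blast
    qed
    then show "AE \<omega> in M. (\<Sum>y\<in>?Y. f y \<omega> * real_cond_exp M (Fk k) (indicator (E y)) \<omega>) =
        (\<Sum>y\<in>?Y. (\<Prod>i=1..N. K P (\<theta>k k \<omega>) $ X i k \<omega> $ y i) * f y \<omega>)"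
      by eventually_elim (simp add: mult.commute)
    show "(\<lambda>\<omega>. \<Sum>y\<in>?Y. f y \<omega> * real_cond_exp M (Fk k) (indicator (E y)) \<omega>) \<in> borel_measurable M"
      using fM by measurable
    have th: "\<theta>k k \<in> borel_measurable M" by (rule measurable_Fk_M[OF \<theta>k_measurable])
    have "(\<lambda>\<omega>. K P (\<theta>k k \<omega>) $ X i k \<omega> $ z) \<in> borel_measurable M" if i: "i \<in> {1..N}" for i z
    proof (rule measurable_compose_countable[OF _ X_measurable[OF i]])
      show "(\<lambda>\<omega>. K P (\<theta>k k \<omega>) $ x $ z) \<in> borel_measurable M" for x
        unfolding K_def vec_lambda_beta
        by (intro borel_measurable_times borel_measurable_add borel_measurable_const vec_nth_measurable[OF th])
    qed
    then show "(\<lambda>\<omega>. \<Sum>y\<in>?Y. (\<Prod>i=1..N. K P (\<theta>k k \<omega>) $ X i k \<omega> $ y i) * f y \<omega>) \<in> borel_measurable M"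
      using fM by (intro borel_measurable_sum borel_measurable_times borel_measurable_prod) auto
  qed
  finally show ?thesis .
qed

text \<open>Fluctuation of the next empirical measure around its conditional mean.\<close>

definition "Dk k \<omega> = \<eta>k (Suc k) \<omega> - \<eta>k k \<omega> v* K P (\<theta>k k \<omega>)"

lemma inner_\<eta>k: "\<eta>k k \<omega> \<bullet> c = (1 / real N) * (\<Sum>i=1..N. c $ X i k \<omega>)"
  by (simp add: \<eta>k_def inner_sum_left inner_axis')

lemma inner_Dk: "Dk k \<omega> \<bullet> c = (1 / real N) * (\<Sum>i=1..N. c $ X i (Suc k) \<omega> - (K P (\<theta>k k \<omega>) *v c) $ X i k \<omega>)"
  by (simp add: Dk_def inner_diff_left dot_lmul_matrix inner_\<eta>k sum_subtractf right_diff_distrib)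

lemma K_mult_bound:
  assumes "\<And>x. \<bar>c $ x\<bar> \<le> B" shows "\<bar>(K P (\<theta>k k \<omega>) *v c) $ x\<bar> \<le> B"
proof -
  have "\<bar>(K P (\<theta>k k \<omega>) *v c) $ x\<bar> \<le> (\<Sum>y\<in>UNIV. K P (\<theta>k k \<omega>) $ x $ y * B)"
    unfolding matrix_vector_mult_def using K_nonneg[OF chain \<theta>k_simplex] assms
    by (auto intro!: order_trans[OF sum_abs] sum_mono mult_left_mono simp: abs_mult)
  also have "\<dots> = B" unfolding sum_distrib_right[symmetric] K_row[OF chain \<theta>k_simplex] by simp
  finally show ?thesis .
qed

context
  fixes k :: nat and Y :: "'w \<Rightarrow> real" and c :: "'w \<Rightarrow> real^'s" and BY Bc :: real
  assumes Y: "Y \<in> borel_measurable (Fk k)" "\<And>\<omega>. \<bar>Y \<omega>\<bar> \<le> BY"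
    and c: "c \<in> borel_measurable (Fk k)" "\<And>\<omega> x. \<bar>c \<omega> $ x\<bar> \<le> Bc"
begin

text \<open>The fluctuation with the next configuration \<open>y\<close> as a free argument, the
  form that \<open>one_step_expectation\<close> can take apart.\<close>

private definition "dev y \<omega> = (1 / real N) * (\<Sum>i=1..N. c \<omega> $ y i - (K P (\<theta>k k \<omega>) *v c \<omega>) $ X i k \<omega>)"

private lemma weights_factor: "(\<Sum>y\<in>T. w y * (a * (b * s y))) = a * (b * (\<Sum>y\<in>T. w y * s y))" for a b :: real
  unfolding sum_distrib_left by (intro sum.cong refl) (simp only: mult_ac)

private lemma dev_measurable: "dev y \<in> borel_measurable (Fk k)"
proof -
  have "(\<lambda>\<omega>. (K P (\<theta>k k \<omega>) *v c \<omega>) $ x) \<in> borel_measurable (Fk k)" for x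
    unfolding matrix_vector_mult_def K_def vec_lambda_beta
    by (intro borel_measurable_sum borel_measurable_times borel_measurable_add borel_measurable_const
        vec_nth_measurable[OF c(1)] vec_nth_measurable[OF \<theta>k_measurable])
  then have "(\<lambda>\<omega>. (K P (\<theta>k k \<omega>) *v c \<omega>) $ X i k \<omega>) \<in> borel_measurable (Fk k)" if "i \<in> {1..N}" for i
    by (rule measurable_compose_countable) (rule X_measurable_Fk[OF that])
  then show ?thesis unfolding dev_def using c(1)
    by (intro borel_measurable_times borel_measurable_sum borel_measurable_diff borel_measurable_const
        vec_nth_measurable)
qed

private lemma dev_bound: "\<bar>dev y \<omega>\<bar> \<le> 2 * Bc"
proof -
  have "\<bar>c \<omega> $ z - (K P (\<theta>k k \<omega>) *v c \<omega>) $ x\<bar> \<le> 2 * Bc" for z x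
    using c(2)[of \<omega> z] K_mult_bound[of "c \<omega>" Bc k \<omega> x, OF c(2)] by linarith
  then have "\<bar>\<Sum>i=1..N. c \<omega> $ y i - (K P (\<theta>k k \<omega>) *v c \<omega>) $ X i k \<omega>\<bar> \<le> (\<Sum>i=1..N. 2 * Bc)"
    by (intro order_trans[OF sum_abs] sum_mono)
  then show ?thesis using N by (simp add: dev_def abs_mult field_simps)
qed

private lemma Dk_dev: "Dk k \<omega> \<bullet> c \<omega> = dev (\<lambda>i\<in>{1..N}. X i (Suc k) \<omega>) \<omega>"
  unfolding inner_Dk dev_def by (intro arg_cong[where f = "\<lambda>x. (1 / real N) * x"] sum.cong) auto

private lemma centered: "(\<Sum>z\<in>UNIV. K P (\<theta>k k \<omega>) $ x $ z * (c \<omega> $ z - (K P (\<theta>k k \<omega>) *v c \<omega>) $ x)) = 0"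
proof -
  have "(\<Sum>z\<in>UNIV. K P (\<theta>k k \<omega>) $ x $ z * (c \<omega> $ z - (K P (\<theta>k k \<omega>) *v c \<omega>) $ x)) =
    (K P (\<theta>k k \<omega>) *v c \<omega>) $ x - (\<Sum>z\<in>UNIV. K P (\<theta>k k \<omega>) $ x $ z) * (K P (\<theta>k k \<omega>) *v c \<omega>) $ x"
    by (simp add: right_diff_distrib sum_subtractf sum_distrib_right[symmetric])
      (simp add: matrix_vector_mult_def)
  then show ?thesis by (simp add: K_row[OF chain \<theta>k_simplex])
qed

lemma expectation_Dk: "expectation (\<lambda>\<omega>. Y \<omega> * (Dk k \<omega> \<bullet> c \<omega>)) = 0"
proof -
  have BY0: "0 \<le> BY" using order_trans[OF abs_ge_zero Y(2)] .
  have "expectation (\<lambda>\<omega>. Y \<omega> * (Dk k \<omega> \<bullet> c \<omega>)) =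
    expectation (\<lambda>\<omega>. \<Sum>y\<in>PiE {1..N} (\<lambda>_. UNIV). (\<Prod>i=1..N. K P (\<theta>k k \<omega>) $ X i k \<omega> $ y i) * (Y \<omega> * dev y \<omega>))"
    unfolding Dk_dev
  proof (rule one_step_expectation[where B = "BY * (2 * Bc)"])
    show "(\<lambda>\<omega>. Y \<omega> * dev y \<omega>) \<in> borel_measurable (Fk k)" for y using Y(1) dev_measurable by measurable
    show "\<bar>Y \<omega> * dev y \<omega>\<bar> \<le> BY * (2 * Bc)" for y \<omega>
      unfolding abs_mult by (intro mult_mono Y(2) dev_bound BY0) simp
  qed
  also have "\<dots> = expectation (\<lambda>\<omega>. 0)"
  proof (rule Bochner_Integration.integral_cong[OF refl])
    fix \<omega>
    have "(\<Sum>y\<in>PiE {1..N} (\<lambda>_. UNIV). (\<Prod>i=1..N. K P (\<theta>k k \<omega>) $ X i k \<omega> $ y i) *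
       (\<Sum>i=1..N. c \<omega> $ y i - (K P (\<theta>k k \<omega>) *v c \<omega>) $ X i k \<omega>)) = 0"
      by (rule sum_PiE_centered(1)[where g = "\<lambda>i z. c \<omega> $ z - (K P (\<theta>k k \<omega>) *v c \<omega>) $ X i k \<omega>"
            and k = "\<lambda>i z. K P (\<theta>k k \<omega>) $ X i k \<omega> $ z"]) (simp_all add: K_row[OF chain \<theta>k_simplex] centered)
    then show "(\<Sum>y\<in>PiE {1..N} (\<lambda>_. UNIV). (\<Prod>i=1..N. K P (\<theta>k k \<omega>) $ X i k \<omega> $ y i) * (Y \<omega> * dev y \<omega>)) = 0"
      using weights_factor[of "\<lambda>y. \<Prod>i=1..N. K P (\<theta>k k \<omega>) $ X i k \<omega> $ y i" "Y \<omega>" "1 / real N"]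
      unfolding dev_def by simp
  qed
  finally show ?thesis by simp
qed

text \<open>Given the past the particles move independently, so the variance of their average is
  \<open>1 / N\<close> times the average of the single variances.\<close>

lemma expectation_Dk_square: "expectation (\<lambda>\<omega>. Y \<omega> * (Dk k \<omega> \<bullet> c \<omega>)^2) =
   expectation (\<lambda>\<omega>. Y \<omega> * ((1 / real N) * (\<eta>k k \<omega> \<bullet> kvar (K P (\<theta>k k \<omega>)) (c \<omega>))))"
proof -
  have BY0: "0 \<le> BY" using order_trans[OF abs_ge_zero Y(2)] .
  have "expectation (\<lambda>\<omega>. Y \<omega> * (Dk k \<omega> \<bullet> c \<omega>)^2) =
    expectation (\<lambda>\<omega>. \<Sum>y\<in>PiE {1..N} (\<lambda>_. UNIV). (\<Prod>i=1..N. K P (\<theta>k k \<omega>) $ X i k \<omega> $ y i) * (Y \<omega> * (dev y \<omega>)^2))"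
    unfolding Dk_dev
  proof (rule one_step_expectation[where B = "BY * (2 * Bc)^2"])
    show "(\<lambda>\<omega>. Y \<omega> * (dev y \<omega>)^2) \<in> borel_measurable (Fk k)" for y using Y(1) dev_measurable by measurable
    show "\<bar>Y \<omega> * (dev y \<omega>)^2\<bar> \<le> BY * (2 * Bc)^2" for y \<omega>
    proof -
      have "\<bar>dev y \<omega>\<bar>^2 \<le> (2 * Bc)^2" by (intro power_mono dev_bound) simp
      then show ?thesis unfolding abs_mult by (intro mult_mono Y(2) BY0) auto
    qed
  qed
  also have "\<dots> = expectation (\<lambda>\<omega>. Y \<omega> * ((1 / real N) * (\<eta>k k \<omega> \<bullet> kvar (K P (\<theta>k k \<omega>)) (c \<omega>))))"
  proof (rule Bochner_Integration.integral_cong[OF refl])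
    fix \<omega>
    have "(\<Sum>y\<in>PiE {1..N} (\<lambda>_. UNIV). (\<Prod>i=1..N. K P (\<theta>k k \<omega>) $ X i k \<omega> $ y i) *
       (\<Sum>i=1..N. c \<omega> $ y i - (K P (\<theta>k k \<omega>) *v c \<omega>) $ X i k \<omega>)^2) =
       (\<Sum>i=1..N. \<Sum>z\<in>UNIV. K P (\<theta>k k \<omega>) $ X i k \<omega> $ z * (c \<omega> $ z - (K P (\<theta>k k \<omega>) *v c \<omega>) $ X i k \<omega>)^2)"
      by (rule sum_PiE_centered(2)[where g = "\<lambda>i z. c \<omega> $ z - (K P (\<theta>k k \<omega>) *v c \<omega>) $ X i k \<omega>"
            and k = "\<lambda>i z. K P (\<theta>k k \<omega>) $ X i k \<omega> $ z"]) (simp_all add: K_row[OF chain \<theta>k_simplex] centered)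
    also have "\<dots> = real N * (\<eta>k k \<omega> \<bullet> kvar (K P (\<theta>k k \<omega>)) (c \<omega>))"
      unfolding inner_\<eta>k using N by (simp add: kvar_centered K_row[OF chain \<theta>k_simplex])
    finally show "(\<Sum>y\<in>PiE {1..N} (\<lambda>_. UNIV). (\<Prod>i=1..N. K P (\<theta>k k \<omega>) $ X i k \<omega> $ y i) * (Y \<omega> * (dev y \<omega>)^2)) =
       Y \<omega> * ((1 / real N) * (\<eta>k k \<omega> \<bullet> kvar (K P (\<theta>k k \<omega>)) (c \<omega>)))"
      using weights_factor[of "\<lambda>y. \<Prod>i=1..N. K P (\<theta>k k \<omega>) $ X i k \<omega> $ y i" "Y \<omega>" "(1 / real N)^2"] N
      unfolding dev_def power_mult_distrib by (simp add: power2_eq_square)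
  qed
  finally show ?thesis .
qed

end

end

section \<open>The Lyapunov equation\<close>

declare step_size.simps [simp del]

text \<open>Euler discretization of \<open>hurwitz_form\<close>. That lemma is applied with an
  intermediate rate \<open>M\<close>, whose excess over \<open>L'\<close> absorbs the second-order
  term of the step.\<close>

lemma hurwitz_contraction:
  fixes J :: "real^'n^'n"
  assumes ev: "\<And>z v. v \<noteq> 0 \<Longrightarrow> cmat J *v v = z *s v \<Longrightarrow> Re z \<le> - L" and "L' < L"
  obtains S :: "real^'n^'n" and g0 :: real where "transpose S = S" "\<And>x. x \<bullet> x \<le> x \<bullet> (S *v x)" "g0 > 0"
    "\<And>g x. 0 \<le> g \<Longrightarrow> g \<le> g0 \<Longrightarrow>
       (x + g *\<^sub>R (J *v x)) \<bullet> (S *v (x + g *\<^sub>R (J *v x))) \<le> (1 - g * L')^2 * (x \<bullet> (S *v x))"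
proof -
  define M where "M = (L + L') / 2"
  have M: "L' < M" "M < L" using assms(2) by (simp_all add: M_def)
  obtain S :: "real^'n^'n" where S: "transpose S = S" "\<And>x. x \<bullet> x \<le> x \<bullet> (S *v x)"
    "\<And>x. x \<bullet> (S *v (J *v x)) \<le> - M * (x \<bullet> (S *v x))"
    by (rule hurwitz_form[where J = J, OF _ M(2)], rule ev, assumption, assumption, blast)
  obtain B where B: "0 < B" "\<And>x. norm (S *v x) \<le> norm x * B"
    using bounded_linear.pos_bounded[OF matrix_vector_mul_bounded_linear[of S]] by auto
  obtain C where C: "0 < C" "\<And>x. norm (J *v x) \<le> norm x * C"
    using bounded_linear.pos_bounded[OF matrix_vector_mul_bounded_linear[of J]] by auto
  define D where "D = C^2 * B"
  have D: "0 < D" using B C by (simp add: D_def)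
  have q: "(J *v x) \<bullet> (S *v (J *v x)) \<le> D * (x \<bullet> (S *v x))" for x
  proof -
    have "(J *v x) \<bullet> (S *v (J *v x)) \<le> norm (J *v x) * norm (S *v (J *v x))" by (rule norm_cauchy_schwarz)
    also have "\<dots> \<le> norm (J *v x) * (norm (J *v x) * B)" by (intro mult_left_mono B) simp
    also have "\<dots> = (norm (J *v x))^2 * B" by (simp add: power2_eq_square)
    also have "\<dots> \<le> (norm x * C)^2 * B" using B C by (intro mult_right_mono power_mono) auto
    also have "\<dots> = D * (x \<bullet> x)" by (simp add: D_def power_mult_distrib dot_square_norm)
    also have "\<dots> \<le> D * (x \<bullet> (S *v x))" using D S(2) by (intro mult_left_mono) auto
    finally show ?thesis .
  qed
  show ?thesis
  \<comment> \<open>Largest \<open>g\<close> for which \<open>g^2 * D\<close> is covered by the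
    first-order gain \<open>2 * g * (M - L')\<close>.\<close>
  proof (rule that[of S "2 * (M - L') / D"])
    show "transpose S = S" "\<And>x. x \<bullet> x \<le> x \<bullet> (S *v x)" by (fact S)+
    show "0 < 2 * (M - L') / D" using M D by simp
    fix g :: real and x :: "real^'n" assume g: "0 \<le> g" "g \<le> 2 * (M - L') / D"
    define s where "s = x \<bullet> (S *v x)"
    have s0: "0 \<le> s" using order_trans[OF inner_ge_zero S(2)] by (simp add: s_def)
    have "(x + g *\<^sub>R (J *v x)) \<bullet> (S *v (x + g *\<^sub>R (J *v x))) =
      s + 2 * g * (x \<bullet> (S *v (J *v x))) + g^2 * ((J *v x) \<bullet> (S *v (J *v x)))"
      unfolding s_def using symmetric_matrix_swap[OF S(1), of "J *v x" x]
      by (simp add: matrix_vector_right_distrib matrix_vector_mult_scaleR inner_add_left inner_add_right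
          power2_eq_square algebra_simps)
    also have "\<dots> \<le> s + 2 * g * (- M * s) + g^2 * (D * s)"
      using g S(3)[of x] q[of x] unfolding s_def by (intro add_mono mult_left_mono) auto
    also have "\<dots> = (1 - 2 * g * M + g * (g * D)) * s" by (simp add: power2_eq_square algebra_simps)
    also have "\<dots> \<le> (1 - g * L')^2 * s"
    proof (rule mult_right_mono[OF _ s0])
      have "g * D \<le> 2 * (M - L')" using g(2) D by (simp add: field_simps)
      then have "g * (g * D) \<le> g * (2 * (M - L'))" by (rule mult_left_mono) (rule g)
      then have h: "g * (g * D) \<le> 2 * g * M - 2 * g * L'" by (simp add: algebra_simps)
      have sq: "0 \<le> g^2 * L'^2" by simp
      have e: "(1 - g * L')^2 = 1 - 2 * g * L' + g^2 * L'^2" by (simp add: power2_eq_square algebra_simps)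
      show "1 - 2 * g * M + g * (g * D) \<le> (1 - g * L')^2" unfolding e using h sq by linarith
    qed
    finally show "(x + g *\<^sub>R (J *v x)) \<bullet> (S *v (x + g *\<^sub>R (J *v x))) \<le> (1 - g * L')^2 * (x \<bullet> (S *v x))"
      by (simp add: s_def)
  qed
qed

context qsd_chain
begin

lemma F_mat_entry: "F_mat P \<theta> z $ x $ y = (\<Sum>u\<in>UNIV. Kt $ z $ u * (Rt $ u $ x * Rt $ u $ y)) - (Kt ** Rt) $ z $ x * (Kt ** Rt) $ z $ y"
  by (simp add: F_mat_def Q_eq mult.assoc)

text \<open>Ties the covariance of the theorem to the noise of the algorithm, whose one-step
  variance is a \<open>kvar\<close>; the identification of \<open>Q\<close> with \<open>Rt\<close>
  enters through \<open>F_mat_entry\<close>.\<close>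

lemma F_mat_quadratic: "u \<bullet> (F_mat P \<theta> z *v u) = kvar Kt (Rt *v u) $ z"
proof -
  have sq: "(\<Sum>x\<in>UNIV. \<Sum>y\<in>UNIV. u $ x * u $ y * (c x * c y)) = (\<Sum>x\<in>UNIV. c x * u $ x)^2" for c :: "'s \<Rightarrow> real"
    unfolding power2_eq_square sum_product by (intro sum.cong refl) (simp only: mult_ac)
  have "u \<bullet> (F_mat P \<theta> z *v u) = (\<Sum>x\<in>UNIV. \<Sum>y\<in>UNIV. u $ x * u $ y * F_mat P \<theta> z $ x $ y)"
    by (simp add: inner_vec_def matrix_vector_mult_def sum_distrib_left mult_ac)
  also have "\<dots> = (\<Sum>x\<in>UNIV. \<Sum>y\<in>UNIV. \<Sum>w\<in>UNIV. Kt $ z $ w * (u $ x * u $ y * (Rt $ w $ x * Rt $ w $ y)))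
     - (\<Sum>x\<in>UNIV. \<Sum>y\<in>UNIV. u $ x * u $ y * ((Kt ** Rt) $ z $ x * (Kt ** Rt) $ z $ y))"
    unfolding F_mat_entry right_diff_distrib sum_subtractf sum_distrib_left
    by (intro arg_cong2[where f = "(-)"] sum.cong refl) (simp only: mult_ac)
  also have "(\<Sum>x\<in>UNIV. \<Sum>y\<in>UNIV. \<Sum>w\<in>UNIV. Kt $ z $ w * (u $ x * u $ y * (Rt $ w $ x * Rt $ w $ y)))
     = (\<Sum>w\<in>UNIV. Kt $ z $ w * ((Rt *v u) $ w)^2)"
  proof -
    have "(\<Sum>x\<in>UNIV. \<Sum>y\<in>UNIV. \<Sum>w\<in>UNIV. Kt $ z $ w * (u $ x * u $ y * (Rt $ w $ x * Rt $ w $ y)))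
      = (\<Sum>x\<in>UNIV. \<Sum>w\<in>UNIV. \<Sum>y\<in>UNIV. Kt $ z $ w * (u $ x * u $ y * (Rt $ w $ x * Rt $ w $ y)))"
      by (intro sum.cong refl sum.swap)
    also have "\<dots> = (\<Sum>w\<in>UNIV. \<Sum>x\<in>UNIV. \<Sum>y\<in>UNIV. Kt $ z $ w * (u $ x * u $ y * (Rt $ w $ x * Rt $ w $ y)))"
      by (rule sum.swap)
    also have "\<dots> = (\<Sum>w\<in>UNIV. Kt $ z $ w * ((Rt *v u) $ w)^2)"
      unfolding sum_distrib_left[symmetric] sq by (simp add: matrix_vector_mult_def)
    finally show ?thesis .
  qed
  also have "(\<Sum>x\<in>UNIV. \<Sum>y\<in>UNIV. u $ x * u $ y * ((Kt ** Rt) $ z $ x * (Kt ** Rt) $ z $ y)) = ((Kt *v (Rt *v u)) $ z)^2"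
    unfolding sq matrix_vector_mul_assoc by (simp add: matrix_vector_mult_def)
  finally show ?thesis by (simp add: kvar_def)
qed

lemma U_star_quadratic: "u \<bullet> (U_star P \<theta> *v u) = \<theta> \<bullet> kvar Kt (Rt *v u)"
proof -
  have "U_star P \<theta> *v u = (\<Sum>w\<in>UNIV. \<theta> $ w *\<^sub>R (F_mat P \<theta> w *v u))"
    unfolding U_star_def vec_eq_iff matrix_vector_mult_def
    by (simp add: sum_distrib_left sum_distrib_right mult.assoc) (auto intro: sum.swap)
  then show ?thesis by (simp add: inner_sum_right F_mat_quadratic) (simp add: inner_vec_def)
qed

lemma U_star_symmetric: "transpose (U_star P \<theta>) = U_star P \<theta>"
proof -
  have "F_mat P \<theta> w $ x $ y = F_mat P \<theta> w $ y $ x" for w x y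
    unfolding F_mat_entry by (simp add: mult.commute)
  then show ?thesis by (simp add: U_star_def vec_eq_iff transpose_def)
qed

text \<open>The rows of \<open>Rt\<close> sum to zero, so the limiting noise lives on the tangent
  space; this is what forces solutions of the Lyapunov equation to be tangent.\<close>

lemma U_star_one: "U_star P \<theta> *v 1 = 0"
proof -
  have R1: "Rt *v 1 = 0" by (simp add: Rt_mult \<theta>_one g1_def)
  have R1': "(\<Sum>y\<in>UNIV. Rt $ u $ y) = 0" for u
    using arg_cong[OF R1, of "\<lambda>v. v $ u"] by (simp add: matrix_vector_mult_def)
  have K1': "(\<Sum>y\<in>UNIV. (Kt ** Rt) $ u $ y) = 0" for u
  proof -
    have "(Kt ** Rt) *v 1 = 0" using R1 by (simp add: matrix_vector_mul_assoc[symmetric])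
    from arg_cong[OF this, of "\<lambda>v. v $ u"] show ?thesis by (simp add: matrix_vector_mult_def)
  qed
  have "(\<Sum>y\<in>UNIV. F_mat P \<theta> w $ x $ y) = 0" for w x
  proof -
    have "(\<Sum>y\<in>UNIV. \<Sum>u\<in>UNIV. Kt $ w $ u * (Rt $ u $ x * Rt $ u $ y)) = (\<Sum>u\<in>UNIV. Kt $ w $ u * (Rt $ u $ x * (\<Sum>y\<in>UNIV. Rt $ u $ y)))"
      unfolding sum_distrib_left by (rule sum.swap)
    then show ?thesis unfolding F_mat_entry sum_subtractf by (simp add: R1' sum_distrib_left[symmetric] K1')
  qed
  then have "(\<Sum>y\<in>UNIV. U_star P \<theta> $ x $ y) = 0" for x
    unfolding U_star_def by (simp, subst sum.swap, simp add: sum_distrib_left[symmetric])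
  then show ?thesis by (simp add: vec_eq_iff matrix_vector_mult_def)
qed

end

section \<open>A Hurwitz matrix on the whole space and the Lyapunov operator\<close>

locale clt_chain = qsd_chain P \<theta> for P :: "real ^ ('s::finite) option ^ 's option" and \<theta> +
  fixes L \<gamma> :: real
  assumes L: "L > 0" and eig: "\<And>z. tangent_eigenvalue (grad_h P \<theta>) z \<Longrightarrow> Re z \<le> - L"
    and \<gamma>: "\<gamma> > 0" "\<gamma> > 1 / L"
begin

text \<open>The choice \<open>\<kappa> = L\<close> puts the transversal eigenvalue at
  \<open>- (1 + L)\<close>, beyond the spectral bound \<open>- L\<close>.\<close>

definition J :: "real^'s^'s" where "J = matrix (Jop L)"

lemma J_mult: "J *v y = Jop L y"
  unfolding J_def using fun_cong[OF matrix_vector_mul(2)[OF linear_Jop]] .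

lemma J_one: "(J *v y) \<bullet> 1 = - (1 + L) * (y \<bullet> 1)"
  by (simp only: J_mult Jop_one)

text \<open>The coordinate sum is a left eigenvector of \<open>J\<close>: an eigenvector with
  nonzero sum has eigenvalue \<open>- (1 + L)\<close>, and any other is tangent and falls under the
  hypothesis on \<open>grad_h\<close>.\<close>

lemma J_eigenvalue:
  assumes v: "v \<noteq> 0" "cmat J *v v = z *s v" shows "Re z \<le> - L"
proof -
  define vr where "vr = (\<chi> j. Re (v $ j))"
  define vi where "vi = (\<chi> j. Im (v $ j))"
  have c: "(cmat J *v v) $ i = Complex ((J *v vr) $ i) ((J *v vi) $ i)" for i
    by (simp add: complex_eq_iff matrix_vector_mult_def cmat_def vr_def vi_def)
  have "(\<Sum>i\<in>UNIV. (cmat J *v v) $ i) = Complex ((J *v vr) \<bullet> 1) ((J *v vi) \<bullet> 1)"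
    unfolding c by (simp add: complex_eq_iff inner_one)
  also have "\<dots> = - (1 + of_real L) * (\<Sum>i\<in>UNIV. v $ i)"
    unfolding J_one by (simp add: complex_eq_iff inner_one vr_def vi_def)
  finally have s: "z * (\<Sum>i\<in>UNIV. v $ i) = - (1 + of_real L) * (\<Sum>i\<in>UNIV. v $ i)"
    unfolding v(2) by (simp add: sum_distrib_left)
  show ?thesis
  proof (cases "(\<Sum>i\<in>UNIV. v $ i) = 0")
    case False
    then have "z = - (1 + of_real L)" using s by (simp only: mult_right_cancel[OF False])
    then show ?thesis by simp
  next
    case True
    have "vr \<bullet> 1 = 0" "vi \<bullet> 1 = 0"
      using arg_cong[OF True, of Re] arg_cong[OF True, of Im] by (simp_all add: inner_one vr_def vi_def)
    then have "grad_h P \<theta> vr = J *v vr" "grad_h P \<theta> vi = J *v vi"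
      by (simp_all add: J_mult grad_h_eq)
    then have "tangent_eigenvalue (grad_h P \<theta>) z"
      unfolding tangent_eigenvalue_def using v True c
      by (intro exI[of _ v]) (simp flip: vr_def vi_def)
    then show ?thesis by (rule eig)
  qed
qed

definition lyap_op :: "real^'s^'s \<Rightarrow> real^'s^'s" where
  "lyap_op V = J ** V + transpose (J ** V) + (1 / \<gamma>) *\<^sub>R V"

text \<open>Applied to the vector 1, the equation would make a nonzero \<open>V *v 1\<close> an
  eigenvector of \<open>J\<close> for \<open>1 + L - 1 / \<gamma>\<close>, which is positive and
  hence no eigenvalue.\<close>

lemma columns_tangent:
  assumes V: "transpose V = V" and eq: "U_star P \<theta> + lyap_op V = 0"
  shows "V *v 1 = 0"
proof (rule ccontr)
  assume c: "V *v 1 \<noteq> 0"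
  define c where "c = V *v 1"
  have J1: "1 v* J = (- (1 + L)) *\<^sub>R (1 :: real^'s)"
  proof -
    have "(1 v* J) \<bullet> y = ((- (1 + L)) *\<^sub>R 1) \<bullet> y" for y
      unfolding dot_lmul_matrix using J_one[of y] by (simp add: inner_commute)
    then show ?thesis by (metis vector_eq_rdot)
  qed
  have "transpose (J ** V) *v 1 = V *v (transpose J *v 1)"
    by (simp only: matrix_transpose_mul V matrix_vector_mul_assoc)
  also have "transpose J *v 1 = (- (1 + L)) *\<^sub>R 1" unfolding transpose_matrix_vector by (rule J1)
  finally have t: "transpose (J ** V) *v 1 = (- (1 + L)) *\<^sub>R c"
    by (simp only: matrix_vector_mult_scaleR c_def)
  have "(U_star P \<theta> + lyap_op V) *v 1 = 0" unfolding eq by simp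
  then have "J *v c + (- (1 + L)) *\<^sub>R c + (1 / \<gamma>) *\<^sub>R c = 0"
    unfolding lyap_op_def matrix_vector_mult_add_rdistrib U_star_one t scaleR_matrix_vector_assoc[symmetric]
    by (simp add: c_def matrix_vector_mul_assoc)
  then have Jc: "J *v c = (1 + L - 1 / \<gamma>) *\<^sub>R c" by (simp add: algebra_simps)
  define v where "v = (\<chi> i. complex_of_real (c $ i))"
  have "cmat J *v v = complex_of_real (1 + L - 1 / \<gamma>) *s v"
  proof -
    have "(cmat J *v v) $ i = complex_of_real ((J *v c) $ i)" for i
      by (simp add: matrix_vector_mult_def cmat_def v_def)
    then show ?thesis unfolding Jc by (simp add: vec_eq_iff v_def algebra_simps)
  qed
  moreover have "v \<noteq> 0" using c by (simp add: v_def c_def vec_eq_iff)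
  ultimately have "Re (complex_of_real (1 + L - 1 / \<gamma>)) \<le> - L" using J_eigenvalue by blast
  then have "1 + 2 * L \<le> 1 / \<gamma>" by simp
  moreover have "1 / \<gamma> < L" using \<gamma> L by (simp add: field_simps)
  ultimately show False using L by simp
qed

text \<open>Replaces the derivative by the matrix \<open>J\<close> and turns tangency of the columns
  from a requirement into a consequence, so that existence becomes linear algebra on the symmetric
  matrices.\<close>

lemma lyapunov_solution_iff:
  "lyapunov_solution P \<theta> \<gamma> V \<longleftrightarrow> transpose V = V \<and> U_star P \<theta> + lyap_op V = 0"
proof -
  have cw: "columnwise (grad_h P \<theta>) V = J ** V" if "\<forall>j. column j V \<in> tangent_space"
  proof -
    have "grad_h P \<theta> (column j V) = J *v column j V" for j
      using that grad_h_eq[of "column j V"] by (simp add: tangent_space_def inner_one J_mult)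
    then show ?thesis
      by (simp add: columnwise_def vec_eq_iff matrix_matrix_mult_def matrix_vector_mult_def column_def)
  qed
  have tan: "\<forall>j. column j V \<in> tangent_space" if "transpose V = V" "U_star P \<theta> + lyap_op V = 0"
  proof
    fix j
    have "(V *v 1) $ j = 0" using columns_tangent[OF that] by simp
    then have "(\<Sum>i\<in>UNIV. V $ j $ i) = 0" by (simp add: matrix_vector_mult_def)
    moreover have "V $ j $ i = V $ i $ j" for i using arg_cong[OF that(1), of "\<lambda>M. M $ i $ j"] by (simp add: transpose_def)
    ultimately show "column j V \<in> tangent_space" by (simp add: tangent_space_def column_def)
  qed
  show ?thesis
    using cw tan unfolding lyapunov_solution_def lyap_op_def by (auto simp: add.assoc)
qed

lemma linear_lyap_op: "linear lyap_op"
  by (rule linearI)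
    (simp_all add: lyap_op_def vec_eq_iff matrix_matrix_mult_def transpose_def algebra_simps
      sum.distrib sum_distrib_left)

text \<open>Injectivity on the finite-dimensional space of symmetric matrices gives surjectivity.
  The premise is supplied by \<open>lyapunov_unique\<close>, from the long-time behaviour of the
  backward recursion.\<close>

lemma lyapunov_existence:
  assumes uniq: "\<And>V. transpose V = V \<Longrightarrow> lyap_op V = 0 \<Longrightarrow> V = 0"
  shows "\<exists>!V. lyapunov_solution P \<theta> \<gamma> V"
proof -
  let ?S = "{V :: real^'s^'s. transpose V = V}"
  have S: "subspace ?S" by (auto simp: subspace_def transpose_def vec_eq_iff)
  have img: "lyap_op ` ?S \<subseteq> ?S"
    by (auto simp: lyap_op_def transpose_def vec_eq_iff add.commute)
  have inj: "inj_on lyap_op ?S"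
  proof (rule inj_onI)
    fix V W assume VW: "V \<in> ?S" "W \<in> ?S" "lyap_op V = lyap_op W"
    have "lyap_op (V - W) = 0" using VW(3) by (simp add: linear_diff[OF linear_lyap_op])
    moreover have "transpose (V - W) = V - W" using subspace_diff[OF S VW(1,2)] by simp
    ultimately show "V = W" using uniq[of "V - W"] by simp
  qed
  have "dim (lyap_op ` ?S) = dim ?S"
    by (rule dim_image_eq[OF linear_lyap_op]) (use inj S in \<open>simp add: span_eq_iff[THEN iffD2]\<close>)
  then have "lyap_op ` ?S = ?S"
    using subspace_dim_equal[OF linear_subspace_image[OF linear_lyap_op S] S img] by simp
  moreover have "- U_star P \<theta> \<in> ?S" using U_star_symmetric by (simp add: transpose_def vec_eq_iff)
  ultimately obtain V where V: "V \<in> ?S" "lyap_op V = - U_star P \<theta>" by (metis (no_types, lifting) imageE)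
  show ?thesis
  proof (rule ex1I[of _ V])
    show "lyapunov_solution P \<theta> \<gamma> V" using V by (simp add: lyapunov_solution_iff)
    fix W assume "lyapunov_solution P \<theta> \<gamma> W"
    then have W: "W \<in> ?S" "U_star P \<theta> + lyap_op W = 0" by (auto simp: lyapunov_solution_iff)
    then have "lyap_op W = lyap_op V" using V(2) by (simp add: add_eq_0_iff)
    then show "W = V" using inj_onD[OF inj _ W(1) V(1)] by blast
  qed
qed

end

section \<open>Step sizes and the normalized mean-field map\<close>

context clt_chain
begin

abbreviation "gk \<equiv> step_size \<gamma>"
text \<open>Clock in which \<open>gk k\<close> is \<open>\<gamma> / tm k\<close> for positive
  \<open>k\<close>. The shift is \<open>\<lfloor>\<gamma>\<rfloor>\<close> and not one more, because
  the index of \<open>gk\<close> is already advanced by one.\<close>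

definition "tm k = real k + real_of_int \<lfloor>\<gamma>\<rfloor>"

lemma tm_Suc: "tm (Suc k) = tm k + 1" by (simp add: tm_def)
lemma tm_ge: "real k \<le> tm k" using \<gamma> by (simp add: tm_def)
lemma tm_pos: "1 \<le> k \<Longrightarrow> 0 < tm k" using tm_ge[of k] by simp
lemma tm_ge_1: "1 \<le> k \<Longrightarrow> 1 \<le> tm k" using tm_ge[of k] by simp

lemma gk_eq: "1 \<le> k \<Longrightarrow> gk k = \<gamma> / tm k"
  by (cases k) (simp_all add: tm_def step_size.simps algebra_simps)

lemma gk_nonneg: "0 \<le> gk k" and gk_le_1: "gk k \<le> 1"
  using step_size_bounds[OF \<gamma>(1)] by auto

lemma gk_pos: "1 \<le> k \<Longrightarrow> 0 < gk k" using tm_pos \<gamma> by (simp add: gk_eq)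

lemma gk_half: "1 \<le> k \<Longrightarrow> gk k \<le> 2 * gk (Suc k)"
proof -
  assume k: "1 \<le> k"
  have "\<gamma> / tm k \<le> 2 * (\<gamma> / (tm k + 1))"
  proof -
    have "2 * \<gamma> / (2 * tm k) \<le> 2 * \<gamma> / (tm k + 1)"
      using tm_ge_1[OF k] \<gamma> by (intro divide_left_mono) auto
    then show ?thesis by simp
  qed
  then show ?thesis using k by (simp add: gk_eq tm_Suc)
qed

text \<open>Origin of the term \<open>V / \<gamma>\<close> in the Lyapunov equation: quantities
  normalized by the current step size change at this relative rate.\<close>

lemma gk_diff: "1 \<le> k \<Longrightarrow> gk k - gk (Suc k) = gk k * gk (Suc k) / \<gamma>"
proof -
  assume k: "1 \<le> k"
  have t: "tm k \<noteq> 0" "tm k + 1 \<noteq> 0" using tm_pos[OF k] by auto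
  have "\<gamma> / tm k - \<gamma> / (tm k + 1) = (\<gamma> * (tm k + 1) - \<gamma> * tm k) / (tm k * (tm k + 1))"
    using t by (rule diff_frac_eq)
  also have "\<gamma> * (tm k + 1) - \<gamma> * tm k = \<gamma>" by (simp add: algebra_simps)
  finally show ?thesis using \<gamma> k by (simp add: gk_eq tm_Suc)
qed

lemma tm_at_top: "filterlim tm at_top sequentially"
  by (rule filterlim_at_top_mono[OF filterlim_real_sequentially]) (simp add: tm_ge)

lemma gk_tendsto: "gk \<longlonglongrightarrow> 0"
proof -
  have "(\<lambda>k. \<gamma> / tm k) \<longlonglongrightarrow> 0" by (rule tendsto_divide_0[OF tendsto_const filterlim_at_top_imp_at_infinity[OF tm_at_top]])
  moreover have "\<forall>\<^sub>F k in sequentially. \<gamma> / tm k = gk k"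
    using eventually_ge_at_top[of 1] by eventually_elim (simp add: gk_eq)
  ultimately show ?thesis by (rule Lim_transform_eventually)
qed

lemma gk_eventually_small: "e > 0 \<Longrightarrow> \<exists>k0\<ge>m. \<forall>k\<ge>k0. gk k \<le> e"
proof -
  assume e: "e > 0"
  from LIMSEQ_D[OF gk_tendsto e] obtain k0 where "\<forall>k\<ge>k0. norm (gk k - 0) < e" by blast
  then have "\<forall>k\<ge>max m k0. gk k \<le> e" by force
  then show ?thesis by (intro exI[of _ "max m k0"]) auto
qed

text \<open>\<open>H / tm k\<close> is a supersolution because p > 1: the homogeneous part would
  decay like the power -p of time, faster than the bound, so the source dictates the rate and
  \<open>H\<close> has to beat \<open>c / (p - 1)\<close>.\<close>

lemma recursion_bound:
  fixes a :: "nat \<Rightarrow> real"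
  assumes k0: "1 \<le> k0" and p: "p > 1" and H: "0 \<le> H" "c \<le> (p - 1) * H" "a k0 \<le> H / tm k0"
    and small: "\<And>k. k0 \<le> k \<Longrightarrow> k < n \<Longrightarrow> p \<le> tm (Suc k)"
    and rec: "\<And>k. k0 \<le> k \<Longrightarrow> k < n \<Longrightarrow> a (Suc k) \<le> (1 - p / tm (Suc k)) * a k + c / (tm (Suc k))^2"
    and k: "k0 \<le> k" "k \<le> n"
  shows "a k \<le> H / tm k"
  using k
proof (induction k rule: dec_induct)
  case base
  then show ?case using H by simp
next
  case (step k)
  define t where "t = tm k"
  have t: "0 < t" using tm_pos[of k] k0 step by (simp add: t_def)
  have k: "k0 \<le> k" "k < n" using step by auto
  have nn: "0 \<le> 1 - p / (t + 1)" using small[OF k] t by (simp add: tm_Suc t_def[symmetric])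
  have "a (Suc k) \<le> (1 - p / (t + 1)) * a k + c / (t + 1)^2"
    using rec[OF k] by (simp add: tm_Suc t_def)
  also have "\<dots> \<le> (1 - p / (t + 1)) * (H / t) + (p - 1) * H / (t * (t + 1))"
  proof (rule add_mono)
    show "(1 - p / (t + 1)) * a k \<le> (1 - p / (t + 1)) * (H / t)"
      using step nn by (intro mult_left_mono) (auto simp: t_def)
    have "c / (t + 1)^2 \<le> (p - 1) * H / (t + 1)^2" using H(2) by (rule divide_right_mono) simp
    also have "\<dots> \<le> (p - 1) * H / (t * (t + 1))"
      using p H t by (intro divide_left_mono) (auto simp: power2_eq_square)
    finally show "c / (t + 1)^2 \<le> (p - 1) * H / (t * (t + 1))" .
  qed
  also have "\<dots> = H / (t + 1)"
  proof -
    have "1 - p / (t + 1) = (t + 1 - p) / (t + 1)" using t by (simp add: diff_divide_distrib)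
    then have "(1 - p / (t + 1)) * (H / t) + (p - 1) * H / (t * (t + 1)) = ((t + 1 - p) * H + (p - 1) * H) / (t * (t + 1))"
      by (simp only: times_divide_times_eq add_divide_distrib mult.commute[of "t + 1" t])
    also have "(t + 1 - p) * H + (p - 1) * H = t * H" by (simp add: algebra_simps)
    finally show ?thesis using t by simp
  qed
  finally show ?case by (simp add: tm_Suc t_def)
qed

text \<open>The step sizes are not summable, so the contraction factors multiply to \<open>0\<close>.\<close>
lemma recursion_eventually_small:
  assumes c: "c > 0" and e: "e > 0" and m: "1 \<le> m"
    and small: "\<And>k. m \<le> k \<Longrightarrow> c * gk (Suc k) \<le> 1"
  shows "\<exists>k0\<ge>m. \<forall>w n. w m \<le> B \<longrightarrow>
     (\<forall>k. m \<le> k \<longrightarrow> k < n \<longrightarrow> w (Suc k) \<le> (1 - c * gk (Suc k)) * w k + gk (Suc k) * e) \<longrightarrow>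
     (\<forall>k. k0 \<le> k \<longrightarrow> k \<le> n \<longrightarrow> w k \<le> e / c + e)"
proof -
  define D where "D = max 0 (B - e / c)"
  \<comment> \<open>A multiple of the power \<open>- c * \<gamma>\<close> of
    \<open>tm (Suc k)\<close>. It dominates the product of contraction factors because a step size
    is at least \<open>\<gamma>\<close> times the increment of the logarithm of the clock.\<close>
  define b where "b k = D * exp (- (c * \<gamma>) * (ln (tm (Suc k)) - ln (tm (Suc m))))" for k
  have bound: "w k \<le> e / c + b k"
    if w: "w m \<le> B" "\<forall>k. m \<le> k \<longrightarrow> k < n \<longrightarrow> w (Suc k) \<le> (1 - c * gk (Suc k)) * w k + gk (Suc k) * e"
      and k: "m \<le> k" "k \<le> n" for w n k
    using k
  proof (induction k rule: dec_induct)
    case base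
    then show ?case using w(1) by (simp add: b_def D_def)
  next
    case (step k)
    define g where "g = gk (Suc k)"
    have t: "0 < tm (Suc k)" "0 < tm (Suc (Suc k))" by (simp_all add: tm_pos)
    have nn: "0 \<le> 1 - c * g" using small[of k] step by (simp add: g_def)
    have "ln (tm (Suc (Suc k))) - ln (tm (Suc k)) \<le> 1 / tm (Suc k)"
    proof -
      have "1 + 1 / tm (Suc k) = tm (Suc (Suc k)) / tm (Suc k)"
        using t by (simp add: tm_Suc[of "Suc k"] add_divide_distrib)
      then have "ln (tm (Suc (Suc k))) - ln (tm (Suc k)) = ln (1 + 1 / tm (Suc k))"
        using t by (simp add: ln_div)
      also have "\<dots> \<le> 1 / tm (Suc k)" using t by (intro ln_add_one_self_le_self) simp
      finally show ?thesis .
    qed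
    then have "\<gamma> * (ln (tm (Suc (Suc k))) - ln (tm (Suc k))) \<le> \<gamma> * (1 / tm (Suc k))"
      using \<gamma> by (intro mult_left_mono) auto
    then have g: "\<gamma> * (ln (tm (Suc (Suc k))) - ln (tm (Suc k))) \<le> g" by (simp add: g_def gk_eq)
    have "1 - c * g \<le> exp (- (c * g))" using exp_ge_add_one_self[of "- (c * g)"] by simp
    also have "\<dots> \<le> exp (- (c * \<gamma>) * (ln (tm (Suc (Suc k))) - ln (tm (Suc k))))"
      using mult_left_mono[OF g, of c] c by (simp add: mult.assoc)
    finally have fac: "(1 - c * g) * b k \<le> b (Suc k)"
    proof -
      assume a: "1 - c * g \<le> exp (- (c * \<gamma>) * (ln (tm (Suc (Suc k))) - ln (tm (Suc k))))"
      have "(1 - c * g) * b k \<le> exp (- (c * \<gamma>) * (ln (tm (Suc (Suc k))) - ln (tm (Suc k)))) * b k"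
        using a by (rule mult_right_mono) (simp add: b_def D_def)
      also have "\<dots> = b (Suc k)" by (simp add: b_def exp_add[symmetric] algebra_simps)
      finally show ?thesis .
    qed
    have "w (Suc k) \<le> (1 - c * g) * w k + g * e" using w(2) step by (simp add: g_def)
    also have "\<dots> \<le> (1 - c * g) * (e / c + b k) + g * e" using step nn by (intro add_right_mono mult_left_mono) auto
    also have "\<dots> = e / c + (1 - c * g) * b k" using c by (simp add: field_simps)
    also have "\<dots> \<le> e / c + b (Suc k)" using fac by simp
    finally show ?case .
  qed
  have "b \<longlonglongrightarrow> 0"
  proof -
    have "filterlim (\<lambda>k. tm (Suc k)) at_top sequentially" by (rule filterlim_compose[OF tm_at_top filterlim_Suc])
    then have "filterlim (\<lambda>k. ln (tm (Suc k))) at_top sequentially" by (rule filterlim_compose[OF ln_at_top])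
    then have "filterlim (\<lambda>k. - ln (tm (Suc m)) + ln (tm (Suc k))) at_top sequentially"
      by (rule filterlim_tendsto_add_at_top[OF tendsto_const])
    then have "filterlim (\<lambda>k. (c * \<gamma>) * (- ln (tm (Suc m)) + ln (tm (Suc k)))) at_top sequentially"
      using c \<gamma> by (intro filterlim_tendsto_pos_mult_at_top[OF tendsto_const]) auto
    then have "(\<lambda>k. exp (- ((c * \<gamma>) * (- ln (tm (Suc m)) + ln (tm (Suc k)))))) \<longlonglongrightarrow> 0"
      by (intro filterlim_compose[OF exp_at_bot] filterlim_compose[OF filterlim_uminus_at_bot_at_top])
    from tendsto_mult_right_zero[OF this, of D] show ?thesis by (simp add: b_def[abs_def] algebra_simps)
  qed
  from LIMSEQ_D[OF this e] obtain k0 where k0: "\<forall>k\<ge>k0. norm (b k - 0) < e" by blast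
  show ?thesis
  proof (intro exI[of _ "max m k0"] conjI allI impI)
    fix w n k assume w: "w m \<le> B" "\<forall>k. m \<le> k \<longrightarrow> k < n \<longrightarrow> w (Suc k) \<le> (1 - c * gk (Suc k)) * w k + gk (Suc k) * e"
      and k: "max m k0 \<le> k" "k \<le> n"
    have "w k \<le> e / c + b k" using bound[OF w, of k] k by simp
    moreover have "norm (b k - 0) < e" using k0 k by simp
    ultimately show "w k \<le> e / c + e" by simp
  qed simp
qed

section \<open>Contraction of the normalized mean-field map on the simplex\<close>

text \<open>Spectral projection that removes the Perron direction; it commutes with
  \<open>G\<close>, and its size relative to \<open>z \<bullet> r\<close> measures how far
  \<open>z\<close> is from the ray of \<open>\<theta>\<close>.\<close>

definition proj :: "real^'s \<Rightarrow> real^'s" where "proj z = z - (z \<bullet> r) *\<^sub>R \<theta>"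

lemma proj_r: "proj z \<bullet> r = 0" by (simp add: proj_def inner_diff_left \<theta>_r)

lemma proj_add: "proj (x + y) = proj x + proj y" and proj_scale: "proj (c *\<^sub>R x) = c *\<^sub>R proj x"
  by (simp_all add: proj_def inner_add_left algebra_simps)

lemma proj_G: "proj (z v* G) = proj z v* G"
  by (simp add: proj_def vmult_diff_left vmult_scaleR_left \<theta>_G dot_lmul_matrix G_r)

lemma rnorm_proj_bound: "\<exists>C>0. \<forall>x. rnorm (proj x) \<le> C * norm x"
proof -
  define C where "C = (1 + norm r * norm \<theta>) * (\<Sum>y\<in>UNIV. r $ y)"
  have "0 < (\<Sum>y\<in>UNIV. r $ y)" using r_pos by (intro sum_pos) auto
  moreover have "0 < 1 + norm r * norm \<theta>" by (simp add: add_pos_nonneg)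
  ultimately have "C > 0" by (simp add: C_def)
  moreover have "rnorm (proj x) \<le> C * norm x" for x
  proof -
    have "rnorm (proj x) \<le> (\<Sum>y\<in>UNIV. norm (proj x) * r $ y)"
      unfolding rnorm_def using r_pos by (intro sum_mono mult_right_mono component_le_norm_cart) (auto intro: less_imp_le)
    also have "\<dots> = norm (proj x) * (\<Sum>y\<in>UNIV. r $ y)" by (simp add: sum_distrib_left)
    also have "\<dots> \<le> (norm x + norm x * norm r * norm \<theta>) * (\<Sum>y\<in>UNIV. r $ y)"
    proof (rule mult_right_mono)
      have "norm (proj x) \<le> norm x + \<bar>x \<bullet> r\<bar> * norm \<theta>"
        unfolding proj_def using norm_triangle_ineq4[of x "(x \<bullet> r) *\<^sub>R \<theta>"] by simp
      also have "\<dots> \<le> norm x + norm x * norm r * norm \<theta>"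
        by (intro add_left_mono mult_right_mono Cauchy_Schwarz_ineq2) simp
      finally show "norm (proj x) \<le> norm x + norm x * norm r * norm \<theta>" .
      show "0 \<le> (\<Sum>y\<in>UNIV. r $ y)" using r_pos by (intro sum_nonneg) (auto intro: less_imp_le)
    qed
    finally show ?thesis by (simp add: C_def algebra_simps)
  qed
  ultimately show ?thesis by blast
qed

text \<open>Normalizing by \<open>z \<bullet> r\<close> makes the mean-field map a contraction on the whole simplex, not only
  near the fixed point: \<open>z \<mapsto> z G\<close> acts linearly, and the normalization cancels the growth factor.\<close>
lemma normalized_contraction:
  "\<exists>c>0. \<exists>C\<ge>0. \<forall>z e \<tau> g. 0 \<le> g \<longrightarrow> g \<le> 1 \<longrightarrow> \<tau>0 \<le> \<tau> \<longrightarrow> \<tau> \<le> 1 \<longrightarrow> m \<le> z \<bullet> r \<longrightarrow>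
     m \<le> ((1 - g) *\<^sub>R z + (g * \<tau>) *\<^sub>R (z v* G) + e) \<bullet> r \<longrightarrow> rnorm (proj z) \<le> B * (z \<bullet> r) \<longrightarrow>
     rnorm (proj ((1 - g) *\<^sub>R z + (g * \<tau>) *\<^sub>R (z v* G) + e)) / (((1 - g) *\<^sub>R z + (g * \<tau>) *\<^sub>R (z v* G) + e) \<bullet> r)
       \<le> (1 - c * g) * (rnorm (proj z) / (z \<bullet> r)) + C * norm e"
  if m: "0 < m" and \<tau>0: "0 < \<tau>0" "\<tau>0 \<le> 1" and B: "0 \<le> B"
proof -
  obtain \<kappa> where \<kappa>: "\<kappa> > 0" "\<And>x y. \<kappa> * (r $ x * \<theta> $ y) \<le> G $ x $ y" using minorization by blast
  obtain C2 where C2: "C2 > 0" "\<And>x. rnorm (proj x) \<le> C2 * norm x" using rnorm_proj_bound by blast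
  have \<kappa>\<rho>: "\<kappa> \<le> \<rho>"
  proof -
    fix x
    have "\<kappa> * r $ x = (\<Sum>y\<in>UNIV. \<kappa> * (r $ x * \<theta> $ y) * r $ y)"
      using \<theta>_r by (simp add: inner_vec_def mult.assoc sum_distrib_left[symmetric])
    also have "\<dots> \<le> (\<Sum>y\<in>UNIV. G $ x $ y * r $ y)"
      using \<kappa>(2) r_pos by (intro sum_mono mult_right_mono) (auto intro: less_imp_le)
    also have "\<dots> = \<rho> * r $ x" using arg_cong[OF G_r, of "\<lambda>v. v $ x"] by (simp add: matrix_vector_mult_def)
    finally show ?thesis using r_pos[of x] by simp
  qed
  \<comment> \<open>The gain \<open>g * \<tau> * \<kappa>\<close> on the projected part is taken
    relative to the growth factor \<open>f\<close>, which is at most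
    \<open>1 + \<rho>\<close>.\<close>
  define c where "c = \<tau>0 * \<kappa> / (1 + \<rho>)"
  define C where "C = (C2 + B * norm r) / m"
  have "c > 0" using \<kappa> \<tau>0 \<rho>_pos by (simp add: c_def)
  moreover have "C \<ge> 0" using C2 B m by (simp add: C_def)
  moreover have "rnorm (proj z') / (z' \<bullet> r) \<le> (1 - c * g) * (rnorm (proj z) / (z \<bullet> r)) + C * norm e"
    if g: "0 \<le> g" "g \<le> 1" and \<tau>: "\<tau>0 \<le> \<tau>" "\<tau> \<le> 1" and s: "m \<le> z \<bullet> r" "m \<le> z' \<bullet> r"
      and W: "rnorm (proj z) \<le> B * (z \<bullet> r)" and z': "z' = (1 - g) *\<^sub>R z + (g * \<tau>) *\<^sub>R (z v* G) + e" for z z' e \<tau> g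
  proof -
    \<comment> \<open>Factor by which \<open>z \<bullet> r\<close> grows apart from
      \<open>e\<close>; on the projected part the factor is
      \<open>f - g * \<tau> * \<kappa>\<close>, and \<open>a\<close> is the ratio of the
      two.\<close>
    define f where "f = (1 - g) + g * \<tau> * \<rho>"
    define w where "w = rnorm (proj z) / (z \<bullet> r)"
    have zr: "0 < z \<bullet> r" "0 < z' \<bullet> r" using s m by auto
    have w: "rnorm (proj z) = w * (z \<bullet> r)" "w \<le> B" "0 \<le> w"
      using zr W by (simp_all add: w_def field_simps rnorm_nonneg)
    have gt: "0 \<le> g * \<tau>" using g \<tau> \<tau>0 by simp
    have r1: "rnorm (proj z') \<le> (f - g * \<tau> * \<kappa>) * rnorm (proj z) + C2 * norm e"
    proof -
      have "rnorm (proj z') \<le> rnorm ((1 - g) *\<^sub>R proj z) + rnorm ((g * \<tau>) *\<^sub>R (proj z v* G)) + rnorm (proj e)"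
        unfolding z' proj_add proj_scale proj_G
        by (intro order_trans[OF rnorm_triangle] add_right_mono rnorm_triangle)
      also have "\<dots> \<le> (1 - g) * rnorm (proj z) + (g * \<tau>) * ((\<rho> - \<kappa>) * rnorm (proj z)) + C2 * norm e"
        unfolding rnorm_scale abs_of_nonneg[OF gt] using g gt C2(2)
        by (intro add_mono mult_left_mono contraction[OF \<kappa>(2) proj_r]) simp_all
      also have "\<dots> = (f - g * \<tau> * \<kappa>) * rnorm (proj z) + C2 * norm e" by (simp add: f_def algebra_simps)
      finally show ?thesis .
    qed
    have s1: "z' \<bullet> r = f * (z \<bullet> r) + e \<bullet> r"
      unfolding z' f_def by (simp add: inner_add_left dot_lmul_matrix G_r algebra_simps)
    have fpos: "0 < f"
    proof (cases "g = 0")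
      case True
      then show ?thesis by (simp add: f_def)
    next
      case False
      then have "0 < g * \<tau> * \<rho>" using g \<tau> \<tau>0 \<rho>_pos by simp
      then show ?thesis using g by (simp add: f_def)
    qed
    have fle: "f \<le> 1 + \<rho>"
    proof -
      have "g * \<tau> * \<rho> \<le> 1 * 1 * \<rho>" using g \<tau> \<tau>0 \<rho>_pos by (intro mult_mono) auto
      then show ?thesis using g by (simp add: f_def)
    qed
    define a where "a = (f - g * \<tau> * \<kappa>) / f"
    have a0: "0 \<le> a"
    proof -
      have "g * \<tau> * \<kappa> \<le> g * \<tau> * \<rho>" using gt \<kappa>\<rho> by (rule mult_left_mono[rotated])
      then show ?thesis using g fpos by (simp add: a_def f_def)
    qed
    have a1: "a \<le> 1 - c * g"
    proof -
      have "c * g * f \<le> c * g * (1 + \<rho>)" using fle g \<open>c > 0\<close> by (intro mult_left_mono) auto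
      also have "\<dots> = g * \<tau>0 * \<kappa>" using \<rho>_pos by (simp add: c_def)
      also have "\<dots> \<le> g * \<tau> * \<kappa>" using g \<tau> \<kappa> by (intro mult_left_mono mult_right_mono) auto
      finally show ?thesis using fpos by (simp add: a_def field_simps)
    qed
    have a2: "a \<le> 1" using a1 g \<open>c > 0\<close> mult_nonneg_nonneg[of c g] by linarith
    have ef: "f * (z \<bullet> r) \<le> z' \<bullet> r + norm e * norm r"
      using Cauchy_Schwarz_ineq2[of e r] unfolding s1 by linarith
    have "rnorm (proj z') \<le> a * w * (f * (z \<bullet> r)) + C2 * norm e"
    proof -
      have "f - g * \<tau> * \<kappa> = a * f" using fpos by (simp add: a_def)
      then show ?thesis using r1 unfolding w(1) by (simp add: mult_ac)
    qed
    also have "\<dots> \<le> a * w * (z' \<bullet> r + norm e * norm r) + C2 * norm e"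
      using a0 w(3) ef by (intro add_right_mono mult_left_mono) auto
    also have "\<dots> = a * w * (z' \<bullet> r) + (a * w) * (norm e * norm r) + C2 * norm e" by (simp add: algebra_simps)
    also have "\<dots> \<le> a * w * (z' \<bullet> r) + (1 * B) * (norm e * norm r) + C2 * norm e"
      using a0 a2 w B by (intro add_mono order_refl mult_right_mono mult_mono) auto
    also have "\<dots> = a * w * (z' \<bullet> r) + (C2 + B * norm r) * norm e" by (simp add: algebra_simps)
    finally have "rnorm (proj z') / (z' \<bullet> r) \<le> (a * w * (z' \<bullet> r) + (C2 + B * norm r) * norm e) / (z' \<bullet> r)"
      using zr by (intro divide_right_mono) auto
    also have "\<dots> = a * w + (C2 + B * norm r) * norm e / (z' \<bullet> r)"
      using zr by (simp add: add_divide_distrib)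
    also have "\<dots> \<le> (1 - c * g) * w + (C2 + B * norm r) * norm e / m"
      using a1 w(3) s m C2 B by (intro add_mono mult_right_mono divide_left_mono) auto
    finally show ?thesis by (simp add: w_def C_def)
  qed
  ultimately show ?thesis by blast
qed

text \<open>All probability vectors have the same mass, so the \<open>\<theta>\<close>-coefficient
  removed by the projection can be recovered: \<open>1 - \<nu> \<bullet> r\<close> is the mass of
  \<open>proj \<nu>\<close>.\<close>

lemma proj_small_imp_close:
  "\<exists>C\<ge>0. \<forall>\<nu>\<in>prob_simplex. norm (\<nu> - \<theta>) \<le> C * norm (proj \<nu>)"
proof (intro exI[of _ "1 + norm (1::real^'s) * norm \<theta>"] conjI ballI)
  fix \<nu> :: "real^'s" assume \<nu>: "\<nu> \<in> prob_simplex"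
  have p1: "proj \<nu> \<bullet> 1 = 1 - \<nu> \<bullet> r"
    by (simp add: proj_def inner_diff_left \<theta>_one simplex_inner_one[OF \<nu>])
  have "\<nu> - \<theta> = proj \<nu> - (proj \<nu> \<bullet> 1) *\<^sub>R \<theta>" unfolding p1 by (simp add: proj_def algebra_simps)
  then have "norm (\<nu> - \<theta>) \<le> norm (proj \<nu>) + \<bar>proj \<nu> \<bullet> 1\<bar> * norm \<theta>"
    using norm_triangle_ineq4[of "proj \<nu>" "(proj \<nu> \<bullet> 1) *\<^sub>R \<theta>"] by simp
  also have "\<dots> \<le> norm (proj \<nu>) + norm (proj \<nu>) * norm (1::real^'s) * norm \<theta>"
    by (intro add_left_mono mult_right_mono Cauchy_Schwarz_ineq2) simp
  finally show "norm (\<nu> - \<theta>) \<le> (1 + norm (1::real^'s) * norm \<theta>) * norm (proj \<nu>)" by (simp add: algebra_simps)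
qed simp

end

section \<open>Linear part and remainder of a path\<close>

text \<open>\<open>S\<close> induces the adapted norm \<open>nS\<close>, and \<open>k1\<close> is a
  time from which an Euler step contracts it. \<open>\<gamma> * Lq > 1\<close> is what remains of
  the condition on \<open>\<gamma>\<close> and \<open>L\<close>.\<close>

locale clt_lyap = clt_chain P \<theta> L \<gamma> for P :: "real ^ ('s::finite) option ^ 's option" and \<theta> L \<gamma> +
  fixes S :: "real^'s^'s" and Lq :: real and k1 :: nat
  assumes S_sym: "transpose S = S" and S_ge: "\<And>x. x \<bullet> x \<le> x \<bullet> (S *v x)" and Lq: "\<gamma> * Lq > 1"
    and k1: "1 \<le> k1" and small: "\<And>k. k1 \<le> k \<Longrightarrow> gk (Suc k) * Lq \<le> 1"
    and contr: "\<And>k x. k1 \<le> k \<Longrightarrow>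
      (x + gk (Suc k) *\<^sub>R (J *v x)) \<bullet> (S *v (x + gk (Suc k) *\<^sub>R (J *v x))) \<le> (1 - gk (Suc k) * Lq)^2 * (x \<bullet> (S *v x))"
begin

lemma Lq_pos: "Lq > 0" using Lq \<gamma> by (metis less_trans zero_less_mult_pos zero_less_one)

definition nS :: "real^'s \<Rightarrow> real" where "nS x = sqrt (x \<bullet> (S *v x))"

lemma S_nonneg: "0 \<le> x \<bullet> (S *v x)" using order_trans[OF inner_ge_zero S_ge] .

lemma nS_nonneg: "0 \<le> nS x" by (simp add: nS_def S_nonneg)
lemma nS_square: "(nS x)^2 = x \<bullet> (S *v x)" by (simp add: nS_def S_nonneg)
lemma norm_le_nS: "norm x \<le> nS x" unfolding nS_def norm_eq_sqrt_inner by (rule real_sqrt_le_mono[OF S_ge])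

lemma nS_le: "\<exists>C>0. \<forall>x. nS x \<le> C * norm x"
proof -
  obtain B where B: "0 < B" "\<And>x. norm (S *v x) \<le> norm x * B"
    using bounded_linear.pos_bounded[OF matrix_vector_mul_bounded_linear[of S]] by auto
  have "nS x \<le> sqrt B * norm x" for x
  proof -
    have "x \<bullet> (S *v x) \<le> norm x * (norm x * B)"
      by (rule order_trans[OF norm_cauchy_schwarz]) (intro mult_left_mono B norm_ge_zero)
    also have "\<dots> = (sqrt B * norm x)^2" using B(1) by (simp add: power2_eq_square)
    finally show ?thesis unfolding nS_def using B(1) by (intro real_le_lsqrt) auto
  qed
  then show ?thesis using B(1) by (intro exI[of _ "sqrt B"]) auto
qed

lemma nS_triangle: "nS (x + y) \<le> nS x + nS y"
proof -
  have "(x \<bullet> (S *v y))^2 \<le> (nS x * nS y)^2"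
    using psd_cauchy_schwarz[OF S_sym S_nonneg, of x y] by (simp add: power_mult_distrib nS_square)
  then have c: "x \<bullet> (S *v y) \<le> nS x * nS y"
    by (rule power2_le_imp_le) (simp add: nS_nonneg)
  have "(x + y) \<bullet> (S *v (x + y)) = (nS x)^2 + 2 * (x \<bullet> (S *v y)) + (nS y)^2"
    unfolding nS_square using symmetric_matrix_swap[OF S_sym, of y x]
    by (simp add: matrix_vector_right_distrib inner_add_left inner_add_right)
  also have "\<dots> \<le> (nS x + nS y)^2" using c by (simp add: power2_sum)
  finally show ?thesis unfolding nS_def[of "x + y"] by (intro real_le_lsqrt) (simp_all add: nS_nonneg)
qed

lemma nS_scale: "nS (c *\<^sub>R x) = \<bar>c\<bar> * nS x"
  by (simp add: nS_def matrix_vector_mult_scaleR real_sqrt_mult power2_eq_square[symmetric] mult.assoc[symmetric] del: power2_eq_square)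

lemma nS_contr: assumes "k1 \<le> k" shows "nS (x + gk (Suc k) *\<^sub>R (J *v x)) \<le> (1 - gk (Suc k) * Lq) * nS x"
proof -
  have "nS (x + gk (Suc k) *\<^sub>R (J *v x)) \<le> sqrt ((1 - gk (Suc k) * Lq)^2 * (x \<bullet> (S *v x)))"
    unfolding nS_def by (rule real_sqrt_le_mono[OF contr[OF assms]])
  also have "\<dots> = (1 - gk (Suc k) * Lq) * nS x"
    using small[OF assms] by (simp add: real_sqrt_mult nS_def)
  finally show ?thesis .
qed

text \<open>Pathwise setting: estimates for arbitrary such sequences have constants that are uniform
  in the outcome and in the number of particles.\<close>

definition is_path :: "(nat \<Rightarrow> real^'s) \<Rightarrow> (nat \<Rightarrow> real^'s) \<Rightarrow> bool" where
  "is_path th eta \<longleftrightarrow> (\<forall>k. th k \<in> prob_simplex \<and> eta k \<in> prob_simplex \<and>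
     th (Suc k) = (1 - gk (Suc k)) *\<^sub>R th k + gk (Suc k) *\<^sub>R eta (Suc k))"

definition xi :: "(nat \<Rightarrow> real^'s) \<Rightarrow> (nat \<Rightarrow> real^'s) \<Rightarrow> nat \<Rightarrow> real^'s" where
  "xi th eta k = rop (th k) (eta (Suc k) - eta k v* K P (th k))"

text \<open>Starts from zero at \<open>k1\<close>, where the adapted norm begins to contract; the
  noise before \<open>k1\<close> stays in the initial value of \<open>zeta\<close>.\<close>

primrec Xi :: "(nat \<Rightarrow> real^'s) \<Rightarrow> (nat \<Rightarrow> real^'s) \<Rightarrow> nat \<Rightarrow> real^'s" where
  "Xi th eta 0 = 0"
| "Xi th eta (Suc k) = (if k < k1 then 0 else
     (Xi th eta k + gk (Suc k) *\<^sub>R (J *v Xi th eta k)) + gk (Suc k) *\<^sub>R xi th eta k)"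

definition sop :: "real^'s \<Rightarrow> real^'s \<Rightarrow> real^'s" where "sop \<nu> x = rop \<nu> x - x"

text \<open>Adding \<open>gk k *\<^sub>R sop \<dots>\<close> absorbs the telescoping part of the Poisson decomposition and subtracting
  \<open>Xi\<close> absorbs the martingale part, so that \<open>zeta\<close> follows the mean-field recursion up to \<open>O(gk k\<^sup>2)\<close>
  and an explicit multiple of \<open>Xi\<close>.\<close>
definition zeta :: "(nat \<Rightarrow> real^'s) \<Rightarrow> (nat \<Rightarrow> real^'s) \<Rightarrow> nat \<Rightarrow> real^'s" where
  "zeta th eta k = th k + gk k *\<^sub>R sop (th (k - 1)) (eta k) - Xi th eta k"

lemma Xi_0: "k \<le> k1 \<Longrightarrow> Xi th eta k = 0"
  by (cases k) auto

lemma Xi_step: "k1 \<le> k \<Longrightarrow> Xi th eta (Suc k) =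
    (Xi th eta k + gk (Suc k) *\<^sub>R (J *v Xi th eta k)) + gk (Suc k) *\<^sub>R xi th eta k"
  by simp

lemma rop_bound: "\<exists>C>0. \<forall>\<nu>\<in>prob_simplex. \<forall>x. norm (rop \<nu> x) \<le> C * norm x"
proof -
  obtain c where c: "c > 0" "\<And>x. norm (x v* G) \<le> norm x * c"
    using bounded_linear.pos_bounded[OF bounded_linear_vmult[of G]] by auto
  have "norm (rop \<nu> x) \<le> (c + norm g1) * norm x" if \<nu>: "\<nu> \<in> prob_simplex" for \<nu> x
  proof -
    have "norm (rop \<nu> x) \<le> norm (x v* G) + \<bar>x \<bullet> g1\<bar> * norm (pi \<nu>)"
      unfolding rop_def using norm_triangle_ineq4[of "x v* G" "(x \<bullet> g1) *\<^sub>R pi \<nu>"] by simp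
    also have "\<dots> \<le> norm x * c + (norm x * norm g1) * 1"
      by (intro add_mono c mult_mono Cauchy_Schwarz_ineq2 simplex_norm_le_1 pi_simplex \<nu>) auto
    finally show ?thesis by (simp add: algebra_simps)
  qed
  then show ?thesis using c by (intro exI[of _ "c + norm g1"]) (auto intro: add_pos_nonneg)
qed

lemma vmult_K_simplex:
  assumes "\<eta> \<in> prob_simplex" "\<nu> \<in> prob_simplex" shows "\<eta> v* K P \<nu> \<in> prob_simplex"
proof -
  have "(\<eta> v* K P \<nu>) \<bullet> 1 = \<eta> \<bullet> (K P \<nu> *v 1)" by (rule dot_lmul_matrix)
  also have "K P \<nu> *v 1 = 1"
    by (simp add: K_mult_vec A_one simplex_inner_one[OF assms(2)])
  finally have "(\<eta> v* K P \<nu>) \<bullet> 1 = 1" using simplex_inner_one[OF assms(1)] by simp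
  moreover have "0 \<le> (\<eta> v* K P \<nu>) $ i" for i
    unfolding vmult_eq_sum
    by (intro sum_nonneg mult_nonneg_nonneg simplex_nonneg[OF assms(1)] K_nonneg[OF chain assms(2)])
  ultimately show ?thesis by (simp add: prob_simplex_def inner_one)
qed

lemma xi_bound: "\<exists>C>0. \<forall>th eta k. is_path th eta \<longrightarrow> norm (xi th eta k) \<le> C"
proof -
  obtain C where C: "C > 0" "\<And>\<nu> x. \<nu> \<in> prob_simplex \<Longrightarrow> norm (rop \<nu> x) \<le> C * norm x" using rop_bound by blast
  have "norm (xi th eta k) \<le> C * 2" if p: "is_path th eta" for th eta k
  proof -
    have s: "th k \<in> prob_simplex" "eta k \<in> prob_simplex" "eta (Suc k) \<in> prob_simplex"
      using p by (auto simp: is_path_def)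
    have "norm (eta (Suc k) - eta k v* K P (th k)) \<le> norm (eta (Suc k)) + norm (eta k v* K P (th k))"
      by (rule norm_triangle_ineq4)
    also have "\<dots> \<le> 1 + 1" by (intro add_mono simplex_norm_le_1 s vmult_K_simplex)
    finally have "norm (eta (Suc k) - eta k v* K P (th k)) \<le> 2" by simp
    then show ?thesis unfolding xi_def using C(2)[OF s(1), of "eta (Suc k) - eta k v* K P (th k)"] C(1)
      by (meson mult_left_mono less_imp_le order_trans)
  qed
  then show ?thesis using C(1) by (intro exI[of _ "C * 2"]) auto
qed

lemma J_bound: "\<exists>C>0. \<forall>x. norm (J *v x) \<le> C * norm x"
  using bounded_linear.pos_bounded[OF matrix_vector_mul_bounded_linear[of J]] by (auto simp: mult.commute)

lemma Xi_bound: "\<exists>C>0. \<forall>th eta k. is_path th eta \<longrightarrow> norm (Xi th eta k) \<le> C"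
proof -
  obtain Cx where Cx: "Cx > 0" "\<And>th eta k. is_path th eta \<Longrightarrow> norm (xi th eta k) \<le> Cx" using xi_bound by blast
  obtain CS where CS: "CS > 0" "\<And>x. nS x \<le> CS * norm x" using nS_le by blast
  \<comment> \<open>Fixed point of the scalar recursion:
    \<open>(1 - g * Lq) * H + g * (CS * Cx) = H\<close> for every \<open>g\<close>.\<close>
  define H where "H = CS * Cx / Lq"
  have H: "H > 0" using CS Cx Lq_pos by (simp add: H_def)
  have "nS (Xi th eta k) \<le> H" if p: "is_path th eta" for th eta k
  proof (induction k)
    case 0
    then show ?case using H by (simp add: nS_def)
  next
    case (Suc k)
    show ?case
    proof (cases "k < k1")
      case True
      then show ?thesis using H by (simp add: nS_def)
    next
      case False
      then have k: "k1 \<le> k" by simp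
      define g where "g = gk (Suc k)"
      have g: "0 \<le> g" "g * Lq \<le> 1" unfolding g_def by (fact gk_nonneg, rule small[OF k])
      have "nS (Xi th eta (Suc k)) \<le> (1 - g * Lq) * nS (Xi th eta k) + g * nS (xi th eta k)"
        unfolding Xi_step[OF k] g_def
        by (rule order_trans[OF nS_triangle]) (intro add_mono nS_contr[OF k], simp add: nS_scale gk_nonneg)
      also have "\<dots> \<le> (1 - g * Lq) * H + g * (CS * Cx)"
      proof (intro add_mono mult_left_mono Suc g)
        show "nS (xi th eta k) \<le> CS * Cx"
          using CS(2)[of "xi th eta k"] Cx(2)[OF p, of k] CS(1) by (meson mult_left_mono less_imp_le order_trans)
      qed (use g in simp)
      also have "\<dots> = H" using Lq_pos by (simp add: H_def field_simps)
      finally show ?thesis .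
    qed
  qed
  then show ?thesis using H norm_le_nS order_trans by blast
qed

lemma Xi_increment: "\<exists>C>0. \<forall>th eta k. is_path th eta \<longrightarrow> norm (Xi th eta (Suc k) - Xi th eta k) \<le> C * gk (Suc k)"
proof -
  obtain Cx where Cx: "Cx > 0" "\<And>th eta k. is_path th eta \<Longrightarrow> norm (xi th eta k) \<le> Cx" using xi_bound by blast
  obtain CX where CX: "CX > 0" "\<And>th eta k. is_path th eta \<Longrightarrow> norm (Xi th eta k) \<le> CX" using Xi_bound by blast
  obtain CJ where CJ: "CJ > 0" "\<And>x. norm (J *v x) \<le> CJ * norm x" using J_bound by blast
  have "norm (Xi th eta (Suc k) - Xi th eta k) \<le> (CJ * CX + Cx) * gk (Suc k)" if p: "is_path th eta" for th eta k
  proof (cases "k < k1")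
    case True
    then have "Xi th eta (Suc k) - Xi th eta k = 0" using Xi_0[of k] by simp
    then show ?thesis using CJ CX Cx gk_nonneg[of "Suc k"] by simp
  next
    case False
    then have k: "k1 \<le> k" by simp
    have "Xi th eta (Suc k) - Xi th eta k = gk (Suc k) *\<^sub>R (J *v Xi th eta k + xi th eta k)"
      unfolding Xi_step[OF k] by (simp add: scaleR_add_right)
    then have "norm (Xi th eta (Suc k) - Xi th eta k) = gk (Suc k) * norm (J *v Xi th eta k + xi th eta k)"
      by (simp add: gk_nonneg)
    also have "\<dots> \<le> gk (Suc k) * (CJ * CX + Cx)"
    proof (intro mult_left_mono gk_nonneg order_trans[OF norm_triangle_ineq] add_mono Cx(2)[OF p])
      show "norm (J *v Xi th eta k) \<le> CJ * CX"
        using CJ(2)[of "Xi th eta k"] CX(2)[OF p, of k] CJ(1) by (meson mult_left_mono less_imp_le order_trans)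
    qed
    finally show ?thesis by (simp add: mult.commute)
  qed
  then show ?thesis using CJ CX Cx by (intro exI[of _ "CJ * CX + Cx"]) (auto intro: add_pos_pos)
qed

lemma sop_bound: "\<exists>C>0. \<forall>\<nu>\<in>prob_simplex. \<forall>x\<in>prob_simplex. norm (sop \<nu> x) \<le> C"
proof -
  obtain C where C: "C > 0" "\<And>\<nu> x. \<nu> \<in> prob_simplex \<Longrightarrow> norm (rop \<nu> x) \<le> C * norm x" using rop_bound by blast
  have "norm (sop \<nu> x) \<le> C + 1" if "\<nu> \<in> prob_simplex" "x \<in> prob_simplex" for \<nu> x
  proof -
    have "norm (sop \<nu> x) \<le> norm (rop \<nu> x) + norm x" unfolding sop_def by (rule norm_triangle_ineq4)
    also have "\<dots> \<le> C * norm x + norm x" by (intro add_right_mono C that)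
    also have "\<dots> \<le> C * 1 + 1" using C by (intro add_mono mult_left_mono simplex_norm_le_1 that) auto
    finally show ?thesis by simp
  qed
  then show ?thesis using C(1) by (intro exI[of _ "C + 1"]) auto
qed

lemma path_recursion:
  assumes p: "is_path th eta"
  shows "th (Suc k) - th k = gk (Suc k) *\<^sub>R (pi (th k) - th k + xi th eta k
      - (sop (th k) (eta (Suc k)) - sop (th k) (eta k)))"
proof -
  have s: "th k \<in> prob_simplex" "eta k \<bullet> 1 = 1"
    using p by (auto simp: is_path_def simplex_inner_one)
  have "th (Suc k) - th k = gk (Suc k) *\<^sub>R (eta (Suc k) - th k)"
    using p by (simp add: is_path_def algebra_simps)
  also have "eta (Suc k) - th k = pi (th k) - th k + xi th eta k
      - (sop (th k) (eta (Suc k)) - sop (th k) (eta k))"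
    unfolding xi_def poisson[OF s] sop_def by (simp add: algebra_simps)
  finally show ?thesis .
qed

text \<open>Summation by parts leaves two errors of second order: the change of the step size
  against a bounded term, and the change of \<open>sop\<close> when its first argument moves from
  \<open>th (k - 1)\<close> to \<open>th k\<close>, controlled by the Lipschitz bound for
  \<open>pi\<close>.\<close>

lemma zeta_recursion:
  "\<exists>C>0. \<forall>th eta k. is_path th eta \<longrightarrow> k1 \<le> k \<longrightarrow>
     norm (zeta th eta (Suc k) - zeta th eta k - gk (Suc k) *\<^sub>R ((pi (th k) - th k) - J *v Xi th eta k))
       \<le> C * (gk (Suc k))^2"
proof -
  obtain CS where CS: "CS > 0" "\<And>\<nu> x. \<nu> \<in> prob_simplex \<Longrightarrow> x \<in> prob_simplex \<Longrightarrow> norm (sop \<nu> x) \<le> CS"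
    using sop_bound by blast
  obtain Cp where Cp: "Cp \<ge> 0" "\<And>\<nu> \<nu>'. \<nu> \<in> prob_simplex \<Longrightarrow> \<nu>' \<in> prob_simplex \<Longrightarrow> norm (pi \<nu> - pi \<nu>') \<le> Cp * norm (\<nu> - \<nu>')"
    using pi_lipschitz by blast
  define C where "C = 2 / \<gamma> * CS + 8 * norm g1 * Cp"
  have "norm (zeta th eta (Suc k) - zeta th eta k - gk (Suc k) *\<^sub>R ((pi (th k) - th k) - J *v Xi th eta k))
       \<le> C * (gk (Suc k))^2" if p: "is_path th eta" and k: "k1 \<le> k" for th eta k
  proof -
    define g where "g = gk (Suc k)"
    define g' where "g' = gk k"
    have k0: "1 \<le> k" using k k1 by simp
    then obtain j where j: "k = Suc j" by (cases k) auto
    have g: "0 \<le> g" "0 \<le> g'" "g' \<le> 2 * g" "g' - g = g' * g / \<gamma>"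
      unfolding g_def g'_def using gk_nonneg gk_half[OF k0] gk_diff[OF k0] by blast+
    have s: "th k \<in> prob_simplex" "th j \<in> prob_simplex" "eta k \<in> prob_simplex"
      using p by (auto simp: is_path_def)
    have "zeta th eta (Suc k) - zeta th eta k - g *\<^sub>R ((pi (th k) - th k) - J *v Xi th eta k) =
      (g *\<^sub>R sop (th k) (eta k) - g' *\<^sub>R sop (th j) (eta k))"
      unfolding zeta_def using path_recursion[OF p, of k] unfolding Xi_step[OF k] g_def[symmetric] g'_def[symmetric] diff_Suc_1
      by (simp add: j algebra_simps)
    also have "\<dots> = - (g' - g) *\<^sub>R sop (th k) (eta k) + g' *\<^sub>R (sop (th k) (eta k) - sop (th j) (eta k))"
      by (simp add: algebra_simps)
    also have "sop (th k) (eta k) - sop (th j) (eta k) = - (eta k \<bullet> g1) *\<^sub>R (pi (th k) - pi (th j))"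
      by (simp add: sop_def rop_def algebra_simps)
    finally have e: "zeta th eta (Suc k) - zeta th eta k - g *\<^sub>R ((pi (th k) - th k) - J *v Xi th eta k) =
      - (g' - g) *\<^sub>R sop (th k) (eta k) + g' *\<^sub>R (- (eta k \<bullet> g1) *\<^sub>R (pi (th k) - pi (th j)))" .
    have "norm (zeta th eta (Suc k) - zeta th eta k - g *\<^sub>R ((pi (th k) - th k) - J *v Xi th eta k))
      \<le> norm (- (g' - g) *\<^sub>R sop (th k) (eta k)) + norm (g' *\<^sub>R (- (eta k \<bullet> g1) *\<^sub>R (pi (th k) - pi (th j))))"
      unfolding e by (rule norm_triangle_ineq)
    also have "\<dots> = \<bar>g' - g\<bar> * norm (sop (th k) (eta k)) + g' * (\<bar>eta k \<bullet> g1\<bar> * norm (pi (th k) - pi (th j)))"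
      by (simp only: norm_scaleR abs_minus_cancel abs_of_nonneg[OF g(2)])
    also have "\<dots> \<le> (2 * g * g / \<gamma>) * CS + (2 * g) * (norm g1 * (Cp * (4 * g)))"
    proof (intro add_mono mult_mono)
      have "g' * g / \<gamma> \<le> 2 * g * g / \<gamma>" using g \<gamma> by (intro divide_right_mono mult_right_mono) auto
      moreover have "0 \<le> g' * g / \<gamma>" using g \<gamma> by simp
      ultimately show "\<bar>g' - g\<bar> \<le> 2 * g * g / \<gamma>" using g(4) by simp
      show "norm (sop (th k) (eta k)) \<le> CS" by (rule CS(2)[OF s(1,3)])
      have "\<bar>eta k \<bullet> g1\<bar> \<le> norm (eta k) * norm g1" by (rule Cauchy_Schwarz_ineq2)
      also have "\<dots> \<le> 1 * norm g1" by (intro mult_right_mono simplex_norm_le_1 s) simp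
      finally show "\<bar>eta k \<bullet> g1\<bar> \<le> norm g1" by simp
      have "th k - th j = g' *\<^sub>R (eta k - th j)"
        using p unfolding is_path_def j g'_def by (simp add: algebra_simps)
      then have "norm (th k - th j) = g' * norm (eta k - th j)" using g by simp
      also have "\<dots> \<le> g' * 2"
        using norm_triangle_ineq4[of "eta k" "th j"] simplex_norm_le_1[OF s(3)] simplex_norm_le_1[OF s(2)] g
        by (intro mult_left_mono) auto
      also have "\<dots> \<le> 4 * g" using g by simp
      finally have "norm (th k - th j) \<le> 4 * g" .
      then show "norm (pi (th k) - pi (th j)) \<le> Cp * (4 * g)"
        using Cp(2)[OF s(1,2)] Cp(1) by (meson mult_left_mono order_trans)
    qed (use g \<gamma> CS Cp in auto)
    also have "\<dots> = C * g^2" by (simp add: C_def power2_eq_square algebra_simps)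
    finally show ?thesis unfolding g_def .
  qed
  moreover have "C > 0" using CS Cp \<gamma> by (simp add: C_def add_pos_nonneg)
  ultimately show ?thesis by blast
qed

lemma zeta_close: "\<exists>C>0. \<forall>th eta k. is_path th eta \<longrightarrow> norm (th k - Xi th eta k - zeta th eta k) \<le> C * gk k"
proof -
  obtain CS where CS: "CS > 0" "\<And>\<nu> x. \<nu> \<in> prob_simplex \<Longrightarrow> x \<in> prob_simplex \<Longrightarrow> norm (sop \<nu> x) \<le> CS"
    using sop_bound by blast
  have "norm (th k - Xi th eta k - zeta th eta k) \<le> CS * gk k" if p: "is_path th eta" for th eta k
  proof -
    have "th (k - 1) \<in> prob_simplex" "eta k \<in> prob_simplex" using p by (auto simp: is_path_def)
    then have "norm (sop (th (k - 1)) (eta k)) \<le> CS" by (rule CS(2))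
    then have "gk k * norm (sop (th (k - 1)) (eta k)) \<le> gk k * CS" by (rule mult_left_mono[OF _ gk_nonneg])
    moreover have "th k - Xi th eta k - zeta th eta k = - (gk k *\<^sub>R sop (th (k - 1)) (eta k))"
      by (simp add: zeta_def)
    ultimately show ?thesis by (simp add: gk_nonneg mult.commute)
  qed
  then show ?thesis using CS(1) by blast
qed

section \<open>From small \<open>Xi\<close> to closeness: global and local estimates\<close>

text \<open>\<open>zeta\<close> follows the normalized map up to a perturbation of order
  \<open>gk (Suc k) * \<delta>\<close>, so its distance from the ray of \<open>\<theta>\<close>
  becomes O(\<delta>). The order of quantifiers matters: \<open>\<delta>\<close> is fixed before the
  time \<open>k2\<close>, and \<open>k0\<close> serves all paths and all horizons
  \<open>n\<close>.\<close>

lemma global_convergence: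
  assumes \<epsilon>: "\<epsilon> > 0"
  shows "\<exists>\<delta>>0. \<forall>k2. \<exists>k0\<ge>k1. \<forall>th eta n. is_path th eta \<longrightarrow> (\<forall>k. k2 \<le> k \<longrightarrow> k \<le> n \<longrightarrow> norm (Xi th eta k) \<le> \<delta>) \<longrightarrow>
     (\<forall>k. k0 \<le> k \<longrightarrow> k \<le> n \<longrightarrow> norm (th k - \<theta>) \<le> \<epsilon>)"
proof -
  obtain Cz where Cz: "Cz > 0" "\<And>th eta k. is_path th eta \<Longrightarrow> norm (th k - Xi th eta k - zeta th eta k) \<le> Cz * gk k"
    using zeta_close by blast
  obtain Cr where Cr: "Cr > 0" "\<And>th eta k. is_path th eta \<Longrightarrow> k1 \<le> k \<Longrightarrow>
     norm (zeta th eta (Suc k) - zeta th eta k - gk (Suc k) *\<^sub>R ((pi (th k) - th k) - J *v Xi th eta k)) \<le> Cr * (gk (Suc k))^2"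
    using zeta_recursion by blast
  obtain CJ where CJ: "CJ > 0" "\<And>x. norm (J *v x) \<le> CJ * norm x" using J_bound by blast
  obtain CG where CG: "CG > 0" "\<And>x. norm (x v* G) \<le> norm x * CG"
    using bounded_linear.pos_bounded[OF bounded_linear_vmult[of G]] by auto
  obtain CP where CP: "CP > 0" "\<And>x. rnorm (proj x) \<le> CP * norm x" using rnorm_proj_bound by blast
  obtain Cc where Cc: "Cc \<ge> 0" "\<And>\<nu>. \<nu> \<in> prob_simplex \<Longrightarrow> norm (\<nu> - \<theta>) \<le> Cc * norm (proj \<nu>)"
    using proj_small_imp_close by blast
  define q where "q = Min (range (\<lambda>x. r $ x))"
  have q: "0 < q" unfolding q_def by (subst Min_gr_iff) (auto simp: r_pos)
  have qx: "q \<le> r $ x" for x unfolding q_def by (rule Min_le) auto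
  have simplex_r: "q \<le> \<nu> \<bullet> r" if "\<nu> \<in> prob_simplex" for \<nu>
    using inner_mono_nonneg[of \<nu> "q *\<^sub>R 1" r] that qx by (simp add: simplex_nonneg simplex_inner_one)
  \<comment> \<open>\<open>zeta\<close> leaves the simplex, but only by \<open>2 * \<delta>\<close>;
    half of the lower bound \<open>q\<close> for \<open>\<nu> \<bullet> r\<close> survives.\<close>
  define m where "m = q / 2"
  define \<tau>0 where "\<tau>0 = 1 / (norm g1 + 1)"
  have \<tau>0: "0 < \<tau>0" "\<tau>0 \<le> 1" by (simp_all add: \<tau>0_def add_nonneg_pos)
  define B where "B = CP * 3 / m"
  have m: "0 < m" and B: "0 \<le> B" using q CP by (simp_all add: m_def B_def)
  obtain c C where c: "c > 0" and C: "C \<ge> 0" and step: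
    "\<And>z e \<tau> g. 0 \<le> g \<Longrightarrow> g \<le> 1 \<Longrightarrow> \<tau>0 \<le> \<tau> \<Longrightarrow> \<tau> \<le> 1 \<Longrightarrow> m \<le> z \<bullet> r \<Longrightarrow>
     m \<le> ((1 - g) *\<^sub>R z + (g * \<tau>) *\<^sub>R (z v* G) + e) \<bullet> r \<Longrightarrow> rnorm (proj z) \<le> B * (z \<bullet> r) \<Longrightarrow>
     rnorm (proj ((1 - g) *\<^sub>R z + (g * \<tau>) *\<^sub>R (z v* G) + e)) / (((1 - g) *\<^sub>R z + (g * \<tau>) *\<^sub>R (z v* G) + e) \<bullet> r)
       \<le> (1 - c * g) * (rnorm (proj z) / (z \<bullet> r)) + C * norm e"
    using normalized_contraction[OF m \<tau>0 B] by blast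
  define C1 where "C1 = CG * 2 + 2 + CJ + Cr"
  have C1: "C1 > 0" using CG CJ Cr by (simp add: C1_def)
  \<comment> \<open>Amplification from \<open>\<delta>\<close> to the final distance: the limit of
    the contraction times the bound for \<open>z \<bullet> r\<close>, plus the distance between
    \<open>th\<close> and \<open>zeta\<close>, passed through
    \<open>proj_small_imp_close\<close>.\<close>
  define C2 where "C2 = Cc * ((C * C1 + 1) / c + (C * C1 + 1)) * (norm r * 3) / q + Cc * 2 * CP / q + 1"
  define D where "D = max 1 C2"
  define \<delta> where "\<delta> = min (min 1 (q / (4 * (norm r + 1)))) (\<epsilon> / D)"
  have D: "D \<ge> 1" by (simp add: D_def)
  have nr: "0 < 4 * (norm r + 1)" by (simp add: add_nonneg_pos)
  have "0 < q / (4 * (norm r + 1))" using q nr by (rule divide_pos_pos)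
  then have \<delta>: "0 < \<delta>" "\<delta> \<le> 1" "\<delta> \<le> q / (4 * (norm r + 1))" "\<delta> \<le> \<epsilon> / D"
    using \<epsilon> D unfolding \<delta>_def by auto
  have \<delta>r: "2 * \<delta> * norm r \<le> m"
  proof -
    have "\<delta> * (4 * (norm r + 1)) \<le> q" using \<delta>(3) nr by (simp add: pos_le_divide_eq)
    moreover have "\<delta> * (4 * norm r) \<le> \<delta> * (4 * (norm r + 1))" using \<delta> by (intro mult_left_mono) auto
    ultimately show ?thesis by (simp add: m_def)
  qed
  show ?thesis
  proof (intro exI[of _ \<delta>] conjI allI)
    show "0 < \<delta>" by (rule \<delta>)
    fix k2
    define e where "e = \<delta> / (Cz + 1)"
    have e0: "e > 0" using \<delta> Cz by (simp add: e_def)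
    \<comment> \<open>Steps below \<open>e\<close> keep the corrector under \<open>\<delta>\<close>,
      steps below \<open>\<delta>\<close> turn second-order errors into multiples of
      \<open>gk (Suc k) * \<delta>\<close>, and steps below \<open>1 / c\<close> keep the
      contraction factor nonnegative.\<close>
    define e' where "e' = min (min e \<delta>) (1 / c)"
    have e'0: "0 < e'" using e0 \<delta> c by (simp add: e'_def)
    obtain k3 where k3: "k3 \<ge> max k1 k2" "\<And>k. k3 \<le> k \<Longrightarrow> gk k \<le> e'"
      using gk_eventually_small[OF e'0] by blast
    have sm: "c * gk (Suc k) \<le> 1" if "k3 \<le> k" for k
    proof -
      have "gk (Suc k) \<le> 1 / c" using k3(2)[of "Suc k"] that unfolding e'_def by linarith
      then show ?thesis using c by (simp add: field_simps)
    qed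
    have "0 < C * C1 * \<delta> + \<delta>" using C C1 \<delta> by (simp add: add_nonneg_pos)
    then have Cp: "0 < C * C1 * \<delta> + \<delta>" .
    have "1 \<le> k3" using k3(1) k1 by simp
    from recursion_eventually_small[where B = B, OF c Cp this sm]
    obtain k0 where k0: "k0 \<ge> k3" and rec0: "\<forall>w n. w k3 \<le> B \<longrightarrow>
       (\<forall>k. k3 \<le> k \<longrightarrow> k < n \<longrightarrow> w (Suc k) \<le> (1 - c * gk (Suc k)) * w k + gk (Suc k) * (C * C1 * \<delta> + \<delta>)) \<longrightarrow>
       (\<forall>k. k0 \<le> k \<longrightarrow> k \<le> n \<longrightarrow> w k \<le> (C * C1 * \<delta> + \<delta>) / c + (C * C1 * \<delta> + \<delta>))"
      by blast
    have rec: "w k \<le> (C * C1 * \<delta> + \<delta>) / c + (C * C1 * \<delta> + \<delta>)"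
      if "w k3 \<le> B" "\<And>k. k3 \<le> k \<Longrightarrow> k < n \<Longrightarrow> w (Suc k) \<le> (1 - c * gk (Suc k)) * w k + gk (Suc k) * (C * C1 * \<delta> + \<delta>)"
        "k0 \<le> k" "k \<le> n" for w n k
      using rec0 that by blast
    show "\<exists>k0\<ge>k1. \<forall>th eta n. is_path th eta \<longrightarrow> (\<forall>k. k2 \<le> k \<longrightarrow> k \<le> n \<longrightarrow> norm (Xi th eta k) \<le> \<delta>) \<longrightarrow>
     (\<forall>k. k0 \<le> k \<longrightarrow> k \<le> n \<longrightarrow> norm (th k - \<theta>) \<le> \<epsilon>)"
    proof (intro exI[of _ k0] conjI allI impI)
      show "k1 \<le> k0" using k0 k3 by simp
      fix th eta n k
      assume p: "is_path th eta" and X: "\<forall>k. k2 \<le> k \<longrightarrow> k \<le> n \<longrightarrow> norm (Xi th eta k) \<le> \<delta>"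
        and k: "k0 \<le> k" "k \<le> n"
      define z where "z = zeta th eta"
      define w where "w k = rnorm (proj (z k)) / (z k \<bullet> r)" for k
      have th: "th k \<in> prob_simplex" for k using p by (simp add: is_path_def)
      have close: "norm (th k - z k) \<le> 2 * \<delta>" if k: "k3 \<le> k" "k \<le> n" for k
      proof -
        have "Cz * gk k \<le> Cz * e" using k3(2)[OF k(1)] Cz(1) unfolding e'_def by (intro mult_left_mono) auto
        also have "\<dots> \<le> (Cz + 1) * e" using e0 by simp
        also have "\<dots> = \<delta>" using Cz by (simp add: e_def)
        finally have "norm (th k - Xi th eta k - z k) \<le> \<delta>" using Cz(2)[OF p, of k] by (simp add: z_def)
        moreover have "norm (Xi th eta k) \<le> \<delta>" using X k k3(1) by simp
        ultimately show ?thesis using norm_triangle_ineq[of "th k - Xi th eta k - z k" "Xi th eta k"] by simp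
      qed
      have zr: "m \<le> z k \<bullet> r" and zn: "norm (z k) \<le> 3" if k: "k3 \<le> k" "k \<le> n" for k
      proof -
        have "(th k - z k) \<bullet> r \<le> norm (th k - z k) * norm r" by (rule norm_cauchy_schwarz)
        also have "\<dots> \<le> 2 * \<delta> * norm r" by (intro mult_right_mono close k) simp
        also have "\<dots> \<le> m" by (rule \<delta>r)
        finally show "m \<le> z k \<bullet> r" using simplex_r[OF th[of k]] by (simp add: inner_diff_left m_def)
        show "norm (z k) \<le> 3"
          using norm_triangle_ineq4[of "th k" "th k - z k"] close[OF k] simplex_norm_le_1[OF th[of k]] \<delta> by simp
      qed
      have zB: "rnorm (proj (z k)) \<le> B * (z k \<bullet> r)" if k: "k3 \<le> k" "k \<le> n" for k
      proof -
        have "rnorm (proj (z k)) \<le> CP * norm (z k)" by (rule CP(2))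
        also have "\<dots> \<le> CP * 3" using zn[OF k] CP(1) by (intro mult_left_mono) auto
        also have "\<dots> = B * m" using m by (simp add: B_def)
        also have "\<dots> \<le> B * (z k \<bullet> r)" using zr[OF k] B by (rule mult_left_mono)
        finally show ?thesis .
      qed
      have wk: "w k \<le> (C * C1 * \<delta> + \<delta>) / c + (C * C1 * \<delta> + \<delta>)"
      proof (rule rec[of w n, OF _ _ k])
        have "k3 \<le> n" using k k0 by simp
        then show "w k3 \<le> B" using zB[of k3] zr[of k3] m by (simp add: w_def divide_le_eq)
        fix k assume k: "k3 \<le> k" "k < n"
        define g where "g = gk (Suc k)"
        have g: "0 \<le> g" "g \<le> 1" unfolding g_def by (rule gk_nonneg gk_le_1)+
        have gd: "g \<le> \<delta>" using k3(2)[of "Suc k"] k unfolding e'_def g_def by linarith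
        \<comment> \<open>The normalization of \<open>pi (th k)\<close>, which stays between
          \<open>\<tau>0\<close> and 1. With it frozen the map is linear, so moving its argument
          from \<open>th k\<close> to \<open>z k\<close> is a linear error.\<close>
        define \<tau> where "\<tau> = 1 / (th k \<bullet> g1)"
        have tg: "1 \<le> th k \<bullet> g1" by (rule simplex_g1[OF th])
        have "th k \<bullet> g1 \<le> norm (th k) * norm g1" by (rule norm_cauchy_schwarz)
        also have "\<dots> \<le> 1 * norm g1" by (intro mult_right_mono simplex_norm_le_1 th) simp
        finally have tg2: "th k \<bullet> g1 \<le> norm g1 + 1" by simp
        have \<tau>: "\<tau>0 \<le> \<tau>" "\<tau> \<le> 1" using tg tg2 unfolding \<tau>_def \<tau>0_def
          by (auto intro!: divide_left_mono mult_pos_pos add_nonneg_pos simp: divide_le_eq)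
        define err where "err = z (Suc k) - ((1 - g) *\<^sub>R z k + (g * \<tau>) *\<^sub>R (z k v* G))"
        have zz: "z (Suc k) = (1 - g) *\<^sub>R z k + (g * \<tau>) *\<^sub>R (z k v* G) + err" by (simp add: err_def)
        define rem where "rem = z (Suc k) - z k - g *\<^sub>R ((pi (th k) - th k) - J *v Xi th eta k)"
        have "err = rem + g *\<^sub>R (\<tau> *\<^sub>R ((th k - z k) v* G) - (th k - z k) - J *v Xi th eta k)"
          by (simp add: err_def rem_def pi_def \<tau>_def[symmetric] vmult_diff_left algebra_simps)
        then have "norm err \<le> norm rem + g * norm (\<tau> *\<^sub>R ((th k - z k) v* G) - (th k - z k) - J *v Xi th eta k)"
          using norm_triangle_ineq[of rem "g *\<^sub>R (\<tau> *\<^sub>R ((th k - z k) v* G) - (th k - z k) - J *v Xi th eta k)"] g by simp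
        also have "\<dots> \<le> Cr * (g * \<delta>) + g * (CG * (2 * \<delta>) + 2 * \<delta> + CJ * \<delta>)"
        proof (intro add_mono mult_left_mono g)
          have "norm rem \<le> Cr * g^2" using Cr(2)[OF p, of k] k k3(1) unfolding rem_def z_def g_def by simp
          also have "\<dots> \<le> Cr * (g * \<delta>)" using gd g Cr(1) unfolding power2_eq_square by (intro mult_left_mono) auto
          finally show "norm rem \<le> Cr * (g * \<delta>)" .
          have k': "k3 \<le> k" "k \<le> n" using k by auto
          have n1: "norm (\<tau> *\<^sub>R ((th k - z k) v* G)) \<le> CG * (2 * \<delta>)"
          proof -
            have "norm (\<tau> *\<^sub>R ((th k - z k) v* G)) \<le> 1 * norm ((th k - z k) v* G)"
              using \<tau> \<tau>0 by (simp add: mult_left_le_one_le)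
            also have "\<dots> \<le> norm (th k - z k) * CG" using CG by simp
            also have "\<dots> \<le> 2 * \<delta> * CG" using close[OF k'] CG by (intro mult_right_mono) auto
            finally show ?thesis by (simp add: mult_ac)
          qed
          have n2: "norm (J *v Xi th eta k) \<le> CJ * \<delta>"
          proof -
            have "norm (Xi th eta k) \<le> \<delta>" using X k' k3(1) by simp
            then show ?thesis using CJ(2)[of "Xi th eta k"] CJ(1) by (meson mult_left_mono less_imp_le order_trans)
          qed
          show "norm (\<tau> *\<^sub>R ((th k - z k) v* G) - (th k - z k) - J *v Xi th eta k) \<le> CG * (2 * \<delta>) + 2 * \<delta> + CJ * \<delta>"
            by (intro order_trans[OF norm_triangle_ineq4] add_mono n1 n2 close[OF k'])
        qed
        also have "\<dots> = g * (C1 * \<delta>)" by (simp add: C1_def algebra_simps)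
        finally have ne: "norm err \<le> g * (C1 * \<delta>)" .
        have "w (Suc k) \<le> (1 - c * g) * w k + C * norm err"
          unfolding w_def zz
          by (rule step) (use g \<tau> zr[of k] zr[of "Suc k"] zB[of k] k in \<open>auto simp: zz[symmetric]\<close>)
        also have "\<dots> \<le> (1 - c * g) * w k + C * (g * (C1 * \<delta>))" using ne C by (intro add_left_mono mult_left_mono)
        also have "\<dots> \<le> (1 - c * g) * w k + g * (C * C1 * \<delta> + \<delta>)"
          using g \<delta> by (simp add: algebra_simps)
        finally show "w (Suc k) \<le> (1 - c * gk (Suc k)) * w k + gk (Suc k) * (C * C1 * \<delta> + \<delta>)"
          by (simp add: g_def)
      qed
      have k': "k3 \<le> k" "k \<le> n" using k k0 by auto
      have "q * norm (proj (th k)) \<le> rnorm (proj (th k))"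
      proof -
        have "q * norm (proj (th k)) \<le> q * (\<Sum>x\<in>UNIV. \<bar>proj (th k) $ x\<bar>)"
          using q by (intro mult_left_mono norm_le_l1_cart) auto
        also have "\<dots> \<le> rnorm (proj (th k))"
          unfolding rnorm_def sum_distrib_left by (intro sum_mono) (simp add: mult.commute[of _ "r $ _"] qx mult_right_mono)
        finally show ?thesis .
      qed
      also have "rnorm (proj (th k)) \<le> rnorm (proj (z k)) + rnorm (proj (th k - z k))"
        using rnorm_triangle[of "proj (z k)" "proj (th k - z k)"] unfolding proj_add[symmetric] by simp
      also have "\<dots> \<le> ((C * C1 + 1) / c + (C * C1 + 1)) * (norm r * 3) * \<delta> + CP * (2 * \<delta>)"
      proof (rule add_mono)
        have zp: "0 < z k \<bullet> r" using zr[OF k'] m by simp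
        have zle: "z k \<bullet> r \<le> norm r * 3"
          using norm_cauchy_schwarz[of "z k" r] mult_right_mono[OF zn[OF k'], of "norm r"] by (simp add: mult.commute)
        have "rnorm (proj (z k)) = w k * (z k \<bullet> r)" using zp by (simp add: w_def)
        also have "\<dots> \<le> ((C * C1 * \<delta> + \<delta>) / c + (C * C1 * \<delta> + \<delta>)) * (norm r * 3)"
          using wk zle zp c C C1 \<delta> by (intro mult_mono) (auto intro!: add_nonneg_nonneg divide_nonneg_pos)
        also have "\<dots> = ((C * C1 + 1) / c + (C * C1 + 1)) * (norm r * 3) * \<delta>"
          by (simp add: algebra_simps add_divide_distrib)
        finally show "rnorm (proj (z k)) \<le> ((C * C1 + 1) / c + (C * C1 + 1)) * (norm r * 3) * \<delta>" .
        show "rnorm (proj (th k - z k)) \<le> CP * (2 * \<delta>)"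
          using CP(2)[of "th k - z k"] close[OF k'] CP(1) by (meson mult_left_mono less_imp_le order_trans)
      qed
      finally have "norm (proj (th k)) \<le> (((C * C1 + 1) / c + (C * C1 + 1)) * (norm r * 3) * \<delta> + CP * (2 * \<delta>)) / q"
        using q by (simp add: pos_le_divide_eq mult.commute)
      then have "norm (th k - \<theta>) \<le> Cc * ((((C * C1 + 1) / c + (C * C1 + 1)) * (norm r * 3) * \<delta> + CP * (2 * \<delta>)) / q)"
        using Cc(2)[OF th[of k]] Cc(1) by (meson mult_left_mono order_trans)
      also have "\<dots> = (C2 - 1) * \<delta>" unfolding C2_def by (simp add: add_divide_distrib algebra_simps)
      also have "\<dots> \<le> D * \<delta>" using \<delta> by (intro mult_right_mono) (auto simp: D_def)
      also have "\<dots> \<le> \<epsilon>" using \<delta>(4) D by (simp add: pos_le_divide_eq mult.commute)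
      finally show "norm (th k - \<theta>) \<le> \<epsilon>" .
    qed
  qed
qed

text \<open>Linearizing at \<open>\<theta>\<close> leaves an error quadratic in
  \<open>th k - \<theta>\<close>. The part proportional to \<open>zeta - \<theta>\<close>, with
  small factor, is paid by lowering the rate from \<open>Lq\<close> to \<open>Lr\<close>, still
  above \<open>1 / \<gamma>\<close>; the square of \<open>Xi\<close> remains as a source.\<close>

lemma local_recursion:
  "\<exists>Lr \<epsilon> C. 1 < \<gamma> * Lr \<and> Lr \<le> Lq \<and> 0 < \<epsilon> \<and> 0 \<le> C \<and> (\<forall>th eta k. is_path th eta \<longrightarrow> k1 \<le> k \<longrightarrow> norm (th k - \<theta>) \<le> \<epsilon> \<longrightarrow>
     nS (zeta th eta (Suc k) - \<theta>) \<le> (1 - gk (Suc k) * Lr) * nS (zeta th eta k - \<theta>)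
        + C * gk (Suc k) * (norm (Xi th eta k))^2 + C * (gk (Suc k))^2)"
proof -
  obtain Cz where Cz: "Cz > 0" "\<And>th eta k. is_path th eta \<Longrightarrow> norm (th k - Xi th eta k - zeta th eta k) \<le> Cz * gk k"
    using zeta_close by blast
  obtain Cr where Cr: "Cr > 0" "\<And>th eta k. is_path th eta \<Longrightarrow> k1 \<le> k \<Longrightarrow>
     norm (zeta th eta (Suc k) - zeta th eta k - gk (Suc k) *\<^sub>R ((pi (th k) - th k) - J *v Xi th eta k)) \<le> Cr * (gk (Suc k))^2"
    using zeta_recursion by blast
  obtain CJ where CJ: "CJ > 0" "\<And>x. norm (J *v x) \<le> CJ * norm x" using J_bound by blast
  obtain CS where CS: "CS > 0" "\<And>x. nS x \<le> CS * norm x" using nS_le by blast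
  obtain Ch where Ch: "Ch \<ge> 0" "\<And>\<nu>. \<nu> \<in> prob_simplex \<Longrightarrow> norm (pi \<nu> - \<nu> - J *v (\<nu> - \<theta>)) \<le> Ch * (norm (\<nu> - \<theta>))^2"
    using h_quadratic[of L] unfolding J_mult by blast
  define Lr where "Lr = (Lq + 1 / \<gamma>) / 2"
  have Lq1: "1 / \<gamma> < Lq" using Lq \<gamma> by (simp add: field_simps)
  have Lr: "1 < \<gamma> * Lr" "Lr \<le> Lq" "Lr < Lq" using Lq1 \<gamma> by (simp_all add: Lr_def field_simps)
  \<comment> \<open>Small enough that \<open>2 * \<epsilon> * (CS * Ch)\<close> fits into the gap
    \<open>Lq - Lr\<close>.\<close>
  define \<epsilon> where "\<epsilon> = min 1 ((Lq - Lr) / (2 * (CS * Ch + 1)))"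
  have d: "0 < 2 * (CS * Ch + 1)" using CS Ch by (simp add: add_nonneg_pos)
  have \<epsilon>: "0 < \<epsilon>" "\<epsilon> \<le> 1" "2 * \<epsilon> * (CS * Ch) \<le> Lq - Lr"
  proof -
    show "0 < \<epsilon>" "\<epsilon> \<le> 1" using Lr d by (auto simp: \<epsilon>_def)
    then have "2 * \<epsilon> * (CS * Ch) \<le> \<epsilon> * (2 * (CS * Ch + 1))" by (simp add: algebra_simps)
    also have "\<dots> \<le> Lq - Lr"
    proof -
      have "\<epsilon> \<le> (Lq - Lr) / (2 * (CS * Ch + 1))" by (simp add: \<epsilon>_def)
      then show ?thesis using d by (simp add: pos_le_divide_eq)
    qed
    finally show "2 * \<epsilon> * (CS * Ch) \<le> Lq - Lr" .
  qed
  define C where "C = CS * (Ch + 2 * CJ * Cz + 4 * Ch * Cz + Cr)"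
  have C0: "0 \<le> C" using CS Ch CJ Cz Cr by (simp add: C_def)
  have "nS (zeta th eta (Suc k) - \<theta>) \<le> (1 - gk (Suc k) * Lr) * nS (zeta th eta k - \<theta>)
        + C * gk (Suc k) * (norm (Xi th eta k))^2 + C * (gk (Suc k))^2"
    if p: "is_path th eta" and k: "k1 \<le> k" and close: "norm (th k - \<theta>) \<le> \<epsilon>" for th eta k
  proof -
    define g where "g = gk (Suc k)"
    define z where "z = zeta th eta k - \<theta>"
    define X where "X = Xi th eta k"
    define v where "v = th k - X - zeta th eta k"
    define y where "y = th k - \<theta>"
    have g: "0 \<le> g" unfolding g_def by (rule gk_nonneg)
    have thk: "th k \<in> prob_simplex" using p by (simp add: is_path_def)
    have y: "y = z + X + v" by (simp add: y_def z_def v_def)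
    have nv: "norm v \<le> 2 * Cz * g"
    proof -
      have "norm v \<le> Cz * gk k" using Cz(2)[OF p] by (simp add: v_def X_def)
      also have "\<dots> \<le> Cz * (2 * g)" unfolding g_def using k k1 Cz by (intro mult_left_mono gk_half) auto
      finally show ?thesis by (simp add: mult_ac)
    qed
    define e1 where "e1 = pi (th k) - th k - J *v y"
    have ne1: "norm e1 \<le> Ch * (norm y)^2" unfolding e1_def y_def by (rule Ch(2)[OF thk])
    \<comment> \<open>One factor \<open>norm y\<close> is bounded by \<open>\<epsilon>\<close>,
      except against \<open>norm X\<close>: there Young's inequality keeps the full square, whose
      mean will be of order 1/k.\<close>
    have y2: "(norm y)^2 \<le> 2 * \<epsilon> * norm z + 4 * \<epsilon> * Cz * g + (norm X)^2"
    proof -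
      have yn: "norm y \<le> norm z + norm X + 2 * Cz * g"
        unfolding y using nv by (intro order_trans[OF norm_triangle_ineq] add_mono norm_triangle_ineq) auto
      have ye: "norm y \<le> \<epsilon>" using close by (simp add: y_def)
      have "(norm y)^2 \<le> (norm z + norm X + 2 * Cz * g) * norm y"
        unfolding power2_eq_square by (intro mult_right_mono yn) simp
      also have "\<dots> = (norm z + 2 * Cz * g) * norm y + norm X * norm y" by (simp add: algebra_simps)
      also have "\<dots> \<le> (norm z + 2 * Cz * g) * \<epsilon> + ((norm X)^2 / 2 + (norm y)^2 / 2)"
      proof (intro add_mono mult_left_mono ye)
        show "0 \<le> norm z + 2 * Cz * g" using g Cz by simp
        have "0 \<le> (norm X - norm y)^2" by simp
        then show "norm X * norm y \<le> (norm X)^2 / 2 + (norm y)^2 / 2" by (simp add: power2_diff)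
      qed
      finally show ?thesis by (simp add: algebra_simps)
    qed
    define rem where "rem = zeta th eta (Suc k) - zeta th eta k - g *\<^sub>R ((pi (th k) - th k) - J *v X)"
    have nrem: "norm rem \<le> Cr * g^2" unfolding rem_def g_def X_def by (rule Cr(2)[OF p k])
    have Jy: "J *v y = J *v z + J *v X + J *v v" by (simp only: y matrix_vector_right_distrib)
    have "zeta th eta (Suc k) - \<theta> = z + g *\<^sub>R ((pi (th k) - th k) - J *v X) + rem"
      by (simp add: rem_def z_def)
    also have "(pi (th k) - th k) - J *v X = J *v z + (e1 + J *v v)" by (simp add: e1_def Jy)
    finally have "zeta th eta (Suc k) - \<theta> = (z + g *\<^sub>R (J *v z)) + (g *\<^sub>R (e1 + J *v v) + rem)"
      by (simp add: scaleR_add_right)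
    then have "nS (zeta th eta (Suc k) - \<theta>) \<le> nS (z + g *\<^sub>R (J *v z)) + nS (g *\<^sub>R (e1 + J *v v) + rem)"
      by (simp only: nS_triangle)
    also have "\<dots> \<le> (1 - g * Lq) * nS z + CS * (g * (Ch * (2 * \<epsilon> * norm z + 4 * \<epsilon> * Cz * g + (norm X)^2) + CJ * (2 * Cz * g)) + Cr * g^2)"
    proof (rule add_mono)
      show "nS (z + g *\<^sub>R (J *v z)) \<le> (1 - g * Lq) * nS z" unfolding g_def by (rule nS_contr[OF k])
      have "nS (g *\<^sub>R (e1 + J *v v) + rem) \<le> CS * norm (g *\<^sub>R (e1 + J *v v) + rem)" by (rule CS(2))
      also have "\<dots> \<le> CS * (g * (norm e1 + norm (J *v v)) + norm rem)"
        using CS(1) g norm_triangle_ineq[of "g *\<^sub>R (e1 + J *v v)" rem] mult_left_mono[OF norm_triangle_ineq[of e1 "J *v v"] g]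
        by (intro mult_left_mono) auto
      also have "\<dots> \<le> CS * (g * (Ch * (2 * \<epsilon> * norm z + 4 * \<epsilon> * Cz * g + (norm X)^2) + CJ * (2 * Cz * g)) + Cr * g^2)"
      proof (intro mult_left_mono add_mono nrem g)
        show "norm e1 \<le> Ch * (2 * \<epsilon> * norm z + 4 * \<epsilon> * Cz * g + (norm X)^2)"
          using ne1 mult_left_mono[OF y2 Ch(1)] by (rule order_trans)
        show "norm (J *v v) \<le> CJ * (2 * Cz * g)"
          using CJ(2)[of v] nv CJ(1) by (meson mult_left_mono less_imp_le order_trans)
      qed (use CS in simp)
      finally show "nS (g *\<^sub>R (e1 + J *v v) + rem) \<le> CS * (g * (Ch * (2 * \<epsilon> * norm z + 4 * \<epsilon> * Cz * g + (norm X)^2) + CJ * (2 * Cz * g)) + Cr * g^2)" .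
    qed
    also have "\<dots> = (1 - g * Lq) * nS z + g * (2 * \<epsilon> * (CS * Ch)) * norm z + CS * Ch * g * (norm X)^2
        + CS * (4 * \<epsilon> * Ch * Cz + 2 * CJ * Cz + Cr) * g^2"
      by (simp add: power2_eq_square algebra_simps)
    also have "\<dots> \<le> (1 - g * Lq) * nS z + g * (Lq - Lr) * nS z + C * g * (norm X)^2 + C * g^2"
    proof (intro add_mono order_refl)
      show "g * (2 * \<epsilon> * (CS * Ch)) * norm z \<le> g * (Lq - Lr) * nS z"
        using g \<epsilon> CS Ch Lr by (intro mult_mono norm_le_nS mult_left_mono) auto
      have "CS * Ch \<le> C" unfolding C_def using CS Ch CJ Cz Cr by (intro mult_left_mono) auto
      then show "CS * Ch * g * (norm X)^2 \<le> C * g * (norm X)^2" using g by (intro mult_right_mono) auto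
      have "4 * \<epsilon> * Ch * Cz \<le> 4 * 1 * Ch * Cz" using \<epsilon> Ch Cz by (intro mult_right_mono mult_left_mono) auto
      then have "CS * (4 * \<epsilon> * Ch * Cz + 2 * CJ * Cz + Cr) \<le> C"
        unfolding C_def using CS Ch by (intro mult_left_mono) auto
      then show "CS * (4 * \<epsilon> * Ch * Cz + 2 * CJ * Cz + Cr) * g^2 \<le> C * g^2" by (intro mult_right_mono) auto
    qed
    also have "\<dots> = (1 - g * Lr) * nS z + C * g * (norm X)^2 + C * g^2" by (simp add: algebra_simps)
    finally show ?thesis by (simp add: g_def z_def X_def)
  qed
  then show ?thesis using Lr \<epsilon> C0 by blast
qed

end

section \<open>Second moments of the linear part\<close>

context qsd_chain
begin

definition rvec :: "real^'s \<Rightarrow> real^'s \<Rightarrow> real^'s" where "rvec \<nu> u = G *v u - (pi \<nu> \<bullet> u) *\<^sub>R g1"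

lemma rop_inner: "rop \<nu> x \<bullet> u = x \<bullet> rvec \<nu> u"
  by (simp add: rop_def rvec_def inner_diff_left inner_diff_right dot_lmul_matrix)

lemma pi_measurable: "f \<in> borel_measurable L \<Longrightarrow> (\<lambda>z. pi (f z)) \<in> borel_measurable L"
proof -
  assume f: "f \<in> borel_measurable L"
  have "(\<lambda>z. f z v* G) \<in> borel_measurable L"
    by (rule measurable_compose[OF f])
      (intro borel_measurable_continuous_onI bounded_linear.continuous_on[OF bounded_linear_vmult] continuous_on_id)
  then show ?thesis using f unfolding pi_def by measurable
qed

lemma matrix_vector_measurable:
  "f \<in> borel_measurable L \<Longrightarrow> (\<lambda>z. (M :: real^'n^'m) *v f z) \<in> borel_measurable L"
  by (erule measurable_compose)
    (intro borel_measurable_continuous_onI bounded_linear.continuous_on[OF matrix_vector_mul_bounded_linear] continuous_on_id)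

lemma rvec_measurable:
  assumes "f \<in> borel_measurable L" "v \<in> borel_measurable L"
  shows "(\<lambda>z. rvec (f z) (v z)) \<in> borel_measurable L"
  unfolding rvec_def
  by (intro borel_measurable_diff matrix_vector_measurable borel_measurable_scaleR borel_measurable_inner
      pi_measurable borel_measurable_const assms)

lemma rvec_bound: "\<exists>C>0. \<forall>\<nu>\<in>prob_simplex. \<forall>u. norm (rvec \<nu> u) \<le> C * norm u"
proof -
  obtain c where c: "0 < c" "\<And>x. norm (G *v x) \<le> norm x * c"
    using bounded_linear.pos_bounded[OF matrix_vector_mul_bounded_linear[of G]] by auto
  have "norm (rvec \<nu> u) \<le> (c + norm g1) * norm u" if \<nu>: "\<nu> \<in> prob_simplex" for \<nu> u
  proof -
    have "norm (rvec \<nu> u) \<le> norm (G *v u) + \<bar>pi \<nu> \<bullet> u\<bar> * norm g1"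
      unfolding rvec_def using norm_triangle_ineq4[of "G *v u" "(pi \<nu> \<bullet> u) *\<^sub>R g1"] by simp
    also have "\<dots> \<le> norm u * c + (norm (pi \<nu>) * norm u) * norm g1"
      by (intro add_mono c mult_right_mono Cauchy_Schwarz_ineq2) simp
    also have "\<dots> \<le> norm u * c + (1 * norm u) * norm g1"
      by (intro add_left_mono mult_right_mono simplex_norm_le_1 pi_simplex \<nu>) auto
    finally show ?thesis by (simp add: algebra_simps)
  qed
  then show ?thesis using c(1) by (intro exI[of _ "c + norm g1"]) (auto intro: add_pos_nonneg)
qed

end

lemma kvar_bound:
  assumes ch: "absorbed_chain P" and \<nu>: "\<nu> \<in> prob_simplex" and B: "\<And>x. \<bar>c $ x\<bar> \<le> B"
  shows "0 \<le> kvar (K P \<nu>) c $ w" "kvar (K P \<nu>) c $ w \<le> B^2"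
proof -
  show "0 \<le> kvar (K P \<nu>) c $ w"
    unfolding kvar_centered[OF K_row[OF ch \<nu>]] by (intro sum_nonneg mult_nonneg_nonneg K_nonneg[OF ch \<nu>]) simp
  have "kvar (K P \<nu>) c $ w \<le> (\<Sum>u\<in>UNIV. K P \<nu> $ w $ u * (c $ u)^2)" by (simp add: kvar_def)
  also have "\<dots> \<le> (\<Sum>u\<in>UNIV. K P \<nu> $ w $ u * B^2)"
  proof (intro sum_mono mult_left_mono K_nonneg[OF ch \<nu>])
    fix u
    have "\<bar>c $ u\<bar>^2 \<le> B^2" using B by (intro power_mono) auto
    then show "(c $ u)^2 \<le> B^2" by simp
  qed
  also have "\<dots> = B^2" unfolding sum_distrib_right[symmetric] K_row[OF ch \<nu>] by simp
  finally show "kvar (K P \<nu>) c $ w \<le> B^2" .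
qed

lemma simplex_inner_bounds:
  assumes "\<eta> \<in> prob_simplex" "\<And>w. 0 \<le> f $ w" "\<And>w. f $ w \<le> B"
  shows "0 \<le> \<eta> \<bullet> f" "\<eta> \<bullet> f \<le> B"
proof -
  show "0 \<le> \<eta> \<bullet> f" using inner_mono_nonneg[of \<eta> 0 f] assms simplex_nonneg by auto
  have "\<eta> \<bullet> f \<le> \<eta> \<bullet> (B *\<^sub>R 1)" using assms by (intro inner_mono_nonneg simplex_nonneg) auto
  then show "\<eta> \<bullet> f \<le> B" by (simp add: simplex_inner_one[OF assms(1)])
qed

lemma sum_inverse_squares_le: "(\<Sum>m=1..n. 1 / (real m)^2) \<le> 2"
proof -
  have "(\<Sum>m=1..n. 1 / (real m)^2) \<le> 2 - 1 / real (max 1 n)"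
  proof (induction n)
    case 0
    then show ?case by simp
  next
    case (Suc n)
    show ?case
    proof (cases "n = 0")
      case True
      then show ?thesis by simp
    next
      case False
      then have n: "real n > 0" by simp
      have "1 / (real (Suc n))^2 \<le> 1 / (real n * real (Suc n))"
        using n by (intro divide_left_mono) (auto simp: power2_eq_square)
      also have "\<dots> = 1 / real n - 1 / real (Suc n)" using n by (simp add: diff_frac_eq)
      finally show ?thesis using Suc False by (simp add: max_def split: if_splits)
    qed
  qed
  also have "\<dots> \<le> 2" by simp
  finally show ?thesis .
qed

lemma (in prob_space) bounded_integrable:
  fixes f :: "'a \<Rightarrow> 'b::{banach, second_countable_topology}"
  assumes "f \<in> borel_measurable M" "\<And>z. norm (f z) \<le> B" shows "integrable M f"
  by (rule integrable_const_bound[of _ B]) (use assms in auto)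

lemma (in prob_space) expectation_bounds:
  fixes f :: "'a \<Rightarrow> real"
  assumes "f \<in> borel_measurable M" "\<And>z. 0 \<le> f z" "\<And>z. f z \<le> B"
  shows "0 \<le> expectation f" "expectation f \<le> B"
proof -
  show "0 \<le> expectation f" using assms(2) by (rule Bochner_Integration.integral_nonneg)
  have i: "integrable M f" by (rule bounded_integrable[of _ B]) (use assms in auto)
  have "expectation f \<le> expectation (\<lambda>z. B)" by (rule integral_mono[OF i]) (use assms in auto)
  then show "expectation f \<le> B" by (simp add: prob_space)
qed

lemma (in prob_space) markov_bound:
  fixes f :: "'a \<Rightarrow> real"
  assumes f: "f \<in> borel_measurable M" "\<And>z. 0 \<le> f z" "\<And>z. f z \<le> B" and c: "c > 0"
  shows "prob {z\<in>space M. f z > c} \<le> expectation f / c"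
proof -
  have i: "integrable M f" by (rule bounded_integrable[of _ B]) (use f in auto)
  have "prob {z\<in>space M. f z > c} \<le> prob {z\<in>space M. f z \<ge> c}"
    using f(1) by (intro finite_measure_mono) auto
  also have "\<dots> \<le> expectation f / c"
    by (rule integral_Markov_inequality_measure[OF i]) (use f c in auto)
  finally show ?thesis .
qed

section \<open>The sequence of particle systems and its second moments\<close>

locale clt_setup = clt_lyap P \<theta> L \<gamma> S Lq k1 + prob_space M
  for P :: "real ^ ('s::finite) option ^ 's option" and \<theta> L \<gamma> S Lq k1 and M :: "'w measure" +
  fixes a :: "nat \<Rightarrow> nat" and x0 :: 's and X :: "nat \<Rightarrow> nat \<Rightarrow> nat \<Rightarrow> 'w \<Rightarrow> 's"
  assumes a_pos: "\<And>n. n \<ge> 1 \<Longrightarrow> a n > 0" and a_lim: "filterlim a at_top at_top"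
    and a_rate: "(\<lambda>n. real (a n) / real n) \<longlonglongrightarrow> 0"
    and alg: "\<And>n. n \<ge> 1 \<Longrightarrow> algorithm_I M P \<gamma> (a n) x0 (X n)"
begin

text \<open>The outcome comes before the time, so that \<open>th n z\<close> and
  \<open>et n z\<close> are sequences to which the pathwise estimates apply.\<close>

definition "th n z k = weighted_occupation \<gamma> (a n) x0 (X n) k z"
definition "et n z k = particles.\<eta>k (a n) (X n) k z"
definition "Xn n k z = Xi (th n z) (et n z) k"
abbreviation "Fn n k \<equiv> particle_filtration M (a n) (X n) k"

lemma particles_n: assumes "1 \<le> n" shows "particles M P \<gamma> (a n) x0 (X n)"
  by unfold_locales (use assms alg a_pos \<gamma> chain in auto)

lemma path_n: assumes n: "1 \<le> n" shows "is_path (th n z) (et n z)"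
proof -
  interpret p: particles M P \<gamma> "a n" x0 "X n" by (rule particles_n[OF n])
  show ?thesis unfolding is_path_def th_def et_def using p.\<theta>k_simplex p.\<eta>k_simplex p.\<theta>k_Suc by blast
qed

lemma th_measurable: assumes n: "1 \<le> n" shows "(\<lambda>z. th n z k) \<in> borel_measurable (Fn n k)"
proof -
  interpret p: particles M P \<gamma> "a n" x0 "X n" by (rule particles_n[OF n])
  show ?thesis unfolding th_def by (rule p.\<theta>k_measurable)
qed

lemma et_measurable: assumes n: "1 \<le> n" shows "(\<lambda>z. et n z k) \<in> borel_measurable (Fn n k)"
proof -
  interpret p: particles M P \<gamma> "a n" x0 "X n" by (rule particles_n[OF n])
  show ?thesis unfolding et_def by (rule p.\<eta>k_measurable)
qed

lemma Fn_Suc: assumes n: "1 \<le> n" and "f \<in> measurable (Fn n k) N" shows "f \<in> measurable (Fn n (Suc k)) N"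
proof -
  interpret p: particles M P \<gamma> "a n" x0 "X n" by (rule particles_n[OF n])
  show ?thesis by (rule p.measurable_Fk_Suc[OF assms(2)])
qed

lemma Fn_M: assumes n: "1 \<le> n" and "f \<in> measurable (Fn n k) N" shows "f \<in> measurable M N"
proof -
  interpret p: particles M P \<gamma> "a n" x0 "X n" by (rule particles_n[OF n])
  show ?thesis by (rule p.measurable_Fk_M[OF assms(2)])
qed

definition "dn n k z = et n z (Suc k) - et n z k v* K P (th n z k)"

lemma xi_dn: "xi (th n z) (et n z) k \<bullet> u = dn n k z \<bullet> rvec (th n z k) u"
  by (simp add: xi_def rop_inner dn_def)

lemma vmult_measurable: "f \<in> borel_measurable N \<Longrightarrow> (\<lambda>z. f z v* (Mx :: real^'m^'n)) \<in> borel_measurable N"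
  by (erule measurable_compose)
    (intro borel_measurable_continuous_onI bounded_linear.continuous_on[OF bounded_linear_vmult] continuous_on_id)

lemma xi_measurable: assumes n: "1 \<le> n"
  shows "(\<lambda>z. xi (th n z) (et n z) k) \<in> borel_measurable (Fn n (Suc k))"
  unfolding xi_def rop_def vmult_K
  by (intro borel_measurable_diff borel_measurable_add borel_measurable_scaleR borel_measurable_inner
      vmult_measurable pi_measurable borel_measurable_const et_measurable[OF n]
      Fn_Suc[OF n et_measurable[OF n]] Fn_Suc[OF n th_measurable[OF n]])

lemma Xn_measurable: assumes n: "1 \<le> n" shows "Xn n k \<in> borel_measurable (Fn n k)"
proof (induction k)
  case 0
  have "Xn n 0 = (\<lambda>z. 0)" by (simp add: Xn_def[abs_def])
  then show ?case by simp
next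
  case (Suc k)
  show ?case
  proof (cases "k < k1")
    case True
    then have "Xn n (Suc k) = (\<lambda>z. 0)" by (simp add: Xn_def[abs_def])
    then show ?thesis by simp
  next
    case False
    then have "Xn n (Suc k) = (\<lambda>z. (Xn n k z + gk (Suc k) *\<^sub>R (J *v Xn n k z)) + gk (Suc k) *\<^sub>R xi (th n z) (et n z) k)"
      by (simp add: Xn_def[abs_def] fun_eq_iff)
    then show ?thesis
      by (simp only:) (intro borel_measurable_add borel_measurable_scaleR matrix_vector_measurable
        borel_measurable_const xi_measurable[OF n] Fn_Suc[OF n Suc])
  qed
qed

lemma dn_first:
  assumes n: "1 \<le> n" and Y: "Y \<in> borel_measurable (Fn n k)" "\<And>z. \<bar>Y z\<bar> \<le> BY"
    and c: "c \<in> borel_measurable (Fn n k)" "\<And>z. norm (c z) \<le> Bc"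
  shows "expectation (\<lambda>z. Y z * (dn n k z \<bullet> c z)) = 0"
proof -
  interpret p: particles M P \<gamma> "a n" x0 "X n" by (rule particles_n[OF n])
  have "expectation (\<lambda>z. Y z * (p.Dk k z \<bullet> c z)) = 0"
    by (rule p.expectation_Dk[OF Y c(1)]) (rule order_trans[OF component_le_norm_cart c(2)])
  then show ?thesis by (simp add: dn_def p.Dk_def th_def et_def)
qed

lemma dn_second:
  assumes n: "1 \<le> n" and Y: "Y \<in> borel_measurable (Fn n k)" "\<And>z. \<bar>Y z\<bar> \<le> BY"
    and c: "c \<in> borel_measurable (Fn n k)" "\<And>z. norm (c z) \<le> Bc"
  shows "expectation (\<lambda>z. Y z * (dn n k z \<bullet> c z)^2) =
    expectation (\<lambda>z. Y z * ((1 / real (a n)) * (et n z k \<bullet> kvar (K P (th n z k)) (c z))))"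
proof -
  interpret p: particles M P \<gamma> "a n" x0 "X n" by (rule particles_n[OF n])
  have "expectation (\<lambda>z. Y z * (p.Dk k z \<bullet> c z)^2) =
    expectation (\<lambda>z. Y z * ((1 / real (a n)) * (p.\<eta>k k z \<bullet> kvar (K P (weighted_occupation \<gamma> (a n) x0 (X n) k z)) (c z))))"
    by (rule p.expectation_Dk_square[OF Y c(1)]) (rule order_trans[OF component_le_norm_cart c(2)])
  then show ?thesis by (simp add: dn_def p.Dk_def th_def et_def)
qed

lemma dn_measurable: assumes n: "1 \<le> n" shows "dn n k \<in> borel_measurable (Fn n (Suc k))"
  unfolding dn_def[abs_def] vmult_K
  by (intro borel_measurable_diff borel_measurable_add borel_measurable_scaleR borel_measurable_inner
      vmult_measurable borel_measurable_const et_measurable[OF n]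
      Fn_Suc[OF n et_measurable[OF n]] Fn_Suc[OF n th_measurable[OF n]])

lemma path_simplex: assumes n: "1 \<le> n" shows "th n z k \<in> prob_simplex" "et n z k \<in> prob_simplex"
  using path_n[OF n, of z] by (auto simp: is_path_def)

lemma dn_bound: assumes n: "1 \<le> n" shows "norm (dn n k z) \<le> 2"
proof -
  have "norm (dn n k z) \<le> norm (et n z (Suc k)) + norm (et n z k v* K P (th n z k))"
    unfolding dn_def by (rule norm_triangle_ineq4)
  also have "\<dots> \<le> 1 + 1" by (intro add_mono simplex_norm_le_1 vmult_K_simplex path_simplex n)
  finally show ?thesis by simp
qed

text \<open>Each coordinate has variance at most \<open>1 / a n\<close>, by averaging over the
  particles.\<close>

lemma dn_second_moment: assumes n: "1 \<le> n"
  shows "expectation (\<lambda>z. (norm (dn n k z))^2) \<le> real CARD('s) / real (a n)"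
proof -
  have m: "dn n k \<in> borel_measurable M" by (rule Fn_M[OF n dn_measurable[OF n]])
  have int: "integrable M (\<lambda>z. (dn n k z \<bullet> axis x 1)^2)" for x
  proof (rule bounded_integrable[of _ "(2 * 1)^2"])
    show "(\<lambda>z. (dn n k z \<bullet> axis x 1)^2) \<in> borel_measurable M" using m by measurable
    have "\<bar>dn n k z \<bullet> axis x 1\<bar> \<le> 2 * 1" for z
      using Cauchy_Schwarz_ineq2[of "dn n k z" "axis x 1"] dn_bound[OF n, of k z] by (simp add: norm_axis_1)
    then show "norm ((dn n k z \<bullet> axis x 1)^2) \<le> (2 * 1)^2" for z
      by (metis norm_power real_norm_def power_mono abs_ge_zero)
  qed
  have "expectation (\<lambda>z. (norm (dn n k z))^2) = expectation (\<lambda>z. \<Sum>x\<in>UNIV. (dn n k z \<bullet> axis x 1)^2)"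
    by (simp add: norm_vec_def L2_set_def sum_nonneg inner_axis)
  also have "\<dots> = (\<Sum>x\<in>UNIV. expectation (\<lambda>z. 1 * (dn n k z \<bullet> axis x 1)^2))"
    using int by (subst Bochner_Integration.integral_sum) auto
  also have "\<dots> = (\<Sum>x\<in>UNIV. expectation (\<lambda>z. 1 * ((1 / real (a n)) * (et n z k \<bullet> kvar (K P (th n z k)) (axis x 1)))))"
    by (intro sum.cong refl dn_second[OF n, where BY = 1 and Bc = 1]) (simp_all add: norm_axis_1)
  also have "\<dots> \<le> (\<Sum>x\<in>(UNIV::'s set). 1 / real (a n))"
  proof (rule sum_mono)
    fix x
    have k1: "0 \<le> kvar (K P (th n z k)) (axis x 1) $ w" "kvar (K P (th n z k)) (axis x 1) $ w \<le> 1" for z w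
      using kvar_bound[OF chain path_simplex(1)[OF n], of "axis x 1" 1] by (auto simp: axis_def)
    have b: "0 \<le> et n z k \<bullet> kvar (K P (th n z k)) (axis x 1)" "et n z k \<bullet> kvar (K P (th n z k)) (axis x 1) \<le> 1" for z
      using simplex_inner_bounds[OF path_simplex(2)[OF n] k1] by auto
    have "expectation (\<lambda>z. 1 * ((1 / real (a n)) * (et n z k \<bullet> kvar (K P (th n z k)) (axis x 1)))) \<le> expectation (\<lambda>z. 1 / real (a n))"
    proof (rule integral_mono')
      show "integrable M (\<lambda>z. 1 / real (a n))" by simp
      show "1 * ((1 / real (a n)) * (et n z k \<bullet> kvar (K P (th n z k)) (axis x 1))) \<le> 1 / real (a n)" for z
        using mult_left_mono[OF b(2)[of z], of "1 / real (a n)"] by simp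
    qed simp
    then show "expectation (\<lambda>z. 1 * ((1 / real (a n)) * (et n z k \<bullet> kvar (K P (th n z k)) (axis x 1)))) \<le> 1 / real (a n)"
      by (simp add: prob_space)
  qed
  finally show ?thesis by simp
qed

lemma Xn_bound: "\<exists>C>0. \<forall>n\<ge>1. \<forall>k z. norm (Xn n k z) \<le> C"
  using Xi_bound path_n unfolding Xn_def by meson

lemma nS_measurable: "f \<in> borel_measurable N \<Longrightarrow> (\<lambda>z. nS (f z)) \<in> borel_measurable N"
proof -
  assume f: "f \<in> borel_measurable N"
  have [measurable]: "(\<lambda>z. f z \<bullet> (S *v f z)) \<in> borel_measurable N"
    by (intro borel_measurable_inner matrix_vector_measurable f)
  show ?thesis unfolding nS_def by measurable
qed

text \<open>The noise is orthogonal to the propagated value, so the second moments obey a scalar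
  recursion with source of order \<open>(gk (Suc k))^2 / a n\<close>. One power of the squared
  contraction factor is kept; its rate \<open>\<gamma> * Lq\<close> already exceeds 1.\<close>

lemma Xn_second_moment:
  "\<exists>H\<ge>0. \<forall>n\<ge>1. \<forall>k\<ge>k1. expectation (\<lambda>z. (nS (Xn n k z))^2) \<le> H / (real (a n) * tm k)"
proof -
  obtain CX where CX: "CX > 0" "\<And>n k z. 1 \<le> n \<Longrightarrow> norm (Xn n k z) \<le> CX" using Xn_bound by meson
  obtain CS where CS: "CS > 0" "\<And>x. nS x \<le> CS * norm x" using nS_le by blast
  obtain CR where CR: "CR > 0" "\<And>\<nu> x. \<nu> \<in> prob_simplex \<Longrightarrow> norm (rop \<nu> x) \<le> CR * norm x" using rop_bound by blast
  obtain CV where CV: "CV > 0" "\<And>\<nu> u. \<nu> \<in> prob_simplex \<Longrightarrow> norm (rvec \<nu> u) \<le> CV * norm u" using rvec_bound by blast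
  obtain CJ where CJ: "CJ > 0" "\<And>x. norm (J *v x) \<le> CJ * norm x" using J_bound by blast
  obtain B where B: "0 < B" "\<And>x. norm (S *v x) \<le> norm x * B"
    using bounded_linear.pos_bounded[OF matrix_vector_mul_bounded_linear[of S]] by auto
  obtain Cx where Cx: "Cx > 0" "\<And>th eta k. is_path th eta \<Longrightarrow> norm (xi th eta k) \<le> Cx" using xi_bound by blast
  define D where "D = (CS * CR)^2 * real CARD('s)"
  have D: "0 \<le> D" by (simp add: D_def)
  have rec: "expectation (\<lambda>z. (nS (Xn n (Suc k) z))^2) \<le>
     (1 - gk (Suc k) * Lq) * expectation (\<lambda>z. (nS (Xn n k z))^2) + (gk (Suc k))^2 * (D / real (a n))"
    if n: "1 \<le> n" and k: "k1 \<le> k" for n k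
  proof -
    define g where "g = gk (Suc k)"
    have g: "0 \<le> g" "g \<le> 1" "g * Lq \<le> 1" unfolding g_def by (rule gk_nonneg gk_le_1 small[OF k])+
    define x' where "x' z = Xn n k z + g *\<^sub>R (J *v Xn n k z)" for z
    define \<xi> where "\<xi> z = xi (th n z) (et n z) k" for z
    have Xs: "Xn n (Suc k) z = x' z + g *\<^sub>R \<xi> z" for z
      unfolding Xn_def Xi_step[OF k] x'_def \<xi>_def g_def ..
    have x'F: "x' \<in> borel_measurable (Fn n k)"
      unfolding x'_def[abs_def]
      by (intro borel_measurable_add borel_measurable_scaleR matrix_vector_measurable borel_measurable_const Xn_measurable n)
    have x'M: "x' \<in> borel_measurable M" by (rule Fn_M[OF n x'F])
    have \<xi>M: "\<xi> \<in> borel_measurable M" unfolding \<xi>_def[abs_def] by (rule Fn_M[OF n xi_measurable[OF n]])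
    have XM: "Xn n k \<in> borel_measurable M" by (rule Fn_M[OF n Xn_measurable[OF n]])
    have x'b: "norm (x' z) \<le> CX + CJ * CX" for z
    proof -
      have "norm (J *v Xn n k z) \<le> CJ * CX"
        using CJ(2)[of "Xn n k z"] CX(2)[OF n, of k z] CJ(1) by (meson mult_left_mono less_imp_le order_trans)
      then have "norm (g *\<^sub>R (J *v Xn n k z)) \<le> CJ * CX"
        using g mult_left_le_one_le[of "norm (J *v Xn n k z)" g] by simp
      then show ?thesis unfolding x'_def
        using CX(2)[OF n, of k z] by (intro order_trans[OF norm_triangle_ineq] add_mono)
    qed
    have \<xi>b: "norm (\<xi> z) \<le> Cx" for z unfolding \<xi>_def by (rule Cx(2)[OF path_n[OF n]])
    \<comment> \<open>\<open>S *v x' z\<close> seen through the adjoint of \<open>rop\<close>: the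
      cross term becomes \<open>dn\<close> against a vector known at time \<open>k\<close>.\<close>
    define c where "c z = rvec (th n z k) (S *v x' z)" for z
    have cF: "c \<in> borel_measurable (Fn n k)"
      unfolding c_def[abs_def] by (intro rvec_measurable th_measurable[OF n] matrix_vector_measurable x'F)
    have cb: "norm (c z) \<le> CV * ((CX + CJ * CX) * B)" for z
    proof -
      have "norm (S *v x' z) \<le> (CX + CJ * CX) * B"
        using B(2)[of "x' z"] mult_right_mono[OF x'b, of B z] B(1) by linarith
      then show ?thesis unfolding c_def
        using CV(2)[OF path_simplex(1)[OF n, of z k], of "S *v x' z"] CV(1) by (meson mult_left_mono less_imp_le order_trans)
    qed
    have cross: "\<xi> z \<bullet> (S *v x' z) = dn n k z \<bullet> c z" for z
      unfolding \<xi>_def c_def by (rule xi_dn)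
    have ex0: "expectation (\<lambda>z. \<xi> z \<bullet> (S *v x' z)) = 0"
      using dn_first[OF n, of "\<lambda>z. 1" k 1 c, OF _ _ cF cb] unfolding cross by simp
    have expand: "(nS (Xn n (Suc k) z))^2 = (nS (x' z))^2 + 2 * g * (\<xi> z \<bullet> (S *v x' z)) + g^2 * (nS (\<xi> z))^2" for z
      unfolding nS_square Xs using symmetric_matrix_swap[OF S_sym, of "x' z" "\<xi> z"]
      by (simp add: matrix_vector_right_distrib matrix_vector_mult_scaleR inner_add_left inner_add_right
          power2_eq_square algebra_simps)
    have nSb: "0 \<le> (nS v)^2" "(nS v)^2 \<le> (CS * Bd)^2" if "norm v \<le> Bd" for v Bd
    proof -
      have "nS v \<le> CS * Bd" using CS(2)[of v] mult_left_mono[OF that, of CS] CS(1) by linarith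
      then show "(nS v)^2 \<le> (CS * Bd)^2" using nS_nonneg by (intro power_mono)
    qed simp
    have i1: "integrable M (\<lambda>z. (nS (x' z))^2)"
      by (rule bounded_integrable[of _ "(CS * (CX + CJ * CX))^2"])
        (use nS_measurable[OF x'M] nSb[OF x'b] in auto)
    have i0: "integrable M (\<lambda>z. (nS (Xn n k z))^2)"
      by (rule bounded_integrable[of _ "(CS * CX)^2"])
        (use nS_measurable[OF XM] nSb[OF CX(2)[OF n]] in auto)
    have i2: "integrable M (\<lambda>z. (nS (\<xi> z))^2)"
      by (rule bounded_integrable[of _ "(CS * Cx)^2"])
        (use nS_measurable[OF \<xi>M] nSb[OF \<xi>b] in auto)
    have i3: "integrable M (\<lambda>z. \<xi> z \<bullet> (S *v x' z))"
    proof (rule bounded_integrable[of _ "Cx * ((CX + CJ * CX) * B)"])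
      show "(\<lambda>z. \<xi> z \<bullet> (S *v x' z)) \<in> borel_measurable M"
        by (intro borel_measurable_inner matrix_vector_measurable \<xi>M x'M)
      show "norm (\<xi> z \<bullet> (S *v x' z)) \<le> Cx * ((CX + CJ * CX) * B)" for z
      proof -
        have "norm (S *v x' z) \<le> (CX + CJ * CX) * B"
          using B(2)[of "x' z"] mult_right_mono[OF x'b, of B z] B(1) by linarith
        then show ?thesis
          using Cauchy_Schwarz_ineq2[of "\<xi> z" "S *v x' z"] mult_mono[OF \<xi>b, of "norm (S *v x' z)" "(CX + CJ * CX) * B" z] Cx(1)
          by simp
      qed
    qed
    have i4: "integrable M (\<lambda>z. (norm (dn n k z))^2)"
    proof (rule bounded_integrable[of _ "2^2"])
      show "(\<lambda>z. (norm (dn n k z))^2) \<in> borel_measurable M"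
        using Fn_M[OF n dn_measurable[OF n]] by measurable
      show "norm ((norm (dn n k z))^2) \<le> 2^2" for z
        using power_mono[OF dn_bound[OF n], of k z 2] by simp
    qed
    have e2: "expectation (\<lambda>z. (nS (\<xi> z))^2) \<le> D / real (a n)"
    proof -
      have "expectation (\<lambda>z. (nS (\<xi> z))^2) \<le> expectation (\<lambda>z. (CS * CR)^2 * (norm (dn n k z))^2)"
      proof (rule integral_mono[OF i2 integrable_mult_right[OF i4]])
        fix z
        have "norm (\<xi> z) \<le> CR * norm (dn n k z)"
          unfolding \<xi>_def xi_def dn_def by (rule CR(2)[OF path_simplex(1)[OF n]])
        then have "nS (\<xi> z) \<le> CS * (CR * norm (dn n k z))"
          using CS(2)[of "\<xi> z"] CS(1) by (meson mult_left_mono less_imp_le order_trans)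
        then have "(nS (\<xi> z))^2 \<le> (CS * (CR * norm (dn n k z)))^2" by (rule power_mono) (rule nS_nonneg)
        then show "(nS (\<xi> z))^2 \<le> (CS * CR)^2 * (norm (dn n k z))^2" by (simp add: power_mult_distrib)
      qed
      also have "\<dots> = (CS * CR)^2 * expectation (\<lambda>z. (norm (dn n k z))^2)" by simp
      also have "\<dots> \<le> (CS * CR)^2 * (real CARD('s) / real (a n))"
        by (intro mult_left_mono dn_second_moment[OF n]) simp
      finally show ?thesis by (simp add: D_def)
    qed
    have "expectation (\<lambda>z. (nS (Xn n (Suc k) z))^2) =
      expectation (\<lambda>z. (nS (x' z))^2) + 2 * g * expectation (\<lambda>z. \<xi> z \<bullet> (S *v x' z)) + g^2 * expectation (\<lambda>z. (nS (\<xi> z))^2)"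
      unfolding expand using i1 i2 i3 by simp
    also have "\<dots> \<le> (1 - g * Lq) * expectation (\<lambda>z. (nS (Xn n k z))^2) + 0 + g^2 * (D / real (a n))"
    proof (intro add_mono mult_left_mono e2)
      have "expectation (\<lambda>z. (nS (x' z))^2) \<le> expectation (\<lambda>z. (1 - g * Lq) * (nS (Xn n k z))^2)"
      proof (rule integral_mono[OF i1 integrable_mult_right[OF i0]])
        fix z
        have "(nS (x' z))^2 \<le> ((1 - g * Lq) * nS (Xn n k z))^2"
          unfolding x'_def g_def by (rule power_mono[OF nS_contr[OF k] nS_nonneg])
        also have "\<dots> = (1 - g * Lq) * ((1 - g * Lq) * (nS (Xn n k z))^2)" by (simp add: power2_eq_square)
        also have "\<dots> \<le> 1 * ((1 - g * Lq) * (nS (Xn n k z))^2)"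
          using g Lq_pos by (intro mult_right_mono) auto
        finally show "(nS (x' z))^2 \<le> (1 - g * Lq) * (nS (Xn n k z))^2" by simp
      qed
      then show "expectation (\<lambda>z. (nS (x' z))^2) \<le> (1 - g * Lq) * expectation (\<lambda>z. (nS (Xn n k z))^2)" by simp
    qed (simp_all add: ex0)
    finally show ?thesis by (simp add: g_def)
  qed
  define p where "p = \<gamma> * Lq"
  have p: "p > 1" using Lq by (simp add: p_def)
  define H where "H = D * \<gamma>^2 / (p - 1)"
  have H: "0 \<le> H" using D p by (simp add: H_def)
  have "expectation (\<lambda>z. (nS (Xn n k z))^2) \<le> H / (real (a n) * tm k)" if n: "1 \<le> n" and k: "k1 \<le> k" for n k
  proof -
    have an: "0 < real (a n)" using a_pos[OF n] by simp
    have "real (a n) * expectation (\<lambda>z. (nS (Xn n k z))^2) \<le> H / tm k"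
    proof (rule recursion_bound[OF k1 p H, of "D * \<gamma>^2" _ k])
      show "D * \<gamma>^2 \<le> (p - 1) * H" using p by (simp add: H_def)
      have "Xn n k1 z = 0" for z unfolding Xn_def by (rule Xi_0) simp
      then show "real (a n) * expectation (\<lambda>z. (nS (Xn n k1 z))^2) \<le> H / tm k1"
        using H tm_pos[OF k1] by (simp add: nS_def)
      fix j assume j: "k1 \<le> j" "j < k"
      have t: "0 < tm (Suc j)" by (rule tm_pos) simp
      have gj: "gk (Suc j) = \<gamma> / tm (Suc j)" by (rule gk_eq) simp
      have gp: "gk (Suc j) * Lq = p / tm (Suc j)" unfolding gj p_def by simp
      show "p \<le> tm (Suc j)" using small[OF j(1)] t unfolding gp by simp
      have "real (a n) * expectation (\<lambda>z. (nS (Xn n (Suc j) z))^2) \<le>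
        real (a n) * ((1 - p / tm (Suc j)) * expectation (\<lambda>z. (nS (Xn n j z))^2) + (\<gamma> / tm (Suc j))^2 * (D / real (a n)))"
        using rec[OF n j(1)] an unfolding gp unfolding gj by (intro mult_left_mono) auto
      also have "\<dots> = (1 - p / tm (Suc j)) * (real (a n) * expectation (\<lambda>z. (nS (Xn n j z))^2)) + D * \<gamma>^2 / (tm (Suc j))^2"
        using an by (simp add: power_divide ring_distribs mult_ac)
      finally show "real (a n) * expectation (\<lambda>z. (nS (Xn n (Suc j) z))^2) \<le>
        (1 - p / tm (Suc j)) * (real (a n) * expectation (\<lambda>z. (nS (Xn n j z))^2)) + D * \<gamma>^2 / (tm (Suc j))^2" .
    qed (use k in auto)
    then have "expectation (\<lambda>z. (nS (Xn n k z))^2) \<le> (H / tm k) / real (a n)"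
      by (subst pos_le_divide_eq[OF an]) (simp only: mult.commute)
    then show ?thesis by (simp add: mult.commute)
  qed
  then show ?thesis using H by blast
qed

end

section \<open>The remainder is negligible\<close>

context clt_setup
begin

lemma Xn_block:
  "\<exists>C>0. \<forall>n\<ge>1. \<forall>j k z. 1 \<le> j \<longrightarrow> j \<le> k \<longrightarrow> norm (Xn n k z - Xn n j z) \<le> real (k - j) * (C / real j)"
proof -
  obtain C where C: "C > 0" "\<And>th eta k. is_path th eta \<Longrightarrow> norm (Xi th eta (Suc k) - Xi th eta k) \<le> C * gk (Suc k)"
    using Xi_increment by blast
  have "norm (Xn n k z - Xn n j z) \<le> real (k - j) * ((C * \<gamma>) / real j)"
    if n: "1 \<le> n" and j: "1 \<le> j" and k: "j \<le> k" for n j k z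
    using k
  proof (induction k rule: dec_induct)
    case base
    then show ?case by simp
  next
    case (step k)
    have "gk (Suc k) = \<gamma> / tm (Suc k)" by (rule gk_eq) simp
    also have "\<dots> \<le> \<gamma> / real j"
      using tm_ge[of "Suc k"] step j \<gamma> by (intro divide_left_mono) auto
    finally have "C * gk (Suc k) \<le> (C * \<gamma>) / real j"
      using mult_left_mono[of "gk (Suc k)" "\<gamma> / real j" C] C(1) by simp
    then have 1: "norm (Xn n (Suc k) z - Xn n k z) \<le> (C * \<gamma>) / real j"
      unfolding Xn_def using C(2)[OF path_n[OF n], of z k] by (rule order_trans[rotated])
    have "norm (Xn n (Suc k) z - Xn n j z) \<le> norm (Xn n (Suc k) z - Xn n k z) + norm (Xn n k z - Xn n j z)"
      using norm_triangle_ineq[of "Xn n (Suc k) z - Xn n k z" "Xn n k z - Xn n j z"] by simp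
    also have "\<dots> \<le> (C * \<gamma>) / real j + real (k - j) * ((C * \<gamma>) / real j)" by (intro add_mono 1 step)
    also have "\<dots> = real (Suc k - j) * ((C * \<gamma>) / real j)"
    proof -
      have "real (Suc k - j) = 1 + real (k - j)" using step by (simp add: Suc_diff_le)
      then show ?thesis by (simp only: distrib_right mult_1)
    qed
    finally show ?case .
  qed
  then show ?thesis using C(1) \<gamma> by (intro exI[of _ "C * \<gamma>"]) auto
qed

definition bad :: "nat \<Rightarrow> real \<Rightarrow> nat \<Rightarrow> 'w set" where
  "bad k2 \<delta> n = {z\<in>space M. \<exists>k\<in>{k2..n}. norm (Xn n k z) > \<delta>}"

lemma bad_sets: assumes n: "1 \<le> n" shows "bad k2 \<delta> n \<in> sets M"
proof -
  have "bad k2 \<delta> n = (\<Union>k\<in>{k2..n}. {z\<in>space M. norm (Xn n k z) > \<delta>})" by (auto simp: bad_def)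
  moreover have "{z\<in>space M. norm (Xn n k z) > \<delta>} \<in> sets M" for k
  proof -
    have [measurable]: "Xn n k \<in> borel_measurable M" by (rule Fn_M[OF n Xn_measurable[OF n]])
    show ?thesis by measurable
  qed
  ultimately show ?thesis by (simp add: sets.finite_UN)
qed

lemma a_real_at_top: "filterlim (\<lambda>n. real (a n)) at_top sequentially"
  by (rule filterlim_compose[OF filterlim_real_sequentially a_lim])

text \<open>It suffices to control \<open>Xn\<close> at the times \<open>m\<^sup>2\<close>: between them it moves by \<open>O(1/m)\<close>, and along them
  the second moments are summable.\<close>
lemma bad_small:
  assumes \<delta>: "\<delta> > 0"
  shows "\<exists>k2\<ge>k1. \<forall>e>0. \<forall>\<^sub>F n in sequentially. prob (bad k2 \<delta> n) \<le> e"
proof -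
  obtain C where C: "C > 0" "\<And>n j k z. 1 \<le> n \<Longrightarrow> 1 \<le> j \<Longrightarrow> j \<le> k \<Longrightarrow> norm (Xn n k z - Xn n j z) \<le> real (k - j) * (C / real j)"
    using Xn_block by meson
  obtain H where H: "H \<ge> 0" "\<And>n k. 1 \<le> n \<Longrightarrow> k1 \<le> k \<Longrightarrow> expectation (\<lambda>z. (nS (Xn n k z))^2) \<le> H / (real (a n) * tm k)"
    using Xn_second_moment by blast
  obtain CX where CX: "CX > 0" "\<And>n k z. 1 \<le> n \<Longrightarrow> norm (Xn n k z) \<le> CX" using Xn_bound by meson
  obtain m1 where m1: "4 * C / \<delta> \<le> real m1" using real_arch_simple by blast
  \<comment> \<open>From \<open>m2\<close> on, the movement \<open>2 * C / m\<close> between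
    consecutive squares is at most \<open>\<delta> / 2\<close>.\<close>
  define m2 where "m2 = max (max k1 m1) 1"
  define k2 where "k2 = m2^2"
  have m2: "1 \<le> m2" "k1 \<le> m2" "4 * C / \<delta> \<le> real m2" using m1 by (auto simp: m2_def)
  have sq: "m \<le> m^2" for m :: nat by (simp add: power2_eq_square)
  have k2: "k1 \<le> k2" using m2(2) sq[of m2] by (simp add: k2_def)
  have sub: "bad k2 \<delta> n \<subseteq> (\<Union>m\<in>{m2..n}. {z\<in>space M. (norm (Xn n (m^2) z))^2 > (\<delta>/2)^2})" if n: "1 \<le> n" for n
  proof
    fix z assume "z \<in> bad k2 \<delta> n"
    then obtain k where k: "z \<in> space M" "k2 \<le> k" "k \<le> n" "norm (Xn n k z) > \<delta>" by (auto simp: bad_def)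
    define m where "m = floor_sqrt k"
    have m: "m^2 \<le> k" "k < (Suc m)^2" unfolding m_def by (simp, rule Suc_floor_sqrt_power2_gt)
    have "m2 \<le> m" unfolding m_def using mono_floor_sqrt'[OF k(2)] by (simp add: k2_def)
    moreover have "m \<le> n" using m(1) sq[of m] k(3) by linarith
    ultimately have mm: "m \<in> {m2..n}" "1 \<le> m" using m2(1) by auto
    have "real (k - m^2) \<le> 2 * real m"
    proof -
      have "k \<le> m^2 + 2 * m" using m(2) by (simp add: power2_eq_square)
      then show ?thesis using m(1) by linarith
    qed
    then have "real (k - m^2) * (C / real (m^2)) \<le> 2 * real m * (C / real (m^2))"
      using C(1) by (intro mult_right_mono) auto
    also have "\<dots> = 2 * C / real m" using mm(2) by (simp add: power2_eq_square)
    also have "\<dots> \<le> \<delta> / 2"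
    proof -
      have "4 * C / \<delta> \<le> real m" using m2(3) mm(1) by auto
      then show ?thesis using \<delta> mm(2) by (simp add: field_simps)
    qed
    finally have u: "real (k - m^2) * (C / real (m^2)) \<le> \<delta> / 2" .
    have "1 \<le> m^2" using mm(2) by simp
    from order_trans[OF C(2)[OF n this m(1), of z] u]
    have "norm (Xn n k z - Xn n (m^2) z) \<le> \<delta> / 2" .
    then have "\<delta> / 2 < norm (Xn n (m^2) z)"
      using k(4) norm_triangle_ineq[of "Xn n k z - Xn n (m^2) z" "Xn n (m^2) z"] by simp
    then have "(\<delta> / 2)^2 < (norm (Xn n (m^2) z))^2" using \<delta> by (intro power_strict_mono) auto
    then show "z \<in> (\<Union>m\<in>{m2..n}. {z\<in>space M. (norm (Xn n (m^2) z))^2 > (\<delta>/2)^2})" using mm k(1) by blast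
  qed
  \<comment> \<open>Chebyshev at the squares: the second moments \<open>H / (a n * m^2)\<close> are
    summable in \<open>m\<close> uniformly in \<open>n\<close>, and \<open>a n\<close> carries the
    decay.\<close>
  have bound: "prob (bad k2 \<delta> n) \<le> (8 * H / \<delta>^2) / real (a n)" if n: "1 \<le> n" for n
  proof -
    have an: "0 < real (a n)" using a_pos[OF n] by simp
    have Xm: "Xn n k \<in> borel_measurable M" for k by (rule Fn_M[OF n Xn_measurable[OF n]])
    have Em: "{z\<in>space M. (norm (Xn n k z))^2 > (\<delta>/2)^2} \<in> sets M" for k
      using Xm[of k] by measurable
    have single: "prob {z\<in>space M. (norm (Xn n (m^2) z))^2 > (\<delta>/2)^2} \<le> 4 * H / (\<delta>^2 * real (a n)) * (1 / (real m)^2)"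
      if m: "m2 \<le> m" for m
    proof -
      have m1': "1 \<le> m" using m m2 by simp
      have km: "k1 \<le> m^2" using m m2 sq[of m] by simp
      have "prob {z\<in>space M. (norm (Xn n (m^2) z))^2 > (\<delta>/2)^2} \<le> expectation (\<lambda>z. (norm (Xn n (m^2) z))^2) / (\<delta>/2)^2"
      proof (rule markov_bound[of _ "CX^2"])
        show "(\<lambda>z. (norm (Xn n (m^2) z))^2) \<in> borel_measurable M" using Xm[of "m^2"] by measurable
        show "(norm (Xn n (m^2) z))^2 \<le> CX^2" for z by (intro power_mono CX(2)[OF n] norm_ge_zero)
      qed (use \<delta> in auto)
      also have "\<dots> \<le> (H / (real (a n) * (real m)^2)) / (\<delta>/2)^2"
      proof (rule divide_right_mono)
        obtain CS where CS: "CS > 0" "\<And>x. nS x \<le> CS * norm x" using nS_le by blast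
        have "expectation (\<lambda>z. (norm (Xn n (m^2) z))^2) \<le> expectation (\<lambda>z. (nS (Xn n (m^2) z))^2)"
        proof (rule integral_mono)
          show "integrable M (\<lambda>z. (norm (Xn n (m^2) z))^2)"
            by (rule bounded_integrable[of _ "CX^2"])
              (use Xm[of "m^2"] power_mono[OF CX(2)[OF n] norm_ge_zero, of "m^2" _ 2] in auto)
          have "nS (Xn n (m^2) z) \<le> CS * CX" for z
            using CS(2)[of "Xn n (m^2) z"] mult_left_mono[OF CX(2)[OF n, of "m^2" z], of CS] CS(1) by linarith
          then have "(nS (Xn n (m^2) z))^2 \<le> (CS * CX)^2" for z by (intro power_mono nS_nonneg)
          then show "integrable M (\<lambda>z. (nS (Xn n (m^2) z))^2)"
            by (intro bounded_integrable[of _ "(CS * CX)^2"]) (use nS_measurable[OF Xm] in auto)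
          show "(norm (Xn n (m^2) z))^2 \<le> (nS (Xn n (m^2) z))^2" for z
            by (intro power_mono norm_le_nS norm_ge_zero)
        qed
        also have "\<dots> \<le> H / (real (a n) * tm (m^2))" by (rule H(2)[OF n km])
        also have "\<dots> \<le> H / (real (a n) * (real m)^2)"
          using H an m1' tm_ge[of "m^2"] tm_pos[of "m^2"]
          by (intro divide_left_mono mult_left_mono) (auto intro!: mult_pos_pos)
        finally show "expectation (\<lambda>z. (norm (Xn n (m^2) z))^2) \<le> H / (real (a n) * (real m)^2)" .
      qed simp
      also have "\<dots> = 4 * H / (\<delta>^2 * real (a n)) * (1 / (real m)^2)" by (simp add: power_divide mult_ac)
      finally show ?thesis .
    qed
    have "prob (bad k2 \<delta> n) \<le> prob (\<Union>m\<in>{m2..n}. {z\<in>space M. (norm (Xn n (m^2) z))^2 > (\<delta>/2)^2})"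
      by (rule finite_measure_mono[OF sub[OF n]]) (intro sets.finite_UN Em finite_atLeastAtMost)
    also have "\<dots> \<le> (\<Sum>m\<in>{m2..n}. prob {z\<in>space M. (norm (Xn n (m^2) z))^2 > (\<delta>/2)^2})"
      by (rule finite_measure_subadditive_finite) (use Em in auto)
    also have "\<dots> \<le> (\<Sum>m\<in>{m2..n}. 4 * H / (\<delta>^2 * real (a n)) * (1 / (real m)^2))"
      by (intro sum_mono single) auto
    also have "\<dots> \<le> (\<Sum>m\<in>{1..n}. 4 * H / (\<delta>^2 * real (a n)) * (1 / (real m)^2))"
      using H an m2 by (intro sum_mono2) auto
    also have "\<dots> = 4 * H / (\<delta>^2 * real (a n)) * (\<Sum>m=1..n. 1 / (real m)^2)" by (simp only: sum_distrib_left)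
    also have "\<dots> \<le> 4 * H / (\<delta>^2 * real (a n)) * 2" using H an by (intro mult_left_mono sum_inverse_squares_le) auto
    finally show ?thesis by (simp add: divide_divide_eq_left)
  qed
  have "(\<lambda>n. (8 * H / \<delta>^2) / real (a n)) \<longlonglongrightarrow> 0"
    by (rule tendsto_divide_0[OF tendsto_const filterlim_at_top_imp_at_infinity[OF a_real_at_top]])
  then have "\<forall>\<^sub>F n in sequentially. (8 * H / \<delta>^2) / real (a n) < e" if "e > 0" for e
    using that by (rule order_tendstoD(2))
  then have ev: "\<forall>\<^sub>F n in sequentially. (8 * H / \<delta>^2) / real (a n) < e" if "e > 0" for e using that .
  have "\<forall>\<^sub>F n in sequentially. prob (bad k2 \<delta> n) \<le> e" if e: "e > 0" for e
    using ev[OF e] eventually_ge_at_top[of 1]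
  proof eventually_elim
    case (elim n)
    then show ?case using bound[of n] by simp
  qed
  then show ?thesis using k2 by blast
qed

text \<open>The scaling of the theorem; at n = 0 it is 0 by the convention for division.\<close>

definition "sn n = sqrt (real (a n) / gk n)"

lemma sn_nonneg: "0 \<le> sn n" by (simp add: sn_def gk_nonneg)

lemma a_over_tm: "(\<lambda>n. real (a n) / tm n) \<longlonglongrightarrow> 0"
proof (rule tendsto_sandwich[OF _ _ tendsto_const a_rate])
  show "\<forall>\<^sub>F n in sequentially. 0 \<le> real (a n) / tm n"
    using eventually_ge_at_top[of 1] by eventually_elim (simp add: less_imp_le tm_pos)
  show "\<forall>\<^sub>F n in sequentially. real (a n) / tm n \<le> real (a n) / real n"
    using eventually_ge_at_top[of 1]
    by eventually_elim (intro divide_left_mono tm_ge mult_pos_pos tm_pos, auto)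
qed

text \<open>The square of the quotient is \<open>a n / (\<gamma> * tm n)\<close>, so a(n)/n -> 0
  says precisely that errors of order 1/n vanish after scaling.\<close>

lemma sn_over_tm: "(\<lambda>n. sn n / tm n) \<longlonglongrightarrow> 0"
proof -
  have "(\<lambda>n. sqrt (real (a n) / tm n / \<gamma>)) \<longlonglongrightarrow> sqrt (0 / \<gamma>)"
    by (intro tendsto_real_sqrt tendsto_divide a_over_tm tendsto_const) (use \<gamma> in auto)
  moreover have "\<forall>\<^sub>F n in sequentially. sqrt (real (a n) / tm n / \<gamma>) = sn n / tm n"
    using eventually_ge_at_top[of 1]
  proof eventually_elim
    case (elim n)
    have t: "0 < tm n" by (rule tm_pos[OF elim])
    have "sn n / tm n = sqrt (real (a n) * tm n / \<gamma>) / sqrt ((tm n)^2)"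
      using t by (simp add: sn_def gk_eq[OF elim])
    also have "\<dots> = sqrt ((real (a n) * tm n / \<gamma>) / (tm n)^2)" by (rule real_sqrt_divide[symmetric])
    also have "(real (a n) * tm n / \<gamma>) / (tm n)^2 = real (a n) / tm n / \<gamma>"
      using t by (simp add: power2_eq_square)
    finally show ?case by simp
  qed
  ultimately show ?thesis using Lim_transform_eventually by fastforce
qed

text \<open>A law of large numbers uniform over late times: off the bad event
  \<open>global_convergence\<close> applies, and on it the distance is at most 2.\<close>

lemma convergence_in_mean:
  assumes e: "e > 0"
  shows "\<exists>k0\<ge>k1. \<forall>\<^sub>F n in sequentially. \<forall>k\<in>{k0..n}. expectation (\<lambda>z. norm (th n z k - \<theta>)) \<le> e"
proof -
  have e2: "e / 2 > 0" using e by simp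
  obtain \<delta> where \<delta>: "\<delta> > 0" and glob: "\<And>k2. \<exists>k0\<ge>k1. \<forall>th eta n. is_path th eta \<longrightarrow> (\<forall>k. k2 \<le> k \<longrightarrow> k \<le> n \<longrightarrow> norm (Xi th eta k) \<le> \<delta>) \<longrightarrow>
     (\<forall>k. k0 \<le> k \<longrightarrow> k \<le> n \<longrightarrow> norm (th k - \<theta>) \<le> e / 2)"
    using global_convergence[OF e2] by blast
  obtain k2 where k2: "\<And>e. e > 0 \<Longrightarrow> \<forall>\<^sub>F n in sequentially. prob (bad k2 \<delta> n) \<le> e"
    using bad_small[OF \<delta>] by blast
  from glob[of k2] obtain k0 where k0: "k1 \<le> k0"
    and close0: "\<forall>th eta n. is_path th eta \<longrightarrow> (\<forall>k. k2 \<le> k \<longrightarrow> k \<le> n \<longrightarrow> norm (Xi th eta k) \<le> \<delta>) \<longrightarrow>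
     (\<forall>k. k0 \<le> k \<longrightarrow> k \<le> n \<longrightarrow> norm (th k - \<theta>) \<le> e / 2)"
    by (elim exE conjE)
  have close: "norm (th k - \<theta>) \<le> e / 2"
    if "is_path th eta" "\<forall>k. k2 \<le> k \<longrightarrow> k \<le> n \<longrightarrow> norm (Xi th eta k) \<le> \<delta>" "k0 \<le> k" "k \<le> n" for th eta n k
    using spec[OF spec[OF spec[OF close0, of th], of eta], of n] that by blast
  have e4: "e / 4 > 0" using e by simp
  have "\<forall>\<^sub>F n in sequentially. \<forall>k\<in>{k0..n}. expectation (\<lambda>z. norm (th n z k - \<theta>)) \<le> e"
    using k2[OF e4] eventually_ge_at_top[of 1]
  proof eventually_elim
    case (elim n)
    show ?case
    proof
      fix k assume k: "k \<in> {k0..n}"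
      have tm: "(\<lambda>z. th n z k) \<in> borel_measurable M" by (rule Fn_M[OF elim(2) th_measurable[OF elim(2)]])
      have b2: "norm (th n z k - \<theta>) \<le> 2" for z
        using norm_triangle_ineq4[of "th n z k" \<theta>] simplex_norm_le_1[OF path_simplex(1)[OF elim(2)], of z k]
          simplex_norm_le_1[OF \<theta>_simplex] by linarith
      have "expectation (\<lambda>z. norm (th n z k - \<theta>)) \<le> expectation (\<lambda>z. e / 2 + 2 * indicator (bad k2 \<delta> n) z)"
      proof (rule integral_mono)
        show "integrable M (\<lambda>z. norm (th n z k - \<theta>))"
          by (rule bounded_integrable[of _ 2]) (use tm b2 in auto)
        show "integrable M (\<lambda>z. e / 2 + 2 * indicator (bad k2 \<delta> n) z :: real)"
          using bad_sets[OF elim(2)] by (intro Bochner_Integration.integrable_add integrable_mult_right integrable_real_indicator)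
            (auto simp: emeasure_eq_measure)
        fix z assume w: "z \<in> space M"
        show "norm (th n z k - \<theta>) \<le> e / 2 + 2 * indicator (bad k2 \<delta> n) z"
        proof (cases "z \<in> bad k2 \<delta> n")
          case True
          then show ?thesis using b2[of z] e by simp
        next
          case False
          then have "\<forall>k. k2 \<le> k \<longrightarrow> k \<le> n \<longrightarrow> norm (Xi (th n z) (et n z) k) \<le> \<delta>"
            using w by (auto simp: bad_def Xn_def not_less)
          from close[OF path_n[OF elim(2)] this, of k] k False show ?thesis by simp
        qed
      qed
      also have "\<dots> = e / 2 + 2 * prob (bad k2 \<delta> n)"
        using bad_sets[OF elim(2)] by (subst Bochner_Integration.integral_add)
          (auto simp: emeasure_eq_measure prob_space)
      also have "\<dots> \<le> e" using elim(1) by simp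
      finally show "expectation (\<lambda>z. norm (th n z k - \<theta>)) \<le> e" .
    qed
  qed
  then show ?thesis using k0 by blast
qed

lemma zeta_measurable:
  assumes n: "1 \<le> n" shows "(\<lambda>z. zeta (th n z) (et n z) k) \<in> borel_measurable M"
  unfolding zeta_def sop_def rop_def Xn_def[symmetric]
  by (intro borel_measurable_diff borel_measurable_add borel_measurable_scaleR borel_measurable_inner
      vmult_measurable pi_measurable borel_measurable_const Fn_M[OF n et_measurable[OF n]]
      Fn_M[OF n th_measurable[OF n]] Fn_M[OF n Xn_measurable[OF n]])

text \<open>Off the bad event all points after \<open>k0\<close> are near \<open>\<theta>\<close>,
  so \<open>local_recursion\<close> iterates. The mean of its source, the square of
  \<open>Xn\<close>, is of order \<open>1 / tm k\<close>, which gives the remainder mean O(1 / tm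
  n).\<close>

lemma remainder_negligible:
  assumes e: "e > 0"
  shows "\<forall>\<^sub>F n in sequentially. prob {z\<in>space M. sn n * norm (th n z n - \<theta> - Xn n n z) > e} \<le> e"
proof -
  obtain Lr \<epsilon> C where Lr: "1 < \<gamma> * Lr" "Lr \<le> Lq" and \<epsilon>: "0 < \<epsilon>" and C: "0 \<le> C" and loc:
    "\<And>th eta k. is_path th eta \<Longrightarrow> k1 \<le> k \<Longrightarrow> norm (th k - \<theta>) \<le> \<epsilon> \<Longrightarrow>
     nS (zeta th eta (Suc k) - \<theta>) \<le> (1 - gk (Suc k) * Lr) * nS (zeta th eta k - \<theta>)
        + C * gk (Suc k) * (norm (Xi th eta k))^2 + C * (gk (Suc k))^2"
    using local_recursion by blast
  obtain \<delta> where \<delta>: "\<delta> > 0" and glob: "\<And>k2. \<exists>k0\<ge>k1. \<forall>th eta n. is_path th eta \<longrightarrow> (\<forall>k. k2 \<le> k \<longrightarrow> k \<le> n \<longrightarrow> norm (Xi th eta k) \<le> \<delta>) \<longrightarrow>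
     (\<forall>k. k0 \<le> k \<longrightarrow> k \<le> n \<longrightarrow> norm (th k - \<theta>) \<le> \<epsilon>)"
    using global_convergence[OF \<epsilon>] by blast
  obtain k2 where k2: "\<And>e. e > 0 \<Longrightarrow> \<forall>\<^sub>F n in sequentially. prob (bad k2 \<delta> n) \<le> e"
    using bad_small[OF \<delta>] by blast
  from glob[of k2] obtain k0 where k0: "k1 \<le> k0"
    and close0: "\<forall>th eta n. is_path th eta \<longrightarrow> (\<forall>k. k2 \<le> k \<longrightarrow> k \<le> n \<longrightarrow> norm (Xi th eta k) \<le> \<delta>) \<longrightarrow>
     (\<forall>k. k0 \<le> k \<longrightarrow> k \<le> n \<longrightarrow> norm (th k - \<theta>) \<le> \<epsilon>)"
    by (elim exE conjE)
  have close: "norm (th k - \<theta>) \<le> \<epsilon>"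
    if "is_path th eta" "\<forall>k. k2 \<le> k \<longrightarrow> k \<le> n \<longrightarrow> norm (Xi th eta k) \<le> \<delta>" "k0 \<le> k" "k \<le> n" for th eta n k
    using spec[OF spec[OF spec[OF close0, of th], of eta], of n] that by blast
  obtain Hx where Hx: "Hx \<ge> 0" "\<And>n k. 1 \<le> n \<Longrightarrow> k1 \<le> k \<Longrightarrow> expectation (\<lambda>z. (nS (Xn n k z))^2) \<le> Hx / (real (a n) * tm k)"
    using Xn_second_moment by blast
  obtain CX where CX: "CX > 0" "\<And>n k z. 1 \<le> n \<Longrightarrow> norm (Xn n k z) \<le> CX" using Xn_bound by meson
  obtain CS where CS: "CS > 0" "\<And>x. nS x \<le> CS * norm x" using nS_le by blast
  obtain Cz where Cz: "Cz > 0" "\<And>th eta k. is_path th eta \<Longrightarrow> norm (th k - Xi th eta k - zeta th eta k) \<le> Cz * gk k"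
    using zeta_close by blast
  define Z where "Z n k z = nS (zeta (th n z) (et n z) k - \<theta>)" for n k z
  define BB where "BB = CS * (2 + CX + Cz)"
  have BB: "0 \<le> BB" using CS CX Cz by (simp add: BB_def)
  have Zb: "Z n k z \<le> BB" if n: "1 \<le> n" for n k z
  proof -
    have "norm (th n z k - Xi (th n z) (et n z) k - zeta (th n z) (et n z) k) \<le> Cz * 1"
      using Cz(2)[OF path_n[OF n], of z k] mult_left_mono[OF gk_le_1[of k], of Cz] Cz(1) by linarith
    moreover have "norm (Xi (th n z) (et n z) k) \<le> CX" using CX(2)[OF n] by (simp add: Xn_def)
    moreover have "norm (zeta (th n z) (et n z) k - \<theta>) = norm ((th n z k - \<theta>) - Xi (th n z) (et n z) k
       - (th n z k - Xi (th n z) (et n z) k - zeta (th n z) (et n z) k))" by simp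
    moreover have "norm (th n z k - \<theta>) \<le> 2"
      using norm_triangle_ineq4[of "th n z k" \<theta>] simplex_norm_le_1[OF path_simplex(1)[OF n], of z k]
        simplex_norm_le_1[OF \<theta>_simplex] by linarith
    ultimately have "norm (zeta (th n z) (et n z) k - \<theta>) \<le> 2 + CX + Cz"
      using norm_triangle_ineq4[of "(th n z k - \<theta>) - Xi (th n z) (et n z) k" "th n z k - Xi (th n z) (et n z) k - zeta (th n z) (et n z) k"]
        norm_triangle_ineq4[of "th n z k - \<theta>" "Xi (th n z) (et n z) k"] by linarith
    then show ?thesis unfolding Z_def BB_def
      using CS(2)[of "zeta (th n z) (et n z) k - \<theta>"] CS(1) by (meson mult_left_mono less_imp_le order_trans)
  qed
  have Z0: "0 \<le> Z n k z" for n k z by (simp add: Z_def nS_nonneg)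
  have Zm: "Z n k \<in> borel_measurable M" if n: "1 \<le> n" for n k
    unfolding Z_def[abs_def] by (intro nS_measurable borel_measurable_diff zeta_measurable[OF n] borel_measurable_const)
  \<comment> \<open>One indicator for all times: the recursion is pathwise, so the event may depend
    on the whole trajectory up to \<open>n\<close>.\<close>
  define I where "I n z = indicator (space M - bad k2 \<delta> n) z * (1::real)" for n z
  have I01: "0 \<le> I n z" "I n z \<le> 1" for n z by (auto simp: I_def indicator_def)
  have Im: "I n \<in> borel_measurable M" if n: "1 \<le> n" for n
    unfolding I_def[abs_def] using bad_sets[OF n] by measurable
  have IZ: "0 \<le> I n z * Z n k z" "I n z * Z n k z \<le> BB" if n: "1 \<le> n" for n k z
  proof -
    show "0 \<le> I n z * Z n k z" using I01 Z0 by simp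
    have "I n z * Z n k z \<le> 1 * BB" by (intro mult_mono I01 Zb[OF n] Z0) simp
    then show "I n z * Z n k z \<le> BB" by simp
  qed
  have IZm: "(\<lambda>z. I n z * Z n k z) \<in> borel_measurable M" if n: "1 \<le> n" for n k
    using Im[OF n] Zm[OF n] by (rule borel_measurable_times)
  have IZi: "integrable M (\<lambda>z. I n z * Z n k z)" if n: "1 \<le> n" for n k
    by (rule bounded_integrable[of _ BB, OF IZm[OF n]]) (use IZ[OF n] in auto)
  define p where "p = \<gamma> * Lr"
  have p: "p > 1" using Lr by (simp add: p_def)
  \<comment> \<open>The source in units of \<open>1 / (tm (Suc k))^2\<close>: the first summand
    comes from the squares of \<open>Xn\<close>, with 2 paying for \<open>tm k\<close> against
    \<open>tm (Suc k)\<close>, the second from \<open>C * g^2\<close>.\<close>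
  define c where "c = 2 * C * \<gamma> * Hx + C * \<gamma>^2"
  have c: "0 \<le> c" using C \<gamma> Hx by (simp add: c_def)
  define H where "H = max (BB * tm k0) (c / (p - 1))"
  have k01: "1 \<le> k0" using k0 k1 by simp
  have H: "0 \<le> H" using BB tm_pos[OF k01] by (simp add: H_def le_max_iff_disj)
  have mean: "expectation (\<lambda>z. I n z * Z n n z) \<le> H / tm n" if n: "k0 \<le> n" for n
  proof -
    have n1: "1 \<le> n" using n k01 by simp
    have an: "1 \<le> real (a n)" using a_pos[OF n1] by simp
    show ?thesis
    proof (rule recursion_bound[where a = "\<lambda>k. expectation (\<lambda>z. I n z * Z n k z)", OF k01 p H, of c _ n])
      show "c \<le> (p - 1) * H"
      proof -
        have "c = (p - 1) * (c / (p - 1))" using p by simp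
        also have "\<dots> \<le> (p - 1) * H" using p by (intro mult_left_mono) (auto simp: H_def)
        finally show ?thesis .
      qed
      have "expectation (\<lambda>z. I n z * Z n k0 z) \<le> BB" by (rule expectation_bounds(2)[OF IZm[OF n1] IZ[OF n1]])
      also have "\<dots> \<le> H / tm k0" using tm_pos[OF k01] by (simp add: pos_le_divide_eq H_def)
      finally show "expectation (\<lambda>z. I n z * Z n k0 z) \<le> H / tm k0" .
      fix k assume k: "k0 \<le> k" "k < n"
      have k': "k1 \<le> k" "1 \<le> k" using k k0 k01 by auto
      have t: "0 < tm (Suc k)" "0 < tm k" using tm_pos k' by auto
      define g where "g = gk (Suc k)"
      have g: "g = \<gamma> / tm (Suc k)" unfolding g_def by (rule gk_eq) simp
      have g0: "0 \<le> g" "g * Lr \<le> 1"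
      proof -
        show g0: "0 \<le> g" unfolding g_def by (rule gk_nonneg)
        have "g * Lr \<le> g * Lq" using Lr(2) g0 by (rule mult_left_mono)
        also have "\<dots> \<le> 1" unfolding g_def by (rule small[OF k'(1)])
        finally show "g * Lr \<le> 1" .
      qed
      have gp: "g * Lr = p / tm (Suc k)" by (simp add: g p_def)
      show "p \<le> tm (Suc k)" using g0(2) t unfolding gp by simp
      have Xm: "Xn n k \<in> borel_measurable M" by (rule Fn_M[OF n1 Xn_measurable[OF n1]])
      have nX: "nS (Xn n k z) \<le> CS * CX" for z
        using CS(2)[of "Xn n k z"] mult_left_mono[OF CX(2)[OF n1, of k z], of CS] CS(1) by linarith
      have Xi2: "integrable M (\<lambda>z. (nS (Xn n k z))^2)"
        by (rule bounded_integrable[of _ "(CS * CX)^2"])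
          (use nS_measurable[OF Xm] power_mono[OF nX nS_nonneg, of _ 2] in auto)
      have "expectation (\<lambda>z. I n z * Z n (Suc k) z) \<le>
        expectation (\<lambda>z. (1 - g * Lr) * (I n z * Z n k z) + C * g * (nS (Xn n k z))^2 + C * g^2)"
      proof (rule integral_mono)
        show "integrable M (\<lambda>z. I n z * Z n (Suc k) z)" by (rule IZi[OF n1])
        show "integrable M (\<lambda>z. (1 - g * Lr) * (I n z * Z n k z) + C * g * (nS (Xn n k z))^2 + C * g^2)"
          by (intro Bochner_Integration.integrable_add integrable_mult_right IZi[OF n1] Xi2) simp
        fix z assume w: "z \<in> space M"
        show "I n z * Z n (Suc k) z \<le> (1 - g * Lr) * (I n z * Z n k z) + C * g * (nS (Xn n k z))^2 + C * g^2"
        proof (cases "z \<in> bad k2 \<delta> n")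
          case True
          then have "I n z = 0" by (simp add: I_def)
          then show ?thesis using C g0 by simp
        next
          case False
          then have I1: "I n z = 1" using w by (simp add: I_def)
          have "\<forall>k. k2 \<le> k \<longrightarrow> k \<le> n \<longrightarrow> norm (Xi (th n z) (et n z) k) \<le> \<delta>"
            using w False by (auto simp: bad_def Xn_def not_less)
          from close[OF path_n[OF n1] this, of k] k have "norm (th n z k - \<theta>) \<le> \<epsilon>" by simp
          from loc[OF path_n[OF n1] k'(1) this]
          have "Z n (Suc k) z \<le> (1 - g * Lr) * Z n k z + C * g * (norm (Xn n k z))^2 + C * g^2"
            by (simp only: Z_def g_def Xn_def)
          moreover have "C * g * (norm (Xn n k z))^2 \<le> C * g * (nS (Xn n k z))^2"
            using C g0 by (intro mult_left_mono power_mono norm_le_nS) auto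
          ultimately show ?thesis by (simp add: I1)
        qed
      qed
      also have "\<dots> = (1 - g * Lr) * expectation (\<lambda>z. I n z * Z n k z) + C * g * expectation (\<lambda>z. (nS (Xn n k z))^2) + C * g^2"
        using IZi[OF n1, of k] Xi2 by (simp add: prob_space)
      also have "\<dots> \<le> (1 - g * Lr) * expectation (\<lambda>z. I n z * Z n k z) + C * g * (2 * Hx / tm (Suc k)) + C * g^2"
      proof (intro add_mono order_refl mult_left_mono)
        have "expectation (\<lambda>z. (nS (Xn n k z))^2) \<le> Hx / (real (a n) * tm k)" by (rule Hx(2)[OF n1 k'(1)])
        also have "\<dots> \<le> Hx / (1 * (tm (Suc k) / 2))"
        proof (intro divide_left_mono mult_mono)
          show "tm (Suc k) / 2 \<le> tm k" using tm_ge_1[OF k'(2)] by (simp add: tm_Suc)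
        qed (use an t Hx in auto)
        finally show "expectation (\<lambda>z. (nS (Xn n k z))^2) \<le> 2 * Hx / tm (Suc k)" by (simp add: mult.commute)
      qed (use C g0 in auto)
      also have "\<dots> = (1 - p / tm (Suc k)) * expectation (\<lambda>z. I n z * Z n k z) + c / (tm (Suc k))^2"
      proof -
        have "C * g * (2 * Hx / tm (Suc k)) + C * g^2 = c / (tm (Suc k))^2"
          unfolding g c_def by (simp add: power2_eq_square add_divide_distrib mult_ac)
        then show ?thesis by (simp add: gp)
      qed
      finally show "expectation (\<lambda>z. I n z * Z n (Suc k) z) \<le> (1 - p / tm (Suc k)) * expectation (\<lambda>z. I n z * Z n k z) + c / (tm (Suc k))^2" .
    qed (use n in auto)
  qed
  have lim1: "(\<lambda>n. (2 * H / e) * (sn n / tm n)) \<longlonglongrightarrow> 0" using tendsto_mult_right_zero[OF sn_over_tm] .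
  have lim2: "(\<lambda>n. (Cz * \<gamma>) * (sn n / tm n)) \<longlonglongrightarrow> 0" using tendsto_mult_right_zero[OF sn_over_tm] .
  have e2: "e / 2 > 0" using e by simp
  show ?thesis
    using k2[OF e2] order_tendstoD(2)[OF lim1 e2] order_tendstoD(2)[OF lim2 e2] eventually_ge_at_top[of k0]
  proof eventually_elim
    case (elim n)
    have n: "k0 \<le> n" "1 \<le> n" using elim(4) k01 by auto
    have gn: "gk n = \<gamma> / tm n" by (rule gk_eq[OF n(2)])
    have sub: "{z\<in>space M. sn n * norm (th n z n - \<theta> - Xn n n z) > e} \<subseteq>
      bad k2 \<delta> n \<union> {z\<in>space M. sn n * (I n z * Z n n z) > e / 2}"
    proof
      fix z assume w: "z \<in> {z\<in>space M. sn n * norm (th n z n - \<theta> - Xn n n z) > e}"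
      show "z \<in> bad k2 \<delta> n \<union> {z\<in>space M. sn n * (I n z * Z n n z) > e / 2}"
      proof (cases "z \<in> bad k2 \<delta> n")
        case False
        then have I1: "I n z = 1" using w by (simp add: I_def)
        have "norm (th n z n - \<theta> - Xn n n z) \<le> norm (zeta (th n z) (et n z) n - \<theta>) + norm (th n z n - Xn n n z - zeta (th n z) (et n z) n)"
          using norm_triangle_ineq[of "zeta (th n z) (et n z) n - \<theta>" "th n z n - Xn n n z - zeta (th n z) (et n z) n"] by (simp add: algebra_simps)
        also have "\<dots> \<le> Z n n z + Cz * gk n"
          unfolding Z_def Xn_def by (intro add_mono norm_le_nS Cz(2) path_n n)
        finally have "sn n * norm (th n z n - \<theta> - Xn n n z) \<le> sn n * (Z n n z + Cz * gk n)"
          by (rule mult_left_mono[OF _ sn_nonneg])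
        also have "\<dots> = sn n * Z n n z + (Cz * \<gamma>) * (sn n / tm n)" by (simp add: gn algebra_simps)
        finally have u: "sn n * norm (th n z n - \<theta> - Xn n n z) \<le> sn n * Z n n z + (Cz * \<gamma>) * (sn n / tm n)" .
        have "e < sn n * norm (th n z n - \<theta> - Xn n n z)" using w by simp
        with u elim(3) have "e < sn n * Z n n z + e / 2" by linarith
        then show ?thesis using w by (simp add: I1)
      qed simp
    qed
    have m1: "(\<lambda>z. sn n * (I n z * Z n n z)) \<in> borel_measurable M" using IZm[OF n(2)] by measurable
    have "prob {z\<in>space M. sn n * norm (th n z n - \<theta> - Xn n n z) > e} \<le>
      prob (bad k2 \<delta> n \<union> {z\<in>space M. sn n * (I n z * Z n n z) > e / 2})"
      using m1 bad_sets[OF n(2)] by (intro finite_measure_mono[OF sub] sets.Un) auto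
    also have "\<dots> \<le> prob (bad k2 \<delta> n) + prob {z\<in>space M. sn n * (I n z * Z n n z) > e / 2}"
      using m1 bad_sets[OF n(2)] by (intro measure_Un_le) auto
    also have "\<dots> \<le> e / 2 + expectation (\<lambda>z. sn n * (I n z * Z n n z)) / (e / 2)"
    proof (intro add_mono elim(1) markov_bound[of _ "sn n * BB", OF m1])
      show "0 \<le> sn n * (I n z * Z n n z)" for z using sn_nonneg IZ(1)[OF n(2)] by simp
      show "sn n * (I n z * Z n n z) \<le> sn n * BB" for z by (intro mult_left_mono sn_nonneg IZ(2)[OF n(2)])
    qed (rule e2)
    also have "expectation (\<lambda>z. sn n * (I n z * Z n n z)) = sn n * expectation (\<lambda>z. I n z * Z n n z)" by simp
    also have "e / 2 + sn n * expectation (\<lambda>z. I n z * Z n n z) / (e / 2) \<le> e / 2 + sn n * (H / tm n) / (e / 2)"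
      using mean[OF n(1)] e by (intro add_left_mono divide_right_mono mult_left_mono sn_nonneg) auto
    also have "\<dots> = e / 2 + (2 * H / e) * (sn n / tm n)" by (simp add: mult_ac)
    also have "\<dots> \<le> e" using elim(2) by simp
    finally show ?case .
  qed
qed

end

section \<open>Backward transport and quadratic forms\<close>

text \<open>\<open>d\<close> is expanded to second order and \<open>x\<close> to first, because
  \<open>d\<close> will be a martingale increment and \<open>x\<close> a compensator of the size of
  its mean square.\<close>

lemma norm_exp_product_approx:
  fixes d x :: real
  assumes x: "\<bar>x\<bar> \<le> 1"
  shows "norm (iexp d * exp (of_real x) - (1 + \<i> * of_real d - of_real (d^2) / 2 + of_real x)) \<le>
    \<bar>d\<bar>^3 + \<bar>d\<bar> * \<bar>x\<bar> + x^2"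
proof -
  have ex: "\<bar>exp x - 1 - x\<bar> \<le> x^2"
  proof -
    have "1 + x \<le> exp x" by (rule exp_ge_add_one_self)
    moreover have "exp x \<le> 1 + x + x^2"
    proof (cases "0 \<le> x")
      case True
      then show ?thesis using exp_bound[of x] x by simp
    next
      \<comment> \<open>For negative \<open>x\<close> the claim follows by inverting the quadratic
        lower bound for \<open>exp y\<close> with \<open>y = - x\<close>.\<close>
      case False
      define y where "y = - x"
      have y: "0 \<le> y" using False by (simp add: y_def)
      have lo: "1 + y + y^2 / 2 \<le> exp y" using exp_lower_Taylor_quadratic[OF y] by simp
      have pos: "0 < 1 + y + y^2 / 2" using y by (simp add: add_pos_nonneg)
      have "1 \<le> (1 - y + y^2) * (1 + y + y^2 / 2)"
      proof -
        have "(1 - y + y^2) * (1 + y + y^2 / 2) = 1 + (y^2 + y^3 + y^4) / 2"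
          by (simp add: power2_eq_square power3_eq_cube power4_eq_xxxx field_simps)
        then show ?thesis using y by simp
      qed
      moreover have "0 \<le> 1 - y + y^2"
      proof -
        have "0 \<le> (1 - y / 2)^2 + 3 / 4 * y^2" by simp
        then show ?thesis by (simp add: power2_eq_square algebra_simps)
      qed
      ultimately have "1 \<le> (1 - y + y^2) * exp y" using mult_left_mono[OF lo] by (meson order_trans)
      then have "exp (- y) \<le> (1 - y + y^2) * (exp y * exp (- y))"
        using mult_right_mono[of 1 "(1 - y + y^2) * exp y" "exp (- y)"] by (simp add: mult.assoc)
      then show ?thesis by (simp add: y_def exp_minus)
    qed
    ultimately show ?thesis by linarith
  qed
  have i1: "norm (iexp d - 1) \<le> \<bar>d\<bar>" using iexp_approx1[of d 0] by simp
  have i2: "norm (iexp d - (1 + \<i> * of_real d - of_real (d^2) / 2)) \<le> \<bar>d\<bar>^3"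
  proof -
    have "norm (iexp d - (\<Sum>k\<le>2. (\<i> * of_real d)^k / fact k)) \<le> \<bar>d\<bar>^(Suc 2) / fact (Suc 2)"
      using iexp_approx1[of d 2] by simp
    also have "(\<Sum>k\<le>2. (\<i> * complex_of_real d)^k / fact k) = 1 + \<i> * of_real d - of_real (d^2) / 2"
      by (simp add: numeral_2_eq_2 power_mult_distrib)
    also have "\<bar>d\<bar>^(Suc 2) / fact (Suc 2) = \<bar>d\<bar>^3 / 6" by (simp add: eval_nat_numeral fact_Suc)
    also have "\<dots> \<le> \<bar>d\<bar>^3" using zero_le_power_abs[of d 3] by linarith
    finally show ?thesis .
  qed
  have "iexp d * exp (of_real x) - (1 + \<i> * of_real d - of_real (d^2) / 2 + of_real x) =
    iexp d * of_real (exp x - 1 - x) + (iexp d - 1) * of_real x + (iexp d - (1 + \<i> * of_real d - of_real (d^2) / 2))"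
    by (simp add: exp_of_real algebra_simps)
  then have "norm (iexp d * exp (of_real x) - (1 + \<i> * of_real d - of_real (d^2) / 2 + of_real x)) \<le>
    norm (iexp d * of_real (exp x - 1 - x)) + norm ((iexp d - 1) * of_real x) + norm (iexp d - (1 + \<i> * of_real d - of_real (d^2) / 2))"
    by (simp only:) (intro order_trans[OF norm_triangle_ineq] add_right_mono norm_triangle_ineq)
  also have "\<dots> \<le> x^2 + \<bar>d\<bar> * \<bar>x\<bar> + \<bar>d\<bar>^3"
  proof (intro add_mono i2)
    show "norm (iexp d * of_real (exp x - 1 - x)) \<le> x^2"
      unfolding norm_mult norm_exp_i_times norm_of_real using ex by simp
    show "norm ((iexp d - 1) * of_real x) \<le> \<bar>d\<bar> * \<bar>x\<bar>"
      unfolding norm_mult norm_of_real by (intro mult_right_mono i1) simp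
  qed
  finally show ?thesis by simp
qed

lemma abs_square_diff: "\<bar>x^2 - y^2\<bar> \<le> \<bar>x - y\<bar> * (\<bar>x\<bar> + \<bar>y\<bar>)" for x y :: real
proof -
  have "x^2 - y^2 = (x - y) * (x + y)" by (simp add: power2_eq_square algebra_simps)
  then show ?thesis by (simp add: abs_mult mult_left_mono abs_triangle_ineq)
qed

context
  fixes P :: "real ^ ('s::finite) option ^ 's option" and \<nu> :: "real^'s"
  assumes ch: "absorbed_chain P" and \<nu>: "\<nu> \<in> prob_simplex"
begin

lemma K_average_bound:
  assumes "\<And>y. \<bar>f y\<bar> \<le> B" shows "\<bar>\<Sum>y\<in>UNIV. K P \<nu> $ w $ y * f y\<bar> \<le> B"
proof -
  have "\<bar>\<Sum>y\<in>UNIV. K P \<nu> $ w $ y * f y\<bar> \<le> (\<Sum>y\<in>UNIV. K P \<nu> $ w $ y * B)"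
    using K_nonneg[OF ch \<nu>] assms by (auto intro!: order_trans[OF sum_abs] sum_mono mult_left_mono simp: abs_mult)
  also have "\<dots> = B" unfolding sum_distrib_right[symmetric] K_row[OF ch \<nu>] by simp
  finally show ?thesis .
qed

lemma kvar_lipschitz:
  "\<bar>kvar (K P \<nu>) c $ w - kvar (K P \<nu>) c' $ w\<bar> \<le> 2 * norm (c - c') * (norm c + norm c')"
proof -
  have cc: "\<bar>c $ y - c' $ y\<bar> \<le> norm (c - c')" "\<bar>c $ y\<bar> \<le> norm c" "\<bar>c' $ y\<bar> \<le> norm c'" for y
    using component_le_norm_cart[of "c - c'" y] component_le_norm_cart[of c y] component_le_norm_cart[of c' y] by auto
  have 1: "\<bar>\<Sum>y\<in>UNIV. K P \<nu> $ w $ y * ((c $ y)^2 - (c' $ y)^2)\<bar> \<le> norm (c - c') * (norm c + norm c')"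
    by (rule K_average_bound) (rule order_trans[OF abs_square_diff], intro mult_mono add_mono cc, auto)
  have k: "\<bar>(K P \<nu> *v v) $ w\<bar> \<le> norm v" for v
    unfolding matrix_vector_mult_def vec_lambda_beta by (rule K_average_bound) (rule component_le_norm_cart)
  have "\<bar>((K P \<nu> *v c) $ w)^2 - ((K P \<nu> *v c') $ w)^2\<bar> \<le> norm (c - c') * (norm c + norm c')"
    using k[of "c - c'"] by (intro order_trans[OF abs_square_diff] mult_mono add_mono k)
      (auto simp: matrix_vector_mult_diff_distrib)
  moreover have "kvar (K P \<nu>) c $ w - kvar (K P \<nu>) c' $ w =
    (\<Sum>y\<in>UNIV. K P \<nu> $ w $ y * ((c $ y)^2 - (c' $ y)^2)) - (((K P \<nu> *v c) $ w)^2 - ((K P \<nu> *v c') $ w)^2)"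
    by (simp add: kvar_def right_diff_distrib sum_subtractf)
  ultimately show ?thesis using 1 by linarith
qed

lemma kvar_kernel_lipschitz:
  assumes \<nu>': "\<nu>' \<in> prob_simplex"
  shows "\<bar>kvar (K P \<nu>) c $ w - kvar (K P \<nu>') c $ w\<bar> \<le> 3 * norm (\<nu> - \<nu>') * (norm c)^2"
proof -
  define \<beta> where "\<beta> = P $ Some w $ None"
  have \<beta>: "0 \<le> \<beta>" "\<beta> \<le> 1"
  proof -
    have nn: "0 \<le> P $ Some w $ y" for y using ch by (simp add: absorbed_chain_def transition_matrix_def)
    have "\<beta> \<le> (\<Sum>y\<in>UNIV. P $ Some w $ y)" unfolding \<beta>_def by (rule member_le_sum) (use nn in auto)
    then show "\<beta> \<le> 1" using ch by (simp add: absorbed_chain_def transition_matrix_def)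
    show "0 \<le> \<beta>" unfolding \<beta>_def by (rule nn)
  qed
  have "(\<Sum>y\<in>UNIV. K P \<nu> $ w $ y * f y) - (\<Sum>y\<in>UNIV. K P \<nu>' $ w $ y * f y) = \<beta> * ((\<nu> - \<nu>') \<bullet> (\<chi> y. f y))" for f
    unfolding sum_subtractf[symmetric] inner_vec_def sum_distrib_left
    by (intro sum.cong refl) (simp add: K_def \<beta>_def algebra_simps)
  note diff = this
  have c2: "norm (\<chi> y. (c $ y)^2) \<le> (norm c)^2"
  proof -
    have "norm (\<chi> y. (c $ y)^2) \<le> (\<Sum>y\<in>UNIV. \<bar>(\<chi> y. (c $ y)^2) $ y\<bar>)" by (rule norm_le_l1_cart)
    also have "\<dots> = (norm c)^2" by (simp add: norm_vec_def L2_set_def sum_nonneg)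
    finally show ?thesis .
  qed
  have 1: "\<bar>(\<Sum>y\<in>UNIV. K P \<nu> $ w $ y * (c $ y)^2) - (\<Sum>y\<in>UNIV. K P \<nu>' $ w $ y * (c $ y)^2)\<bar> \<le> norm (\<nu> - \<nu>') * (norm c)^2"
  proof -
    have "\<bar>\<beta> * ((\<nu> - \<nu>') \<bullet> (\<chi> y. (c $ y)^2))\<bar> \<le> 1 * (norm (\<nu> - \<nu>') * norm (\<chi> y. (c $ y)^2))"
      unfolding abs_mult using \<beta> by (intro mult_mono Cauchy_Schwarz_ineq2) auto
    also have "\<dots> \<le> norm (\<nu> - \<nu>') * (norm c)^2" using c2 by (simp add: mult_left_mono)
    finally show ?thesis unfolding diff .
  qed
  have k: "\<bar>(K P \<nu> *v c) $ w\<bar> \<le> norm c"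
    unfolding matrix_vector_mult_def vec_lambda_beta by (rule K_average_bound) (rule component_le_norm_cart)
  have k': "\<bar>(K P \<nu>' *v c) $ w\<bar> \<le> norm c"
  proof -
    have "\<bar>(K P \<nu>' *v c) $ w\<bar> \<le> (\<Sum>y\<in>UNIV. K P \<nu>' $ w $ y * norm c)"
      unfolding matrix_vector_mult_def vec_lambda_beta using K_nonneg[OF ch \<nu>']
      by (auto intro!: order_trans[OF sum_abs] sum_mono mult_left_mono component_le_norm_cart simp: abs_mult)
    also have "\<dots> = norm c" unfolding sum_distrib_right[symmetric] K_row[OF ch \<nu>'] by simp
    finally show ?thesis .
  qed
  have d: "\<bar>(K P \<nu> *v c) $ w - (K P \<nu>' *v c) $ w\<bar> \<le> norm (\<nu> - \<nu>') * norm c"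
  proof -
    have "(K P \<nu> *v c) $ w - (K P \<nu>' *v c) $ w = \<beta> * ((\<nu> - \<nu>') \<bullet> c)"
      using diff[of "\<lambda>y. c $ y"] by (simp add: matrix_vector_mult_def)
    moreover have "\<bar>\<beta> * ((\<nu> - \<nu>') \<bullet> c)\<bar> \<le> 1 * (norm (\<nu> - \<nu>') * norm c)"
      unfolding abs_mult using \<beta> by (intro mult_mono Cauchy_Schwarz_ineq2) auto
    ultimately show ?thesis by simp
  qed
  have "\<bar>((K P \<nu> *v c) $ w)^2 - ((K P \<nu>' *v c) $ w)^2\<bar> \<le> (norm (\<nu> - \<nu>') * norm c) * (norm c + norm c)"
    by (intro order_trans[OF abs_square_diff] mult_mono add_mono k k' d) auto
  then have "\<bar>((K P \<nu> *v c) $ w)^2 - ((K P \<nu>' *v c) $ w)^2\<bar> \<le> 2 * (norm (\<nu> - \<nu>') * (norm c)^2)"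
    by (simp add: power2_eq_square mult_ac)
  then show ?thesis using 1 unfolding kvar_def vec_lambda_beta by (simp add: mult.assoc)
qed

end

context qsd_chain
begin

lemma rvec_\<theta>: "rvec \<theta> u = Rt *v u"
  by (simp add: rvec_def Rt_mult pi_\<theta>)

text \<open>Lets conditional variances be evaluated at \<open>\<theta>\<close>, at the price of a
  distance whose mean tends to zero.\<close>

lemma kvar_rvec_lipschitz:
  "\<exists>C>0. \<forall>\<nu>\<in>prob_simplex. \<forall>u w. \<bar>kvar (K P \<nu>) (rvec \<nu> u) $ w - kvar Kt (Rt *v u) $ w\<bar> \<le> C * norm (\<nu> - \<theta>) * (norm u)^2"
proof -
  obtain CV where CV: "CV > 0" "\<And>\<nu> u. \<nu> \<in> prob_simplex \<Longrightarrow> norm (rvec \<nu> u) \<le> CV * norm u" using rvec_bound by blast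
  obtain Cp where Cp: "Cp \<ge> 0" "\<And>\<nu> \<nu>'. \<nu> \<in> prob_simplex \<Longrightarrow> \<nu>' \<in> prob_simplex \<Longrightarrow> norm (pi \<nu> - pi \<nu>') \<le> Cp * norm (\<nu> - \<nu>')"
    using pi_lipschitz by blast
  define C where "C = 2 * (Cp * norm g1) * (CV + CV) + 3 * CV^2"
  have "\<bar>kvar (K P \<nu>) (rvec \<nu> u) $ w - kvar Kt (Rt *v u) $ w\<bar> \<le> C * norm (\<nu> - \<theta>) * (norm u)^2"
    if \<nu>: "\<nu> \<in> prob_simplex" for \<nu> u w
  proof -
    have "rvec \<nu> u - rvec \<theta> u = - ((pi \<nu> - pi \<theta>) \<bullet> u) *\<^sub>R g1"
      by (simp add: rvec_def inner_diff_left algebra_simps)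
    then have "norm (rvec \<nu> u - rvec \<theta> u) = \<bar>(pi \<nu> - pi \<theta>) \<bullet> u\<bar> * norm g1" by simp
    also have "\<dots> \<le> ((Cp * norm (\<nu> - \<theta>)) * norm u) * norm g1"
      by (intro mult_right_mono order_trans[OF Cauchy_Schwarz_ineq2] Cp(2)[OF \<nu> \<theta>_simplex]) auto
    finally have d: "norm (rvec \<nu> u - rvec \<theta> u) \<le> (Cp * norm g1) * norm (\<nu> - \<theta>) * norm u" by (simp add: mult_ac)
    have "\<bar>kvar (K P \<nu>) (rvec \<nu> u) $ w - kvar (K P \<nu>) (rvec \<theta> u) $ w\<bar> \<le>
      2 * norm (rvec \<nu> u - rvec \<theta> u) * (norm (rvec \<nu> u) + norm (rvec \<theta> u))"
      by (rule kvar_lipschitz[OF chain \<nu>])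
    also have "\<dots> \<le> 2 * ((Cp * norm g1) * norm (\<nu> - \<theta>) * norm u) * (CV * norm u + CV * norm u)"
      using d by (intro mult_mono add_mono CV(2) \<nu> \<theta>_simplex) (auto simp: Cp(1))
    finally have 1: "\<bar>kvar (K P \<nu>) (rvec \<nu> u) $ w - kvar (K P \<nu>) (rvec \<theta> u) $ w\<bar> \<le>
      2 * (Cp * norm g1) * (CV + CV) * norm (\<nu> - \<theta>) * (norm u)^2" by (simp add: power2_eq_square algebra_simps)
    have "\<bar>kvar (K P \<nu>) (rvec \<theta> u) $ w - kvar Kt (rvec \<theta> u) $ w\<bar> \<le> 3 * norm (\<nu> - \<theta>) * (norm (rvec \<theta> u))^2"
      by (rule kvar_kernel_lipschitz[OF chain \<nu> \<theta>_simplex])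
    also have "\<dots> \<le> 3 * norm (\<nu> - \<theta>) * (CV * norm u)^2"
      by (intro mult_left_mono power_mono CV(2) \<theta>_simplex) auto
    finally have 2: "\<bar>kvar (K P \<nu>) (rvec \<theta> u) $ w - kvar Kt (rvec \<theta> u) $ w\<bar> \<le> 3 * CV^2 * norm (\<nu> - \<theta>) * (norm u)^2"
      by (simp add: power_mult_distrib mult_ac)
    show ?thesis using 1 2 unfolding rvec_\<theta> C_def by (simp add: ring_distribs)
  qed
  moreover have "C > 0" using CV Cp by (simp add: C_def add_nonneg_pos)
  ultimately show ?thesis by blast
qed

text \<open>Poisson solution for the variance function \<open>kvar Kt (Rt *v u)\<close>: the second
  corrector.\<close>

definition cvec :: "real^'s \<Rightarrow> real^'s" where "cvec u = Rt *v (kvar Kt (Rt *v u))"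

lemma Rt_norm: "\<exists>C>0. \<forall>x. norm (Rt *v x) \<le> C * norm x"
  using bounded_linear.pos_bounded[OF matrix_vector_mul_bounded_linear[of Rt]] by (auto simp: mult.commute)

lemma norm_le_card: assumes "\<And>w. \<bar>(v::real^'s) $ w\<bar> \<le> B" shows "norm v \<le> real CARD('s) * B"
proof -
  have "norm v \<le> (\<Sum>w\<in>UNIV. \<bar>v $ w\<bar>)" by (rule norm_le_l1_cart)
  also have "\<dots> \<le> (\<Sum>w\<in>(UNIV::'s set). B)" by (intro sum_mono assms)
  finally show ?thesis by simp
qed

lemma cvec_lipschitz: "\<exists>C>0. \<forall>u v. norm (cvec u - cvec v) \<le> C * norm (u - v) * (norm u + norm v)"
proof -
  obtain CR where CR: "CR > 0" "\<And>x. norm (Rt *v x) \<le> CR * norm x" using Rt_norm by blast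
  define C where "C = CR * (real CARD('s) * (2 * CR * CR))"
  have "norm (cvec u - cvec v) \<le> C * norm (u - v) * (norm u + norm v)" for u v
  proof -
    have comp: "\<bar>(kvar Kt (Rt *v u) - kvar Kt (Rt *v v)) $ w\<bar> \<le> 2 * (CR * norm (u - v)) * (CR * norm u + CR * norm v)" for w
    proof -
      have "\<bar>(kvar Kt (Rt *v u) - kvar Kt (Rt *v v)) $ w\<bar> \<le> 2 * norm (Rt *v u - Rt *v v) * (norm (Rt *v u) + norm (Rt *v v))"
        using kvar_lipschitz[OF chain \<theta>_simplex, of "Rt *v u" w "Rt *v v"] by simp
      also have "\<dots> \<le> 2 * (CR * norm (u - v)) * (CR * norm u + CR * norm v)"
        using CR(2)[of "u - v"] CR(1)
        by (intro mult_mono add_mono CR(2)) (auto simp: matrix_vector_mult_diff_distrib)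
      finally show ?thesis .
    qed
    have "norm (cvec u - cvec v) = norm (Rt *v (kvar Kt (Rt *v u) - kvar Kt (Rt *v v)))"
      by (simp add: cvec_def matrix_vector_mult_diff_distrib)
    also have "\<dots> \<le> CR * norm (kvar Kt (Rt *v u) - kvar Kt (Rt *v v))" by (rule CR(2))
    also have "\<dots> \<le> CR * (real CARD('s) * (2 * (CR * norm (u - v)) * (CR * norm u + CR * norm v)))"
      using CR(1) by (intro mult_left_mono norm_le_card comp) auto
    also have "\<dots> = C * norm (u - v) * (norm u + norm v)" by (simp add: C_def algebra_simps)
    finally show ?thesis .
  qed
  moreover have "C > 0" using CR by (simp add: C_def)
  ultimately show ?thesis by blast
qed

lemma cvec_0: "cvec 0 = 0"
proof -
  have "kvar Kt 0 = 0" by (simp add: kvar_def vec_eq_iff)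
  then show ?thesis by (simp add: cvec_def)
qed

end

context clt_chain
begin

lemma gk_average: "(\<lambda>n. (\<Sum>k<n. gk (Suc k)) / tm n) \<longlonglongrightarrow> 0"
proof -
  \<comment> \<open>The sum grows logarithmically; a square root is easier to propagate and small
    enough against \<open>tm n\<close>.\<close>
  have le: "(\<Sum>k<n. gk (Suc k)) \<le> 2 * \<gamma> * sqrt (real n)" for n
  proof (induction n)
    case 0
    then show ?case by simp
  next
    case (Suc n)
    have "gk (Suc n) = \<gamma> / tm (Suc n)" by (rule gk_eq) simp
    also have "\<dots> \<le> \<gamma> / real (Suc n)"
      using tm_ge[of "Suc n"] \<gamma> by (intro divide_left_mono) auto
    also have "\<dots> \<le> 2 * \<gamma> * (sqrt (real (Suc n)) - sqrt (real n))"
    proof -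
      define s where "s = sqrt (real (Suc n))"
      define s' where "s' = sqrt (real n)"
      have s: "1 \<le> s" "0 \<le> s'" "s' \<le> s" by (auto simp: s_def s'_def)
      have "(s - s') * (s + s') = s^2 - s'^2" by (simp add: power2_eq_square algebra_simps)
      also have "\<dots> = 1" by (simp add: s_def s'_def)
      finally have 1: "(s - s') * (s + s') = 1" .
      have "s + s' \<le> 2 * s^2"
      proof -
        have "s * 1 \<le> s * s" using s by (intro mult_left_mono) auto
        then show ?thesis unfolding power2_eq_square using s by linarith
      qed
      then have "(s - s') * (s + s') \<le> (s - s') * (2 * s^2)" using s by (intro mult_left_mono) auto
      then have "1 \<le> (2 * (s - s')) * s^2" unfolding 1 by (simp only: mult_ac)
      then have "1 / s^2 \<le> 2 * (s - s')" using s by (subst pos_divide_le_eq) auto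
      then have "\<gamma> * (1 / s^2) \<le> \<gamma> * (2 * (s - s'))" using \<gamma> by (intro mult_left_mono) auto
      then show ?thesis by (simp add: s_def s'_def algebra_simps)
    qed
    finally show ?case using Suc by (simp add: algebra_simps)
  qed
  have "(\<lambda>n. 2 * \<gamma> / sqrt (real n)) \<longlonglongrightarrow> 0"
    by (intro tendsto_divide_0[OF tendsto_const] filterlim_at_top_imp_at_infinity
        filterlim_compose[OF sqrt_at_top filterlim_real_sequentially])
  then show ?thesis
  proof (rule Lim_null_comparison[rotated])
    show "\<forall>\<^sub>F n in sequentially. norm ((\<Sum>k<n. gk (Suc k)) / tm n) \<le> 2 * \<gamma> / sqrt (real n)"
      using eventually_ge_at_top[of 1]
    proof eventually_elim
      case (elim n)
      have "norm ((\<Sum>k<n. gk (Suc k)) / tm n) = (\<Sum>k<n. gk (Suc k)) / tm n"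
        using tm_pos[OF elim] by (simp add: sum_nonneg gk_nonneg)
      also have "\<dots> \<le> 2 * \<gamma> * sqrt (real n) / real n"
        using le[of n] tm_ge[of n] elim \<gamma> by (intro frac_le) auto
      also have "\<dots> = 2 * \<gamma> / sqrt (real n)" using elim by (simp add: field_simps)
      finally show ?case .
    qed
  qed
qed

lemma inverse_tm: "(\<lambda>n. 1 / tm n) \<longlonglongrightarrow> 0"
  by (rule tendsto_divide_0[OF tendsto_const filterlim_at_top_imp_at_infinity[OF tm_at_top]])

lemma inner_transpose_J: "x \<bullet> (transpose J *v y) = (J *v x) \<bullet> y"
  unfolding transpose_matrix_vector using dot_lmul_matrix[of y J x] by (simp add: inner_commute)

primrec ub :: "nat \<Rightarrow> real^'s \<Rightarrow> nat \<Rightarrow> real^'s" where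
  "ub n u 0 = u"
| "ub n u (Suc j) = ub n u j + gk (n - j) *\<^sub>R (transpose J *v ub n u j)"

text \<open>\<open>un n u k\<close> is \<open>u\<close> transported backwards from time \<open>n\<close> to time \<open>k\<close> by the adjoint linear recursion, so
  that \<open>un n u k \<bullet> Xn n k\<close> changes in \<open>k\<close> only by martingale increments.\<close>
definition "un n u k = ub n u (n - k)"

lemma un_self: "un n u n = u" by (simp add: un_def)

lemma un_step: assumes "k < n"
  shows "un n u k = un n u (Suc k) + gk (Suc k) *\<^sub>R (transpose J *v un n u (Suc k))"
proof -
  have "n - k = Suc (n - Suc k)" "n - (n - Suc k) = Suc k" using assms by auto
  then show ?thesis by (simp add: un_def)
qed

text \<open>On the diagonal the two transposed terms agree, and \<open>J\<close> passes to
  \<open>transpose J\<close> acting on \<open>u\<close>, the matrix of the backward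
  recursion.\<close>

lemma lyap_op_quadratic:
  assumes "transpose V = V"
  shows "u \<bullet> (lyap_op V *v u) = 2 * (u \<bullet> (V *v (transpose J *v u))) + (1 / \<gamma>) * (u \<bullet> (V *v u))"
proof -
  have "transpose (J ** V) *v u = V *v (transpose J *v u)"
    by (simp only: matrix_transpose_mul assms matrix_vector_mul_assoc)
  moreover have "u \<bullet> (transpose (J ** V) *v u) = u \<bullet> ((J ** V) *v u)"
    unfolding transpose_matrix_vector using dot_lmul_matrix[of u "J ** V" u] by (simp add: inner_commute)
  ultimately show ?thesis
    by (simp add: lyap_op_def matrix_vector_mult_add_rdistrib inner_add_right scaleR_matrix_vector_assoc[symmetric])
qed

end

context clt_lyap
begin

text \<open>Duality: testing \<open>un\<close> against \<open>x\<close> moves the recursion onto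
  \<open>x\<close>, where \<open>nS\<close> contracts. Since \<open>\<gamma> * Lq > 1\<close>, the
  factor of a step is at most \<open>tm j / tm (Suc j)\<close>, and these quotients
  telescope.\<close>

lemma un_bound: "\<exists>C>0. \<forall>n u k. k1 \<le> k \<longrightarrow> k \<le> n \<longrightarrow> norm (un n u k) \<le> C * norm u * (tm k / tm n)"
proof -
  obtain CS where CS: "CS > 0" "\<And>x. nS x \<le> CS * norm x" using nS_le by blast
  have main: "\<bar>x \<bullet> un n u k\<bar> \<le> tm k / tm n * nS x * norm u" if k: "k1 \<le> k" "k \<le> n" for n u k x
    using k(2) k(1)
  proof (induction k arbitrary: x rule: inc_induct)
    case base
    then have "tm n > 0" using tm_pos k1 by simp
    then show ?case
      using Cauchy_Schwarz_ineq2[of x u] mult_right_mono[OF norm_le_nS[of x], of "norm u"] by (simp add: un_self)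
  next
    case (step j)
    define g where "g = gk (Suc j)"
    have j: "k1 \<le> j" "1 \<le> j" using step k1 by auto
    have t: "0 < tm n" "0 < tm (Suc j)" "0 < tm j" using tm_pos j step by auto
    have "g = \<gamma> / tm (Suc j)" unfolding g_def by (rule gk_eq) simp
    then have g: "g * tm (Suc j) = \<gamma>" using t by simp
    have "x \<bullet> un n u j = (x + g *\<^sub>R (J *v x)) \<bullet> un n u (Suc j)"
      unfolding un_step[OF step.hyps(2)] g_def[symmetric]
      by (simp only: inner_add_left inner_add_right inner_scaleR_left inner_scaleR_right inner_transpose_J)
    then have "\<bar>x \<bullet> un n u j\<bar> \<le> tm (Suc j) / tm n * nS (x + g *\<^sub>R (J *v x)) * norm u"
      using step.IH[of "x + g *\<^sub>R (J *v x)"] j by simp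
    also have "\<dots> \<le> tm (Suc j) / tm n * ((1 - g * Lq) * nS x) * norm u"
      unfolding g_def using t by (intro mult_right_mono mult_left_mono nS_contr j) auto
    also have "\<dots> = (tm (Suc j) * (1 - g * Lq)) / tm n * nS x * norm u" by simp
    also have "tm (Suc j) * (1 - g * Lq) = tm (Suc j) - \<gamma> * Lq" using g by (simp add: algebra_simps)
    also have "(tm (Suc j) - \<gamma> * Lq) / tm n * nS x * norm u \<le> tm j / tm n * nS x * norm u"
      using Lq t nS_nonneg by (intro mult_right_mono divide_right_mono) (auto simp: tm_Suc)
    finally show ?case .
  qed
  have "norm (un n u k) \<le> CS * norm u * (tm k / tm n)" if k: "k1 \<le> k" "k \<le> n" for n u k
  proof (cases "un n u k = 0")
    case True
    then show ?thesis using CS tm_pos[of k] tm_pos[of n] k k1 by (simp add: less_imp_le)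
  next
    case False
    have t: "0 < tm n" "0 < tm k" using tm_pos k k1 by auto
    have "norm (un n u k) * norm (un n u k) \<le> tm k / tm n * nS (un n u k) * norm u"
      using main[OF k, of "un n u k" u] by (simp add: power2_norm_eq_inner[symmetric] power2_eq_square)
    also have "\<dots> \<le> tm k / tm n * (CS * norm (un n u k)) * norm u"
      using t by (intro mult_right_mono mult_left_mono CS(2)) auto
    also have "\<dots> = (CS * norm u * (tm k / tm n)) * norm (un n u k)" by simp
    finally show ?thesis by (rule mult_right_le_imp_le) (use False in simp)
  qed
  then show ?thesis using CS(1) by blast
qed

text \<open>For positive \<open>n\<close> this is \<open>(sn n * gk k)^2 / a n\<close>, the weight
  of the noise entering at time \<open>k\<close> in the scaled conditional variance.\<close>

definition "wn n k = (gk k)^2 / gk n"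
definition "qn V n u k = gk k / gk n * (un n u k \<bullet> (V *v un n u k))"

text \<open>Every single time contributes O(1 / tm n) to the limiting variance, and the form
  accumulated up to time \<open>k\<close> is of order \<open>tm k / tm n\<close>.\<close>

lemma wn_un: "\<exists>C>0. \<forall>n k. k1 \<le> k \<longrightarrow> k \<le> n \<longrightarrow> wn n k * (norm (un n u k))^2 \<le> C / tm n \<and>
    gk k / gk n * (norm (un n u k))^2 \<le> C * (tm k / tm n)"
proof -
  obtain C where C: "C > 0" "\<And>n u k. k1 \<le> k \<Longrightarrow> k \<le> n \<Longrightarrow> norm (un n u k) \<le> C * norm u * (tm k / tm n)"
    using un_bound by blast
  define D where "D = (C * norm u)^2 * (\<gamma> + 1) + 1"
  have "wn n k * (norm (un n u k))^2 \<le> D / tm n \<and> gk k / gk n * (norm (un n u k))^2 \<le> D * (tm k / tm n)"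
    if k: "k1 \<le> k" "k \<le> n" for n k
  proof -
    have k1': "1 \<le> k" "1 \<le> n" using k k1 by auto
    have t: "0 < tm n" "0 < tm k" using tm_pos k1' by auto
    have sq: "(norm (un n u k))^2 \<le> (C * norm u)^2 * (tm k / tm n)^2"
      using power_mono[OF C(2)[OF k, of u], of 2] by (simp only: power_mult_distrib norm_ge_zero)
    have "wn n k * (norm (un n u k))^2 \<le> wn n k * ((C * norm u)^2 * (tm k / tm n)^2)"
      by (intro mult_left_mono sq) (simp add: wn_def gk_nonneg)
    also have "\<dots> = ((C * norm u)^2 * \<gamma>) / tm n"
      using t \<gamma> by (simp add: wn_def gk_eq[OF k1'(1)] gk_eq[OF k1'(2)] power2_eq_square)
    also have "\<dots> \<le> D / tm n"
      using t by (intro divide_right_mono) (auto simp: D_def algebra_simps)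
    finally have 1: "wn n k * (norm (un n u k))^2 \<le> D / tm n" .
    have "gk k / gk n * (norm (un n u k))^2 \<le> gk k / gk n * ((C * norm u)^2 * (tm k / tm n)^2)"
      by (intro mult_left_mono sq) (simp add: gk_nonneg)
    also have "\<dots> = (C * norm u)^2 * (tm k / tm n)"
      using t \<gamma> by (simp add: gk_eq[OF k1'(1)] gk_eq[OF k1'(2)] power2_eq_square)
    also have "\<dots> \<le> D * (tm k / tm n)"
    proof (rule mult_right_mono)
      have "0 \<le> (C * norm u)^2 * \<gamma>" using \<gamma> by simp
      then show "(C * norm u)^2 \<le> D" unfolding D_def by (simp add: ring_distribs)
    qed (use t in simp)
    finally show ?thesis using 1 by simp
  qed
  moreover have "D > 0" using \<gamma> by (simp add: D_def add_nonneg_pos)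
  ultimately show ?thesis by blast
qed

lemma matrix_form_bound: "\<exists>C>0. \<forall>x y. \<bar>x \<bullet> ((V::real^'s^'s) *v y)\<bar> \<le> C * (norm x * norm y)"
proof -
  obtain B where B: "0 < B" "\<And>x. norm (V *v x) \<le> norm x * B"
    using bounded_linear.pos_bounded[OF matrix_vector_mul_bounded_linear[of V]] by auto
  have "\<bar>x \<bullet> (V *v y)\<bar> \<le> B * (norm x * norm y)" for x y
    using Cauchy_Schwarz_ineq2[of x "V *v y"] mult_left_mono[OF B(2)[of y], of "norm x"] by (simp add: mult_ac)
  then show ?thesis using B(1) by blast
qed

text \<open>A backward step adds \<open>g\<close> times the form of \<open>lyap_op V\<close>, except
  for its part \<open>V / \<gamma>\<close>; that part is exactly what the change of the
  normalization \<open>gk k / gk n\<close> produces, by \<open>gk_diff\<close>. The rest is of third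
  order in the step sizes before division by \<open>gk n\<close>.\<close>

lemma qn_step:
  assumes V: "transpose V = V"
  shows "\<exists>C>0. \<forall>n k. k1 \<le> k \<longrightarrow> k < n \<longrightarrow>
    \<bar>qn V n u (Suc k) - qn V n u k + wn n (Suc k) * (un n u (Suc k) \<bullet> (lyap_op V *v un n u (Suc k)))\<bar> \<le> C * gk (Suc k) / tm n"
proof -
  obtain CV where CV: "CV > 0" "\<And>x y. \<bar>x \<bullet> (V *v y)\<bar> \<le> CV * (norm x * norm y)" using matrix_form_bound by blast
  obtain CL where CL: "CL > 0" "\<And>x y. \<bar>x \<bullet> (lyap_op V *v y)\<bar> \<le> CL * (norm x * norm y)" using matrix_form_bound by blast
  obtain CT where CT: "CT > 0" "\<And>x. norm (transpose J *v x) \<le> norm x * CT"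
    using bounded_linear.pos_bounded[OF matrix_vector_mul_bounded_linear[of "transpose J"]] by auto
  obtain Cw where Cw: "Cw > 0" "\<And>n k. k1 \<le> k \<Longrightarrow> k \<le> n \<Longrightarrow> wn n k * (norm (un n u k))^2 \<le> Cw / tm n"
    using wn_un[of u] by blast
  define D where "D = CL / \<gamma> + CV * CT^2"
  have D: "D > 0" using CL CV CT \<gamma> by (simp add: D_def add_pos_nonneg)
  have "\<bar>qn V n u (Suc k) - qn V n u k + wn n (Suc k) * (un n u (Suc k) \<bullet> (lyap_op V *v un n u (Suc k)))\<bar>
     \<le> (2 * D * Cw) * gk (Suc k) / tm n" if k: "k1 \<le> k" "k < n" for n k
  proof -
    define x where "x = un n u (Suc k)"
    define y where "y = transpose J *v x"
    define g where "g = gk (Suc k)"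
    define g' where "g' = gk k"
    define gn where "gn = gk n"
    have k': "1 \<le> k" using k k1 by simp
    have g: "0 \<le> g" "0 \<le> g'" "0 < gn" "g' \<le> 2 * g" "g' - g = g' * g / \<gamma>"
      unfolding g_def g'_def gn_def using gk_half[OF k'] gk_diff[OF k'] gk_pos[of n] k by (auto simp: gk_nonneg)
    have un: "un n u k = x + g *\<^sub>R y" unfolding un_step[OF k(2)] x_def y_def g_def ..
    have vx: "y \<bullet> (V *v x) = x \<bullet> (V *v y)" by (rule symmetric_matrix_swap[OF V])
    have lx: "x \<bullet> (lyap_op V *v x) = 2 * (x \<bullet> (V *v y)) + (1 / \<gamma>) * (x \<bullet> (V *v x))"
      unfolding y_def by (rule lyap_op_quadratic[OF V])
    define \<Lambda> where "\<Lambda> = x \<bullet> (lyap_op V *v x)"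
    have xy: "2 * (x \<bullet> (V *v y)) = \<Lambda> - (1 / \<gamma>) * (x \<bullet> (V *v x))" using lx by (simp add: \<Lambda>_def)
    have "un n u k \<bullet> (V *v un n u k) = x \<bullet> (V *v x) + g * (2 * (x \<bullet> (V *v y))) + g^2 * (y \<bullet> (V *v y))"
      unfolding un by (simp add: matrix_vector_right_distrib matrix_vector_mult_scaleR inner_add_left inner_add_right vx
          power2_eq_square algebra_simps)
    also have "\<dots> = (1 - g / \<gamma>) * (x \<bullet> (V *v x)) + g * \<Lambda> + g^2 * (y \<bullet> (V *v y))"
      unfolding xy by (simp add: algebra_simps)
    finally have uV: "un n u k \<bullet> (V *v un n u k) = (1 - g / \<gamma>) * (x \<bullet> (V *v x)) + g * \<Lambda> + g^2 * (y \<bullet> (V *v y))" .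
    have e1: "qn V n u k = (g' * (1 - g / \<gamma>)) / gn * (x \<bullet> (V *v x)) + g' / gn * (g * \<Lambda> + g^2 * (y \<bullet> (V *v y)))"
      unfolding qn_def g'_def[symmetric] gn_def[symmetric] uV
      by (simp add: algebra_simps add_divide_distrib diff_divide_distrib)
    \<comment> \<open>The normalization at time \<open>k\<close> and the factor due to
      \<open>V / \<gamma>\<close> combine to the normalization at time \<open>Suc k\<close>.\<close>
    have "g' * (1 - g / \<gamma>) = g" using g(5) by (simp add: algebra_simps)
    then have e2: "qn V n u k = qn V n u (Suc k) + g' / gn * (g * \<Lambda> + g^2 * (y \<bullet> (V *v y)))"
      unfolding e1 by (simp add: qn_def x_def g_def gn_def)
    have "qn V n u (Suc k) - qn V n u k + wn n (Suc k) * \<Lambda> = - ((g' - g) * g * \<Lambda> / gn + g' * g^2 * (y \<bullet> (V *v y)) / gn)"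
      unfolding e2 wn_def g_def[symmetric] gn_def[symmetric]
      by (simp add: algebra_simps power2_eq_square diff_divide_distrib add_divide_distrib)
    also have "\<dots> = - (g' * g^2 / gn * (\<Lambda> / \<gamma> + y \<bullet> (V *v y)))"
      unfolding g(5) by (simp add: algebra_simps power2_eq_square add_divide_distrib)
    finally have e3: "\<bar>qn V n u (Suc k) - qn V n u k + wn n (Suc k) * \<Lambda>\<bar> = g' * g^2 / gn * \<bar>\<Lambda> / \<gamma> + y \<bullet> (V *v y)\<bar>"
      using g by (simp add: abs_mult)
    have "\<bar>\<Lambda> / \<gamma> + y \<bullet> (V *v y)\<bar> \<le> D * (norm x)^2"
    proof -
      have "\<bar>\<Lambda> / \<gamma>\<bar> \<le> (CL * (norm x * norm x)) / \<gamma>"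
        using CL(2)[of x x] \<gamma> by (simp add: \<Lambda>_def abs_divide divide_right_mono)
      moreover have "\<bar>y \<bullet> (V *v y)\<bar> \<le> CV * (CT^2 * (norm x)^2)"
      proof -
        have "norm y * norm y \<le> (norm x * CT) * (norm x * CT)"
          unfolding y_def using CT by (intro mult_mono) auto
        then have "CV * (norm y * norm y) \<le> CV * (CT^2 * (norm x)^2)"
          using CV by (simp add: power2_eq_square mult_ac)
        then show ?thesis using CV(2)[of y y] by linarith
      qed
      ultimately have "\<bar>\<Lambda> / \<gamma> + y \<bullet> (V *v y)\<bar> \<le> (CL * (norm x * norm x)) / \<gamma> + CV * (CT^2 * (norm x)^2)"
        using abs_triangle_ineq[of "\<Lambda> / \<gamma>" "y \<bullet> (V *v y)"] by linarith
      then show ?thesis by (simp add: D_def power2_eq_square algebra_simps)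
    qed
    then have "g' * g^2 / gn * \<bar>\<Lambda> / \<gamma> + y \<bullet> (V *v y)\<bar> \<le> (2 * g) * g^2 / gn * (D * (norm x)^2)"
      using g by (intro mult_mono divide_right_mono mult_right_mono) auto
    also have "\<dots> = (2 * D * g) * (wn n (Suc k) * (norm x)^2)"
      by (simp add: wn_def g_def gn_def)
    also have "\<dots> \<le> (2 * D * g) * (Cw / tm n)"
      unfolding x_def using k D g by (intro mult_left_mono Cw(2)) auto
    finally show ?thesis unfolding e3[unfolded \<Lambda>_def x_def] by (simp add: g_def x_def \<Lambda>_def mult_ac)
  qed
  moreover have "2 * D * Cw > 0" using D Cw by simp
  ultimately show ?thesis by blast
qed

text \<open>The starting time is forgotten: by \<open>wn_un\<close> the form at \<open>k1\<close> is
  of order \<open>tm k1 / tm n\<close>.\<close>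

lemma qn_k1_tendsto: "(\<lambda>n. qn V n u k1) \<longlonglongrightarrow> 0"
proof -
  obtain CV where CV: "CV > 0" "\<And>x y. \<bar>x \<bullet> (V *v y)\<bar> \<le> CV * (norm x * norm y)" using matrix_form_bound by blast
  obtain Cw where Cw: "Cw > 0" "\<And>n k. k1 \<le> k \<Longrightarrow> k \<le> n \<Longrightarrow> gk k / gk n * (norm (un n u k))^2 \<le> Cw * (tm k / tm n)"
    using wn_un[of u] by blast
  have "(\<lambda>n. (CV * Cw * tm k1) * (1 / tm n)) \<longlonglongrightarrow> 0" using tendsto_mult_right_zero[OF inverse_tm] .
  then show ?thesis
  proof (rule Lim_null_comparison[rotated])
    show "\<forall>\<^sub>F n in sequentially. norm (qn V n u k1) \<le> (CV * Cw * tm k1) * (1 / tm n)"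
      using eventually_ge_at_top[of k1]
    proof eventually_elim
      case (elim n)
      have "norm (qn V n u k1) = gk k1 / gk n * \<bar>un n u k1 \<bullet> (V *v un n u k1)\<bar>"
        by (simp add: qn_def abs_mult gk_nonneg)
      also have "\<dots> \<le> gk k1 / gk n * (CV * (norm (un n u k1) * norm (un n u k1)))"
        by (intro mult_left_mono CV) (simp add: gk_nonneg)
      also have "\<dots> = CV * (gk k1 / gk n * (norm (un n u k1))^2)" by (simp add: power2_eq_square)
      also have "\<dots> \<le> CV * (Cw * (tm k1 / tm n))" using CV elim by (intro mult_left_mono Cw(2)) auto
      finally show ?case by simp
    qed
  qed
qed

text \<open>Telescopes \<open>qn_step\<close> from \<open>k1\<close> to \<open>n\<close>; the errors
  add up to an average of step sizes. Any symmetric \<open>V\<close> is allowed, so that it serves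
  both \<open>lyap_op V = 0\<close> and \<open>lyap_op V = - U_star P \<theta>\<close>.\<close>

lemma lyapunov_limit:
  assumes V: "transpose V = V"
  shows "(\<lambda>n. u \<bullet> (V *v u) + (\<Sum>k\<in>{k1..<n}. wn n (Suc k) * (un n u (Suc k) \<bullet> (lyap_op V *v un n u (Suc k))))) \<longlonglongrightarrow> 0"
proof -
  obtain C where C: "C > 0" "\<And>n k. k1 \<le> k \<Longrightarrow> k < n \<Longrightarrow>
    \<bar>qn V n u (Suc k) - qn V n u k + wn n (Suc k) * (un n u (Suc k) \<bullet> (lyap_op V *v un n u (Suc k)))\<bar> \<le> C * gk (Suc k) / tm n"
    using qn_step[OF V] by blast
  define s where "s n = (\<Sum>k\<in>{k1..<n}. wn n (Suc k) * (un n u (Suc k) \<bullet> (lyap_op V *v un n u (Suc k))))" for n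
  have "(\<lambda>n. C * ((\<Sum>k<n. gk (Suc k)) / tm n) + norm (qn V n u k1)) \<longlonglongrightarrow> C * 0 + norm (0::real)"
    by (intro tendsto_add tendsto_mult tendsto_const gk_average tendsto_norm qn_k1_tendsto)
  then have lim: "(\<lambda>n. C * ((\<Sum>k<n. gk (Suc k)) / tm n) + norm (qn V n u k1)) \<longlonglongrightarrow> 0" by simp
  then have "(\<lambda>n. u \<bullet> (V *v u) + s n) \<longlonglongrightarrow> 0"
  proof (rule Lim_null_comparison[rotated])
    show "\<forall>\<^sub>F n in sequentially. norm (u \<bullet> (V *v u) + s n) \<le> C * ((\<Sum>k<n. gk (Suc k)) / tm n) + norm (qn V n u k1)"
      using eventually_ge_at_top[of k1]
    proof eventually_elim
      case (elim n)
      have n: "1 \<le> n" using elim k1 by simp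
      have qnn: "qn V n u n = u \<bullet> (V *v u)" using gk_pos[OF n] by (simp add: qn_def un_self)
      have tel: "(\<Sum>k\<in>{k1..<n}. qn V n u (Suc k) - qn V n u k) = qn V n u n - qn V n u k1"
        using elim by (rule sum_Suc_diff')
      have "u \<bullet> (V *v u) + s n = qn V n u k1 + (\<Sum>k\<in>{k1..<n}. qn V n u (Suc k) - qn V n u k
         + wn n (Suc k) * (un n u (Suc k) \<bullet> (lyap_op V *v un n u (Suc k))))"
        unfolding sum.distrib tel qnn s_def by simp
      then have "norm (u \<bullet> (V *v u) + s n) \<le> norm (qn V n u k1) + norm (\<Sum>k\<in>{k1..<n}. qn V n u (Suc k) - qn V n u k
         + wn n (Suc k) * (un n u (Suc k) \<bullet> (lyap_op V *v un n u (Suc k))))"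
        by (simp only: norm_triangle_ineq)
      also have "\<dots> \<le> norm (qn V n u k1) + (\<Sum>k\<in>{k1..<n}. C * gk (Suc k) / tm n)"
        by (intro add_left_mono sum_norm_le) (use C(2) in auto)
      also have "\<dots> \<le> norm (qn V n u k1) + (\<Sum>k<n. C * gk (Suc k) / tm n)"
        using C(1) tm_pos[OF n] by (intro add_left_mono sum_mono2) (auto simp: gk_nonneg less_imp_le)
      also have "\<dots> = C * ((\<Sum>k<n. gk (Suc k)) / tm n) + norm (qn V n u k1)"
        by (simp add: sum_distrib_left sum_divide_distrib)
      finally show ?case .
    qed
  qed
  then show ?thesis by (simp add: s_def)
qed

text \<open>All summands in \<open>lyapunov_limit\<close> vanish, hence so does the quadratic form,
  and Cauchy-Schwarz extends this to the bilinear form.\<close>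

lemma lyapunov_unique:
  assumes V: "transpose V = V" and eq: "lyap_op V = 0" shows "V = 0"
proof -
  have z: "u \<bullet> (V *v u) = 0" for u
    using lyapunov_limit[OF V, of u] unfolding eq by (simp add: LIMSEQ_const_iff)
  have "(u \<bullet> (V *v w))^2 \<le> (u \<bullet> (V *v u)) * (w \<bullet> (V *v w))" for u w
    by (rule psd_cauchy_schwarz[OF V]) (simp add: z)
  then have "u \<bullet> (V *v w) = 0" for u w by (simp add: z)
  then have "V *v w = 0 *v w" for w by (metis inner_eq_zero_iff matrix_vector_mult_0)
  then show ?thesis using matrix_eq by blast
qed

text \<open>By \<open>U_star_quadratic\<close> the sum in \<open>lyapunov_limit\<close> is minus a
  weighted sum of variances.\<close>

lemma lyapunov_psd:
  assumes V: "transpose V = V" and eq: "U_star P \<theta> + lyap_op V = 0"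
  shows "0 \<le> u \<bullet> (V *v u)"
proof -
  have lo: "lyap_op V = - U_star P \<theta>" using eq by (simp add: add_eq_0_iff2)
  define s where "s n = (\<Sum>k\<in>{k1..<n}. wn n (Suc k) * (un n u (Suc k) \<bullet> (lyap_op V *v un n u (Suc k))))" for n
  have "s n \<le> 0" for n
    unfolding s_def
  proof (rule sum_nonpos)
    fix k
    define x where "x = un n u (Suc k)"
    have "0 \<le> \<theta> \<bullet> kvar Kt (Rt *v x)"
      using inner_mono_nonneg[of \<theta> 0 "kvar Kt (Rt *v x)"] \<theta>_nonneg
        kvar_bound(1)[OF chain \<theta>_simplex, of "Rt *v x" "norm (Rt *v x)"] component_le_norm_cart[of "Rt *v x"] by auto
    then have "x \<bullet> (lyap_op V *v x) \<le> 0"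
    proof -
      have "(- U_star P \<theta>) *v x = - (U_star P \<theta> *v x)" by (simp add: vec_eq_iff matrix_vector_mult_def sum_negf)
      then show ?thesis unfolding lo using U_star_quadratic[of x] \<open>0 \<le> \<theta> \<bullet> kvar Kt (Rt *v x)\<close> by simp
    qed
    then show "wn n (Suc k) * (un n u (Suc k) \<bullet> (lyap_op V *v un n u (Suc k))) \<le> 0"
      unfolding x_def[symmetric] by (intro mult_nonneg_nonpos) (auto simp: wn_def gk_nonneg)
  qed
  then have "\<forall>n. u \<bullet> (V *v u) + s n \<le> u \<bullet> (V *v u)" by simp
  with lyapunov_limit[OF V, of u] show ?thesis unfolding s_def[symmetric] by (intro LIMSEQ_le_const2) auto
qed

end

section \<open>The characteristic function of the linear part\<close>

context clt_lyap
begin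

definition "bn n u k = wn n k *\<^sub>R cvec (un n u k)"

lemma cvec_bound: "\<exists>C>0. \<forall>x. norm (cvec x) \<le> C * (norm x)^2"
proof -
  obtain C where C: "C > 0" "\<And>u v. norm (cvec u - cvec v) \<le> C * norm (u - v) * (norm u + norm v)"
    using cvec_lipschitz by blast
  have "norm (cvec x) \<le> C * (norm x)^2" for x
    using C(2)[of x 0] by (simp add: cvec_0 power2_eq_square mult.assoc)
  then show ?thesis using C(1) by blast
qed

text \<open>Size O(1 / tm n) makes the corrector negligible at both ends; increments smaller by a
  further step size make the summation by parts negligible in total.\<close>

lemma bn_bounds:
  "\<exists>C>0. (\<forall>n k. k1 \<le> k \<longrightarrow> k \<le> n \<longrightarrow> norm (bn n u k) \<le> C / tm n) \<and>
     (\<forall>n k. k1 \<le> k \<longrightarrow> k < n \<longrightarrow> norm (bn n u k - bn n u (Suc k)) \<le> C * gk (Suc k) / tm n)"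
proof -
  obtain Cc where Cc: "Cc > 0" "\<And>x. norm (cvec x) \<le> Cc * (norm x)^2" using cvec_bound by blast
  obtain Cl where Cl: "Cl > 0" "\<And>u v. norm (cvec u - cvec v) \<le> Cl * norm (u - v) * (norm u + norm v)"
    using cvec_lipschitz by blast
  obtain CT where CT: "CT > 0" "\<And>x. norm (transpose J *v x) \<le> norm x * CT"
    using bounded_linear.pos_bounded[OF matrix_vector_mul_bounded_linear[of "transpose J"]] by auto
  obtain Cw where Cw: "Cw > 0" "\<And>n k. k1 \<le> k \<Longrightarrow> k \<le> n \<Longrightarrow> wn n k * (norm (un n u k))^2 \<le> Cw / tm n"
    using wn_un[of u] by blast
  have w0: "0 \<le> wn n k" for n k by (simp add: wn_def gk_nonneg)
  have b1: "norm (bn n u k) \<le> Cc * Cw / tm n" if k: "k1 \<le> k" "k \<le> n" for n k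
  proof -
    have "norm (bn n u k) = wn n k * norm (cvec (un n u k))" by (simp add: bn_def w0)
    also have "\<dots> \<le> wn n k * (Cc * (norm (un n u k))^2)" by (intro mult_left_mono Cc w0)
    also have "\<dots> = Cc * (wn n k * (norm (un n u k))^2)" by simp
    also have "\<dots> \<le> Cc * (Cw / tm n)" using Cc(1) by (intro mult_left_mono Cw(2) k) auto
    finally show ?thesis by simp
  qed
  define D where "D = 6 / \<gamma> * (Cc * (1 + CT)^2) + Cl * CT * (2 + CT)"
  have D: "0 < D" using Cc Cl CT \<gamma> by (simp add: D_def add_pos_pos)
  have b2: "norm (bn n u k - bn n u (Suc k)) \<le> D * Cw * gk (Suc k) / tm n" if k: "k1 \<le> k" "k < n" for n k
  proof -
    define x where "x = un n u (Suc k)"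
    define y where "y = un n u k"
    define g where "g = gk (Suc k)"
    define g' where "g' = gk k"
    define w where "w = wn n (Suc k)"
    have k': "1 \<le> k" using k k1 by simp
    have gn: "0 < gk n" using gk_pos[of n] k by simp
    have g: "0 \<le> g" "g \<le> 1" "0 \<le> g'" "g' \<le> 2 * g" "g' - g = g' * g / \<gamma>"
      unfolding g_def g'_def by (fact gk_nonneg gk_le_1 gk_half[OF k'] gk_diff[OF k'])+
    have w: "0 \<le> w" unfolding w_def by (rule w0)
    have yx: "y = x + g *\<^sub>R (transpose J *v x)" unfolding y_def x_def g_def by (rule un_step[OF k(2)])
    have d: "norm (y - x) \<le> g * (norm x * CT)"
      unfolding yx using CT(2)[of x] g by (simp add: mult_left_mono)
    have "g * (norm x * CT) \<le> 1 * (norm x * CT)" using g CT by (intro mult_right_mono) auto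
    then have ny: "norm y \<le> (1 + CT) * norm x"
      using d norm_triangle_ineq[of "y - x" x] by (simp add: algebra_simps)
    have dw: "\<bar>wn n k - w\<bar> \<le> 6 / \<gamma> * g * w"
    proof -
      have "wn n k - w = (g' - g) * (g' + g) / gk n"
        by (simp add: wn_def w_def g_def g'_def power2_eq_square algebra_simps diff_divide_distrib)
      also have "\<dots> = (g' * g / \<gamma>) * (g' + g) / gk n" unfolding g(5) ..
      finally have e: "\<bar>wn n k - w\<bar> = (g' * g / \<gamma>) * (g' + g) / gk n"
        using g gn \<gamma> by (simp add: abs_mult)
      \<comment> \<open>The later 6 is the product of the factors in \<open>g' \<le> 2 * g\<close>
        and \<open>g' + g \<le> 3 * g\<close>.\<close>
      have "(g' * g / \<gamma>) * (g' + g) / gk n \<le> ((2 * g) * g / \<gamma>) * (3 * g) / gk n"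
        using g gn \<gamma> by (intro divide_right_mono mult_mono) auto
      also have "\<dots> = 6 / \<gamma> * g * w" by (simp add: w_def wn_def g_def power2_eq_square)
      finally show ?thesis unfolding e .
    qed
    have "bn n u k - bn n u (Suc k) = (wn n k - w) *\<^sub>R cvec y + w *\<^sub>R (cvec y - cvec x)"
      by (simp add: bn_def x_def y_def w_def algebra_simps)
    then have "norm (bn n u k - bn n u (Suc k)) \<le> \<bar>wn n k - w\<bar> * norm (cvec y) + w * norm (cvec y - cvec x)"
      using norm_triangle_ineq[of "(wn n k - w) *\<^sub>R cvec y" "w *\<^sub>R (cvec y - cvec x)"] w by simp
    also have "\<dots> \<le> (6 / \<gamma> * g * w) * (Cc * ((1 + CT) * norm x)^2) + w * (Cl * (g * (norm x * CT)) * ((1 + CT) * norm x + norm x))"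
    proof (intro add_mono mult_mono dw order_refl)
      have "norm (cvec y) \<le> Cc * (norm y)^2" by (rule Cc(2))
      also have "\<dots> \<le> Cc * ((1 + CT) * norm x)^2" using Cc(1) ny by (intro mult_left_mono power_mono) auto
      finally show "norm (cvec y) \<le> Cc * ((1 + CT) * norm x)^2" .
      have "norm (cvec y - cvec x) \<le> Cl * norm (y - x) * (norm y + norm x)" by (rule Cl(2))
      also have "\<dots> \<le> Cl * (g * (norm x * CT)) * ((1 + CT) * norm x + norm x)"
        using Cl(1) d ny g CT by (intro mult_mono add_mono mult_left_mono) auto
      finally show "norm (cvec y - cvec x) \<le> Cl * (g * (norm x * CT)) * ((1 + CT) * norm x + norm x)" .
    qed (use g \<gamma> w in auto)
    also have "\<dots> = D * g * (w * (norm x)^2)"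
      by (simp add: D_def power_mult_distrib power2_eq_square algebra_simps)
    also have "\<dots> \<le> D * g * (Cw / tm n)"
      unfolding w_def x_def using D g k by (intro mult_left_mono Cw(2)) auto
    finally show ?thesis by (simp add: g_def mult_ac)
  qed
  define C where "C = Cc * Cw + D * Cw"
  have C: "C > 0" using Cc Cw D by (simp add: C_def add_pos_pos)
  have "norm (bn n u k) \<le> C / tm n" if "k1 \<le> k" "k \<le> n" for n k
    using b1[OF that] tm_pos[of n] that k1 D Cw
    by (elim order_trans) (intro divide_right_mono, auto simp: C_def less_imp_le)
  moreover have "norm (bn n u k - bn n u (Suc k)) \<le> C * gk (Suc k) / tm n" if "k1 \<le> k" "k < n" for n k
  proof -
    have "D * Cw * gk (Suc k) / tm n \<le> C * gk (Suc k) / tm n"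
      using tm_pos[of n] that k1 Cc Cw gk_nonneg[of "Suc k"]
      by (intro divide_right_mono mult_right_mono) (auto simp: C_def less_imp_le)
    then show ?thesis using b2[OF that] by linarith
  qed
  ultimately show ?thesis using C by blast
qed

end

context clt_setup
begin

section \<open>Martingale increments of the complex exponential and their compensator\<close>

lemma complex_expectation_eqI:
  fixes f :: "'w \<Rightarrow> complex"
  assumes f: "integrable M f" "integrable M f'"
    and "expectation (\<lambda>z. Re (f z)) = expectation (\<lambda>z. Re (f' z))" "expectation (\<lambda>z. Im (f z)) = expectation (\<lambda>z. Im (f' z))"
  shows "expectation f = expectation f'"
  using assms by (intro complex_eqI) (simp_all flip: integral_Re integral_Im)

lemma dn_first_complex:
  fixes Z :: "'w \<Rightarrow> complex"
  assumes n: "1 \<le> n" and Z: "Z \<in> borel_measurable (Fn n k)" "\<And>z. norm (Z z) \<le> BZ"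
    and c: "c \<in> borel_measurable (Fn n k)" "\<And>z. norm (c z) \<le> Bc"
  shows "expectation (\<lambda>z. Z z * of_real (dn n k z \<bullet> c z)) = 0"
proof -
  have ZM: "Z \<in> borel_measurable M" and cM: "c \<in> borel_measurable M" and dM: "dn n k \<in> borel_measurable M"
    by (rule Fn_M[OF n Z(1)], rule Fn_M[OF n c(1)], rule Fn_M[OF n dn_measurable[OF n]])
  have b: "\<bar>dn n k z \<bullet> c z\<bar> \<le> 2 * Bc" for z
  proof -
    have "\<bar>dn n k z \<bullet> c z\<bar> \<le> norm (dn n k z) * norm (c z)" by (rule Cauchy_Schwarz_ineq2)
    also have "\<dots> \<le> 2 * Bc" by (intro mult_mono dn_bound[OF n] c(2)) auto
    finally show ?thesis .
  qed
  have BZ: "0 \<le> BZ" using order_trans[OF norm_ge_zero Z(2)] .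
  have i: "integrable M (\<lambda>z. Z z * of_real (dn n k z \<bullet> c z))"
  proof (rule bounded_integrable[of _ "BZ * (2 * Bc)"])
    show "(\<lambda>z. Z z * of_real (dn n k z \<bullet> c z)) \<in> borel_measurable M" using ZM cM dM by measurable
    show "norm (Z z * of_real (dn n k z \<bullet> c z)) \<le> BZ * (2 * Bc)" for z
      unfolding norm_mult norm_of_real by (intro mult_mono Z(2) b BZ) simp
  qed
  have r: "expectation (\<lambda>z. Re (Z z) * (dn n k z \<bullet> c z)) = 0"
    by (rule dn_first[OF n _ _ c, where BY = BZ])
      (use Z(1) order_trans[OF abs_Re_le_cmod Z(2)] in auto)
  have m: "expectation (\<lambda>z. Im (Z z) * (dn n k z \<bullet> c z)) = 0"
    by (rule dn_first[OF n _ _ c, where BY = BZ])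
      (use Z(1) order_trans[OF abs_Im_le_cmod Z(2)] in auto)
  have "expectation (\<lambda>z. Z z * of_real (dn n k z \<bullet> c z)) = expectation (\<lambda>z. 0)"
    by (rule complex_expectation_eqI[OF i]) (use r m in simp_all)
  then show ?thesis by simp
qed

lemma dn_second_complex:
  fixes Z :: "'w \<Rightarrow> complex"
  assumes n: "1 \<le> n" and Z: "Z \<in> borel_measurable (Fn n k)" "\<And>z. norm (Z z) \<le> BZ"
    and c: "c \<in> borel_measurable (Fn n k)" "\<And>z. norm (c z) \<le> Bc"
    and i1: "integrable M (\<lambda>z. Z z * of_real ((dn n k z \<bullet> c z)^2))"
    and i2: "integrable M (\<lambda>z. Z z * of_real ((1 / real (a n)) * (et n z k \<bullet> kvar (K P (th n z k)) (c z))))"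
  shows "expectation (\<lambda>z. Z z * of_real ((dn n k z \<bullet> c z)^2)) =
    expectation (\<lambda>z. Z z * of_real ((1 / real (a n)) * (et n z k \<bullet> kvar (K P (th n z k)) (c z))))"
proof (rule complex_expectation_eqI[OF i1 i2])
  have r: "expectation (\<lambda>z. Re (Z z) * (dn n k z \<bullet> c z)^2) =
    expectation (\<lambda>z. Re (Z z) * ((1 / real (a n)) * (et n z k \<bullet> kvar (K P (th n z k)) (c z))))"
    by (rule dn_second[OF n _ _ c, where BY = BZ])
      (use Z(1) order_trans[OF abs_Re_le_cmod Z(2)] in auto)
  have m: "expectation (\<lambda>z. Im (Z z) * (dn n k z \<bullet> c z)^2) =
    expectation (\<lambda>z. Im (Z z) * ((1 / real (a n)) * (et n z k \<bullet> kvar (K P (th n z k)) (c z))))"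
    by (rule dn_second[OF n _ _ c, where BY = BZ])
      (use Z(1) order_trans[OF abs_Im_le_cmod Z(2)] in auto)
  show "expectation (\<lambda>z. Re (Z z * of_real ((dn n k z \<bullet> c z)^2))) =
    expectation (\<lambda>z. Re (Z z * of_real ((1 / real (a n)) * (et n z k \<bullet> kvar (K P (th n z k)) (c z)))))"
    using r by simp
  show "expectation (\<lambda>z. Im (Z z * of_real ((dn n k z \<bullet> c z)^2))) =
    expectation (\<lambda>z. Im (Z z * of_real ((1 / real (a n)) * (et n z k \<bullet> kvar (K P (th n z k)) (c z)))))"
    using m by simp
qed

lemma kvar_measurable:
  assumes n: "1 \<le> n" and c: "c \<in> borel_measurable (Fn n k)"
  shows "(\<lambda>z. et n z k \<bullet> kvar (K P (th n z k)) (c z)) \<in> borel_measurable (Fn n k)"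
proof -
  have "(\<lambda>z. kvar (K P (th n z k)) (c z) $ w) \<in> borel_measurable (Fn n k)" for w
    unfolding kvar_def matrix_vector_mult_def K_def vec_lambda_beta
    by (intro borel_measurable_diff borel_measurable_power borel_measurable_sum borel_measurable_times borel_measurable_add
        borel_measurable_const vec_nth_measurable[OF c] vec_nth_measurable[OF th_measurable[OF n]])
  then show ?thesis unfolding inner_vec_def inner_real_def
    by (intro borel_measurable_sum borel_measurable_times vec_nth_measurable[OF et_measurable[OF n]])
qed

text \<open>The deterministic factor compensates the conditional variance of the linear functional of \<open>Xn\<close>.\<close>
definition Zf :: "real^'s^'s \<Rightarrow> real^'s \<Rightarrow> nat \<Rightarrow> nat \<Rightarrow> 'w \<Rightarrow> complex" where
  "Zf V u n k z = iexp (sn n * (un n u k \<bullet> Xn n k z)) * exp (of_real (qn V n u k / 2))"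

text \<open>Increment in \<open>k\<close> of \<open>sn n * (un n u k \<bullet> Xn n k z)\<close>:
  the backward transport has cancelled the drift of \<open>Xn\<close>.\<close>

definition df :: "real^'s \<Rightarrow> nat \<Rightarrow> nat \<Rightarrow> 'w \<Rightarrow> real" where
  "df u n k z = sn n * gk (Suc k) * (dn n k z \<bullet> rvec (th n z k) (un n u (Suc k)))"

text \<open>Up to the weight \<open>wn n (Suc k)\<close>, the conditional variance of
  \<open>df u n k\<close>.\<close>

definition vf :: "real^'s \<Rightarrow> nat \<Rightarrow> nat \<Rightarrow> 'w \<Rightarrow> real" where
  "vf u n k z = et n z k \<bullet> kvar (K P (th n z k)) (rvec (th n z k) (un n u (Suc k)))"

lemma Zf_measurable: assumes n: "1 \<le> n" shows "Zf V u n k \<in> borel_measurable (Fn n k)"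
proof -
  have [measurable]: "(\<lambda>z. un n u k \<bullet> Xn n k z) \<in> borel_measurable (Fn n k)"
    by (intro borel_measurable_inner borel_measurable_const Xn_measurable n)
  show ?thesis unfolding Zf_def[abs_def] by measurable
qed

lemma Zf_bound: "\<exists>C>0. \<forall>n\<ge>1. \<forall>k z. k1 \<le> k \<longrightarrow> k \<le> n \<longrightarrow> norm (Zf V u n k z) \<le> C"
proof -
  obtain CV where CV: "CV > 0" "\<And>x y. \<bar>x \<bullet> (V *v y)\<bar> \<le> CV * (norm x * norm y)" using matrix_form_bound by blast
  obtain Cw where Cw: "Cw > 0" "\<And>n k. k1 \<le> k \<Longrightarrow> k \<le> n \<Longrightarrow> gk k / gk n * (norm (un n u k))^2 \<le> Cw * (tm k / tm n)"
    using wn_un[of u] by blast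
  have "norm (Zf V u n k z) \<le> exp (CV * Cw)" if n: "1 \<le> n" and k: "k1 \<le> k" "k \<le> n" for n k z
  proof -
    have t: "0 < tm n" "tm k \<le> tm n" using tm_pos[OF n] k by (auto simp: tm_def)
    have "qn V n u k \<le> gk k / gk n * (CV * (norm (un n u k) * norm (un n u k)))"
      unfolding qn_def using CV(2)[of "un n u k" "un n u k"] by (intro mult_left_mono) (auto simp: gk_nonneg)
    also have "\<dots> = CV * (gk k / gk n * (norm (un n u k))^2)" by (simp add: power2_eq_square)
    also have "\<dots> \<le> CV * (Cw * (tm k / tm n))" using CV(1) by (intro mult_left_mono Cw(2) k) auto
    also have "\<dots> \<le> CV * (Cw * 1)" using CV(1) Cw(1) t by (intro mult_left_mono) auto
    finally have q: "qn V n u k \<le> CV * Cw" by simp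
    have "norm (Zf V u n k z) = exp (qn V n u k / 2)" by (simp add: Zf_def norm_mult norm_exp_i_times)
    also have "\<dots> \<le> exp (CV * Cw)"
    proof -
      have "0 < CV * Cw" using CV(1) Cw(1) by simp
      then show ?thesis using q by simp
    qed
    finally show ?thesis .
  qed
  then show ?thesis by (intro exI[of _ "exp (CV * Cw)"]) auto
qed

lemma Zf_step:
  assumes n: "1 \<le> n" and k: "k1 \<le> k" "k < n"
  shows "Zf V u n (Suc k) z = Zf V u n k z * (iexp (df u n k z) * exp (of_real ((qn V n u (Suc k) - qn V n u k) / 2)))"
proof -
  have X: "Xn n (Suc k) z = (Xn n k z + gk (Suc k) *\<^sub>R (J *v Xn n k z)) + gk (Suc k) *\<^sub>R xi (th n z) (et n z) k"
    unfolding Xn_def by (rule Xi_step[OF k(1)])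
  have "un n u k \<bullet> Xn n k z = un n u (Suc k) \<bullet> (Xn n k z + gk (Suc k) *\<^sub>R (J *v Xn n k z))"
    unfolding un_step[OF k(2)] inner_add_left inner_add_right inner_scaleR_left inner_scaleR_right
    using inner_transpose_J[of "Xn n k z" "un n u (Suc k)"] by (simp only: inner_commute)
  then have "sn n * (un n u (Suc k) \<bullet> Xn n (Suc k) z) = sn n * (un n u k \<bullet> Xn n k z) + df u n k z"
    unfolding X df_def xi_dn[symmetric] inner_add_right[of _ "_ + _"] inner_scaleR_right
    by (simp add: inner_commute algebra_simps)
  then show ?thesis
    unfolding Zf_def by (simp add: exp_add[symmetric] ring_distribs) (simp add: algebra_simps diff_divide_distrib)
qed

text \<open>A uniform Lindeberg condition: the step size \<open>gk (Suc k)\<close> and the bound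
  \<open>tm (Suc k) / tm n\<close> for \<open>un\<close> compensate, so all increments are of the
  order \<open>sn n / tm n\<close>, which tends to zero.\<close>

lemma df_bound: "\<exists>C>0. \<forall>n\<ge>1. \<forall>k z. k1 \<le> k \<longrightarrow> k < n \<longrightarrow> \<bar>df u n k z\<bar> \<le> C * (sn n / tm n)"
proof -
  obtain Cx where Cx: "Cx > 0" "\<And>th eta k. is_path th eta \<Longrightarrow> norm (xi th eta k) \<le> Cx" using xi_bound by blast
  obtain Cu where Cu: "Cu > 0" "\<And>n u k. k1 \<le> k \<Longrightarrow> k \<le> n \<Longrightarrow> norm (un n u k) \<le> Cu * norm u * (tm k / tm n)"
    using un_bound by blast
  define C where "C = Cx * (Cu * norm u) * \<gamma> + 1"
  have C: "C > 0" using Cx Cu \<gamma> by (simp add: C_def add_nonneg_pos)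
  have "\<bar>df u n k z\<bar> \<le> C * (sn n / tm n)" if n: "1 \<le> n" and k: "k1 \<le> k" "k < n" for n k z
  proof -
    have t: "0 < tm n" "0 < tm (Suc k)" using tm_pos n by auto
    have "\<bar>df u n k z\<bar> = sn n * gk (Suc k) * \<bar>xi (th n z) (et n z) k \<bullet> un n u (Suc k)\<bar>"
      unfolding df_def xi_dn[symmetric] by (simp add: abs_mult sn_nonneg gk_nonneg)
    also have "\<dots> \<le> sn n * gk (Suc k) * (Cx * (Cu * norm u * (tm (Suc k) / tm n)))"
      using Cx(1) k by (intro mult_left_mono order_trans[OF Cauchy_Schwarz_ineq2] mult_mono Cx(2) path_n n Cu(2))
        (auto simp: sn_nonneg gk_nonneg)
    also have "\<dots> = Cx * (Cu * norm u) * (gk (Suc k) * tm (Suc k)) * (sn n / tm n)" by simp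
    also have "gk (Suc k) * tm (Suc k) = \<gamma>" using t gk_eq[of "Suc k"] by simp
    also have "Cx * (Cu * norm u) * \<gamma> * (sn n / tm n) \<le> C * (sn n / tm n)"
      using t by (intro mult_right_mono) (auto simp: C_def sn_nonneg)
    finally show ?thesis .
  qed
  then show ?thesis using C by blast
qed

lemma vf_bound: "\<exists>C>0. \<forall>n\<ge>1. \<forall>k z. k1 \<le> k \<longrightarrow> k < n \<longrightarrow> 0 \<le> vf u n k z \<and> wn n (Suc k) * vf u n k z \<le> C / tm n"
proof -
  obtain CR where CR: "CR > 0" "\<And>\<nu> u. \<nu> \<in> prob_simplex \<Longrightarrow> norm (rvec \<nu> u) \<le> CR * norm u" using rvec_bound by blast
  obtain Cw where Cw: "Cw > 0" "\<And>n k. k1 \<le> k \<Longrightarrow> k \<le> n \<Longrightarrow> wn n k * (norm (un n u k))^2 \<le> Cw / tm n"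
    using wn_un[of u] by blast
  have "0 \<le> vf u n k z \<and> wn n (Suc k) * vf u n k z \<le> CR^2 * Cw / tm n" if n: "1 \<le> n" and k: "k1 \<le> k" "k < n" for n k z
  proof -
    have c: "\<bar>rvec (th n z k) (un n u (Suc k)) $ w\<bar> \<le> CR * norm (un n u (Suc k))" for w
      by (rule order_trans[OF component_le_norm_cart CR(2)[OF path_simplex(1)[OF n]]])
    note kv = kvar_bound[OF chain path_simplex(1)[OF n] c]
    have v: "0 \<le> vf u n k z" "vf u n k z \<le> (CR * norm (un n u (Suc k)))^2"
      unfolding vf_def using simplex_inner_bounds[OF path_simplex(2)[OF n] kv] by auto
    have "wn n (Suc k) * vf u n k z \<le> wn n (Suc k) * (CR * norm (un n u (Suc k)))^2"
      using v by (intro mult_left_mono) (auto simp: wn_def gk_nonneg)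
    also have "\<dots> = CR^2 * (wn n (Suc k) * (norm (un n u (Suc k)))^2)" by (simp add: power_mult_distrib)
    also have "\<dots> \<le> CR^2 * (Cw / tm n)" using k by (intro mult_left_mono Cw(2)) auto
    finally show ?thesis using v by simp
  qed
  then show ?thesis using CR(1) Cw(1) by (intro exI[of _ "CR^2 * Cw"]) auto
qed

lemma df_measurable: assumes n: "1 \<le> n" shows "df u n k \<in> borel_measurable M"
  unfolding df_def[abs_def]
  by (intro borel_measurable_times borel_measurable_const borel_measurable_inner Fn_M[OF n dn_measurable[OF n]]
      rvec_measurable Fn_M[OF n th_measurable[OF n]])

lemma vf_measurable: assumes n: "1 \<le> n" shows "vf u n k \<in> borel_measurable M"
  unfolding vf_def[abs_def]
  by (rule Fn_M[OF n kvar_measurable[OF n]]) (intro rvec_measurable th_measurable[OF n] borel_measurable_const)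

lemma df_moments:
  fixes Z :: "'w \<Rightarrow> complex"
  assumes n: "1 \<le> n" and k: "k1 \<le> k" "k < n"
    and Z: "Z \<in> borel_measurable (Fn n k)" "\<And>z. norm (Z z) \<le> BZ"
  shows "expectation (\<lambda>z. Z z * of_real (df u n k z)) = 0"
    and "expectation (\<lambda>z. Z z * of_real ((df u n k z)^2)) = expectation (\<lambda>z. Z z * of_real (wn n (Suc k) * vf u n k z))"
proof -
  obtain CR where CR: "CR > 0" "\<And>\<nu> u. \<nu> \<in> prob_simplex \<Longrightarrow> norm (rvec \<nu> u) \<le> CR * norm u" using rvec_bound by blast
  obtain Cd where Cd: "Cd > 0" "\<And>n k z. 1 \<le> n \<Longrightarrow> k1 \<le> k \<Longrightarrow> k < n \<Longrightarrow> \<bar>df u n k z\<bar> \<le> Cd * (sn n / tm n)"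
    using df_bound[of u] by blast
  obtain Cv where Cv: "Cv > 0" "\<And>n k z. 1 \<le> n \<Longrightarrow> k1 \<le> k \<Longrightarrow> k < n \<Longrightarrow> 0 \<le> vf u n k z \<and> wn n (Suc k) * vf u n k z \<le> Cv / tm n"
    using vf_bound[of u] by blast
  define c where "c z = rvec (th n z k) (un n u (Suc k))" for z
  have c: "c \<in> borel_measurable (Fn n k)" "norm (c z) \<le> CR * norm (un n u (Suc k))" for z
    unfolding c_def[abs_def] by (intro rvec_measurable th_measurable[OF n] borel_measurable_const, rule CR(2)[OF path_simplex(1)[OF n]])
  have ZM: "Z \<in> borel_measurable M" by (rule Fn_M[OF n Z(1)])
  have BZ: "0 \<le> BZ" using order_trans[OF norm_ge_zero Z(2)] .
  define \<sigma> where "\<sigma> = sn n * gk (Suc k)"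
  have d: "df u n k z = \<sigma> * (dn n k z \<bullet> c z)" for z by (simp add: df_def c_def \<sigma>_def)
  have "expectation (\<lambda>z. Z z * of_real (df u n k z)) = expectation (\<lambda>z. of_real \<sigma> * (Z z * of_real (dn n k z \<bullet> c z)))"
    unfolding d by (simp add: mult_ac)
  also have "\<dots> = of_real \<sigma> * 0" unfolding integral_mult_right_zero dn_first_complex[OF n Z c] ..
  finally show "expectation (\<lambda>z. Z z * of_real (df u n k z)) = 0" by simp
  have an: "0 < real (a n)" using a_pos[OF n] by simp
  have gn: "0 < gk n" by (rule gk_pos[OF n])
  \<comment> \<open>The particle number in the square of \<open>sn n\<close> cancels the averaging
    factor \<open>1 / a n\<close> of the conditional variance.\<close>
  have \<sigma>2: "\<sigma>^2 = real (a n) * wn n (Suc k)"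
    using an gn by (simp add: \<sigma>_def sn_def wn_def power_mult_distrib)
  show "expectation (\<lambda>z. Z z * of_real ((df u n k z)^2)) = expectation (\<lambda>z. Z z * of_real (wn n (Suc k) * vf u n k z))"
  proof (cases "\<sigma> = 0")
    case True
    then have "wn n (Suc k) = 0" using \<sigma>2 an by simp
    then show ?thesis unfolding d True by simp
  next
    case False
    have i1: "integrable M (\<lambda>z. Z z * of_real ((dn n k z \<bullet> c z)^2))"
    proof (rule bounded_integrable[of _ "BZ * (2 * (CR * norm (un n u (Suc k))))^2"])
      show "(\<lambda>z. Z z * of_real ((dn n k z \<bullet> c z)^2)) \<in> borel_measurable M"
        using ZM Fn_M[OF n c(1)] Fn_M[OF n dn_measurable[OF n]] by measurable
      have b: "\<bar>dn n k z \<bullet> c z\<bar> \<le> 2 * (CR * norm (un n u (Suc k)))" for z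
        by (rule order_trans[OF Cauchy_Schwarz_ineq2]) (intro mult_mono dn_bound[OF n] c(2), auto)
      show "norm (Z z * of_real ((dn n k z \<bullet> c z)^2)) \<le> BZ * (2 * (CR * norm (un n u (Suc k))))^2" for z
        using power_mono[OF b[of z] abs_ge_zero, of 2]
        unfolding norm_mult norm_of_real by (intro mult_mono Z(2) BZ) (auto simp: power_abs[symmetric])
    qed
    have i2: "integrable M (\<lambda>z. Z z * of_real ((1 / real (a n)) * (et n z k \<bullet> kvar (K P (th n z k)) (c z))))"
    proof (rule bounded_integrable[of _ "BZ * (1 / real (a n) * (CR * norm (un n u (Suc k)))^2)"])
      show "(\<lambda>z. Z z * of_real ((1 / real (a n)) * (et n z k \<bullet> kvar (K P (th n z k)) (c z)))) \<in> borel_measurable M"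
        using ZM Fn_M[OF n kvar_measurable[OF n c(1)]] by measurable
      fix z
      have cc: "\<bar>c z $ w\<bar> \<le> CR * norm (un n u (Suc k))" for w
        by (rule order_trans[OF component_le_norm_cart c(2)])
      note kv = kvar_bound[OF chain path_simplex(1)[OF n] cc]
      have v: "0 \<le> et n z k \<bullet> kvar (K P (th n z k)) (c z)" "et n z k \<bullet> kvar (K P (th n z k)) (c z) \<le> (CR * norm (un n u (Suc k)))^2"
        using simplex_inner_bounds[OF path_simplex(2)[OF n] kv] by auto
      have "\<bar>(1 / real (a n)) * (et n z k \<bullet> kvar (K P (th n z k)) (c z))\<bar> \<le> 1 / real (a n) * (CR * norm (un n u (Suc k)))^2"
        unfolding abs_mult using v an by (intro mult_mono) auto
      then show "norm (Z z * of_real ((1 / real (a n)) * (et n z k \<bullet> kvar (K P (th n z k)) (c z)))) \<le>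
        BZ * (1 / real (a n) * (CR * norm (un n u (Suc k)))^2)"
        unfolding norm_mult norm_of_real by (intro mult_mono Z(2) BZ) auto
    qed
    have "expectation (\<lambda>z. Z z * of_real ((df u n k z)^2)) = expectation (\<lambda>z. of_real (\<sigma>^2) * (Z z * of_real ((dn n k z \<bullet> c z)^2)))"
      unfolding d by (simp add: power_mult_distrib mult_ac)
    also have "\<dots> = expectation (\<lambda>z. of_real (\<sigma>^2) * (Z z * of_real ((1 / real (a n)) * (et n z k \<bullet> kvar (K P (th n z k)) (c z)))))"
      unfolding integral_mult_right_zero dn_second_complex[OF n Z c i1 i2] ..
    also have "\<dots> = expectation (\<lambda>z. Z z * of_real (wn n (Suc k) * vf u n k z))"
      unfolding \<sigma>2 vf_def c_def using an by (simp add: mult_ac)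
    finally show ?thesis .
  qed
qed

text \<open>The compensator of \<open>Zf\<close> is quadratic in the empirical measure; the Poisson equation turns its
  deviation from the stationary value into a martingale increment and a telescoping term.\<close>
lemma compensator_decomposition:
  assumes V: "transpose V = V" and eq: "U_star P \<theta> + lyap_op V = 0"
  shows "\<exists>C>0. \<forall>n\<ge>1. \<forall>k z. k1 \<le> k \<longrightarrow> k < n \<longrightarrow>
     \<bar>(qn V n u (Suc k) - qn V n u k) - wn n (Suc k) * vf u n k z
        - (et n z (Suc k) - et n z k) \<bullet> bn n u (Suc k) + dn n k z \<bullet> bn n u (Suc k)\<bar>
       \<le> C / tm n * (norm (th n z k - \<theta>) + gk (Suc k))"
proof -
  obtain Cq where Cq: "Cq > 0" "\<And>n k. k1 \<le> k \<Longrightarrow> k < n \<Longrightarrow>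
    \<bar>qn V n u (Suc k) - qn V n u k + wn n (Suc k) * (un n u (Suc k) \<bullet> (lyap_op V *v un n u (Suc k)))\<bar> \<le> Cq * gk (Suc k) / tm n"
    using qn_step[OF V] by blast
  obtain Ck where Ck: "Ck > 0" "\<And>\<nu> u w. \<nu> \<in> prob_simplex \<Longrightarrow>
     \<bar>kvar (K P \<nu>) (rvec \<nu> u) $ w - kvar Kt (Rt *v u) $ w\<bar> \<le> Ck * norm (\<nu> - \<theta>) * (norm u)^2"
    using kvar_rvec_lipschitz by blast
  obtain Cb where Cb: "Cb > 0" "\<And>n k. k1 \<le> k \<Longrightarrow> k \<le> n \<Longrightarrow> norm (bn n u k) \<le> Cb / tm n"
    using bn_bounds[of u] by blast
  obtain Cw where Cw: "Cw > 0" "\<And>n k. k1 \<le> k \<Longrightarrow> k \<le> n \<Longrightarrow> wn n k * (norm (un n u k))^2 \<le> Cw / tm n"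
    using wn_un[of u] by blast
  define C where "C = norm b * Cb + Cq + real CARD('s) * (Ck * Cw)"
  have C: "C > 0" using Cb Cq Ck Cw by (simp add: C_def add_nonneg_pos add_pos_nonneg)
  have lo: "lyap_op V = - U_star P \<theta>" using eq by (simp add: add_eq_0_iff2)
  have "\<bar>(qn V n u (Suc k) - qn V n u k) - wn n (Suc k) * vf u n k z
        - (et n z (Suc k) - et n z k) \<bullet> bn n u (Suc k) + dn n k z \<bullet> bn n u (Suc k)\<bar>
       \<le> C / tm n * (norm (th n z k - \<theta>) + gk (Suc k))"
    if n: "1 \<le> n" and k: "k1 \<le> k" "k < n" for n k z
  proof -
    define x where "x = un n u (Suc k)"
    define w where "w = wn n (Suc k)"
    define f where "f = kvar Kt (Rt *v x)"
    define f' where "f' = kvar (K P (th n z k)) (rvec (th n z k) x)"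
    define e where "e = et n z k"
    define D where "D = norm (th n z k - \<theta>)"
    have t: "0 < tm n" by (rule tm_pos[OF n])
    have w0: "0 \<le> w" by (simp add: w_def wn_def gk_nonneg)
    have e1: "e \<bullet> 1 = 1" unfolding e_def by (rule simplex_inner_one[OF path_simplex(2)[OF n]])
    have bx: "bn n u (Suc k) = w *\<^sub>R (Rt *v f)" by (simp add: bn_def cvec_def w_def x_def f_def)
    have U: "x \<bullet> (lyap_op V *v x) = - (\<theta> \<bullet> f)"
    proof -
      have "(- U_star P \<theta>) *v x = - (U_star P \<theta> *v x)" by (simp add: vec_eq_iff matrix_vector_mult_def sum_negf)
      then show ?thesis unfolding lo f_def using U_star_quadratic[of x] by simp
    qed
    define r1 where "r1 = qn V n u (Suc k) - qn V n u k - w * (\<theta> \<bullet> f)"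
    have r1: "\<bar>r1\<bar> \<le> Cq * gk (Suc k) / tm n"
      using Cq(2)[OF k] unfolding x_def[symmetric] w_def[symmetric] U r1_def by simp
    \<comment> \<open>Poisson equation at \<open>\<theta>\<close> with the variance function
      \<open>f\<close> as right-hand side; its stationary value \<open>\<theta> \<bullet> f\<close>
      is the one supplied by \<open>U_star\<close>.\<close>
    have pois: "(e - \<theta>) \<bullet> f = (e - e v* Kt) \<bullet> (Rt *v f)"
    proof -
      have "rop \<theta> (e - e v* Kt) = e - \<theta>" using poisson[OF \<theta>_simplex e1, of e] by (simp add: pi_\<theta>)
      then have "(e - \<theta>) \<bullet> f = (e - e v* Kt) \<bullet> rvec \<theta> f" by (simp only: rop_inner[symmetric])
      then show ?thesis by (simp only: rvec_\<theta>)
    qed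
    \<comment> \<open>The particles move with the kernel at \<open>th n z k\<close>; as the kernel
      is affine in its parameter, the discrepancy is linear in
      \<open>\<theta> - th n z k\<close>.\<close>
    have KK: "e v* Kt = e v* K P (th n z k) + (e \<bullet> b) *\<^sub>R (\<theta> - th n z k)"
      by (simp add: vmult_K algebra_simps)
    have dn: "e - e v* K P (th n z k) = dn n k z - (et n z (Suc k) - e)" by (simp add: dn_def e_def)
    have ee: "(e - e v* Kt) = dn n k z - (et n z (Suc k) - e) - (e \<bullet> b) *\<^sub>R (\<theta> - th n z k)"
      unfolding KK dn[symmetric] by simp
    have p2: "w * ((e - \<theta>) \<bullet> f) = dn n k z \<bullet> bn n u (Suc k) - (et n z (Suc k) - e) \<bullet> bn n u (Suc k)
       - (e \<bullet> b) * ((\<theta> - th n z k) \<bullet> bn n u (Suc k))"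
      unfolding pois bx ee by (simp add: inner_diff_left algebra_simps)
    have vf: "vf u n k z = e \<bullet> f'" by (simp add: vf_def f'_def e_def x_def)
    have "(qn V n u (Suc k) - qn V n u k) - w * vf u n k z
        - (et n z (Suc k) - e) \<bullet> bn n u (Suc k) + dn n k z \<bullet> bn n u (Suc k)
      = r1 + (e \<bullet> b) * ((\<theta> - th n z k) \<bullet> bn n u (Suc k)) - w * (e \<bullet> (f' - f))
        - (w * ((e - \<theta>) \<bullet> f) - (dn n k z \<bullet> bn n u (Suc k) - (et n z (Suc k) - e) \<bullet> bn n u (Suc k)
       - (e \<bullet> b) * ((\<theta> - th n z k) \<bullet> bn n u (Suc k))))"
      unfolding vf r1_def by (simp add: inner_diff_left inner_diff_right algebra_simps)
    also have "\<dots> = r1 + (e \<bullet> b) * ((\<theta> - th n z k) \<bullet> bn n u (Suc k)) - w * (e \<bullet> (f' - f))"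
      unfolding p2 by simp
    finally have "\<bar>(qn V n u (Suc k) - qn V n u k) - w * vf u n k z
        - (et n z (Suc k) - e) \<bullet> bn n u (Suc k) + dn n k z \<bullet> bn n u (Suc k)\<bar>
      \<le> \<bar>r1\<bar> + \<bar>e \<bullet> b\<bar> * \<bar>(\<theta> - th n z k) \<bullet> bn n u (Suc k)\<bar> + w * \<bar>e \<bullet> (f' - f)\<bar>"
      using abs_triangle_ineq4[of "r1 + (e \<bullet> b) * ((\<theta> - th n z k) \<bullet> bn n u (Suc k))" "w * (e \<bullet> (f' - f))"]
        abs_triangle_ineq[of r1 "(e \<bullet> b) * ((\<theta> - th n z k) \<bullet> bn n u (Suc k))"] w0 by (simp add: abs_mult)
    also have "\<dots> \<le> Cq * gk (Suc k) / tm n + norm b * (D * (Cb / tm n)) + real CARD('s) * (Ck * D * (Cw / tm n))"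
    proof (rule add_mono[OF add_mono[OF r1 mult_mono]])
      have "\<bar>e \<bullet> b\<bar> \<le> norm e * norm b" by (rule Cauchy_Schwarz_ineq2)
      also have "\<dots> \<le> 1 * norm b"
        unfolding e_def by (intro mult_right_mono simplex_norm_le_1 path_simplex n) auto
      finally show "\<bar>e \<bullet> b\<bar> \<le> norm b" by simp
      show "\<bar>(\<theta> - th n z k) \<bullet> bn n u (Suc k)\<bar> \<le> D * (Cb / tm n)"
        by (rule order_trans[OF Cauchy_Schwarz_ineq2])
          (intro mult_mono Cb(2), use k in \<open>auto simp: D_def norm_minus_commute\<close>)
      have fc: "\<bar>(f' - f) $ y\<bar> \<le> Ck * D * (norm x)^2" for y
        using Ck(2)[OF path_simplex(1)[OF n], of z k x y] by (simp add: f_def f'_def D_def)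
      have "\<bar>e \<bullet> (f' - f)\<bar> \<le> norm e * norm (f' - f)" by (rule Cauchy_Schwarz_ineq2)
      also have "\<dots> \<le> 1 * (real CARD('s) * (Ck * D * (norm x)^2))"
        unfolding e_def by (intro mult_mono simplex_norm_le_1 path_simplex n norm_le_card fc) auto
      finally have "w * \<bar>e \<bullet> (f' - f)\<bar> \<le> w * (real CARD('s) * (Ck * D * (norm x)^2))" using w0 by (intro mult_left_mono) auto
      also have "\<dots> = real CARD('s) * (Ck * D * (w * (norm x)^2))" by simp
      also have "\<dots> \<le> real CARD('s) * (Ck * D * (Cw / tm n))"
        unfolding w_def x_def using Ck(1) k by (intro mult_left_mono Cw(2)) (auto simp: D_def)
      finally show "w * \<bar>e \<bullet> (f' - f)\<bar> \<le> real CARD('s) * (Ck * D * (Cw / tm n))" .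
    qed auto
    also have "\<dots> = (Cq / tm n) * gk (Suc k) + (norm b * Cb + real CARD('s) * (Ck * Cw)) / tm n * D"
      by (simp add: add_divide_distrib algebra_simps)
    also have "\<dots> \<le> (C / tm n) * gk (Suc k) + C / tm n * D"
      using t Cb Cq Ck Cw by (intro add_mono mult_right_mono divide_right_mono) (auto simp: C_def D_def gk_nonneg)
    also have "\<dots> = C / tm n * (D + gk (Suc k))" by (simp add: algebra_simps)
    finally show ?thesis by (simp add: w_def e_def D_def)
  qed
  then show ?thesis using C by blast
qed

end

text \<open>Bookkeeping for one step: in the application the first line of the right-hand side has
  expectation zero and the second is the error. \<open>s\<close> accounts for the change of the
  coefficient \<open>bn\<close>, so that \<open>T1 - (T0 - s)\<close> involves only one such
  coefficient.\<close>

lemma exponential_increment_decomposition: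
  fixes Z Z' E :: complex and d D w v m r T0 T1 s :: real
  assumes Z': "Z' = Z * E"
    and r: "r = 2 * D - w * v - (T1 - (T0 - s)) + m"
  shows "Z' * of_real (1 - T1 / 2) - Z * of_real (1 - T0 / 2) =
    (\<i> * (Z * of_real d) - (1/2) * (Z * of_real m) + (1/2) * (Z * of_real (w * v) - Z * of_real (d^2)))
    + Z * (of_real (r / 2) + (E - (1 + \<i> * of_real d - of_real (d^2) / 2 + of_real D)) + of_real (s / 2) - of_real (T1 / 2) * (E - 1))"
  unfolding Z' r by (simp add: field_simps)

lemma norm_exp_product_minus_one:
  fixes d x :: real
  assumes "\<bar>d\<bar> \<le> 1" "\<bar>x\<bar> \<le> 1"
  shows "norm (iexp d * exp (of_real x) - 1) \<le> 4 * \<bar>d\<bar> + 2 * \<bar>x\<bar>"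
proof -
  have a: "\<bar>d\<bar>^3 \<le> \<bar>d\<bar>" "\<bar>d\<bar> * \<bar>x\<bar> \<le> \<bar>d\<bar>" "x^2 \<le> \<bar>x\<bar>" "d^2 \<le> \<bar>d\<bar>"
    using assms mult_left_le[of "\<bar>x\<bar>" "\<bar>d\<bar>"] mult_left_le[of "\<bar>d\<bar>" "\<bar>d\<bar>"] mult_left_le[of "\<bar>x\<bar>" "\<bar>x\<bar>"]
      power_decreasing[of 1 3 "\<bar>d\<bar>"] by (auto simp: power2_eq_square abs_mult_self_eq)
  define Rm where "Rm = iexp d * exp (of_real x) - (1 + \<i> * of_real d - of_real (d^2) / 2 + of_real x)"
  have R: "norm Rm \<le> \<bar>d\<bar>^3 + \<bar>d\<bar> * \<bar>x\<bar> + x^2"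
    unfolding Rm_def by (rule norm_exp_product_approx[OF assms(2)])
  have "norm (iexp d * exp (of_real x) - 1) = norm (Rm + \<i> * of_real d - of_real (d^2 / 2) + of_real x)"
    by (simp add: Rm_def)
  also have "\<dots> \<le> norm Rm + norm (\<i> * complex_of_real d) + norm (complex_of_real (d^2 / 2)) + norm (complex_of_real x)"
    by (intro order_trans[OF norm_triangle_ineq] add_right_mono order_trans[OF norm_triangle_ineq4] norm_triangle_ineq)
  also have "\<dots> \<le> (\<bar>d\<bar>^3 + \<bar>d\<bar> * \<bar>x\<bar> + x^2) + \<bar>d\<bar> + d^2 / 2 + \<bar>x\<bar>"
    using R unfolding norm_of_real norm_mult by simp
  also have "\<dots> \<le> 4 * \<bar>d\<bar> + 2 * \<bar>x\<bar>" using a by linarith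
  finally show ?thesis .
qed

context clt_lyap
begin

lemma qn_increment:
  assumes V: "transpose V = V"
  shows "\<exists>C>0. \<forall>n k. k1 \<le> k \<longrightarrow> k < n \<longrightarrow> \<bar>qn V n u (Suc k) - qn V n u k\<bar> \<le> C / tm n"
proof -
  obtain Cq where Cq: "Cq > 0" "\<And>n k. k1 \<le> k \<Longrightarrow> k < n \<Longrightarrow>
    \<bar>qn V n u (Suc k) - qn V n u k + wn n (Suc k) * (un n u (Suc k) \<bullet> (lyap_op V *v un n u (Suc k)))\<bar> \<le> Cq * gk (Suc k) / tm n"
    using qn_step[OF V] by blast
  obtain CL where CL: "CL > 0" "\<And>x y. \<bar>x \<bullet> (lyap_op V *v y)\<bar> \<le> CL * (norm x * norm y)" using matrix_form_bound by blast
  obtain Cw where Cw: "Cw > 0" "\<And>n k. k1 \<le> k \<Longrightarrow> k \<le> n \<Longrightarrow> wn n k * (norm (un n u k))^2 \<le> Cw / tm n"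
    using wn_un[of u] by blast
  have "\<bar>qn V n u (Suc k) - qn V n u k\<bar> \<le> (Cq + CL * Cw) / tm n" if k: "k1 \<le> k" "k < n" for n k
  proof -
    have t: "0 < tm n" using tm_pos k by simp
    define x where "x = un n u (Suc k)"
    have w: "0 \<le> wn n (Suc k)" by (simp add: wn_def gk_nonneg)
    have "\<bar>wn n (Suc k) * (x \<bullet> (lyap_op V *v x))\<bar> \<le> wn n (Suc k) * (CL * (norm x * norm x))"
      unfolding abs_mult using w CL(2)[of x x] by (simp add: mult_left_mono)
    also have "\<dots> = CL * (wn n (Suc k) * (norm x)^2)" by (simp add: power2_eq_square)
    also have "\<dots> \<le> CL * (Cw / tm n)" unfolding x_def using CL(1) k by (intro mult_left_mono Cw(2)) auto
    finally have 1: "\<bar>wn n (Suc k) * (x \<bullet> (lyap_op V *v x))\<bar> \<le> CL * Cw / tm n" by simp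
    have "Cq * gk (Suc k) / tm n \<le> Cq * 1 / tm n"
      using t Cq(1) by (intro divide_right_mono mult_left_mono gk_le_1) auto
    then show ?thesis using Cq(2)[OF k] 1 unfolding x_def add_divide_distrib by linarith
  qed
  then show ?thesis using Cq(1) CL(1) Cw(1) by (intro exI[of _ "Cq + CL * Cw"]) (auto intro: add_pos_pos)
qed

end

context clt_setup
begin

text \<open>The factor involving \<open>bn\<close> is the Poisson correction of the compensator.\<close>
definition Yn :: "real^'s^'s \<Rightarrow> real^'s \<Rightarrow> nat \<Rightarrow> nat \<Rightarrow> complex" where
  "Yn V u n k = expectation (\<lambda>z. Zf V u n k z * of_real (1 - (et n z k \<bullet> bn n u k) / 2))"

definition mean_dist :: "nat \<Rightarrow> nat \<Rightarrow> real" where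
  "mean_dist n k = expectation (\<lambda>z. norm (th n z k - \<theta>))"

lemma th_dist_le_2: assumes n: "1 \<le> n" shows "norm (th n z k - \<theta>) \<le> 2"
  using norm_triangle_ineq4[of "th n z k" \<theta>] simplex_norm_le_1[OF path_simplex(1)[OF n], of z k]
    simplex_norm_le_1[OF \<theta>_simplex] by linarith

lemma th_dist_integrable: assumes n: "1 \<le> n" shows "integrable M (\<lambda>z. norm (th n z k - \<theta>))"
proof (rule bounded_integrable[of _ 2])
  have "(\<lambda>z. th n z k) \<in> borel_measurable M" by (rule Fn_M[OF n th_measurable[OF n]])
  then show "(\<lambda>z. norm (th n z k - \<theta>)) \<in> borel_measurable M" by measurable
qed (use th_dist_le_2[OF n] in auto)

lemma complex_scaled_integrable:
  fixes Z :: "'w \<Rightarrow> complex" and f :: "'w \<Rightarrow> real"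
  assumes "Z \<in> borel_measurable M" "\<And>z. norm (Z z) \<le> B" "f \<in> borel_measurable M" "\<And>z. \<bar>f z\<bar> \<le> B'"
  shows "integrable M (\<lambda>z. Z z * of_real (f z))"
proof (rule bounded_integrable[of _ "B * B'"])
  show "(\<lambda>z. Z z * of_real (f z)) \<in> borel_measurable M" using assms by measurable
  show "norm (Z z * of_real (f z)) \<le> B * B'" for z
    using order_trans[OF norm_ge_zero assms(2)] unfolding norm_mult norm_of_real by (intro mult_mono assms) auto
qed

text \<open>What is not centred is \<open>1 / tm n\<close> times quantities that vanish on average
  over the times \<open>k\<close>, so that the fewer than \<open>n\<close> steps can be
  summed.\<close>

lemma Yn_step:
  assumes V: "transpose V = V" and eq: "U_star P \<theta> + lyap_op V = 0"
  shows "\<exists>C>0. \<forall>\<^sub>F n in sequentially. \<forall>k. k1 \<le> k \<longrightarrow> k < n \<longrightarrow>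
    norm (Yn V u n (Suc k) - Yn V u n k) \<le> C / tm n * (mean_dist n k + gk (Suc k) + sn n / tm n + 1 / tm n)"
proof -
  obtain Cr where Cr: "Cr > 0" "\<And>n k z. 1 \<le> n \<Longrightarrow> k1 \<le> k \<Longrightarrow> k < n \<Longrightarrow>
     \<bar>(qn V n u (Suc k) - qn V n u k) - wn n (Suc k) * vf u n k z
        - (et n z (Suc k) - et n z k) \<bullet> bn n u (Suc k) + dn n k z \<bullet> bn n u (Suc k)\<bar>
       \<le> Cr / tm n * (norm (th n z k - \<theta>) + gk (Suc k))"
    using compensator_decomposition[OF V eq] by blast
  obtain Cd where Cd: "Cd > 0" "\<And>n k z. 1 \<le> n \<Longrightarrow> k1 \<le> k \<Longrightarrow> k < n \<Longrightarrow> \<bar>df u n k z\<bar> \<le> Cd * (sn n / tm n)"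
    using df_bound[of u] by blast
  obtain Cv where Cv: "Cv > 0" "\<And>n k z. 1 \<le> n \<Longrightarrow> k1 \<le> k \<Longrightarrow> k < n \<Longrightarrow> 0 \<le> vf u n k z \<and> wn n (Suc k) * vf u n k z \<le> Cv / tm n"
    using vf_bound[of u] by blast
  obtain CZ where CZ: "CZ > 0" "\<And>n k z. 1 \<le> n \<Longrightarrow> k1 \<le> k \<Longrightarrow> k \<le> n \<Longrightarrow> norm (Zf V u n k z) \<le> CZ"
    using Zf_bound[of V u] by blast
  obtain Cb where Cb: "Cb > 0" "\<And>n k. k1 \<le> k \<Longrightarrow> k \<le> n \<Longrightarrow> norm (bn n u k) \<le> Cb / tm n"
    "\<And>n k. k1 \<le> k \<Longrightarrow> k < n \<Longrightarrow> norm (bn n u k - bn n u (Suc k)) \<le> Cb * gk (Suc k) / tm n"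
    using bn_bounds[of u] by blast
  obtain Cq where Cq: "Cq > 0" "\<And>n k. k1 \<le> k \<Longrightarrow> k < n \<Longrightarrow> \<bar>qn V n u (Suc k) - qn V n u k\<bar> \<le> Cq / tm n"
    using qn_increment[OF V] by blast
  define C where "C = CZ * (Cr + Cb + Cd * Cv + Cd * Cq + Cq^2 + 4 * Cd * Cb + 2 * Cq * Cb)"
  have C: "C > 0" unfolding C_def using CZ Cr Cd Cv Cb Cq by (intro mult_pos_pos add_pos_pos) auto
  have step: "norm (Yn V u n (Suc k) - Yn V u n k) \<le> C / tm n * (mean_dist n k + gk (Suc k) + sn n / tm n + 1 / tm n)"
    if n: "1 \<le> n" and d1: "Cd * (sn n / tm n) < 1" and q1: "Cq * (1 / tm n) < 1" and k: "k1 \<le> k" "k < n" for n k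
  proof -
    define i where "i = 1 / tm n"
    define \<delta> where "\<delta> = sn n / tm n"
    define g where "g = gk (Suc k)"
    define w where "w = wn n (Suc k)"
    define D where "D = (qn V n u (Suc k) - qn V n u k) / 2"
    define Z where "Z = Zf V u n k"
    define d where "d = df u n k"
    define v where "v = vf u n k"
    define N where "N z = norm (th n z k - \<theta>)" for z
    define m where "m z = dn n k z \<bullet> bn n u (Suc k)" for z
    define T0 where "T0 z = et n z k \<bullet> bn n u k" for z
    define T1 where "T1 z = et n z (Suc k) \<bullet> bn n u (Suc k)" for z
    define s where "s z = et n z k \<bullet> (bn n u k - bn n u (Suc k))" for z
    define r where "r z = 2 * D - w * v z - (T1 z - (T0 z - s z)) + m z" for z
    define E where "E z = iexp (d z) * exp (of_real D)" for z
    have t: "0 < tm n" using tm_pos n by auto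
    have i: "0 < i" and \<delta>: "0 \<le> \<delta>" and g: "0 \<le> g" and w: "0 \<le> w"
      using t by (auto simp: i_def \<delta>_def g_def w_def sn_nonneg gk_nonneg wn_def)
    have kn: "Suc k \<le> n" "k \<le> n" "k1 \<le> Suc k" using k by auto
    have dM: "d \<in> borel_measurable M" unfolding d_def by (rule df_measurable[OF n])
    have vM: "v \<in> borel_measurable M" unfolding v_def by (rule vf_measurable[OF n])
    have ZF: "Z \<in> borel_measurable (Fn n k)" unfolding Z_def by (rule Zf_measurable[OF n])
    have ZM: "Z \<in> borel_measurable M" by (rule Fn_M[OF n ZF])
    have Z'M: "Zf V u n (Suc k) \<in> borel_measurable M" by (rule Fn_M[OF n Zf_measurable[OF n]])
    have [measurable]: "(\<lambda>z. et n z j) \<in> borel_measurable M" for j by (rule Fn_M[OF n et_measurable[OF n]])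
    have [measurable]: "dn n k \<in> borel_measurable M" by (rule Fn_M[OF n dn_measurable[OF n]])
    have mM: "m \<in> borel_measurable M" and T0M: "T0 \<in> borel_measurable M" and T1M: "T1 \<in> borel_measurable M"
      unfolding m_def[abs_def] T0_def[abs_def] T1_def[abs_def] by measurable
    have Zb: "norm (Z z) \<le> CZ" "norm (Zf V u n (Suc k) z) \<le> CZ" for z
      unfolding Z_def using CZ(2) n k by auto
    have db: "\<bar>d z\<bar> \<le> Cd * \<delta>" "\<bar>d z\<bar> \<le> 1" for z
      using Cd(2)[OF n k, of z] d1 by (auto simp: d_def \<delta>_def)
    have vb: "0 \<le> w * v z" "w * v z \<le> Cv * i" for z
      using Cv(2)[OF n k, of z] w by (auto simp: v_def w_def i_def)
    have Db: "\<bar>D\<bar> \<le> Cq * i" "\<bar>D\<bar> \<le> 1"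
    proof -
      have "\<bar>D\<bar> \<le> \<bar>qn V n u (Suc k) - qn V n u k\<bar>" by (simp add: D_def abs_divide)
      then show "\<bar>D\<bar> \<le> Cq * i" using Cq(2)[OF k] by (simp add: i_def)
      then show "\<bar>D\<bar> \<le> 1" using q1 by (simp add: i_def)
    qed
    have etb: "\<bar>et n z j \<bullet> x\<bar> \<le> norm x" for z j x
      using Cauchy_Schwarz_ineq2[of "et n z j" x] mult_right_mono[OF simplex_norm_le_1[OF path_simplex(2)[OF n]], of "norm x" z j]
      by simp
    have T1b: "\<bar>T1 z\<bar> \<le> Cb * i" and T0b: "\<bar>T0 z\<bar> \<le> Cb * i" and sb: "\<bar>s z\<bar> \<le> Cb * g * i" for z
      using order_trans[OF etb Cb(2)[OF kn(3) kn(1)], of z "Suc k"] order_trans[OF etb Cb(2)[OF k(1) kn(2)], of z k]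
        order_trans[OF etb Cb(3)[OF k], of z k] by (auto simp: T1_def T0_def s_def i_def g_def)
    have mb: "\<bar>m z\<bar> \<le> 2 * (Cb * i)" for z
      unfolding m_def i_def using Cb(2)[OF kn(3) kn(1)]
      by (intro order_trans[OF Cauchy_Schwarz_ineq2] mult_mono dn_bound[OF n]) auto
    have rb: "\<bar>r z\<bar> \<le> Cr * i * (N z + g)" for z
    proof -
      have "r z = (qn V n u (Suc k) - qn V n u k) - wn n (Suc k) * vf u n k z
        - (et n z (Suc k) - et n z k) \<bullet> bn n u (Suc k) + dn n k z \<bullet> bn n u (Suc k)"
        by (simp add: r_def D_def w_def v_def T1_def T0_def s_def m_def inner_diff_left inner_diff_right)
      then show ?thesis using Cr(2)[OF n k, of z] by (simp add: i_def N_def g_def)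
    qed
    \<comment> \<open>The terms removed by the moment identities: increments of the linear
      functional and of the corrector have mean zero, and the square is exchanged for its
      conditional mean.\<close>
    define mart where "mart z = \<i> * (Z z * of_real (d z)) - (1/2) * (Z z * of_real (m z))
       + (1/2) * (Z z * of_real (w * v z) - Z z * of_real ((d z)^2))" for z
    define err where "err z = Z z * (of_real (r z / 2) + (E z - (1 + \<i> * of_real (d z) - of_real ((d z)^2) / 2 + of_real D))
       + of_real (s z / 2) - of_real (T1 z / 2) * (E z - 1))" for z
    have Z'E: "Zf V u n (Suc k) z = Z z * E z" for z
      unfolding Z_def E_def d_def D_def by (rule Zf_step[OF n k])
    have decomp: "Zf V u n (Suc k) z * of_real (1 - T1 z / 2) - Z z * of_real (1 - T0 z / 2) = mart z + err z" for z
      unfolding mart_def err_def by (rule exponential_increment_decomposition[OF Z'E]) (simp add: r_def)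
    have d2: "(d z)^2 \<le> 1" "0 \<le> (d z)^2" for z using power_mono[OF db(2), of z 2] by simp_all
    have ints: "integrable M (\<lambda>z. Z z * of_real (d z))" "integrable M (\<lambda>z. Z z * of_real (m z))"
      "integrable M (\<lambda>z. Z z * of_real (w * v z))" "integrable M (\<lambda>z. Z z * of_real ((d z)^2))"
      by (rule complex_scaled_integrable[OF ZM Zb(1)]; use dM mM vM db(2) mb vb d2 in \<open>measurable?; fastforce\<close>)+
    have mart_int: "integrable M mart" unfolding mart_def[abs_def]
      using ints by (intro Bochner_Integration.integrable_add Bochner_Integration.integrable_diff integrable_mult_right)
    have mart0: "expectation mart = 0"
    proof -
      have e1: "expectation (\<lambda>z. Z z * of_real (d z)) = 0"
        unfolding d_def by (rule df_moments(1)[OF n k ZF Zb(1)])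
      have e2: "expectation (\<lambda>z. Z z * of_real ((d z)^2)) = expectation (\<lambda>z. Z z * of_real (w * v z))"
        unfolding d_def w_def v_def by (rule df_moments(2)[OF n k ZF Zb(1)])
      have e3: "expectation (\<lambda>z. Z z * of_real (m z)) = 0"
        unfolding m_def by (rule dn_first_complex[OF n ZF Zb(1), where c = "\<lambda>z. bn n u (Suc k)"]) auto
      show ?thesis unfolding mart_def[abs_def] using ints by (simp add: e1 e2 e3 del: of_real_power of_real_mult)
    qed
    have Yi: "integrable M (\<lambda>z. Zf V u n (Suc k) z * of_real (1 - T1 z / 2))" "integrable M (\<lambda>z. Z z * of_real (1 - T0 z / 2))"
    proof -
      have b: "\<bar>1 - x / 2\<bar> \<le> 1 + Cb * i" if "\<bar>x\<bar> \<le> Cb * i" for x using that by linarith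
      show "integrable M (\<lambda>z. Zf V u n (Suc k) z * of_real (1 - T1 z / 2))"
        by (rule complex_scaled_integrable[OF Z'M Zb(2) _ b[OF T1b]]) (use T1M in measurable)
      show "integrable M (\<lambda>z. Z z * of_real (1 - T0 z / 2))"
        by (rule complex_scaled_integrable[OF ZM Zb(1) _ b[OF T0b]]) (use T0M in measurable)
    qed
    have dec': "err = (\<lambda>z. (Zf V u n (Suc k) z * of_real (1 - T1 z / 2) - Z z * of_real (1 - T0 z / 2)) - mart z)"
      by (rule ext) (simp only: decomp add_diff_cancel_left')
    have err_int: "integrable M err"
      unfolding dec' using Yi mart_int by (intro Bochner_Integration.integrable_diff)
    have Ydiff: "Yn V u n (Suc k) - Yn V u n k = expectation err"
    proof -
      have "Yn V u n (Suc k) - Yn V u n k = expectation (\<lambda>z. Zf V u n (Suc k) z * of_real (1 - T1 z / 2) - Z z * of_real (1 - T0 z / 2))"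
        unfolding Yn_def Z_def[symmetric] T0_def[symmetric] T1_def[symmetric]
        by (rule Bochner_Integration.integral_diff[symmetric]) (fact Yi)+
      also have "\<dots> = expectation mart + expectation err"
        unfolding decomp by (rule Bochner_Integration.integral_add) (fact mart_int err_int)+
      finally show ?thesis by (simp add: mart0)
    qed
    \<comment> \<open>The part of the error bound that does not depend on the outcome.\<close>
    define c0 where "c0 = Cd * Cq * \<delta> * i + Cq^2 * i^2 + (4 * Cd * \<delta> + 2 * Cq * i) * (Cb * i) + Cb * g * i + Cr * i * g"
    have errb: "norm (err z) \<le> CZ * (Cr * i * N z + Cd * \<delta> * (d z)^2 + c0)" for z
    proof -
      define Rm where "Rm = E z - (1 + \<i> * of_real (d z) - of_real ((d z)^2) / 2 + of_real D)"
      have "norm Rm \<le> \<bar>d z\<bar>^3 + \<bar>d z\<bar> * \<bar>D\<bar> + D^2"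
        unfolding Rm_def E_def by (rule norm_exp_product_approx[OF Db(2)])
      also have "\<dots> \<le> (Cd * \<delta>) * (d z)^2 + (Cd * \<delta>) * (Cq * i) + (Cq * i)^2"
      proof (intro add_mono mult_mono db Db)
        \<comment> \<open>Only one factor is estimated uniformly; the remaining square has mean O(1
          / tm n), which is better than its uniform bound.\<close>
        show "\<bar>d z\<bar>^3 \<le> (Cd * \<delta>) * (d z)^2"
          using mult_right_mono[OF db(1)[of z], of "(d z)^2"] by (simp add: power3_eq_cube power2_eq_square abs_mult_self_eq mult.assoc)
        show "D^2 \<le> (Cq * i)^2" using power_mono[OF Db(1), of 2] by simp
      qed (use Cd(1) \<delta> in auto)
      finally have R: "norm Rm \<le> (Cd * \<delta>) * (d z)^2 + (Cd * \<delta>) * (Cq * i) + (Cq * i)^2" .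
      have "norm (E z - 1) \<le> 4 * \<bar>d z\<bar> + 2 * \<bar>D\<bar>"
        unfolding E_def by (rule norm_exp_product_minus_one[OF db(2) Db(2)])
      also have "\<dots> \<le> 4 * (Cd * \<delta>) + 2 * (Cq * i)" using db(1) Db(1) by (intro add_mono mult_left_mono) auto
      finally have E1: "norm (E z - 1) \<le> 4 * (Cd * \<delta>) + 2 * (Cq * i)" .
      have T: "norm (of_real (T1 z / 2) * (E z - 1)) \<le> (Cb * i) * (4 * (Cd * \<delta>) + 2 * (Cq * i))"
        unfolding norm_mult norm_of_real using T1b[of z] by (intro mult_mono E1) auto
      have "norm (of_real (r z / 2) + Rm + of_real (s z / 2) - of_real (T1 z / 2) * (E z - 1)) \<le>
        norm (of_real (r z / 2) :: complex) + norm Rm + norm (of_real (s z / 2) :: complex) + norm (of_real (T1 z / 2) * (E z - 1))"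
        by (intro order_trans[OF norm_triangle_ineq4] add_right_mono order_trans[OF norm_triangle_ineq] norm_triangle_ineq)
      also have "\<dots> \<le> Cr * i * (N z + g) + ((Cd * \<delta>) * (d z)^2 + (Cd * \<delta>) * (Cq * i) + (Cq * i)^2) + Cb * g * i
         + (Cb * i) * (4 * (Cd * \<delta>) + 2 * (Cq * i))"
        unfolding norm_of_real using rb[of z] sb[of z] by (intro add_mono R T) auto
      also have "\<dots> = Cr * i * N z + Cd * \<delta> * (d z)^2 + c0"
        by (simp add: c0_def algebra_simps power2_eq_square)
      finally show ?thesis
        unfolding err_def Rm_def[symmetric] norm_mult using Zb(1)[of z] CZ(1) by (intro mult_mono) auto
    qed
    have Ni: "integrable M N" unfolding N_def[abs_def] by (rule th_dist_integrable[OF n])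
    have d2i: "integrable M (\<lambda>z. (d z)^2)"
      by (rule bounded_integrable[of _ 1]) (use dM d2 in auto)
    \<comment> \<open>The second moment identity for \<open>df\<close> with the constant test
      function 1.\<close>
    have Ed2: "expectation (\<lambda>z. (d z)^2) \<le> Cv * i"
    proof -
      have "complex_of_real (expectation (\<lambda>z. (d z)^2)) = expectation (\<lambda>z. 1 * complex_of_real ((d z)^2))"
        by (simp del: of_real_power)
      also have "\<dots> = expectation (\<lambda>z. 1 * complex_of_real (w * v z))"
        unfolding d_def w_def v_def by (rule df_moments(2)[OF n k, where BZ = 1]) auto
      also have "\<dots> = complex_of_real (expectation (\<lambda>z. w * v z))" by (simp del: of_real_mult)
      finally have "expectation (\<lambda>z. (d z)^2) = expectation (\<lambda>z. w * v z)" by (simp only: of_real_eq_iff)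
      also have "\<dots> \<le> Cv * i" by (rule expectation_bounds(2)) (use vM vb in auto)
      finally show ?thesis .
    qed
    have "norm (expectation err) \<le> expectation (\<lambda>z. norm (err z))" by (rule integral_norm_bound)
    also have "\<dots> \<le> expectation (\<lambda>z. CZ * (Cr * i * N z + Cd * \<delta> * (d z)^2 + c0))"
      by (rule integral_mono) (use err_int Ni d2i errb in auto)
    also have "\<dots> = CZ * (Cr * i * expectation N + Cd * \<delta> * expectation (\<lambda>z. (d z)^2) + c0)"
      using Ni d2i by (simp add: prob_space)
    also have "\<dots> \<le> CZ * (Cr * i * expectation N + Cd * \<delta> * (Cv * i) + c0)"
      using CZ(1) Cd(1) Cr(1) i \<delta> Ed2 by (intro mult_left_mono add_mono) auto
    also have "\<dots> \<le> C * i * (expectation N + g + \<delta> + i)"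
    proof -
      have EN: "0 \<le> expectation N" by (rule Bochner_Integration.integral_nonneg) (simp add: N_def)
      define c1 where "c1 = Cr + Cb + Cd * Cv + Cd * Cq + Cq^2 + 4 * Cd * Cb + 2 * Cq * Cb"
      have c1: "Cr \<le> c1" "Cb + Cr \<le> c1" "Cd * Cv + Cd * Cq + 4 * Cd * Cb \<le> c1" "Cq^2 + 2 * Cq * Cb \<le> c1"
        unfolding c1_def using Cr(1) Cb(1) Cd(1) Cv(1) Cq(1) by (auto simp: add_nonneg_nonneg)
      have "Cr * i * expectation N + Cd * \<delta> * (Cv * i) + c0 =
        (Cr * expectation N + (Cb + Cr) * g + (Cd * Cv + Cd * Cq + 4 * Cd * Cb) * \<delta> + (Cq^2 + 2 * Cq * Cb) * i) * i"
        by (simp add: c0_def algebra_simps power2_eq_square)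
      also have "\<dots> \<le> (c1 * expectation N + c1 * g + c1 * \<delta> + c1 * i) * i"
        using c1 EN g \<delta> i by (intro mult_right_mono add_mono) auto
      also have "\<dots> = c1 * i * (expectation N + g + \<delta> + i)" by (simp add: algebra_simps)
      finally have "CZ * (Cr * i * expectation N + Cd * \<delta> * (Cv * i) + c0) \<le> CZ * (c1 * i * (expectation N + g + \<delta> + i))"
        using CZ(1) by (intro mult_left_mono) auto
      then show ?thesis by (simp add: C_def c1_def mult.assoc)
    qed
    finally show ?thesis unfolding Ydiff by (simp add: i_def \<delta>_def g_def N_def[abs_def] mean_dist_def)
  qed
  have "(\<lambda>n. Cd * (sn n / tm n)) \<longlonglongrightarrow> Cd * 0" "(\<lambda>n. Cq * (1 / tm n)) \<longlonglongrightarrow> Cq * 0"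
    by (intro tendsto_mult tendsto_const sn_over_tm inverse_tm)+
  then have "\<forall>\<^sub>F n in sequentially. Cd * (sn n / tm n) < 1" "\<forall>\<^sub>F n in sequentially. Cq * (1 / tm n) < 1"
    by (auto elim!: order_tendstoD(2))
  then have "\<forall>\<^sub>F n in sequentially. \<forall>k. k1 \<le> k \<longrightarrow> k < n \<longrightarrow>
    norm (Yn V u n (Suc k) - Yn V u n k) \<le> C / tm n * (mean_dist n k + gk (Suc k) + sn n / tm n + 1 / tm n)"
    using eventually_ge_at_top[of 1] by eventually_elim (use step in blast)
  then show ?thesis using C by blast
qed

end

section \<open>Weak convergence\<close>

context clt_setup
begin

lemma mean_dist_le_2: assumes n: "1 \<le> n" shows "0 \<le> mean_dist n k" "mean_dist n k \<le> 2"
proof -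
  have m: "(\<lambda>z. norm (th n z k - \<theta>)) \<in> borel_measurable M"
    by (rule borel_measurable_integrable[OF th_dist_integrable[OF n]])
  show "0 \<le> mean_dist n k" "mean_dist n k \<le> 2"
    unfolding mean_dist_def using expectation_bounds[OF m _ th_dist_le_2[OF n]] by auto
qed

text \<open>Cesaro argument: the times before \<open>k0\<close> contribute at most 2 each, the later
  ones a small mean distance.\<close>

lemma mean_dist_average: "(\<lambda>n. (\<Sum>k\<in>{k1..<n}. mean_dist n k) / tm n) \<longlonglongrightarrow> 0"
proof (rule tendstoI)
  fix e :: real assume e: "e > 0"
  then have e3: "e / 3 > 0" by simp
  obtain k0 where k0: "k1 \<le> k0" and ev: "\<forall>\<^sub>F n in sequentially. \<forall>k\<in>{k0..n}. expectation (\<lambda>z. norm (th n z k - \<theta>)) \<le> e / 3"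
    using convergence_in_mean[OF e3] by blast
  have "(\<lambda>n. (2 * real k0) * (1 / tm n)) \<longlonglongrightarrow> 0" by (rule tendsto_mult_right_zero[OF inverse_tm])
  then have "\<forall>\<^sub>F n in sequentially. (2 * real k0) * (1 / tm n) < e / 3" using e3 by (rule order_tendstoD(2))
  then show "\<forall>\<^sub>F n in sequentially. dist ((\<Sum>k\<in>{k1..<n}. mean_dist n k) / tm n) 0 < e"
    using ev eventually_ge_at_top[of k0]
  proof eventually_elim
    case (elim n)
    have n: "1 \<le> n" using elim k0 k1 by simp
    have t: "0 < tm n" by (rule tm_pos[OF n])
    have "(\<Sum>k\<in>{k1..<n}. mean_dist n k) = (\<Sum>k\<in>{k1..<k0}. mean_dist n k) + (\<Sum>k\<in>{k0..<n}. mean_dist n k)"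
      by (rule sum.atLeastLessThan_concat[symmetric]) (use k0 elim in auto)
    also have "\<dots> \<le> real (card {k1..<k0}) * 2 + real (card {k0..<n}) * (e / 3)"
      using elim(2) mean_dist_le_2[OF n] by (intro add_mono sum_bounded_above) (auto simp: mean_dist_def)
    also have "\<dots> \<le> real k0 * 2 + tm n * (e / 3)"
      using tm_ge[of n] e by (intro add_mono mult_right_mono) auto
    finally have "(\<Sum>k\<in>{k1..<n}. mean_dist n k) / tm n \<le> (real k0 * 2 + tm n * (e / 3)) / tm n"
      using t by (intro divide_right_mono) auto
    also have "\<dots> = (2 * real k0) * (1 / tm n) + e / 3" using t by (simp add: add_divide_distrib)
    finally have "(\<Sum>k\<in>{k1..<n}. mean_dist n k) / tm n < e" using elim(1) e by linarith
    moreover have "0 \<le> (\<Sum>k\<in>{k1..<n}. mean_dist n k) / tm n"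
      using t mean_dist_le_2[OF n] by (intro divide_nonneg_pos sum_nonneg) auto
    ultimately show ?case by simp
  qed
qed

lemma Yn_limit:
  assumes V: "transpose V = V" and eq: "U_star P \<theta> + lyap_op V = 0"
  shows "(\<lambda>n. Yn V u n n - Yn V u n k1) \<longlonglongrightarrow> 0"
proof -
  obtain C where C: "C > 0" and st: "\<forall>\<^sub>F n in sequentially. \<forall>k. k1 \<le> k \<longrightarrow> k < n \<longrightarrow>
    norm (Yn V u n (Suc k) - Yn V u n k) \<le> C / tm n * (mean_dist n k + gk (Suc k) + sn n / tm n + 1 / tm n)"
    using Yn_step[OF V eq] by blast
  define B where "B n = C * ((\<Sum>k\<in>{k1..<n}. mean_dist n k) / tm n + (\<Sum>k<n. gk (Suc k)) / tm n + sn n / tm n + 1 / tm n)" for n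
  have "B \<longlonglongrightarrow> C * (0 + 0 + 0 + 0)" unfolding B_def[abs_def]
    by (intro tendsto_mult tendsto_add tendsto_const mean_dist_average gk_average sn_over_tm inverse_tm)
  then have "B \<longlonglongrightarrow> 0" by simp
  then show ?thesis
  proof (rule Lim_null_comparison[rotated])
    show "\<forall>\<^sub>F n in sequentially. norm (Yn V u n n - Yn V u n k1) \<le> B n"
      using st eventually_ge_at_top[of k1]
    proof eventually_elim
      case (elim n)
      have t: "0 < tm n" using tm_pos[of n] elim(2) k1 by simp
      define c where "c = sn n / tm n + 1 / tm n"
      have c: "0 \<le> c" using t sn_nonneg[of n] by (simp add: c_def)
      have "Yn V u n n - Yn V u n k1 = (\<Sum>k\<in>{k1..<n}. Yn V u n (Suc k) - Yn V u n k)"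
        using elim(2) by (rule sum_Suc_diff'[symmetric])
      then have "norm (Yn V u n n - Yn V u n k1) \<le> (\<Sum>k\<in>{k1..<n}. C / tm n * (mean_dist n k + gk (Suc k) + c))"
        using elim(1) by (simp only:) (intro sum_norm_le, auto simp: c_def add.assoc)
      also have "\<dots> = C / tm n * ((\<Sum>k\<in>{k1..<n}. mean_dist n k) + (\<Sum>k\<in>{k1..<n}. gk (Suc k)) + real (n - k1) * c)"
        unfolding sum_distrib_left[symmetric] sum.distrib by simp
      also have "\<dots> \<le> C / tm n * ((\<Sum>k\<in>{k1..<n}. mean_dist n k) + (\<Sum>k<n. gk (Suc k)) + tm n * c)"
      proof (intro mult_left_mono add_mono mult_right_mono order_refl c)
        show "(\<Sum>k\<in>{k1..<n}. gk (Suc k)) \<le> (\<Sum>k<n. gk (Suc k))" by (intro sum_mono2) (auto simp: gk_nonneg)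
        show "real (n - k1) \<le> tm n" using tm_ge[of n] by simp
      qed (use C t in auto)
      also have "\<dots> = B n" using t by (simp add: B_def c_def field_simps)
      finally show ?case .
    qed
  qed
qed

lemma Yn_Zf: "\<exists>C. \<forall>n\<ge>1. \<forall>k. k1 \<le> k \<longrightarrow> k \<le> n \<longrightarrow> norm (expectation (Zf V u n k) - Yn V u n k) \<le> C / tm n"
proof -
  obtain CZ where CZ: "CZ > 0" "\<And>n k z. 1 \<le> n \<Longrightarrow> k1 \<le> k \<Longrightarrow> k \<le> n \<Longrightarrow> norm (Zf V u n k z) \<le> CZ"
    using Zf_bound[of V u] by blast
  obtain Cb where Cb: "Cb > 0" "\<And>n k. k1 \<le> k \<Longrightarrow> k \<le> n \<Longrightarrow> norm (bn n u k) \<le> Cb / tm n"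
    using bn_bounds[of u] by blast
  have "norm (expectation (Zf V u n k) - Yn V u n k) \<le> CZ * Cb / tm n" if n: "1 \<le> n" and k: "k1 \<le> k" "k \<le> n" for n k
  proof -
    have ZM: "Zf V u n k \<in> borel_measurable M" by (rule Fn_M[OF n Zf_measurable[OF n]])
    note Zb = CZ(2)[OF n k]
    have [measurable]: "(\<lambda>z. et n z k) \<in> borel_measurable M" by (rule Fn_M[OF n et_measurable[OF n]])
    have T: "\<bar>et n z k \<bullet> bn n u k / 2\<bar> \<le> Cb / tm n" for z
    proof -
      have "\<bar>et n z k \<bullet> bn n u k\<bar> \<le> norm (et n z k) * norm (bn n u k)" by (rule Cauchy_Schwarz_ineq2)
      also have "\<dots> \<le> 1 * (Cb / tm n)" by (intro mult_mono Cb(2) k simplex_norm_le_1 path_simplex n) auto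
      finally show ?thesis unfolding abs_divide using abs_ge_zero[of "et n z k \<bullet> bn n u k"] by linarith
    qed
    have i1: "integrable M (Zf V u n k)" by (rule bounded_integrable[OF ZM Zb])
    have i2: "integrable M (\<lambda>z. Zf V u n k z * of_real (et n z k \<bullet> bn n u k / 2))"
      by (rule complex_scaled_integrable[OF ZM Zb _ T]) measurable
    have "Yn V u n k = expectation (\<lambda>z. Zf V u n k z - Zf V u n k z * of_real (et n z k \<bullet> bn n u k / 2))"
      unfolding Yn_def by (simp add: ring_distribs)
    also have "\<dots> = expectation (Zf V u n k) - expectation (\<lambda>z. Zf V u n k z * of_real (et n z k \<bullet> bn n u k / 2))"
      by (rule Bochner_Integration.integral_diff[OF i1 i2])
    finally have "norm (expectation (Zf V u n k) - Yn V u n k) = norm (expectation (\<lambda>z. Zf V u n k z * of_real (et n z k \<bullet> bn n u k / 2)))"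
      by simp
    also have "\<dots> \<le> expectation (\<lambda>z. norm (Zf V u n k z * of_real (et n z k \<bullet> bn n u k / 2)))" by (rule integral_norm_bound)
    also have "\<dots> \<le> CZ * (Cb / tm n)"
    proof (rule expectation_bounds(2))
      show "(\<lambda>z. norm (Zf V u n k z * of_real (et n z k \<bullet> bn n u k / 2))) \<in> borel_measurable M"
        using borel_measurable_integrable[OF i2] by measurable
      show "norm (Zf V u n k z * of_real (et n z k \<bullet> bn n u k / 2)) \<le> CZ * (Cb / tm n)" for z
        unfolding norm_mult norm_of_real using CZ(1) by (intro mult_mono Zb T) auto
    qed simp
    finally show ?thesis by simp
  qed
  then show ?thesis by blast
qed

text \<open>At time \<open>k1\<close> the linear part is zero and the deterministic exponent tends
  to zero, so the value there tends to 1. \<open>Yn_limit\<close> carries it to time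
  \<open>n\<close>, the correctors being O(1 / tm n) at both ends.\<close>

lemma Zf_limit:
  assumes V: "transpose V = V" and eq: "U_star P \<theta> + lyap_op V = 0"
  shows "(\<lambda>n. expectation (Zf V u n n)) \<longlonglongrightarrow> 1"
proof -
  obtain C where C: "\<And>n k. 1 \<le> n \<Longrightarrow> k1 \<le> k \<Longrightarrow> k \<le> n \<Longrightarrow> norm (expectation (Zf V u n k) - Yn V u n k) \<le> C / tm n"
    using Yn_Zf[of V u] by blast
  have lim: "(\<lambda>n. C * (1 / tm n)) \<longlonglongrightarrow> 0" by (rule tendsto_mult_right_zero[OF inverse_tm])
  have a: "(\<lambda>n. expectation (Zf V u n n) - Yn V u n n) \<longlonglongrightarrow> 0"
    by (rule Lim_null_comparison[OF _ lim], use eventually_ge_at_top[of k1] in eventually_elim) (use C k1 in auto)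
  have b: "(\<lambda>n. expectation (Zf V u n k1) - Yn V u n k1) \<longlonglongrightarrow> 0"
    by (rule Lim_null_comparison[OF _ lim], use eventually_ge_at_top[of k1] in eventually_elim) (use C k1 in auto)
  have X0: "Xn n k1 z = 0" for n z unfolding Xn_def by (rule Xi_0) simp
  have "expectation (Zf V u n k1) = of_real (exp (qn V n u k1 / 2))" for n
    by (simp add: Zf_def[abs_def] X0 prob_space exp_of_real[symmetric])
  moreover have "(\<lambda>n. complex_of_real (exp (qn V n u k1 / 2))) \<longlonglongrightarrow> of_real (exp (0 / 2))"
    by (intro tendsto_of_real tendsto_exp tendsto_divide qn_k1_tendsto tendsto_const) simp
  ultimately have c: "(\<lambda>n. expectation (Zf V u n k1)) \<longlonglongrightarrow> 1" by simp
  have "(\<lambda>n. (expectation (Zf V u n n) - Yn V u n n) + (Yn V u n n - Yn V u n k1)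
     - (expectation (Zf V u n k1) - Yn V u n k1) + expectation (Zf V u n k1)) \<longlonglongrightarrow> 0 + 0 - 0 + 1"
    by (intro tendsto_add tendsto_diff a b c Yn_limit[OF V eq])
  then show ?thesis by simp
qed

lemma Xn_char_limit:
  assumes V: "transpose V = V" and eq: "U_star P \<theta> + lyap_op V = 0"
  shows "(\<lambda>n. expectation (\<lambda>z. iexp (sn n * (u \<bullet> Xn n n z)))) \<longlonglongrightarrow> exp (- of_real (u \<bullet> (V *v u)) / 2)"
proof -
  define q where "q = u \<bullet> (V *v u)"
  have "(\<lambda>n. expectation (Zf V u n n) * exp (- of_real q / 2)) \<longlonglongrightarrow> 1 * exp (- of_real q / 2)"
    by (intro tendsto_mult Zf_limit[OF V eq] tendsto_const)
  moreover have "\<forall>\<^sub>F n in sequentially. expectation (Zf V u n n) * exp (- of_real q / 2) = expectation (\<lambda>z. iexp (sn n * (u \<bullet> Xn n n z)))"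
    using eventually_ge_at_top[of 1]
  proof eventually_elim
    case (elim n)
    have q: "qn V n u n = q" using gk_pos[OF elim] by (simp add: qn_def un_self q_def)
    have "exp (complex_of_real (q / 2)) * exp (- of_real q / 2) = 1"
      by (simp add: exp_add[symmetric])
    then have "expectation (\<lambda>z. iexp (sn n * (u \<bullet> Xn n n z))) =
       expectation (\<lambda>z. iexp (sn n * (u \<bullet> Xn n n z)) * exp (complex_of_real (q / 2))) * exp (- of_real q / 2)"
      by (simp only: integral_mult_left_zero mult.assoc mult_1_right)
    then show ?case unfolding Zf_def[abs_def] q un_self ..
  qed
  ultimately have "(\<lambda>n. expectation (\<lambda>z. iexp (sn n * (u \<bullet> Xn n n z)))) \<longlonglongrightarrow> 1 * exp (- of_real q / 2)"
    by (rule Lim_transform_eventually)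
  then show ?thesis by (simp add: q_def)
qed

section \<open>From the linear part to the weighted occupation measure: Slutsky's lemma and
  tightness\<close>

definition "Zn n z = sn n *\<^sub>R (th n z n - \<theta>)"

lemma Zn_measurable: "Zn n \<in> borel_measurable M"
proof (cases "1 \<le> n")
  case True
  have "(\<lambda>z. th n z n) \<in> borel_measurable M" by (rule Fn_M[OF True th_measurable[OF True]])
  then show ?thesis unfolding Zn_def[abs_def] by measurable
next
  case False
  then have "n = 0" by simp
  then have "Zn n = (\<lambda>z. sn 0 *\<^sub>R (axis x0 1 - \<theta>))" by (simp add: Zn_def[abs_def] th_def)
  then show ?thesis by simp
qed

lemma Zn_Xn: "norm (Zn n z - sn n *\<^sub>R Xn n n z) = sn n * norm (th n z n - \<theta> - Xn n n z)"
  unfolding Zn_def scaleR_diff_right[symmetric] norm_scaleR using sn_nonneg[of n] by simp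

lemma norm_iexp_diff: "norm (iexp x - iexp y) \<le> \<bar>x - y\<bar>" for x y :: real
proof -
  have "iexp x - iexp y = iexp y * (iexp (x - y) - 1)" by (simp add: exp_diff exp_add[symmetric] field_simps)
  then have "norm (iexp x - iexp y) = norm (iexp (x - y) - 1)" by (simp add: norm_mult)
  also have "\<dots> \<le> \<bar>x - y\<bar>" using iexp_approx1[of "x - y" 0] by simp
  finally show ?thesis .
qed

lemma remainder_event_measurable:
  assumes n: "1 \<le> n" shows "{z\<in>space M. sn n * norm (th n z n - \<theta> - Xn n n z) > e} \<in> sets M"
proof -
  have [measurable]: "(\<lambda>z. th n z n) \<in> borel_measurable M" by (rule Fn_M[OF n th_measurable[OF n]])
  have [measurable]: "Xn n n \<in> borel_measurable M" by (rule Fn_M[OF n Xn_measurable[OF n]])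
  show ?thesis by measurable
qed

text \<open>Slutsky's lemma for characteristic functions: the exponentials differ by at most the
  difference of the phases, and by at most 2 on the exceptional event.\<close>

lemma Zn_char_limit:
  assumes V: "transpose V = V" and eq: "U_star P \<theta> + lyap_op V = 0"
  shows "(\<lambda>n. expectation (\<lambda>z. iexp (u \<bullet> Zn n z))) \<longlonglongrightarrow> exp (- of_real (u \<bullet> (V *v u)) / 2)"
proof -
  have "(\<lambda>n. expectation (\<lambda>z. iexp (u \<bullet> Zn n z)) - expectation (\<lambda>z. iexp (sn n * (u \<bullet> Xn n n z)))) \<longlonglongrightarrow> 0"
  proof (rule tendstoI)
    fix e :: real assume e: "e > 0"
    \<comment> \<open>\<open>norm u * e'\<close> pays for close arguments and \<open>2 * e'\<close>
      for the exceptional event; the third unit makes the inequality strict.\<close>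
    define e' where "e' = e / (norm u + 3)"
    have u3: "0 < norm u + 3" by (simp add: add_nonneg_pos)
    have e': "e' > 0" using e u3 by (simp add: e'_def)
    show "\<forall>\<^sub>F n in sequentially. dist (expectation (\<lambda>z. iexp (u \<bullet> Zn n z)) - expectation (\<lambda>z. iexp (sn n * (u \<bullet> Xn n n z)))) 0 < e"
      using remainder_negligible[OF e'] eventually_ge_at_top[of 1]
    proof eventually_elim
      case (elim n)
      define A where "A = {z\<in>space M. sn n * norm (th n z n - \<theta> - Xn n n z) > e'}"
      have A: "A \<in> sets M" unfolding A_def by (rule remainder_event_measurable[OF elim(2)])
      have [measurable]: "Zn n \<in> borel_measurable M" by (rule Zn_measurable)
      have [measurable]: "Xn n n \<in> borel_measurable M" by (rule Fn_M[OF elim(2) Xn_measurable[OF elim(2)]])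
      have i: "integrable M (\<lambda>z. iexp (u \<bullet> Zn n z))" "integrable M (\<lambda>z. iexp (sn n * (u \<bullet> Xn n n z)))"
        by (rule bounded_integrable[of _ 1]; simp)+
      have "norm (expectation (\<lambda>z. iexp (u \<bullet> Zn n z)) - expectation (\<lambda>z. iexp (sn n * (u \<bullet> Xn n n z))))
        = norm (expectation (\<lambda>z. iexp (u \<bullet> Zn n z) - iexp (sn n * (u \<bullet> Xn n n z))))"
        using Bochner_Integration.integral_diff[OF i] by simp
      also have "\<dots> \<le> expectation (\<lambda>z. norm (iexp (u \<bullet> Zn n z) - iexp (sn n * (u \<bullet> Xn n n z))))"
        by (rule integral_norm_bound)
      also have "\<dots> \<le> expectation (\<lambda>z. norm u * e' + 2 * indicator A z)"
      proof (rule integral_mono)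
        show "integrable M (\<lambda>z. norm (iexp (u \<bullet> Zn n z) - iexp (sn n * (u \<bullet> Xn n n z))))"
          using i by (intro integrable_norm Bochner_Integration.integrable_diff)
        show "integrable M (\<lambda>z. norm u * e' + 2 * indicator A z :: real)"
          using A by (intro Bochner_Integration.integrable_add integrable_mult_right integrable_real_indicator)
            (auto simp: emeasure_eq_measure)
        fix z assume w: "z \<in> space M"
        show "norm (iexp (u \<bullet> Zn n z) - iexp (sn n * (u \<bullet> Xn n n z))) \<le> norm u * e' + 2 * indicator A z"
        proof (cases "z \<in> A")
          case True
          have "norm (iexp (u \<bullet> Zn n z) - iexp (sn n * (u \<bullet> Xn n n z))) \<le> 1 + 1"
            by (rule order_trans[OF norm_triangle_ineq4]) simp
          then show ?thesis using True e' by (simp add: add_increasing)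
        next
          case False
          then have r: "norm (Zn n z - sn n *\<^sub>R Xn n n z) \<le> e'" using w unfolding Zn_Xn A_def by auto
          have "norm (iexp (u \<bullet> Zn n z) - iexp (sn n * (u \<bullet> Xn n n z))) \<le> \<bar>u \<bullet> Zn n z - sn n * (u \<bullet> Xn n n z)\<bar>"
            by (rule norm_iexp_diff)
          also have "\<dots> = \<bar>u \<bullet> (Zn n z - sn n *\<^sub>R Xn n n z)\<bar>" by (simp add: inner_diff_right)
          also have "\<dots> \<le> norm u * e'"
            by (rule order_trans[OF Cauchy_Schwarz_ineq2]) (intro mult_left_mono r norm_ge_zero)
          finally show ?thesis using False by simp
        qed
      qed
      also have "\<dots> = norm u * e' + 2 * prob A"
        using A by (subst Bochner_Integration.integral_add) (auto simp: emeasure_eq_measure prob_space)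
      also have "\<dots> \<le> norm u * e' + 2 * e'" using elim(1) unfolding A_def by simp
      also have "\<dots> < (norm u + 3) * e'" using e' by (simp add: algebra_simps)
      also have "\<dots> = e" using u3 by (simp add: e'_def)
      finally show ?case by simp
    qed
  qed
  from tendsto_add[OF this Xn_char_limit[OF V eq, of u]] show ?thesis by simp
qed

text \<open>Chebyshev with matching scales,
  \<open>(sn n)^2 * (H / (a n * tm n)) = H / \<gamma>\<close>; the scaled remainder exceeds
  \<open>e / 2\<close> only with small probability.\<close>

lemma Zn_tight:
  assumes e: "e > 0"
  shows "\<exists>T. \<forall>\<^sub>F n in sequentially. prob {z\<in>space M. norm (Zn n z) > T} \<le> e"
proof -
  obtain H where H: "H \<ge> 0" "\<And>n k. 1 \<le> n \<Longrightarrow> k1 \<le> k \<Longrightarrow> expectation (\<lambda>z. (nS (Xn n k z))^2) \<le> H / (real (a n) * tm k)"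
    using Xn_second_moment by blast
  obtain CX where CX: "CX > 0" "\<And>n k z. 1 \<le> n \<Longrightarrow> norm (Xn n k z) \<le> CX" using Xn_bound by meson
  obtain CS where CS: "CS > 0" "\<And>x. nS x \<le> CS * norm x" using nS_le by blast
  define T where "T = sqrt (2 * H / (\<gamma> * e)) + 1"
  have T0: "0 < T" using H \<gamma> e by (simp add: T_def add_nonneg_pos)
  have T2: "H / \<gamma> / T^2 \<le> e / 2"
  proof -
    have "2 * H / (\<gamma> * e) = (sqrt (2 * H / (\<gamma> * e)))^2" using H \<gamma> e by simp
    also have "\<dots> \<le> T^2" unfolding T_def using H \<gamma> e by (intro power_mono) auto
    finally show ?thesis using T0 \<gamma> e by (simp add: field_simps)
  qed
  have e2: "e / 2 > 0" using e by simp
  have "\<forall>\<^sub>F n in sequentially. prob {z\<in>space M. norm (Zn n z) > T + e / 2} \<le> e"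
    using remainder_negligible[OF e2] eventually_ge_at_top[of k1]
  proof eventually_elim
    case (elim n)
    have n: "1 \<le> n" using elim(2) k1 by simp
    have an: "0 < real (a n)" using a_pos[OF n] by simp
    have t: "0 < tm n" by (rule tm_pos[OF n])
    have XM[measurable]: "Xn n n \<in> borel_measurable M" by (rule Fn_M[OF n Xn_measurable[OF n]])
    define A where "A = {z\<in>space M. sn n * norm (th n z n - \<theta> - Xn n n z) > e / 2}"
    define B where "B = {z\<in>space M. (sn n * norm (Xn n n z))^2 > T^2}"
    have A: "A \<in> sets M" unfolding A_def by (rule remainder_event_measurable[OF n])
    have B: "B \<in> sets M" unfolding B_def by measurable
    have sub: "{z\<in>space M. norm (Zn n z) > T + e / 2} \<subseteq> A \<union> B"
    proof
      fix z assume w: "z \<in> {z\<in>space M. norm (Zn n z) > T + e / 2}"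
      have "norm (Zn n z) \<le> norm (Zn n z - sn n *\<^sub>R Xn n n z) + norm (sn n *\<^sub>R Xn n n z)"
        using norm_triangle_ineq[of "Zn n z - sn n *\<^sub>R Xn n n z" "sn n *\<^sub>R Xn n n z"] by simp
      then have le: "norm (Zn n z) \<le> sn n * norm (th n z n - \<theta> - Xn n n z) + sn n * norm (Xn n n z)"
        unfolding Zn_Xn using sn_nonneg[of n] by simp
      show "z \<in> A \<union> B"
      proof (cases "z \<in> A")
        case False
        then have "T < sn n * norm (Xn n n z)" using w le by (auto simp: A_def)
        then have "T^2 < (sn n * norm (Xn n n z))^2" using T0 by (intro power_strict_mono) auto
        then show ?thesis using w by (simp add: B_def)
      qed simp
    qed
    have "prob B \<le> expectation (\<lambda>z. (sn n * norm (Xn n n z))^2) / T^2"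
      unfolding B_def
    proof (rule markov_bound)
      show "(\<lambda>z. (sn n * norm (Xn n n z))^2) \<in> borel_measurable M" by measurable
      show "(sn n * norm (Xn n n z))^2 \<le> (sn n * CX)^2" for z
        using CX(2)[OF n] sn_nonneg[of n] by (intro power_mono mult_left_mono) auto
    qed (use T0 in auto)
    also have "expectation (\<lambda>z. (sn n * norm (Xn n n z))^2) \<le> H / \<gamma>"
    proof -
      have nSb: "(nS (Xn n n z))^2 \<le> (CS * CX)^2" for z
        by (rule power_mono[OF order_trans[OF CS(2) mult_left_mono[OF CX(2)[OF n]]] nS_nonneg]) (use CS(1) in simp)
      have "expectation (\<lambda>z. (sn n * norm (Xn n n z))^2) \<le> expectation (\<lambda>z. (sn n)^2 * (nS (Xn n n z))^2)"
      proof (rule integral_mono)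
        show "integrable M (\<lambda>z. (sn n * norm (Xn n n z))^2)"
        proof (rule bounded_integrable[of _ "(sn n * CX)^2"])
          show "norm ((sn n * norm (Xn n n z))^2) \<le> (sn n * CX)^2" for z
            using power_mono[of "sn n * norm (Xn n n z)" "sn n * CX" 2] mult_left_mono[OF CX(2)[OF n, of n z] sn_nonneg[of n]] sn_nonneg[of n]
            by simp
        qed measurable
        show "integrable M (\<lambda>z. (sn n)^2 * (nS (Xn n n z))^2)"
          by (intro integrable_mult_right bounded_integrable[of _ "(CS * CX)^2"])
            (use nS_measurable[OF XM] nSb in auto)
        show "(sn n * norm (Xn n n z))^2 \<le> (sn n)^2 * (nS (Xn n n z))^2" for z
          unfolding power_mult_distrib by (intro mult_left_mono power_mono norm_le_nS) auto
      qed
      also have "\<dots> = (sn n)^2 * expectation (\<lambda>z. (nS (Xn n n z))^2)" by simp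
      also have "\<dots> \<le> (sn n)^2 * (H / (real (a n) * tm n))" by (intro mult_left_mono H(2) n elim) simp
      also have "\<dots> = H / \<gamma>"
        using an t \<gamma> gk_pos[OF n] by (simp add: sn_def gk_eq[OF n])
      finally show ?thesis .
    qed
    then have "expectation (\<lambda>z. (sn n * norm (Xn n n z))^2) / T^2 \<le> H / \<gamma> / T^2"
      using T0 by (intro divide_right_mono) auto
    also note T2
    finally have pB: "prob B \<le> e / 2" .
    have "prob {z\<in>space M. norm (Zn n z) > T + e / 2} \<le> prob (A \<union> B)"
      using A B by (intro finite_measure_mono sub) auto
    also have "\<dots> \<le> prob A + prob B" by (rule measure_Un_le[OF A B])
    finally show ?case using pB elim(1) unfolding A_def by linarith
  qed
  then show ?thesis by blast
qed

theorem clt: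
  assumes V: "transpose V = V" and eq: "U_star P \<theta> + lyap_op V = 0" and \<mu>: "normal_law \<mu> 0 V"
  shows "converges_in_distribution M (\<lambda>n z. sqrt (real (a n) / gk n) *\<^sub>R (weighted_occupation \<gamma> (a n) x0 (X n) n z - \<theta>)) \<mu>"
proof -
  have "converges_in_distribution M Zn \<mu>"
  proof (rule converges_in_distribution_of_char)
    show "prob_space M" by unfold_locales
    show "prob_space \<mu>" "sets \<mu> = sets borel" using \<mu> by (auto simp: normal_law_def)
    show "(\<lambda>n. CLINT z|M. iexp (u \<bullet> Zn n z)) \<longlonglongrightarrow> (CLINT x|\<mu>. iexp (u \<bullet> x))" for u
    proof -
      have "(CLINT x|\<mu>. iexp (u \<bullet> x)) = exp (- of_real (u \<bullet> (V *v u)) / 2)"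
        using \<mu> by (simp add: normal_law_def)
      then show ?thesis using Zn_char_limit[OF V eq, of u] by simp
    qed
    show "\<exists>T. \<forall>\<^sub>F n in sequentially. measure M {z\<in>space M. norm (Zn n z) > T} \<le> e" if "e > 0" for e
      by (rule Zn_tight[OF that])
  qed (rule Zn_measurable)
  then show ?thesis by (simp add: Zn_def[abs_def] sn_def th_def)
qed

end

theorem theorem1p2:
  fixes P :: "real ^ ('s::finite) option ^ 's option"
    and \<theta>s :: "real ^ 's"
    and L \<gamma>s :: real
    and a :: "nat \<Rightarrow> nat"
    and x0 :: 's
    and M :: "'w measure"
    and X :: "nat \<Rightarrow> nat \<Rightarrow> nat \<Rightarrow> 'w \<Rightarrow> 's"
  assumes chain: "absorbed_chain P"
    and qsd: "quasi_stationary P \<theta>s"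
    and L: "L > 0" "\<And>z. tangent_eigenvalue (grad_h P \<theta>s) z \<Longrightarrow> Re z \<le> - L"
    and gamma: "\<gamma>s > 0" "\<gamma>s > 1 / L"
    and a_pos: "\<And>n. n \<ge> 1 \<Longrightarrow> a n > 0"
    and a_mono: "\<And>m n. 1 \<le> m \<Longrightarrow> m \<le> n \<Longrightarrow> a m \<le> a n"
    and a_lim: "filterlim a at_top at_top"
    and a_rate: "(\<lambda>n. real (a n) / real n) \<longlonglongrightarrow> 0"
    and M: "prob_space M"
    and alg: "\<And>n. n \<ge> 1 \<Longrightarrow> algorithm_I M P \<gamma>s (a n) x0 (X n)"
  shows "\<exists>V. lyapunov_solution P \<theta>s \<gamma>s V \<and>
             (\<forall>V'. lyapunov_solution P \<theta>s \<gamma>s V' \<longrightarrow> V' = V) \<and>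
             (\<exists>\<mu>. normal_law \<mu> 0 V \<and>
                converges_in_distribution M
                  (\<lambda>n \<omega>. sqrt (real (a n) / step_size \<gamma>s n) *\<^sub>R
                     (weighted_occupation \<gamma>s (a n) x0 (X n) n \<omega> - \<theta>s))
                  \<mu>)"
proof -
  interpret clt_chain P \<theta>s L \<gamma>s
    by unfold_locales (fact chain qsd L gamma)+
  \<comment> \<open>Midpoint of \<open>1 / \<gamma>s\<close> and \<open>L\<close>: below
    \<open>L\<close> to admit an adapted norm, above \<open>1 / \<gamma>s\<close> so that the
    recursions decay at the rate \<open>1 / tm k\<close>.\<close>
  define Lq where "Lq = (L + 1 / \<gamma>s) / 2"
  have Lq: "Lq < L" "1 / \<gamma>s < Lq" "0 < Lq" "\<gamma>s * Lq > 1"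
  proof -
    have "1 / \<gamma>s < L" using L(1) gamma by (simp add: field_simps)
    then show 1: "Lq < L" "1 / \<gamma>s < Lq" by (auto simp: Lq_def)
    then show "\<gamma>s * Lq > 1" using gamma(1) by (simp add: field_simps)
    show "0 < Lq" using L(1) gamma(1) by (simp add: Lq_def add_pos_pos)
  qed
  obtain S g0 where S: "transpose S = S" "\<And>x. x \<bullet> x \<le> x \<bullet> (S *v x)" and g0: "g0 > 0"
    and contr: "\<And>g x. 0 \<le> g \<Longrightarrow> g \<le> g0 \<Longrightarrow>
      (x + g *\<^sub>R (J *v x)) \<bullet> (S *v (x + g *\<^sub>R (J *v x))) \<le> (1 - g * Lq)^2 * (x \<bullet> (S *v x))"
  proof (rule hurwitz_contraction[OF J_eigenvalue Lq(1)])
    fix S :: "real^'s^'s" and g0 :: real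
    assume "transpose S = S" "\<And>x. x \<bullet> x \<le> x \<bullet> (S *v x)" "g0 > 0" "\<And>g x. 0 \<le> g \<Longrightarrow> g \<le> g0 \<Longrightarrow>
      (x + g *\<^sub>R (J *v x)) \<bullet> (S *v (x + g *\<^sub>R (J *v x))) \<le> (1 - g * Lq)^2 * (x \<bullet> (S *v x))"
    then show thesis by (rule that)
  qed
  \<comment> \<open>Below \<open>g0\<close> an Euler step contracts the adapted norm, and below
    \<open>1 / Lq\<close> the contraction factor is nonnegative.\<close>
  have "min g0 (1 / Lq) > 0" using g0 Lq(3) by simp
  then obtain k1 where k1: "1 \<le> k1" "\<And>k. k1 \<le> k \<Longrightarrow> step_size \<gamma>s k \<le> min g0 (1 / Lq)"
    using gk_eventually_small[of "min g0 (1 / Lq)" 1] by blast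
  have gk: "step_size \<gamma>s (Suc k) \<le> g0" "step_size \<gamma>s (Suc k) * Lq \<le> 1" if "k1 \<le> k" for k
    using k1(2)[of "Suc k"] that Lq(3) by (auto simp: pos_le_divide_eq)
  interpret clt_lyap P \<theta>s L \<gamma>s S Lq k1
    by unfold_locales (use S Lq(4) k1(1) gk(2) contr[OF gk_nonneg gk(1)] in auto)
  interpret prob_space M by (rule M)
  interpret clt_setup P \<theta>s L \<gamma>s S Lq k1 M a x0 X
    by unfold_locales (fact a_pos a_lim a_rate alg)+
  \<comment> \<open>Uniqueness was derived through the adapted norm, so existence becomes available
    only now that \<open>S\<close> and \<open>k1\<close> have been constructed.\<close>
  from lyapunov_existence[OF lyapunov_unique]
  obtain V where V: "lyapunov_solution P \<theta>s \<gamma>s V" "\<forall>V'. lyapunov_solution P \<theta>s \<gamma>s V' \<longrightarrow> V' = V"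
    by (rule ex1E)
  have V': "transpose V = V" "U_star P \<theta>s + lyap_op V = 0" using V(1) by (simp_all only: lyapunov_solution_iff)
  from normal_law_exists[OF V'(1) lyapunov_psd[OF V']] obtain \<mu> where \<mu>: "normal_law \<mu> 0 V" ..
  show ?thesis by (intro exI[of _ V] exI[of _ \<mu>] conjI V \<mu> clt[OF V' \<mu>])
qed

end
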